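(* There is a sufficiently small constant $\delta>0$ such that the following holds. Suppose that the $n\times n$ cost matrix $X$ of an instance of the Asymmetric Traveling Salesman Problem is drawn uniformly at random from a row symmetric simplex $\{X\in\mathbb{R}_+^{[n]\times[n]}:\sum_{(v,w)\in[n]^2}\alpha_{v,w}X_{v,w}\le L\}$ whose coefficient vector $\alpha$ is $M$-bounded with $M=M(n)\le n^{\delta}$. Then there is an $O(n^3)$ time algorithm that with high probability finds a tour that is asymptotically optimal, i.e. with high probability the ratio of the cost of the tour found to the optimal tour cost tends to one (as $n\to\infty$).
   Context: In the Asymmetric Traveling Salesman Problem (ATSP) one is given a cost $X_{v,w}\ge0$ for each ordered pair $(v,w)\in[n]^2$, $[n]=\{1,\dots,n\}$, and seeks a tour, i.e. a directed Hamilton cycle on $[n]$, of minimum total cost. The coefficients satisfy $\alpha_{v,w}>0$; $\alpha$ is $M$-bounded if $1/M\le\alpha_{v,w}\le M$ for all $v,w$. The simplex is row symmetric if $\alpha_{v_1,w}=\alpha_{v_2,w}$ for all $v_1,v_2,w$. $L=L(n)>0$ is the right-hand side of the simplex, normalized in the paper to equal the number of coordinates (rescaling $L$ only rescales all costs and does not affect the ratio). "With high probability" means with probability tending to $1$ as $n\to\infty$. *)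

theory Defs
  imports "HOL-Probability.Probability" "HOL-Library.Landau_Symbols"
begin

section \<open>A real RAM\<close>

text \<open>
  Running times refer to the usual real RAM: real numbers are atomic, with exact arithmetic and
  comparison at unit cost and without rounding; integers are machine words of $O(\log n)$ bits, used
  for control and for indirect addressing. Programs are written as while-programs over two memories,
  one of integers and one of reals, each divided into named arrays with two indices. A scalar
  variable is an array used at index (0,0) only. The only constants in a program are integers.
\<close>

type_synonym name = string

datatype iexp =
    IConst int
  | IRead name iexp iexp
  | IPlus iexp iexp
  | IMinus iexp iexp
  | ITimes iexp iexp

datatype rexp =
    ROfInt iexp
  | RRead name iexp iexp
  | RPlus rexp rexp
  | RMinus rexp rexp
  | RTimes rexp rexp
  | RDivide rexp rexp

datatype bexp =
    ILess iexp iexp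
  | RLess rexp rexp
  | BNot bexp
  | BAnd bexp bexp

datatype com =
    Skip
  | IWrite name iexp iexp iexp
  | RWrite name iexp iexp rexp
  | Seq com com
  | Cond bexp com com
  | While bexp com

record state =
  ints :: "name \<Rightarrow> int \<times> int \<Rightarrow> int"
  reals :: "name \<Rightarrow> int \<times> int \<Rightarrow> real"

primrec ival :: "iexp \<Rightarrow> state \<Rightarrow> int" where
  "ival (IConst z) s = z"
| "ival (IRead a e f) s = ints s a (ival e s, ival f s)"
| "ival (IPlus e f) s = ival e s + ival f s"
| "ival (IMinus e f) s = ival e s - ival f s"
| "ival (ITimes e f) s = ival e s * ival f s"

primrec rval :: "rexp \<Rightarrow> state \<Rightarrow> real" where
  "rval (ROfInt e) s = real_of_int (ival e s)"
| "rval (RRead a e f) s = reals s a (ival e s, ival f s)"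
| "rval (RPlus p q) s = rval p s + rval q s"
| "rval (RMinus p q) s = rval p s - rval q s"
| "rval (RTimes p q) s = rval p s * rval q s"
| "rval (RDivide p q) s = rval p s / rval q s"

primrec bval :: "bexp \<Rightarrow> state \<Rightarrow> bool" where
  "bval (ILess e f) s \<longleftrightarrow> ival e s < ival f s"
| "bval (RLess p q) s \<longleftrightarrow> rval p s < rval q s"
| "bval (BNot b) s \<longleftrightarrow> \<not> bval b s"
| "bval (BAnd b c) s \<longleftrightarrow> bval b s \<and> bval c s"

definition write_int :: "name \<Rightarrow> int \<times> int \<Rightarrow> int \<Rightarrow> state \<Rightarrow> state" where
  "write_int a ij z s = s\<lparr>ints := (ints s)(a := (ints s a)(ij := z))\<rparr>"

definition write_real :: "name \<Rightarrow> int \<times> int \<Rightarrow> real \<Rightarrow> state \<Rightarrow> state" where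
  "write_real a ij x s = s\<lparr>reals := (reals s)(a := (reals s a)(ij := x))\<rparr>"

text \<open>
  \<open>exec c s t m s'\<close>: started in \<open>s\<close>, the program \<open>c\<close> halts in \<open>s'\<close> after \<open>t\<close> steps, and \<open>m\<close> is the
  largest absolute value of an integer written on the way. A step is an assignment, a skip or the
  evaluation of a guard. The expressions occurring in a run are those of the program text, so each
  step costs a number of elementary operations that is bounded by a constant of the program.
\<close>

inductive exec :: "com \<Rightarrow> state \<Rightarrow> nat \<Rightarrow> nat \<Rightarrow> state \<Rightarrow> bool" where
  Skip: "exec Skip s 1 0 s"
| IWrite: "exec (IWrite a e f g) s 1 (nat \<bar>ival g s\<bar>) (write_int a (ival e s, ival f s) (ival g s) s)"
| RWrite: "exec (RWrite a e f p) s 1 0 (write_real a (ival e s, ival f s) (rval p s) s)"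
| Seq: "exec c s t m s' \<Longrightarrow> exec d s' t' m' s'' \<Longrightarrow> exec (Seq c d) s (t + t') (max m m') s''"
| CondTrue: "bval b s \<Longrightarrow> exec c s t m s' \<Longrightarrow> exec (Cond b c d) s (Suc t) m s'"
| CondFalse: "\<not> bval b s \<Longrightarrow> exec d s t m s' \<Longrightarrow> exec (Cond b c d) s (Suc t) m s'"
| WhileFalse: "\<not> bval b s \<Longrightarrow> exec (While b c) s 1 0 s"
| WhileTrue: "bval b s \<Longrightarrow> exec c s t m s' \<Longrightarrow> exec (While b c) s' t' m' s'' \<Longrightarrow>
    exec (While b c) s (Suc (t + t')) (max m m') s''"

lemma exec_deterministic:
  "exec c s t m s' \<Longrightarrow> exec c s u k s'' \<Longrightarrow> t = u \<and> m = k \<and> s' = s''"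
proof (induction arbitrary: u k s'' rule: exec.induct)
  case (Seq c s t m s' d t' m' s3)
  from Seq.prems obtain t1 m1 s1 t2 m2 where "exec c s t1 m1 s1" "exec d s1 t2 m2 s''"
    "u = t1 + t2" "k = max m1 m2" by cases
  then show ?case using Seq.IH by blast
next
  case (CondTrue b s c t m s' d)
  from CondTrue.prems show ?case by cases (use CondTrue.hyps CondTrue.IH in blast)+
next
  case (CondFalse b s d t m s' c)
  from CondFalse.prems show ?case by cases (use CondFalse.hyps CondFalse.IH in blast)+
next
  case (WhileTrue b s c t m s' t' m' s3)
  from WhileTrue.prems WhileTrue.hyps(1) obtain t1 m1 s1 t2 m2 where
    "exec c s t1 m1 s1" "exec (While b c) s1 t2 m2 s''"
    "u = Suc (t1 + t2)" "k = max m1 m2" by cases auto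
  then show ?case using WhileTrue.IH by blast
next
  case (WhileFalse b s c)
  from WhileFalse.prems WhileFalse.hyps show ?case by cases auto
qed (erule exec.cases; simp)+


section \<open>The asymmetric travelling salesman problem\<close>

abbreviation arcs :: "nat \<Rightarrow> (nat \<times> nat) set" where
  "arcs n \<equiv> {1..n} \<times> {1..n}"

text \<open>
  A tour is given by the list of its vertices in the order of traversal; its arcs join cyclically
  consecutive entries.
\<close>

definition is_tour :: "nat \<Rightarrow> nat list \<Rightarrow> bool" where
  "is_tour n vs \<longleftrightarrow> distinct vs \<and> set vs = {1..n}"

definition tour_cost :: "(nat \<times> nat \<Rightarrow> real) \<Rightarrow> nat list \<Rightarrow> real" where
  "tour_cost X vs = (\<Sum>i<length vs. X (vs ! i, vs ! (Suc i mod length vs)))"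

definition opt_cost :: "nat \<Rightarrow> (nat \<times> nat \<Rightarrow> real) \<Rightarrow> real" where
  "opt_cost n X = Min {tour_cost X vs | vs. is_tour n vs}"

text \<open>
  Input: the integer \<open>n\<close> and the cost matrix, nothing else (in particular not the coefficients of the
  simplex). Output: the \<open>i\<close>-th vertex of the tour is the entry of the integer array \<open>tour\<close> at (i,0).
\<close>

definition atsp_input :: "nat \<Rightarrow> (nat \<times> nat \<Rightarrow> real) \<Rightarrow> state" where
  "atsp_input n X =
    \<lparr>ints = (\<lambda>a ij. if a = ''n'' \<and> ij = (0, 0) then int n else 0),
     reals = (\<lambda>a (i, j). if a = ''X'' \<and> i \<in> {1..int n} \<and> j \<in> {1..int n} then X (nat i, nat j) else 0)\<rparr>"

definition atsp_output :: "nat \<Rightarrow> state \<Rightarrow> nat list" where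
  "atsp_output n s = map (\<lambda>i. nat (ints s ''tour'' (int i, 0))) [1..<Suc n]"

definition outputs :: "com \<Rightarrow> nat \<Rightarrow> (nat \<times> nat \<Rightarrow> real) \<Rightarrow> nat list \<Rightarrow> bool" where
  "outputs P n X vs \<longleftrightarrow> (\<exists>t m s. exec P (atsp_input n X) t m s \<and> vs = atsp_output n s)"

text \<open>
  Worst-case running time over all instances. The polynomial bound on the integers is the word size
  restriction, without which unit-cost integer arithmetic would be unrealistically powerful.
\<close>

definition cubic_time :: "com \<Rightarrow> bool" where
  "cubic_time P \<longleftrightarrow>
    (\<exists>(T :: nat \<Rightarrow> real) (W :: nat \<Rightarrow> real) k.
      T \<in> O(\<lambda>n. real n ^ 3) \<and> W \<in> O(\<lambda>n. real n ^ k) \<and>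
      (\<forall>n\<ge>1. \<forall>X :: nat \<times> nat \<Rightarrow> real. (\<forall>a\<in>arcs n. 0 \<le> X a) \<longrightarrow>
        (\<exists>t m s. exec P (atsp_input n X) t m s \<and> real t \<le> T n \<and> real m \<le> W n)))"


section \<open>Random instances from a simplex\<close>

definition cost_simplex :: "nat \<Rightarrow> (nat \<times> nat \<Rightarrow> real) \<Rightarrow> real \<Rightarrow> (nat \<times> nat \<Rightarrow> real) set" where
  "cost_simplex n \<alpha> L = {X \<in> (arcs n \<rightarrow>\<^sub>E {0..}). (\<Sum>a\<in>arcs n. \<alpha> a * X a) \<le> L}"

definition uniform_simplex :: "nat \<Rightarrow> (nat \<times> nat \<Rightarrow> real) \<Rightarrow> real \<Rightarrow> (nat \<times> nat \<Rightarrow> real) measure" where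
  "uniform_simplex n \<alpha> L = uniform_measure (\<Pi>\<^sub>M a\<in>arcs n. lborel) (cost_simplex n \<alpha> L)"

definition row_symmetric :: "nat \<Rightarrow> (nat \<times> nat \<Rightarrow> real) \<Rightarrow> bool" where
  "row_symmetric n \<alpha> \<longleftrightarrow> (\<forall>v\<^sub>1\<in>{1..n}. \<forall>v\<^sub>2\<in>{1..n}. \<forall>w\<in>{1..n}. \<alpha> (v\<^sub>1, w) = \<alpha> (v\<^sub>2, w))"

definition M_bounded :: "nat \<Rightarrow> real \<Rightarrow> (nat \<times> nat \<Rightarrow> real) \<Rightarrow> bool" where
  "M_bounded n M \<alpha> \<longleftrightarrow> (\<forall>a\<in>arcs n. 1 / M \<le> \<alpha> a \<and> \<alpha> a \<le> M)"

lemma prob_space_uniform_simplex: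
  assumes "n \<ge> 1" "L > 0" and pos: "\<And>a. a \<in> arcs n \<Longrightarrow> 0 < \<alpha> a"
  shows "prob_space (uniform_simplex n \<alpha> L)"
proof -
  interpret product_sigma_finite "\<lambda>_ :: nat \<times> nat. lborel :: real measure" ..
  let ?P = "\<Pi>\<^sub>M a\<in>arcs n. (lborel :: real measure)"
  define K where "K = real (card (arcs n))"
  have fin: "finite (arcs n)" by simp
  have K: "K > 0" using assms by (simp add: K_def)
  have eq: "cost_simplex n \<alpha> L =
      {X \<in> space ?P. (\<forall>a\<in>arcs n. 0 \<le> X a) \<and> (\<Sum>a\<in>arcs n. \<alpha> a * X a) \<le> L}"
    by (auto simp: cost_simplex_def space_PiM PiE_def Pi_def)
  have meas: "cost_simplex n \<alpha> L \<in> sets ?P"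
    unfolding eq by measurable
  have "0 < (\<Prod>a\<in>arcs n. L / (K * \<alpha> a))"
    using K assms by (intro prod_pos) auto
  then have "0 < ennreal (\<Prod>a\<in>arcs n. L / (K * \<alpha> a))" by simp
  also have "\<dots> = emeasure ?P (\<Pi>\<^sub>E a\<in>arcs n. {0 .. L / (K * \<alpha> a)})"
    using K assms by (subst emeasure_PiM) (auto simp: prod_ennreal less_imp_le)
  also have "\<dots> \<le> emeasure ?P (cost_simplex n \<alpha> L)"
  proof (rule emeasure_mono[OF _ meas], rule subsetI)
    fix X assume X: "X \<in> (\<Pi>\<^sub>E a\<in>arcs n. {0 .. L / (K * \<alpha> a)})"
    have "(\<Sum>a\<in>arcs n. \<alpha> a * X a) \<le> (\<Sum>a\<in>arcs n. L / K)"
    proof (rule sum_mono)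
      fix a assume a: "a \<in> arcs n"
      then have "X a \<le> L / (K * \<alpha> a)" using X by (auto simp: PiE_def Pi_def)
      then show "\<alpha> a * X a \<le> L / K" using pos[OF a] K by (simp add: field_simps)
    qed
    also have "\<dots> = L" using assms by (simp add: K_def)
    finally show "X \<in> cost_simplex n \<alpha> L"
      using X by (auto simp: cost_simplex_def PiE_def Pi_def)
  qed
  finally have nz: "emeasure ?P (cost_simplex n \<alpha> L) \<noteq> 0" by auto
  have "cost_simplex n \<alpha> L \<subseteq> (\<Pi>\<^sub>E a\<in>arcs n. {0 .. L / \<alpha> a})"
  proof
    fix X assume X: "X \<in> cost_simplex n \<alpha> L"
    have "X a \<le> L / \<alpha> a" if a: "a \<in> arcs n" for a
    proof -
      have "\<alpha> a * X a \<le> (\<Sum>a\<in>arcs n. \<alpha> a * X a)"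
        using X pos by (intro member_le_sum[OF a _ fin])
          (auto simp: cost_simplex_def PiE_def Pi_def less_imp_le)
      also have "\<dots> \<le> L" using X by (simp add: cost_simplex_def)
      finally show ?thesis using pos[OF a] by (simp add: field_simps)
    qed
    then show "X \<in> (\<Pi>\<^sub>E a\<in>arcs n. {0 .. L / \<alpha> a})"
      using X by (auto simp: cost_simplex_def PiE_def Pi_def)
  qed
  then have "emeasure ?P (cost_simplex n \<alpha> L) \<le>
      emeasure ?P (\<Pi>\<^sub>E a\<in>arcs n. {0 .. L / \<alpha> a})"
    by (rule emeasure_mono) (auto intro!: sets_PiM_I_finite)
  also have "\<dots> = (\<Prod>a\<in>arcs n. emeasure lborel {0 .. L / \<alpha> a})"
    by (subst emeasure_PiM) auto
  also have "\<dots> = ennreal (\<Prod>a\<in>arcs n. L / \<alpha> a)"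
    using assms by (subst prod_ennreal[symmetric]) (auto simp: less_imp_le)
  finally have "emeasure ?P (cost_simplex n \<alpha> L) \<noteq> \<infinity>"
    by (auto simp: top_unique)
  with nz show ?thesis
    unfolding uniform_simplex_def by (rule prob_space_uniform_measure)
qed

end

theory Submission
  imports Defs "HOL-Combinatorics.Orbits" "HOL-Combinatorics.Permutations" "HOL-Real_Asymp.Real_Asymp"
begin

text \<open>
  The program solves the assignment problem by the Hungarian method and then repeatedly joins two
  cycles of the optimal assignment by the cheapest exchange of two arcs. An optimal assignment costs
  at most as much as an optimal tour, so only the cost of the joins has to be controlled.

  Up to scaling, a uniform point of the simplex consists of independent exponential variables, and
  the analysis is scale invariant. Since the rows are identically distributed, the optimal assignment
  is a uniformly random permutation and has few cycles, whence one of them is large. Any arc of cost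
  above $3\theta$ could be replaced by a short alternating exchange of arcs of cost at most $\theta$,
  so the optimal assignment depends only on the cheap arcs. By the memoryless property the
  excess of the other arcs over $4\theta$ is independent of it, and it contains a cheap join of the
  large cycle with any other cycle. With $\theta = n^{-2/5}$ and at most $n^{1/20}$ cycles the joins
  cost $O(n^{-7/20})$ in total, while the assignment costs at least $n^{-3/50} / 2$.
\<close>

section \<open>Measurability of program runs\<close>

text \<open>The obstacle is dependence: the assignment is computed from the very costs that must
  afterwards provide cheap joins, and every join changes the assignment seen by later ones. The
  threshold 4\<theta> removes the former dependence. The latter is removed by a union bound over all
  sets D of at most 2K columns that earlier joins may have spoiled, so the run of the patching phase
  needs no probabilistic analysis.

  The comparison of costs bounds \<theta> from above; two demands bound it from below, with M at
  most n^(1/100). A large cycle offers about n/K disjoint pairs of arcs, each cheap with probability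
  of order (\<theta>/M)^2, and the exponent n^(13/100) so obtained must beat the 2 n^(1/20) ln(n+1)
  coming from the choice of D. A set of about sqrt n arcs misses all costs up to \<theta> with
  probability about exp(-n^(9/100)), which must beat every power of n.\<close>

fun run :: "com \<Rightarrow> nat \<Rightarrow> state \<Rightarrow> bool \<times> state" where
  "run Skip k s = (True, s)"
| "run (IWrite a e f g) k s = (True, write_int a (ival e s, ival f s) (ival g s) s)"
| "run (RWrite a e f p) k s = (True, write_real a (ival e s, ival f s) (rval p s) s)"
| "run (Seq c d) k s = (fst (run c k s) \<and> fst (run d k (snd (run c k s))), snd (run d k (snd (run c k s))))"
| "run (Cond b c d) k s = (if bval b s then run c k s else run d k s)"
| "run (While b c) 0 s = (False, s)"
| "run (While b c) (Suc k) s = (if bval b s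
     then (fst (run c k s) \<and> fst (run (While b c) k (snd (run c k s))), snd (run (While b c) k (snd (run c k s))))
     else (True, s))"

text \<open>Fuel is spent on unrolling loops only, and the Boolean records whether it sufficed; the
  state of an unfinished run carries no information. The two halves of a composition may need
  different amounts of fuel, so completed runs must be liftable to a common amount.\<close>

lemma run_mono: "run c k s = (True, s') \<Longrightarrow> k \<le> l \<Longrightarrow> run c l s = (True, s')"
proof (induction c k s arbitrary: l s' rule: run.induct)
  case (4 c d k s)
  define s1 where "s1 = snd (run c k s)"
  have s1: "run c k s = (True, s1)" "run d k s1 = (True, s')"
    using "4.prems" by (auto simp: s1_def prod_eq_iff)
  then have "run c l s = (True, s1)" "run d l s1 = (True, s')"
    using "4.IH"(1)[OF s1(1) "4.prems"(2)] "4.IH"(3)[of s' l] s1 "4.prems"(2) by simp_all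
  then show ?case by simp
next
  case (7 b c k s)
  obtain l' where l: "l = Suc l'" "k \<le> l'" using "7.prems" by (cases l) auto
  show ?case
  proof (cases "bval b s")
    case True
    define s1 where "s1 = snd (run c k s)"
    have s1: "run c k s = (True, s1)" "run (While b c) k s1 = (True, s')"
      using "7.prems" True by (auto simp: s1_def prod_eq_iff)
    then have "run c l' s = (True, s1)" "run (While b c) l' s1 = (True, s')"
      using "7.IH"(1)[OF True s1(1) l(2)] "7.IH"(3)[OF True, of s' l'] s1 l(2) by simp_all
    then show ?thesis using True l by simp
  next
    case False
    then show ?thesis using "7.prems" l by simp
  qed
next
  case (5 b c d k s)
  show ?case
  proof (cases "bval b s")
    case True
    then show ?thesis using "5.IH"(1)[OF True _ "5.prems"(2), of s'] "5.prems"(1) by (simp only: run.simps if_True)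
  next
    case False
    then show ?thesis using "5.IH"(2)[OF False _ "5.prems"(2), of s'] "5.prems"(1) by (simp only: run.simps if_False)
  qed
qed simp_all

text \<open>Every unrolling of a loop takes at least one step, so the step count is always enough
  fuel.\<close>

lemma exec_imp_run: "exec c s t m s' \<Longrightarrow> run c t s = (True, s')"
proof (induction rule: exec.induct)
  case (Seq c s t m s' d t' m' s'')
  have "run c (t + t') s = (True, s')" "run d (t + t') s' = (True, s'')"
    using Seq.IH by (auto intro: run_mono)
  then show ?case by simp
next
  case (CondTrue b s c t m s' d)
  then show ?case by (auto intro: run_mono)
next
  case (CondFalse b s d t m s' c)
  then show ?case by (auto intro: run_mono)
next
  case (WhileTrue b s c t m s' t' m' s'')
  have "run c (t + t') s = (True, s')" "run (While b c) (t + t') s' = (True, s'')"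
    using WhileTrue.IH by (auto intro: run_mono)
  then show ?case using WhileTrue.hyps(1) by simp
qed (auto simp: numeral_eq_Suc)

lemma run_imp_exec: "run c k s = (True, s') \<Longrightarrow> \<exists>t m. exec c s t m s'"
proof (induction c k s arbitrary: s' rule: run.induct)
  case (4 c d k s)
  define s1 where "s1 = snd (run c k s)"
  have s1: "run c k s = (True, s1)" "run d k s1 = (True, s')"
    using "4.prems" by (auto simp: s1_def prod_eq_iff)
  then show ?case using "4.IH"(1)[OF s1(1)] "4.IH"(3)[of s'] exec.Seq by fastforce
next
  case (5 b c d k s)
  show ?case
  proof (cases "bval b s")
    case True
    then show ?thesis using 5(1)[OF True, of s'] 5(3) exec.CondTrue by fastforce
  next
    case False
    then show ?thesis using 5(2)[OF False, of s'] 5(3) exec.CondFalse by fastforce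
  qed
next
  case (7 b c k s)
  show ?case
  proof (cases "bval b s")
    case True
    define s1 where "s1 = snd (run c k s)"
    have s1: "run c k s = (True, s1)" "run (While b c) k s1 = (True, s')"
      using "7.prems" True by (auto simp: s1_def prod_eq_iff)
    then show ?thesis using "7.IH"(1)[OF True s1(1)] "7.IH"(3)[OF True, of s'] exec.WhileTrue[OF True] by fastforce
  next
    case False
    then show ?thesis using "7.prems" exec.WhileFalse by fastforce
  qed
qed (auto intro: exec.intros)

text \<open>There is no sigma-algebra on \<open>state\<close>; each memory cell is required to be
  measurable separately. As there are countably many addresses, this suffices for indirect
  addressing.\<close>

definition state_measurable :: "'a measure \<Rightarrow> ('a \<Rightarrow> state) \<Rightarrow> bool" where
  "state_measurable M F \<longleftrightarrow>
    (\<forall>a ij. (\<lambda>x. ints (F x) a ij) \<in> measurable M (count_space UNIV)) \<and>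
    (\<forall>a ij. (\<lambda>x. reals (F x) a ij) \<in> borel_measurable M)"

lemma state_measurableI:
  assumes "\<And>a ij. (\<lambda>x. ints (F x) a ij) \<in> measurable M (count_space UNIV)"
    and "\<And>a ij. (\<lambda>x. reals (F x) a ij) \<in> borel_measurable M"
  shows "state_measurable M F"
  using assms by (simp add: state_measurable_def)

lemma state_measurableD:
  assumes "state_measurable M F"
  shows "(\<lambda>x. ints (F x) a ij) \<in> measurable M (count_space UNIV)"
    and "(\<lambda>x. reals (F x) a ij) \<in> borel_measurable M"
  using assms unfolding state_measurable_def by blast+

text \<open>The address of a read is itself a function of the random input. It takes countably many
  values, so the read is a countable case distinction between measurable cells.\<close>

lemma measurable_ival:
  assumes F: "state_measurable M F"
  shows "(\<lambda>x. ival e (F x)) \<in> measurable M (count_space UNIV)"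
proof (induction e)
  case (IRead a e f)
  note [measurable] = IRead
  have [measurable]: "(\<lambda>x. ints (F x) a ij) \<in> measurable M (count_space UNIV)" for ij
    by (rule state_measurableD[OF F])
  have "(\<lambda>x. (ival e (F x), ival f (F x))) \<in> measurable M (count_space UNIV)" by measurable
  from measurable_compose_countable[OF state_measurableD(1)[OF F, of a] this]
  show ?case by (simp only: ival.simps)
qed simp_all

lemma borel_measurable_rval:
  assumes F: "state_measurable M F"
  shows "(\<lambda>x. rval p (F x)) \<in> borel_measurable M"
proof (induction p)
  case (RRead a e f)
  note [measurable] = measurable_ival[OF F]
  have [measurable]: "(\<lambda>x. reals (F x) a ij) \<in> borel_measurable M" for ij
    by (rule state_measurableD[OF F])
  have "(\<lambda>x. (ival e (F x), ival f (F x))) \<in> measurable M (count_space UNIV)" by measurable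
  from measurable_compose_countable[OF state_measurableD(2)[OF F, of a] this]
  show ?case by (simp only: rval.simps)
next
  case (ROfInt e)
  note [measurable] = measurable_ival[OF F]
  show ?case by simp
qed simp_all

lemma measurable_bval:
  assumes F: "state_measurable M F"
  shows "Measurable.pred M (\<lambda>x. bval b (F x))"
proof (induction b)
  case (ILess e f)
  note [measurable] = measurable_ival[OF F]
  show ?case by simp
next
  case (RLess p q)
  note [measurable] = borel_measurable_rval[OF F]
  show ?case by simp
qed simp_all

lemma state_measurable_If:
  assumes "Measurable.pred M b" "state_measurable M F" "state_measurable M G"
  shows "state_measurable M (\<lambda>x. if b x then F x else G x)"
proof -
  note [measurable] = assms(1)
  have [measurable]: "(\<lambda>x. ints (F x) a ij) \<in> measurable M (count_space UNIV)"
    "(\<lambda>x. ints (G x) a ij) \<in> measurable M (count_space UNIV)"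
    "(\<lambda>x. reals (F x) a ij) \<in> borel_measurable M"
    "(\<lambda>x. reals (G x) a ij) \<in> borel_measurable M" for a ij
    by (rule state_measurableD assms)+
  show ?thesis
    by (rule state_measurableI) (simp_all add: if_distrib[of ints] if_distrib[of reals] if_distribR)
qed

lemma state_measurable_write_int:
  assumes F: "state_measurable M F"
  shows "state_measurable M (\<lambda>x. write_int a (ival e (F x), ival f (F x)) (ival g (F x)) (F x))"
proof -
  note [measurable] = measurable_ival[OF F]
  have [measurable]: "(\<lambda>x. ints (F x) a ij) \<in> measurable M (count_space UNIV)"
    "(\<lambda>x. reals (F x) a ij) \<in> borel_measurable M" for a ij
    by (rule state_measurableD[OF F])+
  have "ints (write_int a (ival e s, ival f s) (ival g s) s) b ij =
      (if b = a \<and> fst ij = ival e s \<and> snd ij = ival f s then ival g s else ints s b ij)" for s b ij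
    by (cases ij) (auto simp: write_int_def)
  moreover have "reals (write_int a (ival e s, ival f s) (ival g s) s) = reals s" for s
    by (simp add: write_int_def)
  ultimately show ?thesis by (intro state_measurableI) simp_all
qed

lemma state_measurable_write_real:
  assumes F: "state_measurable M F"
  shows "state_measurable M (\<lambda>x. write_real a (ival e (F x), ival f (F x)) (rval g (F x)) (F x))"
proof -
  note [measurable] = measurable_ival[OF F] borel_measurable_rval[OF F]
  have [measurable]: "(\<lambda>x. ints (F x) a ij) \<in> measurable M (count_space UNIV)"
    "(\<lambda>x. reals (F x) a ij) \<in> borel_measurable M" for a ij
    by (rule state_measurableD[OF F])+
  have "reals (write_real a (ival e s, ival f s) (rval g s) s) b ij =
      (if b = a \<and> fst ij = ival e s \<and> snd ij = ival f s then rval g s else reals s b ij)" for s b ij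
    by (cases ij) (auto simp: write_real_def)
  moreover have "ints (write_real a (ival e s, ival f s) (rval g s) s) = ints s" for s
    by (simp add: write_real_def)
  ultimately show ?thesis by (intro state_measurableI) simp_all
qed

text \<open>The input map \<open>F\<close> stays arbitrary because the second half of a composition
  starts from the random state left by the first. Loops need an inner induction on the fuel, which
  is the purpose of the fuel.\<close>

lemma measurable_run:
  assumes "state_measurable M F"
  shows "Measurable.pred M (\<lambda>x. fst (run c k (F x))) \<and> state_measurable M (\<lambda>x. snd (run c k (F x)))"
  using assms
proof (induction c arbitrary: k F)
  case (Seq c d)
  from Seq.IH(1)[OF Seq.prems] have 1: "Measurable.pred M (\<lambda>x. fst (run c k (F x)))"
    "state_measurable M (\<lambda>x. snd (run c k (F x)))" by auto
  from Seq.IH(2)[OF 1(2), of k] have 2: "Measurable.pred M (\<lambda>x. fst (run d k (snd (run c k (F x)))))"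
    "state_measurable M (\<lambda>x. snd (run d k (snd (run c k (F x)))))" by auto
  note [measurable] = 1(1) 2(1)
  show ?case using 2(2) by simp
next
  case (Cond b c d)
  note [measurable] = measurable_bval[OF Cond.prems]
  from Cond.IH(1)[OF Cond.prems, of k] Cond.IH(2)[OF Cond.prems, of k]
  show ?case
    by (auto intro!: state_measurable_If measurable_bval Cond.prems simp: if_distrib[of fst] if_distrib[of snd])
next
  case (While b c)
  show ?case using While.prems
  proof (induction k arbitrary: F)
    case (Suc k)
    note [measurable] = measurable_bval[OF Suc.prems]
    from While.IH[OF Suc.prems, of k] have 1: "Measurable.pred M (\<lambda>x. fst (run c k (F x)))"
      "state_measurable M (\<lambda>x. snd (run c k (F x)))" by auto
    note [measurable] = 1(1)
    from Suc.IH[OF 1(2)] show ?case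
      by (auto intro!: state_measurable_If measurable_bval Suc.prems simp: if_distrib[of fst] if_distrib[of snd])
  qed simp
qed (auto intro: state_measurable_write_int state_measurable_write_real)

text \<open>With the quantifier over runs replaced by one over the fuel, the event that a given list
  is output becomes a countable union.\<close>

lemma outputs_iff_run:
  "outputs P n X vs \<longleftrightarrow> (\<exists>k. fst (run P k (atsp_input n X)) \<and> atsp_output n (snd (run P k (atsp_input n X))) = vs)"
proof
  assume "outputs P n X vs"
  then obtain t m s where "exec P (atsp_input n X) t m s" "vs = atsp_output n s"
    by (auto simp: outputs_def)
  then show "\<exists>k. fst (run P k (atsp_input n X)) \<and> atsp_output n (snd (run P k (atsp_input n X))) = vs"
    by (intro exI[of _ t]) (simp add: exec_imp_run)
next
  assume "\<exists>k. fst (run P k (atsp_input n X)) \<and> atsp_output n (snd (run P k (atsp_input n X))) = vs"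
  then obtain k where k: "fst (run P k (atsp_input n X))" "atsp_output n (snd (run P k (atsp_input n X))) = vs"
    by blast
  obtain t m where "exec P (atsp_input n X) t m (snd (run P k (atsp_input n X)))"
    using run_imp_exec[of P k "atsp_input n X"] k(1) by (metis prod.collapse)
  then show "outputs P n X vs" using k(2) unfolding outputs_def by blast
qed

lemma state_measurable_atsp_input:
  "state_measurable (\<Pi>\<^sub>M a\<in>arcs n. (lborel :: real measure)) (atsp_input n)"
proof (rule state_measurableI)
  fix a and ij :: "int \<times> int"
  show "(\<lambda>X. reals (atsp_input n X) a ij) \<in> borel_measurable (\<Pi>\<^sub>M a\<in>arcs n. (lborel :: real measure))"
  proof (cases "a = ''X'' \<and> fst ij \<in> {1..int n} \<and> snd ij \<in> {1..int n}")
    case True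
    then have "(nat (fst ij), nat (snd ij)) \<in> arcs n" by auto
    then have "(\<lambda>X. X (nat (fst ij), nat (snd ij))) \<in> borel_measurable (\<Pi>\<^sub>M a\<in>arcs n. (lborel :: real measure))"
      using measurable_component_singleton[of "(nat (fst ij), nat (snd ij))" "arcs n" "\<lambda>_. lborel :: real measure"] by simp
    then show ?thesis using True by (cases ij) (simp add: atsp_input_def)
  next
    case False
    then show ?thesis by (cases ij) (auto simp: atsp_input_def)
  qed
qed (auto simp: atsp_input_def)

lemma sets_outputs:
  "{X \<in> space (\<Pi>\<^sub>M a\<in>arcs n. (lborel :: real measure)). outputs P n X vs} \<in> sets (\<Pi>\<^sub>M a\<in>arcs n. (lborel :: real measure))"
proof -
  let ?M = "\<Pi>\<^sub>M a\<in>arcs n. (lborel :: real measure)"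
  have [measurable]: "Measurable.pred ?M (\<lambda>X. fst (run P k (atsp_input n X)))" for k
    using measurable_run[OF state_measurable_atsp_input] by blast
  have "(\<lambda>X. ints (snd (run P k (atsp_input n X))) a ij) \<in> measurable ?M (count_space UNIV)" for k a ij
    using measurable_run[OF state_measurable_atsp_input] state_measurableD(1) by blast
  note [measurable] = this
  have "atsp_output n s = vs \<longleftrightarrow> length vs = n \<and> (\<forall>i<n. nat (ints s ''tour'' (int (Suc i), 0)) = vs ! i)" for s
    unfolding atsp_output_def list_eq_iff_nth_eq by (auto simp: nth_append simp del: upt_Suc)
  then have "outputs P n X vs \<longleftrightarrow> (\<exists>k. fst (run P k (atsp_input n X)) \<and> length vs = n \<and>
      (\<forall>i\<in>{..<n}. nat (ints (snd (run P k (atsp_input n X))) ''tour'' (int (Suc i), 0)) = vs ! i))" for X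
    unfolding outputs_iff_run by auto
  then show ?thesis by (simp only:) measurable
qed

section \<open>Tours, the optimal cost and the success event\<close>

lemma finite_tours: "finite {vs. is_tour n vs}"
proof (rule finite_subset)
  show "{vs. is_tour n vs} \<subseteq> {vs. set vs \<subseteq> {1..n} \<and> length vs = n}"
  proof
    fix vs assume "vs \<in> {vs. is_tour n vs}"
    then have vs: "distinct vs" "set vs = {1..n}" by (simp_all add: is_tour_def)
    have "length vs = n" using distinct_card[OF vs(1)] vs(2) by simp
    then show "vs \<in> {vs. set vs \<subseteq> {1..n} \<and> length vs = n}" using vs(2) by simp
  qed
qed (rule finite_lists_length_eq, simp)

lemma borel_measurable_tour_cost:
  assumes "is_tour n vs"
  shows "(\<lambda>X. tour_cost X vs) \<in> borel_measurable (\<Pi>\<^sub>M a\<in>arcs n. (lborel :: real measure))"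
proof -
  have "(\<lambda>X. X (vs ! i, vs ! (Suc i mod length vs))) \<in> borel_measurable (\<Pi>\<^sub>M a\<in>arcs n. (lborel :: real measure))"
    if "i < length vs" for i
  proof -
    have "Suc i mod length vs < length vs" using that by (intro mod_less_divisor) auto
    then have "vs ! i \<in> set vs" "vs ! (Suc i mod length vs) \<in> set vs"
      using that by (simp_all only: nth_mem)
    then have "(vs ! i, vs ! (Suc i mod length vs)) \<in> arcs n" using assms by (auto simp: is_tour_def)
    from measurable_component_singleton[OF this, of "\<lambda>_. lborel :: real measure"] show ?thesis by simp
  qed
  then show ?thesis unfolding tour_cost_def by (intro borel_measurable_sum) auto
qed

lemma tour_exists: "is_tour n [1..<Suc n]"
  by (auto simp: is_tour_def)

lemma opt_cost_le: "is_tour n vs \<Longrightarrow> opt_cost n X \<le> tour_cost X vs"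
  unfolding opt_cost_def by (intro Min_le) (auto simp: finite_tours)

lemma opt_cost_attained: "\<exists>vs. is_tour n vs \<and> opt_cost n X = tour_cost X vs"
proof -
  have "opt_cost n X \<in> {tour_cost X vs | vs. is_tour n vs}"
    unfolding opt_cost_def using tour_exists[of n] by (intro Min_in) (auto simp: finite_tours)
  then show ?thesis by auto
qed

lemma borel_measurable_opt_cost:
  "opt_cost n \<in> borel_measurable (\<Pi>\<^sub>M a\<in>arcs n. (lborel :: real measure))"
proof -
  have eq: "opt_cost n = (\<lambda>X. Min ((\<lambda>vs. tour_cost X vs) ` {vs. is_tour n vs}))"
    by (auto simp: opt_cost_def fun_eq_iff intro!: arg_cong[of _ _ Min])
  show ?thesis unfolding eq
    using tour_exists[of n]
    by (intro borel_measurable_Min finite_tours borel_measurable_tour_cost) auto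
qed

text \<open>Success is bounded from below by monotonicity of \<open>measure\<close>, which is
  available for measurable sets only. There are finitely many tours, so the quantifier over
  \<open>vs\<close> is a finite union.\<close>

lemma sets_good_output:
  "{X \<in> space (\<Pi>\<^sub>M a\<in>arcs n. (lborel :: real measure)). \<exists>vs. outputs P n X vs \<and> is_tour n vs \<and>
      \<bar>tour_cost X vs / opt_cost n X - 1\<bar> \<le> \<epsilon>} \<in> sets (\<Pi>\<^sub>M a\<in>arcs n. (lborel :: real measure))"
  (is "{X \<in> space ?M. ?Q X} \<in> _")
proof -
  have "{X \<in> space ?M. ?Q X} = (\<Union>vs\<in>{vs. is_tour n vs}.
      {X \<in> space ?M. outputs P n X vs} \<inter> {X \<in> space ?M. \<bar>tour_cost X vs / opt_cost n X - 1\<bar> \<le> \<epsilon>})"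
    by auto
  also have "\<dots> \<in> sets ?M"
  proof (intro sets.finite_UN finite_tours sets.Int sets_outputs)
    fix vs assume "vs \<in> {vs. is_tour n vs}"
    then have [measurable]: "(\<lambda>X. tour_cost X vs) \<in> borel_measurable ?M"
      by (intro borel_measurable_tour_cost) simp
    note [measurable] = borel_measurable_opt_cost[of n]
    show "{X \<in> space ?M. \<bar>tour_cost X vs / opt_cost n X - 1\<bar> \<le> \<epsilon>} \<in> sets ?M"
      by measurable
  qed
  finally show ?thesis .
qed

section \<open>Products of exponential distributions\<close>

definition expo :: "real \<Rightarrow> real measure" where
  "expo l = density lborel (exponential_density l)"

lemma sets_expo[simp, measurable_cong]: "sets (expo l) = sets borel"
  by (simp add: expo_def)

lemma space_expo[simp]: "space (expo l) = UNIV"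
  by (simp add: expo_def)

lemma prob_space_expo: "0 < l \<Longrightarrow> prob_space (expo l)"
  unfolding expo_def by (rule prob_space_exponential_density)

lemma emeasure_expo_atMost:
  assumes "0 < l" "0 \<le> a"
  shows "emeasure (expo l) {..a} = ennreal (1 - exp (- l * a))"
  unfolding expo_def using assms by (simp add: emeasure_erlang_density erlang_CDF_def)

lemma emeasure_expo_greaterThan:
  assumes "0 < l" "0 \<le> a"
  shows "emeasure (expo l) {a<..} = ennreal (exp (- l * a))"
proof -
  interpret prob_space "expo l" using assms by (rule_tac prob_space_expo)
  have "{a<..} = space (expo l) - {..a}" by auto
  then have "prob {a<..} = 1 - prob {..a}" by (simp add: prob_compl del: space_expo)
  also have "prob {..a} = 1 - exp (- l * a)"
    using emeasure_expo_atMost[OF assms] assms by (simp add: emeasure_eq_measure)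
  finally show ?thesis by (simp add: emeasure_eq_measure)
qed

lemma emeasure_expo_singleton: "emeasure (expo l) {a} = 0"
proof -
  have "absolutely_continuous lborel (expo l)"
    unfolding expo_def by (rule absolutely_continuousI_density) simp
  moreover have "{a} \<in> null_sets lborel" by (simp add: null_sets_def)
  ultimately show ?thesis by (auto simp: absolutely_continuous_def)
qed

lemma emeasure_expo_lessThan:
  assumes "0 < l" "0 \<le> a"
  shows "emeasure (expo l) {..<a} = ennreal (1 - exp (- l * a))"
proof -
  have "emeasure (expo l) {..a} = emeasure (expo l) {..<a} + emeasure (expo l) {a}"
    by (subst plus_emeasure) (auto intro!: arg_cong[of _ _ "emeasure _"])
  then show ?thesis using emeasure_expo_atMost[OF assms] by (simp add: emeasure_expo_singleton)
qed

lemma emeasure_expo_atLeast: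
  assumes "0 < l" "0 \<le> a"
  shows "emeasure (expo l) {a..} = ennreal (exp (- l * a))"
proof -
  have "emeasure (expo l) {a..} = emeasure (expo l) {a<..} + emeasure (expo l) {a}"
    by (subst plus_emeasure) (auto intro!: arg_cong[of _ _ "emeasure _"])
  then show ?thesis using emeasure_expo_greaterThan[OF assms] by (simp add: emeasure_expo_singleton)
qed

lemma nn_integral_exp_tail:
  assumes "0 \<le> s"
  shows "(\<integral>\<^sup>+ t. ennreal (exp (- t)) * indicator {s..} t \<partial>lborel) = ennreal (exp (- s))"
proof -
  have "(\<integral>\<^sup>+ t. ennreal (exp (- t)) * indicator {s..} t \<partial>lborel) = emeasure (expo 1) {s..}"
    unfolding expo_def using assms
    by (subst emeasure_density) (auto intro!: nn_integral_cong simp: exponential_density_def split: split_indicator)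
  then show ?thesis using emeasure_expo_atLeast[of 1 s] assms by simp
qed

text \<open>Rates are positive off \<open>I\<close> too, because the product locales want a
  probability space at every index. A rate function given on \<open>I\<close> alone is extended by 1
  before the locale is instantiated.\<close>

locale expo_product =
  fixes I :: "'i set" and \<alpha> :: "'i \<Rightarrow> real"
  assumes finite_index: "finite I" and rate_pos: "\<And>a. 0 < \<alpha> a"
begin

abbreviation vol :: "('i \<Rightarrow> real) measure" where
  "vol \<equiv> \<Pi>\<^sub>M a\<in>I. lborel"

definition P :: "('i \<Rightarrow> real) measure" where
  "P = (\<Pi>\<^sub>M a\<in>I. expo (\<alpha> a))"

definition corner :: "real \<Rightarrow> ('i \<Rightarrow> real) set" where
  "corner t = {x \<in> I \<rightarrow>\<^sub>E {0..}. (\<Sum>a\<in>I. \<alpha> a * x a) \<le> t}"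

sublocale E: product_prob_space "\<lambda>a. expo (\<alpha> a)" I
proof -
  interpret prob_space "expo (\<alpha> a)" for a by (rule prob_space_expo[OF rate_pos])
  show "product_prob_space (\<lambda>a. expo (\<alpha> a))" by unfold_locales
qed

sublocale V: product_sigma_finite "\<lambda>_ :: 'i. lborel :: real measure" ..

sublocale prob_space P
  unfolding P_def by (rule E.P.prob_space_axioms)

lemma sets_P[simp, measurable_cong]: "sets P = sets vol"
  unfolding P_def by (intro sets_PiM_cong) auto

lemma space_P: "space P = I \<rightarrow>\<^sub>E UNIV"
  by (simp add: P_def space_PiM)

lemma sigma_finite_vol: "sigma_finite_measure vol"
  by (rule V.sigma_finite[OF finite_index])

text \<open>A product measure is determined by its values on boxes, and there the integral of the
  product density factors.\<close>

lemma P_eq_density: "P = density vol (\<lambda>x. ennreal (\<Prod>a\<in>I. exponential_density (\<alpha> a) (x a)))"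
  unfolding P_def
proof (rule E.PiM_eqI[symmetric, OF finite_index])
  show "sets (density vol (\<lambda>x. ennreal (\<Prod>a\<in>I. exponential_density (\<alpha> a) (x a)))) =
      sets (\<Pi>\<^sub>M a\<in>I. expo (\<alpha> a))"
    by (auto intro!: sets_PiM_cong)
next
  fix A assume A: "\<And>i. i \<in> I \<Longrightarrow> A i \<in> sets (expo (\<alpha> i))"
  then have [measurable]: "i \<in> I \<Longrightarrow> A i \<in> sets borel" for i by simp
  have [measurable]: "Pi\<^sub>E I A \<in> sets vol" using A finite_index by (intro sets_PiM_I_finite) auto
  have "emeasure (density vol (\<lambda>x. ennreal (\<Prod>a\<in>I. exponential_density (\<alpha> a) (x a)))) (Pi\<^sub>E I A) =
      (\<integral>\<^sup>+x. (\<Prod>a\<in>I. ennreal (exponential_density (\<alpha> a) (x a)) * indicator (A a) (x a)) \<partial>vol)"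
  proof (subst emeasure_density, measurable, intro nn_integral_cong)
    fix x assume "x \<in> space vol"
    then have "indicator (Pi\<^sub>E I A) x = (\<Prod>a\<in>I. indicator (A a) (x a) :: ennreal)"
      using finite_index by (auto simp: indicator_def space_PiM PiE_def Pi_def prod_zero_iff)
    then show "ennreal (\<Prod>a\<in>I. exponential_density (\<alpha> a) (x a)) * indicator (Pi\<^sub>E I A) x =
        (\<Prod>a\<in>I. ennreal (exponential_density (\<alpha> a) (x a)) * indicator (A a) (x a))"
      using rate_pos by (simp add: prod_ennreal prod.distrib less_imp_le)
  qed
  also have "\<dots> = (\<Prod>a\<in>I. emeasure (expo (\<alpha> a)) (A a))"
    by (subst V.product_nn_integral_prod[OF finite_index])
      (auto simp: expo_def emeasure_density intro!: prod.cong)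
  finally show "emeasure (density vol (\<lambda>x. ennreal (\<Prod>a\<in>I. exponential_density (\<alpha> a) (x a)))) (Pi\<^sub>E I A) =
      (\<Prod>a\<in>I. emeasure (expo (\<alpha> a)) (A a))" .
qed

lemma measurable_scale: "(\<lambda>x. \<lambda>i\<in>I. c * x i) \<in> measurable vol vol"
  by (intro measurable_restrict) simp

text \<open>By uniqueness of the product measure only boxes have to be checked, and each side of a
  box contributes one factor \<open>c\<close>.\<close>

lemma vol_scale: 
  assumes c: "0 < c" and B: "B \<in> sets vol"
  shows "emeasure vol B = ennreal (c ^ card I) * emeasure vol {x \<in> space vol. (\<lambda>i\<in>I. c * x i) \<in> B}"
proof -
  note [measurable] = measurable_scale
  define N where "N = density (distr vol vol (\<lambda>x. \<lambda>i\<in>I. c * x i)) (\<lambda>_. ennreal (c ^ card I))"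
  have "N = vol"
  proof (rule V.PiM_eqI[OF finite_index])
    show "sets N = sets vol" by (simp add: N_def)
    fix A :: "'i \<Rightarrow> real set" assume "\<And>i. i \<in> I \<Longrightarrow> A i \<in> sets lborel"
    then have A[measurable]: "i \<in> I \<Longrightarrow> A i \<in> sets borel" for i by simp
    have [measurable]: "Pi\<^sub>E I A \<in> sets vol" using A finite_index by (intro sets_PiM_I_finite) auto
    have pre: "(\<lambda>x. \<lambda>i\<in>I. c * x i) -` Pi\<^sub>E I A \<inter> space vol = (\<Pi>\<^sub>E i\<in>I. (\<lambda>y. c * y) -` A i)"
      by (auto simp: space_PiM PiE_def Pi_def)
    have one: "emeasure lborel (A i) = ennreal c * emeasure lborel ((\<lambda>y. c * y) -` A i)" if "i \<in> I" for i
    proof -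
      have "emeasure lborel (A i) = emeasure (density (distr lborel borel (\<lambda>x. 0 + c * x)) (\<lambda>_. ennreal \<bar>c\<bar>)) (A i)"
        using c by (subst lborel_real_affine[of c 0]) auto
      also have "\<dots> = ennreal c * emeasure lborel ((\<lambda>y. c * y) -` A i)"
        using c A[OF that] by (simp add: emeasure_density nn_integral_cmult_indicator emeasure_distr)
      finally show ?thesis .
    qed
    have "emeasure N (Pi\<^sub>E I A) = ennreal (c ^ card I) * emeasure vol (\<Pi>\<^sub>E i\<in>I. (\<lambda>y. c * y) -` A i)"
      unfolding N_def by (simp add: emeasure_density nn_integral_cmult_indicator emeasure_distr pre)
    also have "emeasure vol (\<Pi>\<^sub>E i\<in>I. (\<lambda>y. c * y) -` A i) = (\<Prod>i\<in>I. emeasure lborel ((\<lambda>y. c * y) -` A i))"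
      using measurable_sets[of "\<lambda>y. c * y" borel borel]
      by (intro V.emeasure_PiM finite_index) (auto simp: A)
    also have "ennreal (c ^ card I) * \<dots> = (\<Prod>i\<in>I. ennreal c * emeasure lborel ((\<lambda>y. c * y) -` A i))"
      using c by (simp add: prod.distrib ennreal_power)
    also have "\<dots> = (\<Prod>i\<in>I. emeasure lborel (A i))" using one by (intro prod.cong) auto
    finally show "emeasure N (Pi\<^sub>E I A) = (\<Prod>i\<in>I. emeasure lborel (A i))" .
  qed
  then have "emeasure vol B = emeasure N B" by simp
  also have "\<dots> = ennreal (c ^ card I) * emeasure vol ((\<lambda>x. \<lambda>i\<in>I. c * x i) -` B \<inter> space vol)"
    unfolding N_def using B by (simp add: emeasure_density nn_integral_cmult_indicator emeasure_distr)
  finally show ?thesis by (simp add: vimage_def Int_def conj_commute)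
qed

lemma sets_corner[measurable]: "corner t \<in> sets vol"
proof -
  have "corner t = {x \<in> space vol. (\<forall>a\<in>I. 0 \<le> x a) \<and> (\<Sum>a\<in>I. \<alpha> a * x a) \<le> t}"
    by (auto simp: corner_def space_PiM PiE_def Pi_def)
  also have "\<dots> \<in> sets vol" using finite_index by measurable
  finally show ?thesis .
qed

text \<open>Writing $e^{-s}$ as $\int_{t \ge s} e^{-t}$ turns the product density, a function of
  $s = \sum_a \alpha_a x_a$ only, into a mixture of uniform distributions on simplices.\<close>

lemma P_cone_mixture:
  assumes A[measurable]: "A \<in> sets vol" and nonneg: "\<And>x a. x \<in> A \<Longrightarrow> a \<in> I \<Longrightarrow> 0 \<le> x a"
    and cone: "\<And>x c. x \<in> space vol \<Longrightarrow> 0 < c \<Longrightarrow> (\<lambda>i\<in>I. c * x i) \<in> A \<longleftrightarrow> x \<in> A"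
    and L: "0 < L"
  shows "emeasure P A =
    (\<integral>\<^sup>+t. ennreal ((\<Prod>a\<in>I. \<alpha> a) * exp (- t) * (t / L) ^ card I) * indicator {0<..} t \<partial>lborel) *
      emeasure vol (A \<inter> corner L)"
proof -
  define s where "s x = (\<Sum>a\<in>I. \<alpha> a * x a)" for x
  define C where "C = (\<Prod>a\<in>I. \<alpha> a)"
  have C: "0 < C" unfolding C_def using rate_pos by (simp add: prod_pos)
  have [measurable]: "s \<in> borel_measurable vol" unfolding s_def using finite_index by measurable
  have s0: "0 \<le> s x" if "x \<in> A" for x
    unfolding s_def using nonneg[OF that] rate_pos by (intro sum_nonneg mult_nonneg_nonneg) (auto simp: less_imp_le)
  interpret vs: sigma_finite_measure vol by (rule sigma_finite_vol)
  interpret pair_sigma_finite vol lborel ..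
  have dens: "(\<Prod>a\<in>I. exponential_density (\<alpha> a) (x a)) = C * exp (- s x)" if "x \<in> A" for x
  proof -
    have "(\<Prod>a\<in>I. exponential_density (\<alpha> a) (x a)) = (\<Prod>a\<in>I. \<alpha> a * exp (- (\<alpha> a * x a)))"
    proof (rule prod.cong[OF refl])
      fix a assume "a \<in> I"
      then show "exponential_density (\<alpha> a) (x a) = \<alpha> a * exp (- (\<alpha> a * x a))"
        using nonneg[OF that, of a] by (simp add: exponential_density_def mult.commute)
    qed
    also have "\<dots> = C * exp (- s x)"
      using finite_index by (simp add: prod.distrib C_def s_def exp_sum sum_negf[symmetric])
    finally show ?thesis .
  qed
  have corner: "x \<in> corner t \<longleftrightarrow> s x \<le> t" if "x \<in> A" for x t
    using nonneg[OF that] sets.sets_into_space[OF A] that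
    by (auto simp: corner_def s_def space_PiM PiE_def Pi_def)
  have "emeasure P A = (\<integral>\<^sup>+x. ennreal (C * exp (- s x)) * indicator A x \<partial>vol)"
    unfolding P_eq_density by (subst emeasure_density) (auto intro!: nn_integral_cong simp: dens split: split_indicator)
  also have "\<dots> = (\<integral>\<^sup>+x. (\<integral>\<^sup>+t. ennreal C * ennreal (exp (- t)) * indicator {s x..} t * indicator A x \<partial>lborel) \<partial>vol)"
  proof (intro nn_integral_cong)
    fix x
    show "ennreal (C * exp (- s x)) * indicator A x =
        (\<integral>\<^sup>+t. ennreal C * ennreal (exp (- t)) * indicator {s x..} t * indicator A x \<partial>lborel)"
      using nn_integral_exp_tail[OF s0, of x] C
      by (auto split: split_indicator simp: mult.assoc nn_integral_cmult ennreal_mult)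
  qed
  also have "\<dots> = (\<integral>\<^sup>+t. (\<integral>\<^sup>+x. ennreal C * ennreal (exp (- t)) * indicator {s x..} t * indicator A x \<partial>vol) \<partial>lborel)"
  proof (rule Fubini'[symmetric])
    have "(\<lambda>(x, t). ennreal C * ennreal (exp (- t)) * (if s x \<le> t then 1 else 0) * indicator A x)
        \<in> borel_measurable (vol \<Otimes>\<^sub>M lborel)" by measurable
    then show "(\<lambda>(x, t). ennreal C * ennreal (exp (- t)) * indicator {s x..} t * indicator A x)
        \<in> borel_measurable (vol \<Otimes>\<^sub>M lborel)" by (simp add: indicator_def)
  qed
  also have "\<dots> = (\<integral>\<^sup>+t. ennreal (C * exp (- t) * (t / L) ^ card I) * indicator {0<..} t * emeasure vol (A \<inter> corner L) \<partial>lborel)"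
  proof (rule nn_integral_cong_AE)
    \<comment> \<open>At t = 0 the scaling by t/L degenerates, so this single point is
      discarded.\<close>
    have "AE t in lborel. t \<noteq> (0::real)" by (rule AE_lborel_singleton)
    then show "AE t in lborel. (\<integral>\<^sup>+x. ennreal C * ennreal (exp (- t)) * indicator {s x..} t * indicator A x \<partial>vol) =
        ennreal (C * exp (- t) * (t / L) ^ card I) * indicator {0<..} t * emeasure vol (A \<inter> corner L)"
    proof eventually_elim
      case (elim t)
      have "(\<integral>\<^sup>+x. ennreal C * ennreal (exp (- t)) * indicator {s x..} t * indicator A x \<partial>vol) =
          (\<integral>\<^sup>+x. ennreal (C * exp (- t)) * indicator (A \<inter> corner t) x \<partial>vol)"
        using C by (intro nn_integral_cong) (auto split: split_indicator simp: corner ennreal_mult)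
      also have "\<dots> = ennreal (C * exp (- t)) * emeasure vol (A \<inter> corner t)"
        by (simp add: nn_integral_cmult_indicator)
      also have "\<dots> = ennreal (C * exp (- t) * (t / L) ^ card I) * indicator {0<..} t * emeasure vol (A \<inter> corner L)"
      proof (cases "0 < t")
        case True
        then have c: "0 < t / L" using L by simp
        \<comment> \<open>Scaling by t/L maps the cone \<open>A\<close> to itself and
          \<open>corner L\<close> to \<open>corner t\<close>. Hence the volume at level t is that at
          level L times a power of t/L, and the t-integral splits off as a constant.\<close>
        have "{x \<in> space vol. (\<lambda>i\<in>I. (t / L) * x i) \<in> A \<inter> corner t} = A \<inter> corner L"
        proof -
          have "(\<lambda>i\<in>I. (t / L) * x i) \<in> A \<inter> corner t \<longleftrightarrow> x \<in> A \<inter> corner L" if x: "x \<in> space vol" for x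
          proof -
            have "s (\<lambda>i\<in>I. (t / L) * x i) = (t / L) * s x"
              unfolding s_def by (simp add: sum_distrib_left mult_ac)
            moreover have "(t / L) * s x \<le> t \<longleftrightarrow> s x \<le> L" using L True by (simp add: field_simps)
            ultimately show ?thesis using cone[OF x c] corner by (metis IntE IntI)
          qed
          then show ?thesis using sets.sets_into_space[OF A] by blast
        qed
        then have "emeasure vol (A \<inter> corner t) = ennreal ((t / L) ^ card I) * emeasure vol (A \<inter> corner L)"
          using vol_scale[OF c, of "A \<inter> corner t"] by simp
        then show ?thesis using True C L by (simp add: ennreal_mult mult.assoc)
      next
        case False
        then have "A \<inter> corner t = {}" using elim s0 corner by force
        then show ?thesis using False by simp
      qed
      finally show ?case .
    qed
  qed
  also have "\<dots> = (\<integral>\<^sup>+t. ennreal (C * exp (- t) * (t / L) ^ card I) * indicator {0<..} t \<partial>lborel) * emeasure vol (A \<inter> corner L)"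
    by (intro nn_integral_multc) measurable
  finally show ?thesis unfolding C_def .
qed

lemma P_nonneg: "emeasure P {x \<in> space vol. \<forall>a\<in>I. 0 \<le> x a} = 1"
proof -
  have "{x \<in> space vol. \<forall>a\<in>I. 0 \<le> x a} = (\<Pi>\<^sub>E a\<in>I. {0..})"
    by (auto simp: space_PiM PiE_def Pi_def)
  moreover have "emeasure P (\<Pi>\<^sub>E a\<in>I. {0..}) = (\<Prod>a\<in>I. emeasure (expo (\<alpha> a)) {0..})"
    unfolding P_def by (intro E.emeasure_PiM finite_index) simp
  ultimately show ?thesis using emeasure_expo_atLeast[OF rate_pos, of 0] by simp
qed

text \<open>By \<open>P_cone_mixture\<close>, \<open>P\<close> is a constant times volume on all
  cones alike. The nonnegative orthant, of probability 1, identifies the constant as the reciprocal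
  volume of the simplex. Scale invariant events therefore have the same probability under the
  exponential product and under the uniform distribution.\<close>

lemma P_cone:
  assumes A: "A \<in> sets vol" and nonneg: "\<And>x a. x \<in> A \<Longrightarrow> a \<in> I \<Longrightarrow> 0 \<le> x a"
    and cone: "\<And>x c. x \<in> space vol \<Longrightarrow> 0 < c \<Longrightarrow> (\<lambda>i\<in>I. c * x i) \<in> A \<longleftrightarrow> x \<in> A"
    and L: "0 < L"
  shows "emeasure P A * emeasure vol (corner L) = emeasure vol (A \<inter> corner L)"
proof -
  define G where "G = (\<integral>\<^sup>+t. ennreal ((\<Prod>a\<in>I. \<alpha> a) * exp (- t) * (t / L) ^ card I) * indicator {0<..} t \<partial>lborel)"
  let ?O = "{x \<in> space vol. \<forall>a\<in>I. 0 \<le> x a}"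
  have O: "?O \<in> sets vol" using finite_index by measurable
  have "1 = G * emeasure vol (?O \<inter> corner L)"
    unfolding G_def P_nonneg[symmetric]
    by (rule P_cone_mixture[OF O _ _ L]) (auto simp: space_PiM zero_le_mult_iff not_less)
  also have "?O \<inter> corner L = corner L"
    by (auto simp: corner_def space_PiM PiE_def Pi_def)
  finally have G: "G * emeasure vol (corner L) = 1" by simp
  have "emeasure P A = G * emeasure vol (A \<inter> corner L)"
    unfolding G_def by (rule P_cone_mixture) (fact A | fact L | erule (1) nonneg | erule (1) cone)+
  then have "emeasure P A * emeasure vol (corner L) = (G * emeasure vol (corner L)) * emeasure vol (A \<inter> corner L)"
    by (simp add: mult_ac)
  then show ?thesis unfolding G by simp
qed

end

section \<open>Resampling the excess over a threshold\<close>

definition resample :: "real \<Rightarrow> real \<Rightarrow> real \<Rightarrow> real" where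
  "resample \<beta> u v = (if u < \<beta> then u else \<beta> + max 0 v)"

lemma measurable_resample[measurable]: "case_prod (resample \<beta>) \<in> borel_measurable (borel \<Otimes>\<^sub>M borel)"
  unfolding resample_def by measurable

text \<open>The \<open>max 0\<close> in \<open>resample\<close> is there to make this true for every
  real \<open>v\<close>, not only almost surely.\<close>

lemma resample_less_iff: "resample \<beta> u v < \<beta> \<longleftrightarrow> u < \<beta>"
  by (simp add: resample_def)

lemma resample_eq: "u < \<beta> \<Longrightarrow> resample \<beta> u v = u"
  by (simp add: resample_def)

text \<open>Memorylessness: given that an exponential variable is at least \<beta>, its excess over
  \<beta> has the original law, so it may be replaced by an independent copy. The proof compares
  distribution functions on either side of \<beta>.\<close>

lemma distr_resample_expo:
  assumes l: "0 < l" and \<beta>: "0 \<le> \<beta>"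
  shows "distr (expo l \<Otimes>\<^sub>M expo l) borel (case_prod (resample \<beta>)) = expo l"
proof -
  interpret e: prob_space "expo l" by (rule prob_space_expo[OF l])
  interpret ee: pair_prob_space "expo l" "expo l" ..
  have "distributed (expo l \<Otimes>\<^sub>M expo l) lborel (case_prod (resample \<beta>)) (exponential_density l)"
  proof (rule erlang_distributedI[OF _ l])
    show "case_prod (resample \<beta>) \<in> borel_measurable (expo l \<Otimes>\<^sub>M expo l)" by measurable
    fix a :: real assume a: "0 \<le> a"
    have "emeasure (expo l \<Otimes>\<^sub>M expo l) {x \<in> space (expo l \<Otimes>\<^sub>M expo l). case_prod (resample \<beta>) x \<le> a} =
        ennreal (1 - exp (- l * a))"
    proof (cases "a < \<beta>")
      case True
      then have "{x \<in> space (expo l \<Otimes>\<^sub>M expo l). case_prod (resample \<beta>) x \<le> a} = {..a} \<times> UNIV"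
        using \<beta> by (auto simp: resample_def space_pair_measure split: if_splits)
      then show ?thesis
        using emeasure_expo_atMost[OF l a] e.emeasure_space_1
        by (simp add: e.emeasure_pair_measure_Times)
    next
      case False
      then have eq: "{x \<in> space (expo l \<Otimes>\<^sub>M expo l). case_prod (resample \<beta>) x \<le> a} =
          ({..<\<beta>} \<times> UNIV) \<union> ({\<beta>..} \<times> {..a - \<beta>})"
        by (auto simp: resample_def space_pair_measure split: if_splits)
      have "emeasure (expo l \<Otimes>\<^sub>M expo l) (({..<\<beta>} \<times> UNIV) \<union> ({\<beta>..} \<times> {..a - \<beta>})) =
          emeasure (expo l \<Otimes>\<^sub>M expo l) ({..<\<beta>} \<times> UNIV) + emeasure (expo l \<Otimes>\<^sub>M expo l) ({\<beta>..} \<times> {..a - \<beta>})"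
        by (subst plus_emeasure) auto
      also have "\<dots> = ennreal (1 - exp (- l * \<beta>)) + ennreal (exp (- l * \<beta>)) * ennreal (1 - exp (- l * (a - \<beta>)))"
        using False emeasure_expo_lessThan[OF l \<beta>] emeasure_expo_atLeast[OF l \<beta>] emeasure_expo_atMost[OF l, of "a - \<beta>"] e.emeasure_space_1
        by (simp add: e.emeasure_pair_measure_Times)
      also have "\<dots> = ennreal (1 - exp (- l * \<beta>) + exp (- l * \<beta>) * (1 - exp (- l * (a - \<beta>))))"
        using l \<beta> False by (simp add: ennreal_plus[symmetric] ennreal_mult[symmetric] del: ennreal_plus)
      also have "1 - exp (- l * \<beta>) + exp (- l * \<beta>) * (1 - exp (- l * (a - \<beta>))) = 1 - exp (- l * a)"
        by (simp add: algebra_simps exp_add[symmetric])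
      finally show ?thesis unfolding eq .
    qed
    then show "emeasure (expo l \<Otimes>\<^sub>M expo l) {x \<in> space (expo l \<Otimes>\<^sub>M expo l). case_prod (resample \<beta>) x \<le> a} =
        ennreal (erlang_CDF 0 l a)"
      using a by (simp add: erlang_CDF_def)
  qed
  from distributed_distr_eq_density[OF this] show ?thesis
    by (metis distr_cong expo_def sets_lborel)
qed

context expo_product
begin

lemma emeasure_P_PiE:
  assumes "\<And>i. i \<in> I \<Longrightarrow> A i \<in> sets borel"
  shows "emeasure P (Pi\<^sub>E I A) = (\<Prod>i\<in>I. emeasure (expo (\<alpha> i)) (A i))"
  unfolding P_def using assms by (intro E.emeasure_PiM finite_index) auto

lemma measurable_resample_product:
  "(\<lambda>(U, V). \<lambda>a\<in>I. resample \<beta> (U a) (V a)) \<in> measurable (vol \<Otimes>\<^sub>M vol) vol"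
proof -
  have "(\<lambda>UV. \<lambda>a\<in>I. case_prod (resample \<beta>) (fst UV a, snd UV a)) \<in> measurable (vol \<Otimes>\<^sub>M vol) vol"
  proof (rule measurable_restrict)
    fix a assume "a \<in> I"
    then have "(\<lambda>UV. (fst UV a, snd UV a)) \<in> measurable (vol \<Otimes>\<^sub>M vol) (borel \<Otimes>\<^sub>M borel)"
      by measurable
    from measurable_compose[OF this measurable_resample[of \<beta>]]
    show "(\<lambda>UV. case_prod (resample \<beta>) (fst UV a, snd UV a)) \<in> measurable (vol \<Otimes>\<^sub>M vol) lborel" by simp
  qed
  then show ?thesis by (simp add: case_prod_beta')
qed

text \<open>On a box the condition separates by coordinates, so Fubini reduces the claim to one
  exponential variable at a time.\<close>

lemma distr_resample_product:
  assumes \<beta>: "0 \<le> \<beta>"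
  shows "distr (P \<Otimes>\<^sub>M P) vol (\<lambda>(U, V). \<lambda>a\<in>I. resample \<beta> (U a) (V a)) = P" (is "?D = P")
proof -
  interpret PP: pair_prob_space P P ..
  note meas = measurable_resample_product[of \<beta>]
  have meas': "(\<lambda>(U, V). \<lambda>a\<in>I. resample \<beta> (U a) (V a)) \<in> measurable (P \<Otimes>\<^sub>M P) vol"
    using meas by (simp cong: measurable_cong_sets sets_pair_measure_cong)
  show ?thesis unfolding P_def
  proof (rule E.PiM_eqI[OF finite_index])
    show "sets (distr (Pi\<^sub>M I (\<lambda>a. expo (\<alpha> a)) \<Otimes>\<^sub>M Pi\<^sub>M I (\<lambda>a. expo (\<alpha> a))) vol
        (\<lambda>(U, V). \<lambda>a\<in>I. resample \<beta> (U a) (V a))) = sets (Pi\<^sub>M I (\<lambda>a. expo (\<alpha> a)))"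
      by (simp add: P_def[symmetric])
    fix A assume A: "\<And>i. i \<in> I \<Longrightarrow> A i \<in> sets (expo (\<alpha> i))"
    then have A'[measurable]: "i \<in> I \<Longrightarrow> A i \<in> sets borel" for i by simp
    have box: "Pi\<^sub>E I A \<in> sets vol" using A finite_index by (intro sets_PiM_I_finite) auto
    have sec: "{v. resample \<beta> u v \<in> A i} \<in> sets borel" if "i \<in> I" for u i
    proof -
      have "resample \<beta> u \<in> borel_measurable borel" unfolding resample_def by measurable
      from measurable_sets[OF this A'[OF that]] show ?thesis by (simp add: vimage_def)
    qed
    have [measurable]: "{x. case_prod (resample \<beta>) x \<in> A i} \<in> sets (borel \<Otimes>\<^sub>M borel)" if "i \<in> I" for i
      using measurable_sets[OF measurable_resample A'[OF that], of \<beta>] by (simp add: vimage_def space_pair_measure)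
    have one: "(\<integral>\<^sup>+u. emeasure (expo (\<alpha> i)) {v. resample \<beta> u v \<in> A i} \<partial>expo (\<alpha> i)) = emeasure (expo (\<alpha> i)) (A i)"
      if i: "i \<in> I" for i
    proof -
      interpret e: prob_space "expo (\<alpha> i)" by (rule prob_space_expo[OF rate_pos])
      have s: "{x. case_prod (resample \<beta>) x \<in> A i} \<in> sets (expo (\<alpha> i) \<Otimes>\<^sub>M expo (\<alpha> i))"
        using i by (simp cong: sets_pair_measure_cong)
      have "emeasure (expo (\<alpha> i)) (A i) = emeasure (distr (expo (\<alpha> i) \<Otimes>\<^sub>M expo (\<alpha> i)) borel (case_prod (resample \<beta>))) (A i)"
        by (simp add: distr_resample_expo[OF rate_pos \<beta>])
      also have "\<dots> = emeasure (expo (\<alpha> i) \<Otimes>\<^sub>M expo (\<alpha> i)) {x. case_prod (resample \<beta>) x \<in> A i}"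
        using A'[OF i] by (subst emeasure_distr) (auto simp: vimage_def space_pair_measure)
      also have "\<dots> = (\<integral>\<^sup>+u. emeasure (expo (\<alpha> i)) {v. resample \<beta> u v \<in> A i} \<partial>expo (\<alpha> i))"
        by (subst sigma_finite_measure.emeasure_pair_measure_alt[OF prob_space_imp_sigma_finite[OF prob_space_expo[OF rate_pos]] s]) (simp add: vimage_def)
      finally show ?thesis ..
    qed
    have sm: "(\<lambda>u. emeasure (expo (\<alpha> i)) {v. resample \<beta> u v \<in> A i}) \<in> borel_measurable (expo (\<alpha> i))" if i: "i \<in> I" for i
    proof -
      interpret e: prob_space "expo (\<alpha> i)" by (rule prob_space_expo[OF rate_pos])
      have s: "{x. case_prod (resample \<beta>) x \<in> A i} \<in> sets (expo (\<alpha> i) \<Otimes>\<^sub>M expo (\<alpha> i))"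
        using i by (simp cong: sets_pair_measure_cong)
      from sigma_finite_measure.measurable_emeasure_Pair[OF prob_space_imp_sigma_finite[OF prob_space_expo[OF rate_pos]] s] show ?thesis by (simp add: vimage_def)
    qed
    have "emeasure ?D (Pi\<^sub>E I A) =
        emeasure (P \<Otimes>\<^sub>M P) ((\<lambda>(U, V). \<lambda>a\<in>I. resample \<beta> (U a) (V a)) -` Pi\<^sub>E I A \<inter> space (P \<Otimes>\<^sub>M P))"
      by (rule emeasure_distr[OF meas' box])
    also have "\<dots> = (\<integral>\<^sup>+U. emeasure P (Pair U -` ((\<lambda>(U, V). \<lambda>a\<in>I. resample \<beta> (U a) (V a)) -` Pi\<^sub>E I A \<inter> space (P \<Otimes>\<^sub>M P))) \<partial>P)"
      by (rule emeasure_pair_measure_alt[OF measurable_sets[OF meas' box]])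
    also have "\<dots> = (\<integral>\<^sup>+U. (\<Prod>i\<in>I. emeasure (expo (\<alpha> i)) {v. resample \<beta> (U i) v \<in> A i}) \<partial>P)"
    proof (rule nn_integral_cong)
      fix U assume U: "U \<in> space P"
      have "Pair U -` ((\<lambda>(U, V). \<lambda>a\<in>I. resample \<beta> (U a) (V a)) -` Pi\<^sub>E I A \<inter> space (P \<Otimes>\<^sub>M P)) =
          (\<Pi>\<^sub>E i\<in>I. {v. resample \<beta> (U i) v \<in> A i})"
        using U by (auto simp: space_pair_measure space_P PiE_def Pi_def)
      then show "emeasure P (Pair U -` ((\<lambda>(U, V). \<lambda>a\<in>I. resample \<beta> (U a) (V a)) -` Pi\<^sub>E I A \<inter> space (P \<Otimes>\<^sub>M P))) =
          (\<Prod>i\<in>I. emeasure (expo (\<alpha> i)) {v. resample \<beta> (U i) v \<in> A i})"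
        using sec by (simp add: emeasure_P_PiE)
    qed
    also have "\<dots> = (\<Prod>i\<in>I. \<integral>\<^sup>+u. emeasure (expo (\<alpha> i)) {v. resample \<beta> u v \<in> A i} \<partial>expo (\<alpha> i))"
      unfolding P_def using sm by (intro E.product_nn_integral_prod finite_index) auto
    also have "\<dots> = (\<Prod>i\<in>I. emeasure (expo (\<alpha> i)) (A i))" using one by (intro prod.cong) auto
    finally show "emeasure (distr (Pi\<^sub>M I (\<lambda>a. expo (\<alpha> a)) \<Otimes>\<^sub>M Pi\<^sub>M I (\<lambda>a. expo (\<alpha> a))) vol
        (\<lambda>(U, V). \<lambda>a\<in>I. resample \<beta> (U a) (V a))) (Pi\<^sub>E I A) = (\<Prod>i\<in>I. emeasure (expo (\<alpha> i)) (A i))"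
      by (simp add: P_def[symmetric])
  qed
qed

text \<open>This is conditioning in the form of Fubini's theorem. Fixing \<open>U\<close> fixes all
  costs below \<beta>, and it is enough to bound, uniformly in \<open>U\<close>, the probability
  over the fresh values. The covering event \<open>T\<close> may depend on \<open>U\<close>, which
  lets the caller use everything that the low costs determine.\<close>

lemma prob_resample_le:
  assumes \<beta>: "0 \<le> \<beta>" and S: "S \<in> sets vol"
    and le: "\<And>U. U \<in> space vol \<Longrightarrow>
      \<exists>T\<in>sets vol. {V \<in> space vol. (\<lambda>a\<in>I. resample \<beta> (U a) (V a)) \<in> S} \<subseteq> T \<and> prob T \<le> c"
  shows "prob S \<le> c"
proof -
  interpret PP: pair_prob_space P P ..
  have meas': "(\<lambda>(U, V). \<lambda>a\<in>I. resample \<beta> (U a) (V a)) \<in> measurable (P \<Otimes>\<^sub>M P) vol"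
    using measurable_resample_product[of \<beta>] by (simp cong: measurable_cong_sets sets_pair_measure_cong)
  have c: "0 \<le> c"
  proof -
    obtain U where "U \<in> space P" using not_empty by blast
    then obtain T where "prob T \<le> c" using le[of U] by (auto simp: space_P space_PiM)
    then show ?thesis using measure_nonneg[of P T] by linarith
  qed
  have "emeasure P S = emeasure (distr (P \<Otimes>\<^sub>M P) vol (\<lambda>(U, V). \<lambda>a\<in>I. resample \<beta> (U a) (V a))) S"
    by (simp add: distr_resample_product[OF \<beta>])
  also have "\<dots> = emeasure (P \<Otimes>\<^sub>M P) ((\<lambda>(U, V). \<lambda>a\<in>I. resample \<beta> (U a) (V a)) -` S \<inter> space (P \<Otimes>\<^sub>M P))"
    by (rule emeasure_distr[OF meas' S])
  also have "\<dots> = (\<integral>\<^sup>+U. emeasure P (Pair U -` ((\<lambda>(U, V). \<lambda>a\<in>I. resample \<beta> (U a) (V a)) -` S \<inter> space (P \<Otimes>\<^sub>M P))) \<partial>P)"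
    by (rule emeasure_pair_measure_alt[OF measurable_sets[OF meas' S]])
  also have "\<dots> \<le> (\<integral>\<^sup>+U. ennreal c \<partial>P)"
  proof (rule nn_integral_mono)
    fix U assume U: "U \<in> space P"
    then have "U \<in> space vol" by (simp add: space_P space_PiM)
    from le[OF this] obtain T where T: "T \<in> sets vol"
      "{V \<in> space vol. (\<lambda>a\<in>I. resample \<beta> (U a) (V a)) \<in> S} \<subseteq> T" "prob T \<le> c" by blast
    have "emeasure P (Pair U -` ((\<lambda>(U, V). \<lambda>a\<in>I. resample \<beta> (U a) (V a)) -` S \<inter> space (P \<Otimes>\<^sub>M P))) \<le> emeasure P T"
      using T(1,2) by (intro emeasure_mono) (auto simp: space_pair_measure space_P space_PiM)
    also have "\<dots> \<le> ennreal c" using T(3) by (simp add: emeasure_eq_measure ennreal_leI)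
    finally show "emeasure P (Pair U -` ((\<lambda>(U, V). \<lambda>a\<in>I. resample \<beta> (U a) (V a)) -` S \<inter> space (P \<Otimes>\<^sub>M P))) \<le> ennreal c" .
  qed
  also have "\<dots> = ennreal c" using emeasure_space_1 by simp
  finally show ?thesis using c by (simp add: emeasure_eq_measure)
qed

section \<open>Estimates for independent exponential coordinates\<close>

lemma prob_all_greater:
  assumes F: "F \<subseteq> I" and \<theta>: "0 \<le> \<theta>"
  shows "prob {x \<in> space P. \<forall>a\<in>F. \<theta> < x a} = exp (- (\<Sum>a\<in>F. \<alpha> a) * \<theta>)"
proof -
  have "{x \<in> space P. \<forall>a\<in>F. \<theta> < x a} = (\<Pi>\<^sub>E a\<in>I. if a \<in> F then {\<theta><..} else UNIV)"
    using F by (auto simp: space_P PiE_def Pi_def split: if_splits)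
  then have "emeasure P {x \<in> space P. \<forall>a\<in>F. \<theta> < x a} =
      (\<Prod>a\<in>I. emeasure (expo (\<alpha> a)) (if a \<in> F then {\<theta><..} else UNIV))"
    by (simp add: emeasure_P_PiE)
  also have "\<dots> = (\<Prod>a\<in>I. if a \<in> F then ennreal (exp (- \<alpha> a * \<theta>)) else 1)"
    using emeasure_expo_greaterThan[OF rate_pos \<theta>] prob_space.emeasure_space_1[OF prob_space_expo[OF rate_pos]]
    by (intro prod.cong) auto
  also have "\<dots> = (\<Prod>a\<in>F. ennreal (exp (- \<alpha> a * \<theta>)))"
    using F finite_index by (simp add: prod.If_cases Int_absorb1)
  also have "\<dots> = ennreal (exp (- (\<Sum>a\<in>F. \<alpha> a) * \<theta>))"
    using finite_subset[OF F finite_index]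
    by (simp add: prod_ennreal exp_sum[symmetric] sum_negf sum_distrib_right)
  finally show ?thesis by (simp add: emeasure_eq_measure)
qed

lemma distr_coordinate: "a \<in> I \<Longrightarrow> distr P borel (\<lambda>x. x a) = expo (\<alpha> a)"
proof -
  assume a: "a \<in> I"
  have "distr P (expo (\<alpha> a)) (\<lambda>x. x a) = expo (\<alpha> a)"
    unfolding P_def by (rule distr_PiM_component[OF prob_space_expo[OF rate_pos] a])
  then show ?thesis by (metis distr_cong sets_expo)
qed

lemma measurable_coordinate[measurable (raw)]: "a \<in> I \<Longrightarrow> (\<lambda>x. x a) \<in> borel_measurable P"
  using measurable_component_singleton[of a I "\<lambda>_. lborel"] by (simp cong: measurable_cong_sets)

lemma prob_coordinate:
  assumes "a \<in> I" "A \<in> sets borel"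
  shows "prob {x \<in> space P. x a \<in> A} = measure (expo (\<alpha> a)) A"
proof -
  have "measure (expo (\<alpha> a)) A = measure (distr P borel (\<lambda>x. x a)) A"
    by (simp add: distr_coordinate[OF assms(1)])
  also have "\<dots> = prob ((\<lambda>x. x a) -` A \<inter> space P)"
    using assms by (intro measure_distr measurable_coordinate)
  finally show ?thesis by (simp add: vimage_def Int_def conj_commute)
qed

lemma indep_coordinates: "indep_vars (\<lambda>_. borel) (\<lambda>a x. x a) I"
proof (cases "I = {}")
  case True
  show ?thesis unfolding indep_vars_def indep_sets_def using True by simp
next
  case False
  have "distr P (\<Pi>\<^sub>M a\<in>I. borel) (\<lambda>x. \<lambda>a\<in>I. x a) = distr P P (\<lambda>x. x)"
  proof (rule distr_cong)
    show "sets (\<Pi>\<^sub>M a\<in>I. borel) = sets P" by (auto intro!: sets_PiM_cong)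
  qed (auto simp: space_P PiE_def extensional_restrict)
  also have "\<dots> = (\<Pi>\<^sub>M a\<in>I. distr P borel (\<lambda>x. x a))"
    using distr_coordinate by (simp add: P_def cong: PiM_cong)
  finally show ?thesis
    using False by (subst indep_vars_iff_distr_eq_PiM') auto
qed

end

context expo_product
begin

text \<open>The index pairs \<open>{f k, g k}\<close> are disjoint for different \<open>k\<close>,
  so the events are independent, and both members of a pair are cheap with probability at least the
  square of \<open>p\<close>.\<close>

lemma prob_no_cheap_pair:
  assumes K: "finite K" and f: "f ` K \<subseteq> I" "inj_on f K" and g: "g ` K \<subseteq> I" "inj_on g K"
    and disj: "f ` K \<inter> g ` K = {}"
    and p: "0 \<le> p" "\<And>a. a \<in> I \<Longrightarrow> p \<le> measure (expo (\<alpha> a)) {..\<beta>}"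
  shows "prob {x \<in> space P. \<forall>k\<in>K. \<not> (x (f k) \<le> \<beta> \<and> x (g k) \<le> \<beta>)} \<le> (1 - p\<^sup>2) ^ card K"
proof (cases "K = {}")
  case True
  then show ?thesis by simp
next
  case False
  define J where "J k = {f k, g k}" for k
  have JI: "J k \<subseteq> I" if "k \<in> K" for k using that f g by (auto simp: J_def)
  have "disjoint_family_on J K"
    using f g disj by (auto simp: disjoint_family_on_def J_def dest: inj_onD)
  with JI have ind: "indep_vars (\<lambda>k. \<Pi>\<^sub>M a\<in>J k. borel) (\<lambda>k x. restrict (\<lambda>a. x a) (J k)) K"
    by (intro indep_vars_restrict[OF indep_coordinates]) auto
  define A where "A k = {y \<in> space (\<Pi>\<^sub>M a\<in>J k. (borel :: real measure)). \<not> (y (f k) \<le> \<beta> \<and> y (g k) \<le> \<beta>)}" for k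
  have A: "A k \<in> sets (\<Pi>\<^sub>M a\<in>J k. borel)" for k
  proof -
    have [measurable]: "(\<lambda>y. y (f k)) \<in> borel_measurable (\<Pi>\<^sub>M a\<in>J k. (borel :: real measure))"
      "(\<lambda>y. y (g k)) \<in> borel_measurable (\<Pi>\<^sub>M a\<in>J k. (borel :: real measure))"
      by (auto intro!: measurable_component_singleton simp: J_def)
    show ?thesis unfolding A_def by measurable
  qed
  have pre: "(\<lambda>x. restrict (\<lambda>a. x a) (J k)) -` A k \<inter> space P =
      {x \<in> space P. \<not> (x (f k) \<le> \<beta> \<and> x (g k) \<le> \<beta>)}" if "k \<in> K" for k
    by (auto simp: A_def J_def space_PiM)
  have "prob {x \<in> space P. \<forall>k\<in>K. \<not> (x (f k) \<le> \<beta> \<and> x (g k) \<le> \<beta>)} =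
      prob (\<Inter>k\<in>K. (\<lambda>x. restrict (\<lambda>a. x a) (J k)) -` A k \<inter> space P)"
    using False by (intro arg_cong[of _ _ prob]) (auto simp: pre)
  also have "\<dots> = (\<Prod>k\<in>K. prob ((\<lambda>x. restrict (\<lambda>a. x a) (J k)) -` A k \<inter> space P))"
    by (rule indep_varsD_finite[OF ind False K A])
  also have "\<dots> = (\<Prod>k\<in>K. prob {x \<in> space P. \<not> (x (f k) \<le> \<beta> \<and> x (g k) \<le> \<beta>)})"
    by (intro prod.cong refl) (simp add: pre)
  also have "\<dots> \<le> (\<Prod>k\<in>K. 1 - p\<^sup>2)"
  proof (rule prod_mono, safe)
    fix k assume k: "k \<in> K"
    have fk: "f k \<in> I" and gk: "g k \<in> I" and ne: "f k \<noteq> g k" using k f g disj by auto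
    have [measurable]: "(\<lambda>x. x (f k)) \<in> borel_measurable P" "(\<lambda>x. x (g k)) \<in> borel_measurable P"
      using fk gk by measurable
    have "prob (\<Inter>a\<in>{f k, g k}. (\<lambda>x. x a) -` {..\<beta>} \<inter> space P) = (\<Prod>a\<in>{f k, g k}. prob ((\<lambda>x. x a) -` {..\<beta>} \<inter> space P))"
      using fk gk by (intro indep_varsD[OF indep_coordinates]) auto
    also have "\<dots> = measure (expo (\<alpha> (f k))) {..\<beta>} * measure (expo (\<alpha> (g k))) {..\<beta>}"
      using ne prob_coordinate[OF fk, of "{..\<beta>}"] prob_coordinate[OF gk, of "{..\<beta>}"]
      by (simp add: vimage_def Int_def conj_commute)
    also have "\<dots> \<ge> p * p"
      using p fk gk by (intro mult_mono) auto
    finally have ge: "p\<^sup>2 \<le> prob (\<Inter>a\<in>{f k, g k}. (\<lambda>x. x a) -` {..\<beta>} \<inter> space P)"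
      by (simp add: power2_eq_square)
    have "prob {x \<in> space P. \<not> (x (f k) \<le> \<beta> \<and> x (g k) \<le> \<beta>)} = prob (space P - (\<Inter>a\<in>{f k, g k}. (\<lambda>x. x a) -` {..\<beta>} \<inter> space P))"
      by (intro arg_cong[of _ _ prob]) auto
    also have "\<dots> = 1 - prob (\<Inter>a\<in>{f k, g k}. (\<lambda>x. x a) -` {..\<beta>} \<inter> space P)"
    proof (rule prob_compl)
      have "(\<Inter>a\<in>{f k, g k}. (\<lambda>x. x a) -` {..\<beta>} \<inter> space P) = {x \<in> space P. x (f k) \<le> \<beta> \<and> x (g k) \<le> \<beta>}"
        by auto
      also have "\<dots> \<in> events" by measurable
      finally show "(\<Inter>a\<in>{f k, g k}. (\<lambda>x. x a) -` {..\<beta>} \<inter> space P) \<in> events" .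
    qed
    finally show "prob {x \<in> space P. \<not> (x (f k) \<le> \<beta> \<and> x (g k) \<le> \<beta>)} \<le> 1 - p\<^sup>2" using ge by simp
  qed simp
  finally show ?thesis by simp
qed

text \<open>Integrate over the coordinate \<open>i\<close> innermost: once the others are fixed, at
  most one value satisfies the equation, and exponential laws have no atoms.\<close>

lemma prob_hyperplane:
  assumes i: "i \<in> I" and c: "c i \<noteq> 0"
  shows "prob {x \<in> space P. (\<Sum>a\<in>I. c a * x a) = 0} = 0"
proof -
  define J where "J = I - {i}"
  have J: "I = insert i J" "i \<notin> J" "finite J" using i finite_index by (auto simp: J_def)
  define S where "S = {x \<in> space P. (\<Sum>a\<in>I. c a * x a) = 0}"
  have [measurable]: "(\<lambda>x. \<Sum>a\<in>I. c a * x a) \<in> borel_measurable P" by measurable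
  have S: "S \<in> sets P" unfolding S_def by measurable
  have S': "S \<in> sets (Pi\<^sub>M (insert i J) (\<lambda>a. expo (\<alpha> a)))" using S unfolding J(1)[symmetric] P_def .
  have "emeasure P S = (\<integral>\<^sup>+x. indicator S x \<partial>Pi\<^sub>M (insert i J) (\<lambda>a. expo (\<alpha> a)))"
    using S' unfolding P_def J(1)[symmetric] by simp
  also have "\<dots> = (\<integral>\<^sup>+x. (\<integral>\<^sup>+y. indicator S (x(i := y)) \<partial>expo (\<alpha> i)) \<partial>Pi\<^sub>M J (\<lambda>a. expo (\<alpha> a)))"
    using J S' by (intro E.product_nn_integral_insert) auto
  also have "\<dots> \<le> (\<integral>\<^sup>+x. 0 \<partial>Pi\<^sub>M J (\<lambda>a. expo (\<alpha> a)))"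
  proof (rule nn_integral_mono)
    fix x
    define y0 where "y0 = - (\<Sum>a\<in>J. c a * x a) / c i"
    have "(\<integral>\<^sup>+y. indicator S (x(i := y)) \<partial>expo (\<alpha> i)) \<le> (\<integral>\<^sup>+y. indicator {y0} y \<partial>expo (\<alpha> i))"
    proof (rule nn_integral_mono)
      fix y
      have "y = y0" if "x(i := y) \<in> S"
      proof -
        have "(\<Sum>a\<in>I. c a * (x(i := y)) a) = c i * y + (\<Sum>a\<in>J. c a * x a)"
          using J by (simp, intro sum.cong) auto
        then show ?thesis using that c by (simp add: S_def y0_def field_simps)
      qed
      then show "indicator S (x(i := y)) \<le> (indicator {y0} y :: ennreal)"
        by (auto split: split_indicator)
    qed
    then show "(\<integral>\<^sup>+y. indicator S (x(i := y)) \<partial>expo (\<alpha> i)) \<le> 0" by (simp add: emeasure_expo_singleton)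
  qed
  finally show ?thesis by (simp add: S_def emeasure_eq_measure)
qed

text \<open>This is the form in which symmetry of the rates is used: a permutation of coordinates
  with equal rates preserves the law.\<close>

lemma prob_reindex:
  assumes \<pi>: "inj_on \<pi> I" "\<pi> ` I \<subseteq> I" "\<And>a. a \<in> I \<Longrightarrow> \<alpha> (\<pi> a) = \<alpha> a" and S: "S \<in> sets vol"
  shows "prob {x \<in> space P. (\<lambda>a\<in>I. x (\<pi> a)) \<in> S} = prob S"
proof -
  have eq: "(\<Pi>\<^sub>M a\<in>I. expo (\<alpha> (\<pi> a))) = P" unfolding P_def using \<pi>(3) by (intro PiM_cong) auto
  have "distr P P (\<lambda>x. \<lambda>a\<in>I. x (\<pi> a)) = P"
    using distr_PiM_reindex[of I "\<lambda>a. expo (\<alpha> a)" \<pi> I, OF prob_space_expo[OF rate_pos]] \<pi>(1,2)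
    unfolding eq P_def[symmetric] by auto
  moreover have "(\<lambda>x. \<lambda>a\<in>I. x (\<pi> a)) \<in> measurable P P"
  proof -
    have "(\<lambda>x. \<lambda>a\<in>I. x (\<pi> a)) \<in> measurable P vol"
      using \<pi>(2) by (intro measurable_restrict) auto
    then show ?thesis by (simp cong: measurable_cong_sets)
  qed
  ultimately have "prob S = prob ((\<lambda>x. \<lambda>a\<in>I. x (\<pi> a)) -` S \<inter> space P)"
    using S by (metis measure_distr sets_P)
  then show ?thesis by (simp add: vimage_def Int_def conj_commute)
qed

text \<open>Markov's inequality for the number of small coordinates; each is below \<open>t\<close>
  with probability at most its rate times \<open>t\<close>.\<close>

lemma prob_many_small:
  assumes t: "0 \<le> t" and c: "0 < c"
  shows "prob {x \<in> space P. c \<le> real (card {a \<in> I. x a < t})} \<le> (\<Sum>a\<in>I. \<alpha> a) * t / c"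
proof -
  have card: "real (card {a \<in> I. x a < t}) = (\<Sum>a\<in>I. indicator {..<t} (x a))" for x
    using finite_index by (simp add: indicator_def sum.If_cases Int_def)
  have int: "integrable P (\<lambda>x. indicator {..<t} (x a) :: real)" if "a \<in> I" for a
    using that by (intro integrable_const_bound[where B = 1]) auto
  have "prob {x \<in> space P. c \<le> real (card {a \<in> I. x a < t})} =
      prob {x \<in> space P. c \<le> (\<Sum>a\<in>I. indicator {..<t} (x a))}" by (simp only: card)
  also have "\<dots> \<le> (\<integral>x. (\<Sum>a\<in>I. indicator {..<t} (x a)) \<partial>P) / c"
    using int c by (intro integral_Markov_inequality_measure[where A = "{}"]) (auto intro!: sum_nonneg)
  also have "(\<integral>x. (\<Sum>a\<in>I. indicator {..<t} (x a)) \<partial>P) = (\<Sum>a\<in>I. \<integral>x. (indicator {..<t} (x a) :: real) \<partial>P)"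
    using int by (intro Bochner_Integration.integral_sum) auto
  also have "\<dots> \<le> (\<Sum>a\<in>I. \<alpha> a * t)"
  proof (rule sum_mono)
    fix a assume a: "a \<in> I"
    have "(\<integral>x. indicator {..<t} (x a) \<partial>P) = (\<integral>x. indicator {x \<in> space P. x a < t} x \<partial>P)"
      by (intro Bochner_Integration.integral_cong) (auto split: split_indicator)
    also have "\<dots> = prob {x \<in> space P. x a < t}"
      using a by simp (auto intro!: arg_cong[of _ _ prob])
    also have "\<dots> = measure (expo (\<alpha> a)) {..<t}"
      using prob_coordinate[OF a, of "{..<t}"] by simp
    also have "\<dots> = 1 - exp (- \<alpha> a * t)"
      using emeasure_expo_lessThan[OF rate_pos t, of a] t rate_pos[of a]
      by (simp add: measure_def)
    also have "\<dots> \<le> \<alpha> a * t"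
      using exp_ge_add_one_self[of "- \<alpha> a * t"] by simp
    finally show "(\<integral>x. indicator {..<t} (x a) \<partial>P) \<le> \<alpha> a * t" .
  qed
  finally show ?thesis using c by (simp add: sum_distrib_right divide_right_mono)
qed

end

section \<open>Assignments\<close>

text \<open>An assignment is stored by its columns: \<open>q j\<close> is the row assigned to column \<open>j\<close>, so in a tour
  \<open>q\<close> is the predecessor map.\<close>

definition acost :: "nat \<Rightarrow> (nat \<times> nat \<Rightarrow> real) \<Rightarrow> (nat \<Rightarrow> nat) \<Rightarrow> real" where
  "acost n X q = (\<Sum>j\<in>{1..n}. X (q j, j))"

definition optimal_assignment :: "nat \<Rightarrow> (nat \<times> nat \<Rightarrow> real) \<Rightarrow> (nat \<Rightarrow> nat) \<Rightarrow> bool" where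
  "optimal_assignment n X q \<longleftrightarrow> q permutes {1..n} \<and>
    (\<forall>q'. q' permutes {1..n} \<longrightarrow> acost n X q \<le> acost n X q')"

lemma bij_betw_tour_nth:
  assumes "is_tour n vs"
  shows "length vs = n" "bij_betw (\<lambda>i. vs ! i) {..<n} {1..n}" "bij_betw (\<lambda>i. vs ! (Suc i mod n)) {..<n} {1..n}"
proof -
  have vs: "distinct vs" "set vs = {1..n}" using assms by (simp_all add: is_tour_def)
  show len: "length vs = n" using distinct_card[OF vs(1)] vs(2) by simp
  show 1: "bij_betw (\<lambda>i. vs ! i) {..<n} {1..n}"
    using vs len by (auto intro!: bij_betw_nth)
  have "inj_on (\<lambda>i. Suc i mod n) {..<n}"
    by (rule inj_onI) (auto simp: mod_Suc split: if_splits)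
  moreover have "(\<lambda>i. Suc i mod n) ` {..<n} \<subseteq> {..<n}" by (auto intro: mod_less_divisor)
  ultimately have "bij_betw (\<lambda>i. Suc i mod n) {..<n} {..<n}"
    by (simp add: bij_betw_def endo_inj_surj)
  from bij_betw_trans[OF this 1] show "bij_betw (\<lambda>i. vs ! (Suc i mod n)) {..<n} {1..n}"
    by (simp add: comp_def)
qed

lemma tour_cost_eq_acost:
  assumes vs: "is_tour n vs" and q: "\<And>i. i < n \<Longrightarrow> q (vs ! (Suc i mod n)) = vs ! i"
  shows "tour_cost X vs = acost n X q"
proof -
  note b = bij_betw_tour_nth[OF vs]
  have "acost n X q = (\<Sum>i<n. X (q (vs ! (Suc i mod n)), vs ! (Suc i mod n)))"
    unfolding acost_def by (rule sum.reindex_bij_betw[OF b(3), symmetric])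
  then show ?thesis unfolding tour_cost_def b(1) by (simp add: q)
qed

text \<open>The predecessor map of an optimal tour is an assignment of the same cost, so the
  assignment problem is a relaxation of the tour problem. The map is extended by the identity
  because \<open>permutes\<close> fixes all other points.\<close>

lemma optimal_assignment_le_opt_cost:
  assumes "optimal_assignment n X q"
  shows "acost n X q \<le> opt_cost n X"
proof -
  obtain vs where vs: "is_tour n vs" "opt_cost n X = tour_cost X vs" using opt_cost_attained by blast
  note b = bij_betw_tour_nth[OF vs(1)]
  define g where "g = (\<lambda>i. vs ! (Suc i mod n))"
  define q' where "q' x = (if x \<in> {1..n} then vs ! inv_into {..<n} g x else x)" for x
  have g: "bij_betw g {..<n} {1..n}" using b(3) unfolding g_def .
  have "bij_betw ((\<lambda>i. vs ! i) \<circ> inv_into {..<n} g) {1..n} {1..n}"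
    using bij_betw_trans[OF bij_betw_inv_into[OF g] b(2)] .
  then have "bij_betw q' {1..n} {1..n}"
    by (rule bij_betw_cong[THEN iffD1, rotated]) (simp add: q'_def)
  then have "q' permutes {1..n}" by (rule bij_imp_permutes) (auto simp: q'_def)
  moreover have "tour_cost X vs = acost n X q'"
  proof (rule tour_cost_eq_acost[OF vs(1)])
    fix i assume i: "i < n"
    then have "g i \<in> {1..n}" using g by (auto simp: bij_betw_def)
    moreover have "inv_into {..<n} g (g i) = i" using g i by (auto simp: bij_betw_def)
    ultimately show "q' (vs ! (Suc i mod n)) = vs ! i" by (simp add: q'_def g_def)
  qed
  ultimately show ?thesis using assms vs(2) by (simp add: optimal_assignment_def)
qed

lemma acost_exchange:
  assumes "D \<subseteq> {1..n}" "\<And>x. x \<notin> D \<Longrightarrow> c x = x"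
  shows "acost n X (q \<circ> c) + (\<Sum>x\<in>D. X (q x, x)) = acost n X q + (\<Sum>x\<in>D. X (q (c x), x))"
proof -
  have "acost n X f = (\<Sum>x\<in>{1..n} - D. X (f x, x)) + (\<Sum>x\<in>D. X (f x, x))" for f
    unfolding acost_def using assms(1) by (intro sum.subset_diff) auto
  moreover have "(\<Sum>x\<in>{1..n} - D. X ((q \<circ> c) x, x)) = (\<Sum>x\<in>{1..n} - D. X (q x, x))"
    using assms(2) by (intro sum.cong) auto
  ultimately show ?thesis by simp
qed

text \<open>Otherwise the arc could be exchanged away. Row \<open>q j\<close> has \<open>k\<close>
  cheap columns \<open>W\<close>, column \<open>j\<close> has \<open>k\<close> cheap rows
  \<open>V\<close>, and \<open>dense\<close> gives a cheap arc from the row of some \<open>w\<close>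
  in \<open>W\<close> to a column \<open>t\<close> whose row \<open>q t\<close> lies in
  \<open>V\<close>. Moving \<open>q j\<close> to \<open>w\<close>, \<open>q w\<close> to
  \<open>t\<close> and \<open>q t\<close> to \<open>j\<close> uses three arcs of cost at most
  \<theta> and saves one of cost above 3\<theta>.\<close>

lemma optimal_assignment_short_arcs:
  assumes opt: "optimal_assignment n X q" and j: "j \<in> {1..n}"
    and nonneg: "\<And>a. a \<in> arcs n \<Longrightarrow> 0 \<le> X a"
    and row: "k \<le> card {w \<in> {1..n}. X (q j, w) \<le> \<theta>}"
    and col: "k \<le> card {v \<in> {1..n}. X (v, j) \<le> \<theta>}"
    and dense: "\<And>S T. S \<subseteq> {1..n} \<Longrightarrow> T \<subseteq> {1..n} \<Longrightarrow> card S = k \<Longrightarrow> card T = k \<Longrightarrow> \<exists>s\<in>S. \<exists>t\<in>T. X (s, t) \<le> \<theta>"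
    and \<theta>: "0 \<le> \<theta>"
  shows "X (q j, j) \<le> 3 * \<theta>"
proof (rule ccontr)
  assume long: "\<not> X (q j, j) \<le> 3 * \<theta>"
  have q: "q permutes {1..n}" and le: "\<And>q'. q' permutes {1..n} \<Longrightarrow> acost n X q \<le> acost n X q'"
    using opt by (auto simp: optimal_assignment_def)
  have qin: "q x \<in> {1..n} \<longleftrightarrow> x \<in> {1..n}" for x using permutes_in_image[OF q] .
  obtain W where W: "W \<subseteq> {w \<in> {1..n}. X (q j, w) \<le> \<theta>}" "card W = k"
    using obtain_subset_with_card_n[OF row] by metis
  obtain V where V: "V \<subseteq> {v \<in> {1..n}. X (v, j) \<le> \<theta>}" "card V = k"
    using obtain_subset_with_card_n[OF col] by metis
  have "card (q ` W) = k" using W(2) q by (metis card_image permutes_inj_on)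
  moreover have "card (inv q ` V) = k" using V(2) permutes_inv[OF q] by (metis card_image permutes_inj_on)
  moreover have "q ` W \<subseteq> {1..n}" "inv q ` V \<subseteq> {1..n}"
    using W(1) V(1) qin permutes_in_image[OF permutes_inv[OF q]] by blast+
  ultimately obtain w v where wv: "w \<in> W" "v \<in> V" "X (q w, inv q v) \<le> \<theta>" using dense by blast
  define t where "t = inv q v"
  have qt: "q t = v" unfolding t_def using q by (simp add: permutes_inverses)
  have w: "w \<in> {1..n}" "X (q j, w) \<le> \<theta>" using wv W by auto
  have t: "t \<in> {1..n}" "X (q t, j) \<le> \<theta>" "X (q w, t) \<le> \<theta>" using wv V qin[of t] qt by (auto simp: t_def)
  \<comment> \<open>If \<open>w\<close> or \<open>t\<close> were \<open>j\<close>, the long arc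
    would itself cost at most \<theta>.\<close>
  have wj: "w \<noteq> j" and tj: "t \<noteq> j" using long w t \<theta> by auto
  have n0: "0 \<le> X (q w, w)" "0 \<le> X (q t, t)" using nonneg w t qin by auto
  show False
  proof (cases "w = t")
    case True
    \<comment> \<open>The exchange degenerates to a swap of the rows of \<open>j\<close> and
      \<open>w\<close>, with two new arcs.\<close>
    define c where "c = Transposition.transpose j w"
    have c: "c permutes {1..n}" unfolding c_def by (rule permutes_swap_id[OF j w(1)])
    have "acost n X (q \<circ> c) + (\<Sum>x\<in>{j, w}. X (q x, x)) = acost n X q + (\<Sum>x\<in>{j, w}. X (q (c x), x))"
      using j w by (intro acost_exchange) (auto simp: c_def Transposition.transpose_def)
    moreover have "c j = w" "c w = j" by (auto simp: c_def)
    ultimately have "acost n X (q \<circ> c) < acost n X q" using wj long w t n0 True \<theta> by (simp add: insert_commute)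
    then show False using le[OF permutes_compose[OF c q]] by simp
  next
    case False
    define c where "c = Transposition.transpose j w \<circ> Transposition.transpose j t"
    have c: "c permutes {1..n}" unfolding c_def
      by (rule permutes_compose[OF permutes_swap_id[OF j t(1)] permutes_swap_id[OF j w(1)]])
    have "acost n X (q \<circ> c) + (\<Sum>x\<in>{j, w, t}. X (q x, x)) = acost n X q + (\<Sum>x\<in>{j, w, t}. X (q (c x), x))"
      using j w t by (intro acost_exchange) (auto simp: c_def Transposition.transpose_def)
    moreover have "c j = t" "c w = j" "c t = w" using False wj tj by (auto simp: c_def Transposition.transpose_def)
    ultimately have "acost n X (q \<circ> c) < acost n X q"
      using wj[symmetric] tj[symmetric] False long w t n0 \<theta> by simp
    then show False using le[OF permutes_compose[OF c q]] by simp
  qed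
qed

section \<open>The number of cycles of a uniform permutation\<close>

text \<open>As \<open>a\<close> is a fixed point of \<open>p\<close>, the composition inserts
  \<open>a\<close> just before \<open>b\<close> in the cycle of \<open>b\<close>, and no cycle is
  created. The new orbits are constant along the orbits of \<open>p\<close>, so they are the image
  of the old ones under a map.\<close>

lemma card_orbits_insert:
  assumes F: "finite F" "a \<notin> F" and b: "b \<in> F" and p: "p permutes F"
  shows "card (orbit (Transposition.transpose a b \<circ> p) ` insert a F) \<le> card (orbit p ` F)"
proof -
  define q where "q = Transposition.transpose a b \<circ> p"
  have "p permutes insert a F" using p by (rule permutes_subset) auto
  then have "q permutes insert a F" unfolding q_def
    using b by (intro permutes_compose permutes_swap_id) auto
  then have "permutation q" using F by (auto simp: permutation_permutes)
  then have step: "orbit q (q x) = orbit q x" for x by (rule permutation_orbit_step)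
  have pa: "p a = a" using p F by (simp add: permutes_def)
  have ab: "orbit q a = orbit q b" using step[of a] pa by (simp add: q_def)
  have pstep: "orbit q (p z) = orbit q z" if "z \<in> F" for z
  proof (cases "p z = b")
    case True
    then show ?thesis using step[of z] ab by (simp add: q_def)
  next
    case False
    moreover have "p z \<noteq> a" using that F p permutes_in_image by fastforce
    ultimately show ?thesis using step[of z] by (simp add: q_def Transposition.transpose_def)
  qed
  have "y \<in> F \<and> orbit q y = orbit q x" if "y \<in> orbit p x" "x \<in> F" for x y
    using that by (induction) (auto simp: pstep permutes_in_image[OF p])
  moreover have "x \<in> orbit p x" for x
    using p F by (intro permutation_self_in_orbit) (auto simp: permutation_permutes)
  ultimately have same: "orbit q y = orbit q x" if "orbit p y = orbit p x" "x \<in> F" for x y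
    using that by metis
  have "orbit q ` insert a F = orbit q ` F" using ab b by auto
  \<comment> \<open>The new orbit attached to an old one is read off from an arbitrary
    representative; \<open>same\<close> makes the choice immaterial.\<close>
  also have "\<dots> = (\<lambda>C. orbit q (SOME x. x \<in> F \<and> orbit p x = C)) ` orbit p ` F"
  proof -
    have "orbit q (SOME x. x \<in> F \<and> orbit p x = orbit p y) = orbit q y" if y: "y \<in> F" for y
    proof (rule someI2[of _ y])
      show "y \<in> F \<and> orbit p y = orbit p y" using y by simp
    next
      fix x assume "x \<in> F \<and> orbit p x = orbit p y"
      then show "orbit q x = orbit q y" using same[of x y] y by blast
    qed
    then show ?thesis by (simp add: image_image cong: image_cong)
  qed
  finally have eq: "orbit q ` insert a F = (\<lambda>C. orbit q (SOME x. x \<in> F \<and> orbit p x = C)) ` orbit p ` F" .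
  have "card (orbit q ` insert a F) \<le> card (orbit p ` F)"
    unfolding eq using F by (intro card_image_le) auto
  then show ?thesis by (simp add: q_def)
qed

text \<open>Every permutation of \<open>insert a F\<close> arises from one of \<open>F\<close> by a
  unique choice of \<open>b\<close>. Taking \<open>b = a\<close> adds a fixed point, hence at most
  one cycle; the other choices add none. After division by the number of permutations, the average
  grows by at most the reciprocal of the new size, which sums to the harmonic number.\<close>

lemma sum_card_orbits_le:
  assumes "finite S"
  shows "(\<Sum>p | p permutes S. real (card (orbit p ` S))) \<le> fact (card S) * harm (card S)"
  using assms
proof (induction S)
  case empty
  then show ?case by (simp add: harm_def)
next
  case (insert a F)
  let ?c = "\<lambda>p. real (card (orbit p ` F))"
  define N where "N = card F"
  have cardF: "card {p. p permutes F} = fact N" unfolding N_def using insert by (intro card_permutations) auto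
  have "(\<Sum>p | p permutes insert a F. real (card (orbit p ` insert a F))) =
      (\<Sum>b\<in>insert a F. \<Sum>p | p permutes F. real (card (orbit (Transposition.transpose a b \<circ> p) ` insert a F)))"
    using insert by (intro sum_over_permutations_insert) auto
  also have "\<dots> = (\<Sum>p | p permutes F. real (card (orbit p ` insert a F))) +
      (\<Sum>b\<in>F. \<Sum>p | p permutes F. real (card (orbit (Transposition.transpose a b \<circ> p) ` insert a F)))"
    using insert by simp
  also have "\<dots> \<le> (\<Sum>p | p permutes F. ?c p + 1) + (\<Sum>b\<in>F. \<Sum>p | p permutes F. ?c p)"
  proof (intro add_mono sum_mono)
    fix p assume "p \<in> {p. p permutes F}"
    have "card (orbit p ` insert a F) \<le> Suc (card (orbit p ` F))"
      using insert by (simp add: card_insert_if)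
    then show "real (card (orbit p ` insert a F)) \<le> ?c p + 1" by simp
  next
    fix b p assume "b \<in> F" "p \<in> {p. p permutes F}"
    then show "real (card (orbit (Transposition.transpose a b \<circ> p) ` insert a F)) \<le> ?c p"
      using insert card_orbits_insert by simp
  qed
  also have "\<dots> = real (Suc N) * (\<Sum>p | p permutes F. ?c p) + fact N"
    by (simp add: sum.distrib cardF N_def[symmetric] algebra_simps)
  also have "\<dots> \<le> real (Suc N) * (fact N * harm N) + fact N"
    using insert.IH by (intro add_mono mult_left_mono) (auto simp: N_def)
  also have "\<dots> = fact (Suc N) * harm (Suc N)"
    by (simp add: harm_Suc field_simps)
  finally show ?case using insert by (simp add: N_def)
qed

section \<open>Total correctness with running time\<close>

text \<open>One statement carries correctness, running time \<open>T\<close> and word size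
  \<open>W\<close>. As \<open>exec\<close> is deterministic, the existential quantifier describes
  the only terminating run.\<close>

definition wp :: "com \<Rightarrow> state \<Rightarrow> nat \<Rightarrow> nat \<Rightarrow> (state \<Rightarrow> bool) \<Rightarrow> bool" where
  "wp c s T W Q \<longleftrightarrow> (\<exists>t m s'. exec c s t m s' \<and> t \<le> T \<and> m \<le> W \<and> Q s')"

lemma wp_mono: "wp c s T W Q \<Longrightarrow> T \<le> T' \<Longrightarrow> (\<And>s'. Q s' \<Longrightarrow> Q' s') \<Longrightarrow> wp c s T' W Q'"
  unfolding wp_def by (meson order_trans)

lemma wp_Seq: "wp c s T1 W (\<lambda>s'. wp d s' T2 W Q) \<Longrightarrow> T1 + T2 \<le> T \<Longrightarrow> wp (Seq c d) s T W Q"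
  unfolding wp_def using exec.Seq by (smt (verit) add_mono max.boundedI order_trans)

lemma wp_Cond:
  assumes "bval b s \<Longrightarrow> wp c s T' W Q" "\<not> bval b s \<Longrightarrow> wp d s T' W Q" "Suc T' \<le> T"
  shows "wp (Cond b c d) s T W Q"
proof (cases "bval b s")
  case True
  then obtain t m s' where "exec c s t m s'" "t \<le> T'" "m \<le> W" "Q s'" using assms by (auto simp: wp_def)
  then show ?thesis using exec.CondTrue[OF True] assms(3) unfolding wp_def by (meson Suc_le_mono order_trans)
next
  case False
  then obtain t m s' where "exec d s t m s'" "t \<le> T'" "m \<le> W" "Q s'" using assms by (auto simp: wp_def)
  then show ?thesis using exec.CondFalse[OF False] assms(3) unfolding wp_def by (meson Suc_le_mono order_trans)
qed

text \<open>The index \<open>k\<close> bounds the number of remaining iterations. Each costs at most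
  \<open>B\<close> plus one guard, and the last summand is the guard that fails. A loop may stop
  early, so any index may be left at the exit.\<close>

lemma wp_While:
  assumes step: "\<And>k s. I k s \<Longrightarrow> bval b s \<Longrightarrow> 0 < k \<and> wp c s B W (I (k - 1))"
    and init: "I k s"
  shows "wp (While b c) s (k * (B + 1) + 1) W (\<lambda>s'. (\<exists>k'. I k' s') \<and> \<not> bval b s')"
  using init
proof (induction k arbitrary: s)
  case 0
  have "\<not> bval b s" using step[OF 0] by blast
  then show ?case unfolding wp_def using exec.WhileFalse[of b s c] 0
    by (intro exI[of _ 1] exI[of _ 0] exI[of _ s]) auto
next
  case (Suc k)
  show ?case
  proof (cases "bval b s")
    case False
    then show ?thesis unfolding wp_def using exec.WhileFalse[of b s c] Suc.prems
      by (intro exI[of _ 1] exI[of _ 0] exI[of _ s]) auto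
  next
    case True
    then obtain t m s' where 1: "exec c s t m s'" "t \<le> B" "m \<le> W" "I k s'"
      using step[OF Suc.prems True] by (auto simp: wp_def)
    obtain t' m' s'' where 2: "exec (While b c) s' t' m' s''" "t' \<le> k * (B + 1) + 1" "m' \<le> W"
      "\<exists>k'. I k' s''" "\<not> bval b s''" using Suc.IH[OF 1(4)] by (auto simp: wp_def)
    show ?thesis unfolding wp_def using exec.WhileTrue[OF True 1(1) 2(1)] 1 2
      by (intro exI[of _ "Suc (t + t')"] exI[of _ "max m m'"] exI[of _ s'']) auto
  qed
qed

text \<open>For loop-free code only (on loops the values 0 and False are junk): \<open>post c W s Q\<close> says that
  running \<open>c\<close> from \<open>s\<close> establishes \<open>Q\<close> without writing an integer larger than \<open>W\<close>.\<close>

primrec cost :: "com \<Rightarrow> nat" where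
  "cost Skip = 1"
| "cost (IWrite a e f g) = 1"
| "cost (RWrite a e f p) = 1"
| "cost (Seq c d) = cost c + cost d"
| "cost (Cond b c d) = Suc (max (cost c) (cost d))"
| "cost (While b c) = 0"

primrec post :: "com \<Rightarrow> nat \<Rightarrow> state \<Rightarrow> (state \<Rightarrow> bool) \<Rightarrow> bool" where
  "post Skip W s Q = Q s"
| "post (IWrite a e f g) W s Q =
    (\<bar>ival g s\<bar> \<le> int W \<and> Q (write_int a (ival e s, ival f s) (ival g s) s))"
| "post (RWrite a e f p) W s Q = Q (write_real a (ival e s, ival f s) (rval p s) s)"
| "post (Seq c d) W s Q = post c W s (\<lambda>s'. post d W s' Q)"
| "post (Cond b c d) W s Q = (if bval b s then post c W s Q else post d W s Q)"
| "post (While b c) W s Q = False"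

lemma post_mono: "post c W s Q \<Longrightarrow> (\<And>s'. Q s' \<Longrightarrow> Q' s') \<Longrightarrow> post c W s Q'"
proof (induction c arbitrary: s Q Q')
  case (Seq c d)
  show ?case using Seq.prems(1) unfolding post.simps
    by (rule Seq.IH(1)) (rule Seq.IH(2), assumption, rule Seq.prems(2))
next
  case (Cond b c d)
  then show ?case by (auto split: if_splits)
qed auto

lemma wp_straight: "post c W s Q \<Longrightarrow> cost c \<le> T \<Longrightarrow> wp c s T W Q"
proof (induction c arbitrary: s T Q)
  case (Seq c d)
  have "wp c s (cost c) W (\<lambda>s'. wp d s' (cost d) W Q)"
    using Seq.prems Seq.IH(2) by (intro Seq.IH(1)) (auto elim!: post_mono)
  then show ?case using Seq.prems by (intro wp_Seq) auto
next
  case (Cond b c d)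
  then show ?case by (intro wp_Cond[of b s c "max (cost c) (cost d)"]) (auto split: if_splits)
qed (auto simp: wp_def intro!: exI exec.intros)

primrec iwrites :: "com \<Rightarrow> name set" where
  "iwrites Skip = {}"
| "iwrites (IWrite a e f g) = {a}"
| "iwrites (RWrite a e f p) = {}"
| "iwrites (Seq c d) = iwrites c \<union> iwrites d"
| "iwrites (Cond b c d) = iwrites c \<union> iwrites d"
| "iwrites (While b c) = iwrites c"

primrec rwrites :: "com \<Rightarrow> name set" where
  "rwrites Skip = {}"
| "rwrites (IWrite a e f g) = {}"
| "rwrites (RWrite a e f p) = {a}"
| "rwrites (Seq c d) = rwrites c \<union> rwrites d"
| "rwrites (Cond b c d) = rwrites c \<union> rwrites d"
| "rwrites (While b c) = rwrites c"

definition frame :: "name set \<Rightarrow> name set \<Rightarrow> state \<Rightarrow> state \<Rightarrow> bool" where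
  "frame A R s s' \<longleftrightarrow> (\<forall>a. a \<notin> A \<longrightarrow> ints s' a = ints s a) \<and> (\<forall>a. a \<notin> R \<longrightarrow> reals s' a = reals s a)"

lemma frame_trans: "frame A R s s' \<Longrightarrow> frame A R s' s'' \<Longrightarrow> frame A R s s''"
  by (simp add: frame_def)

lemma frame_subset: "frame A R s s' \<Longrightarrow> A \<subseteq> A' \<Longrightarrow> R \<subseteq> R' \<Longrightarrow> frame A' R' s s'"
  by (auto simp: frame_def)

lemma exec_frame: "exec c s t m s' \<Longrightarrow> frame (iwrites c) (rwrites c) s s'"
  by (induction rule: exec.induct) (auto simp: frame_def write_int_def write_real_def)

lemma wp_frame: "wp c s T W Q \<Longrightarrow> wp c s T W (\<lambda>s'. Q s' \<and> frame (iwrites c) (rwrites c) s s')"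
  unfolding wp_def using exec_frame by blast

text \<open>The frame of the first command is passed on automatically, so \<open>R\<close> has to
  mention only the arrays that the command changes.\<close>

lemma wp_Seq': 
  assumes "wp c s T1 W R" "\<And>s'. R s' \<Longrightarrow> frame (iwrites c) (rwrites c) s s' \<Longrightarrow> wp d s' T2 W Q" "T1 + T2 \<le> T"
  shows "wp (Seq c d) s T W Q"
  using assms(3) by (rule wp_Seq[rotated]) (rule wp_mono[OF wp_frame[OF assms(1)]], auto intro: assms(2))

text \<open>The one-dimensional view of the memory; scalars are entries at index 0.\<close>

definition arr :: "state \<Rightarrow> name \<Rightarrow> int \<Rightarrow> int" where "arr s a j = ints s a (j, 0)"
definition rarr :: "state \<Rightarrow> name \<Rightarrow> int \<Rightarrow> real" where "rarr s a j = reals s a (j, 0)"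

lemma frame_arr: "frame A R s s' \<Longrightarrow> a \<notin> A \<Longrightarrow> arr s' a = arr s a"
  by (simp add: frame_def arr_def fun_eq_iff)

lemma frame_rarr: "frame A R s s' \<Longrightarrow> a \<notin> R \<Longrightarrow> rarr s' a = rarr s a"
  by (simp add: frame_def rarr_def fun_eq_iff)

lemma arr_write:
  "arr (write_int a (i, 0) z s) b = (if b = a then (arr s a)(i := z) else arr s b)"
  "rarr (write_int a ij z s) = rarr s"
  "reals (write_int a ij z s) = reals s"
  "rarr (write_real a (i, 0) x s) b = (if b = a then (rarr s a)(i := x) else rarr s b)"
  "arr (write_real a ij x s) = arr s"
  "reals (write_real a ij x s) b = (if b = a then (reals s a)(ij := x) else reals s b)"
  by (auto simp: arr_def rarr_def write_int_def write_real_def fun_eq_iff)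

section \<open>Program notation and counting loops\<close>

definition V :: "name \<Rightarrow> iexp" where "V x = IRead x (IConst 0) (IConst 0)"
definition At :: "name \<Rightarrow> iexp \<Rightarrow> iexp" where "At a e = IRead a e (IConst 0)"
definition RV :: "name \<Rightarrow> rexp" where "RV x = RRead x (IConst 0) (IConst 0)"
definition RAt :: "name \<Rightarrow> iexp \<Rightarrow> rexp" where "RAt a e = RRead a e (IConst 0)"
definition SetAt :: "name \<Rightarrow> iexp \<Rightarrow> iexp \<Rightarrow> com" where "SetAt a e z = IWrite a e (IConst 0) z"
definition RSetAt :: "name \<Rightarrow> iexp \<Rightarrow> rexp \<Rightarrow> com" where "RSetAt a e x = RWrite a e (IConst 0) x"
definition Set :: "name \<Rightarrow> iexp \<Rightarrow> com" where "Set a z = SetAt a (IConst 0) z"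
definition RSet :: "name \<Rightarrow> rexp \<Rightarrow> com" where "RSet a x = RSetAt a (IConst 0) x"
definition IEq :: "iexp \<Rightarrow> iexp \<Rightarrow> bexp" where "IEq e f = BAnd (BNot (ILess e f)) (BNot (ILess f e))"
definition BOr :: "bexp \<Rightarrow> bexp \<Rightarrow> bexp" where "BOr b c = BNot (BAnd (BNot b) (BNot c))"

lemma val_simps[simp]:
  "ival (V x) s = arr s x 0" "ival (At a e) s = arr s a (ival e s)"
  "rval (RV x) s = rarr s x 0" "rval (RAt a e) s = rarr s a (ival e s)"
  "bval (IEq e f) s \<longleftrightarrow> ival e s = ival f s" "bval (BOr b c) s \<longleftrightarrow> bval b s \<or> bval c s"
  by (auto simp: V_def At_def RV_def RAt_def arr_def rarr_def IEq_def BOr_def)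

lemma post_simps[simp]:
  "post (SetAt a e z) W s Q = (\<bar>ival z s\<bar> \<le> int W \<and> Q (write_int a (ival e s, 0) (ival z s) s))"
  "post (RSetAt a e x) W s Q = Q (write_real a (ival e s, 0) (rval x s) s)"
  "post (Set a z) W s Q = (\<bar>ival z s\<bar> \<le> int W \<and> Q (write_int a (0, 0) (ival z s) s))"
  "post (RSet a x) W s Q = Q (write_real a (0, 0) (rval x s) s)"
  by (simp_all add: SetAt_def RSetAt_def Set_def RSet_def)

lemma cost_simps[simp]:
  "cost (SetAt a e z) = 1" "cost (RSetAt a e x) = 1" "cost (Set a z) = 1" "cost (RSet a x) = 1"
  by (simp_all add: SetAt_def RSetAt_def Set_def RSet_def)

lemma writes_simps[simp]:
  "iwrites (SetAt a e z) = {a}" "iwrites (RSetAt a e x) = {}" "iwrites (Set a z) = {a}" "iwrites (RSet a x) = {}"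
  "rwrites (SetAt a e z) = {}" "rwrites (RSetAt a e x) = {a}" "rwrites (Set a z) = {}" "rwrites (RSet a x) = {a}"
  by (simp_all add: SetAt_def RSetAt_def Set_def RSet_def)

definition For :: "name \<Rightarrow> iexp \<Rightarrow> iexp \<Rightarrow> com \<Rightarrow> com" where
  "For x lo hi c = Seq (Set x lo) (While (ILess (V x) hi) (Seq c (Set x (IPlus (V x) (IConst 1)))))"

lemma writes_For[simp]:
  "iwrites (For x lo hi c) = insert x (iwrites c)" "rwrites (For x lo hi c) = rwrites c"
  by (auto simp: For_def)

text \<open>\<open>I i\<close> is the invariant when the loop variable has just been set to
  \<open>i\<close>, so \<open>step\<close> speaks about the state after the increment. An iteration
  costs the body, the guard and the increment, which gives \<open>B + 2\<close>; the final 2 is the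
  initialisation and the failing guard. The upper limit is evaluated anew in each round and must
  survive all writes of the loop.\<close>

lemma wp_For:
  assumes lo: "ival lo s = l" "0 \<le> l" "l \<le> h" "h \<le> int W" and x: "x \<notin> iwrites c"
    and init: "\<And>s'. s' = write_int x (0, 0) l s \<Longrightarrow> I l s'"
    and hi: "\<And>s'. frame (insert x (iwrites c)) (rwrites c) s s' \<Longrightarrow> ival hi s' = h"
    and step: "\<And>i s'. l \<le> i \<Longrightarrow> i < h \<Longrightarrow> I i s' \<Longrightarrow> arr s' x 0 = i \<Longrightarrow>
        frame (insert x (iwrites c)) (rwrites c) s s' \<Longrightarrow>
        wp c s' B W (\<lambda>s''. I (i + 1) (write_int x (0, 0) (i + 1) s''))"
    and fin: "\<And>s'. I h s' \<Longrightarrow> frame (insert x (iwrites c)) (rwrites c) s s' \<Longrightarrow> Q s'"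
    and T: "nat (h - l) * (B + 2) + 2 \<le> T"
  shows "wp (For x lo hi c) s T W Q"
proof -
  let ?fr = "frame (insert x (iwrites c)) (rwrites c) s"
  define J where "J k s' \<longleftrightarrow> (\<exists>i. l \<le> i \<and> i \<le> h \<and> k = nat (h - i) \<and> I i s' \<and> arr s' x 0 = i \<and> ?fr s')" for k s'
  have loop: "0 < k \<and> wp (Seq c (Set x (IPlus (V x) (IConst 1)))) s' (B + 1) W (J (k - 1))"
    if J: "J k s'" and b: "bval (ILess (V x) hi) s'" for k s'
  proof -
    obtain i where i: "l \<le> i" "i \<le> h" "k = nat (h - i)" "I i s'" "arr s' x 0 = i" "?fr s'"
      using J by (auto simp: J_def)
    have ih: "i < h" using b hi[OF i(6)] i(5) by simp
    have "wp (Seq c (Set x (IPlus (V x) (IConst 1)))) s' (B + 1) W (J (k - 1))"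
    proof (rule wp_Seq'[OF step[OF i(1) ih i(4,5,6)]])
      fix s'' assume s'': "I (i + 1) (write_int x (0, 0) (i + 1) s'')" and fr: "frame (iwrites c) (rwrites c) s' s''"
      have xi: "arr s'' x 0 = i" using frame_arr[OF fr x] i(5) by simp
      have "?fr s''" using frame_trans[OF i(6) frame_subset[OF fr]] by blast
      then have "?fr (write_int x (0, 0) (i + 1) s'')" by (simp add: frame_def write_int_def)
      then have "J (k - 1) (write_int x (0, 0) (i + 1) s'')"
        using i ih s'' unfolding J_def by (intro exI[of _ "i + 1"]) (simp add: arr_write)
      then show "wp (Set x (IPlus (V x) (IConst 1))) s'' 1 W (J (k - 1))"
        using xi i lo ih by (intro wp_straight) simp_all
    qed simp
    then show ?thesis using ih i(3) by simp
  qed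
  define s1 where "s1 = write_int x (0, 0) l s"
  have "J (nat (h - l)) s1"
    unfolding J_def using lo init[OF s1_def] by (intro exI[of _ l]) (simp add: s1_def arr_write frame_def, simp add: write_int_def)
  from wp_While[of J, OF loop this]
  have "wp (While (ILess (V x) hi) (Seq c (Set x (IPlus (V x) (IConst 1))))) s1 (nat (h - l) * (B + 1 + 1) + 1) W Q"
  proof (rule wp_mono)
    fix s' assume "(\<exists>k'. J k' s') \<and> \<not> bval (ILess (V x) hi) s'"
    then obtain i where i: "l \<le> i" "i \<le> h" "I i s'" "arr s' x 0 = i" "?fr s'" "\<not> i < ival hi s'"
      by (auto simp: J_def)
    then have "i = h" using hi[OF i(5)] by simp
    then show "Q s'" using fin i by simp
  qed (assumption+, rule order_refl)
  then have "post (Set x lo) W s (\<lambda>s'. wp (While (ILess (V x) hi) (Seq c (Set x (IPlus (V x) (IConst 1))))) s' (nat (h - l) * (B + 1 + 1) + 1) W Q)"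
    using lo by (simp add: s1_def)
  then show ?thesis unfolding For_def using T by (intro wp_Seq[OF wp_straight[where T = 1]]) simp_all
qed

section \<open>The Hungarian method\<close>

text \<open>The potentials of the dual linear program. Together with tightness on the matched arcs
  they certify optimality.\<close>

definition dual_feasible :: "int \<Rightarrow> (int \<Rightarrow> int \<Rightarrow> real) \<Rightarrow> (int \<Rightarrow> real) \<Rightarrow> (int \<Rightarrow> real) \<Rightarrow> bool" where
  "dual_feasible N X u v \<longleftrightarrow> (\<forall>r\<in>{1..N}. \<forall>j\<in>{1..N}. u r + v j \<le> X r j)"

text \<open>\<open>p j\<close> is the row matched to column \<open>j\<close>, or 0; the rows below \<open>i\<close> are matched.\<close>

definition tight_matching ::
  "int \<Rightarrow> (int \<Rightarrow> int \<Rightarrow> real) \<Rightarrow> int \<Rightarrow> (int \<Rightarrow> int) \<Rightarrow> (int \<Rightarrow> real) \<Rightarrow> (int \<Rightarrow> real) \<Rightarrow> bool" where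
  "tight_matching N X i p u v \<longleftrightarrow>
    (\<forall>j\<in>{1..N}. 0 \<le> p j \<and> p j < i) \<and>
    (\<forall>j\<in>{1..N}. \<forall>k\<in>{1..N}. p j = p k \<longrightarrow> p j \<noteq> 0 \<longrightarrow> j = k) \<and>
    (\<forall>r\<in>{1..<i}. \<exists>j\<in>{1..N}. p j = r) \<and>
    (\<forall>j\<in>{1..N}. p j \<noteq> 0 \<longrightarrow> X (p j) j = u (p j) + v j)"

text \<open>The columns reached by the search, in the order in which they were reached. Column 0 is a
  dummy that holds the row being inserted.\<close>

definition search_tree ::
  "int \<Rightarrow> (int \<Rightarrow> int \<Rightarrow> real) \<Rightarrow> (int \<Rightarrow> int) \<Rightarrow> (int \<Rightarrow> real) \<Rightarrow> (int \<Rightarrow> real) \<Rightarrow> (int \<Rightarrow> int) \<Rightarrow> int list \<Rightarrow> bool" where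
  "search_tree N X p u v way xs \<longleftrightarrow>
    xs \<noteq> [] \<and> xs ! 0 = 0 \<and> distinct xs \<and> set xs \<subseteq> {0..N} \<and>
    (\<forall>t<length xs. 0 < t \<longrightarrow> (\<exists>t'<t. way (xs ! t) = xs ! t' \<and> p (xs ! t') \<noteq> 0 \<and>
      X (p (xs ! t')) (xs ! t) = u (p (xs ! t')) + v (xs ! t)))"

text \<open>The frontier of a Dijkstra search on reduced costs: for an unreached column,
  \<open>minv\<close> is its least reduced cost from a reached one and \<open>way\<close> a column
  that attains it. Keeping it current takes linear time for each reached column, which makes the
  whole method cubic instead of quartic.\<close>

definition slack_invar ::
  "int \<Rightarrow> (int \<Rightarrow> int \<Rightarrow> real) \<Rightarrow> (int \<Rightarrow> int) \<Rightarrow> (int \<Rightarrow> real) \<Rightarrow> (int \<Rightarrow> real) \<Rightarrow> (int \<Rightarrow> real) \<Rightarrow> (int \<Rightarrow> int) \<Rightarrow> int set \<Rightarrow> bool" where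
  "slack_invar N X p u v minv way S \<longleftrightarrow>
    (\<forall>j\<in>{1..N} - S. way j \<in> S \<and> minv j = X (p (way j)) j - u (p (way j)) - v j \<and>
      (\<forall>k\<in>S. minv j \<le> X (p k) j - u (p k) - v j))"

lemma tight_matching_init: "tight_matching N X 1 (\<lambda>_. 0) u v"
  by (simp add: tight_matching_def)

lemma tight_matching_range: "tight_matching N X i p u v \<Longrightarrow> j \<in> {1..N} \<Longrightarrow> 0 \<le> p j \<and> p j < i"
  by (simp add: tight_matching_def)

lemma tight_matching_inj:
  "tight_matching N X i p u v \<Longrightarrow> j \<in> {1..N} \<Longrightarrow> k \<in> {1..N} \<Longrightarrow> p j = p k \<Longrightarrow> p j \<noteq> 0 \<Longrightarrow> j = k"
  by (simp add: tight_matching_def)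

lemma tight_matching_inj0:
  assumes m: "tight_matching N X i p u v" "p 0 = i" and j: "j \<in> {0..N}" "k \<in> {0..N}" "p j = p k" "p j \<noteq> 0"
  shows "j = k"
proof -
  have "j = 0 \<or> j \<in> {1..N}" "k = 0 \<or> k \<in> {1..N}" using j by auto
  then show ?thesis
    using tight_matching_inj[OF m(1), of j k] tight_matching_range[OF m(1), of j] tight_matching_range[OF m(1), of k] j m(2)
    by auto
qed

lemma tight_matching_row:
  assumes "tight_matching N X i p u v" "p 0 = i" "1 \<le> i" "i \<le> N" "j \<in> {0..N}" "p j \<noteq> 0"
  shows "p j \<in> {1..N}"
proof -
  have "j = 0 \<or> j \<in> {1..N}" using assms(5) by auto
  then show ?thesis using assms tight_matching_range[OF assms(1), of j] by auto
qed

text \<open>Otherwise all N + 1 columns, the dummy included, would hold distinct rows out of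
  N.\<close>

lemma unreached_column_exists:
  assumes m: "tight_matching N X i p u v" "p 0 = i" and i: "1 \<le> i" "i \<le> N"
    and S: "S \<subseteq> {0..N}" "\<forall>j\<in>S. p j \<noteq> 0" "0 \<in> S"
  shows "\<exists>j\<in>{1..N}. j \<notin> S"
proof (rule ccontr)
  assume "\<not> (\<exists>j\<in>{1..N}. j \<notin> S)"
  moreover have "j = 0 \<or> j \<in> {1..N}" if "j \<in> {0..N}" for j using that by auto
  ultimately have eq: "S = {0..N}" using S by blast
  have "inj_on p {0..N}"
    using tight_matching_inj0[OF m] S(2) unfolding eq by (intro inj_onI) blast
  moreover have "p ` {0..N} \<subseteq> {1..N}"
    using tight_matching_row[OF m i] S(2) unfolding eq by blast
  ultimately have "card {0..N} \<le> card {1..N}" by (intro card_inj_on_le) auto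
  then show False using i by simp
qed

text \<open>Potentials rise by \<delta> on the rows and fall by \<delta> on the columns of the
  search tree. Reduced costs inside the tree and of matched arcs are unchanged, and those leaving
  the tree drop by \<delta>. As \<delta> is the least slack, feasibility survives and the arc into
  \<open>j1\<close> becomes tight, so that \<open>j1\<close> can join the tree.\<close>

lemma dual_step:
  assumes m: "tight_matching N X i p u v" "p 0 = i" and f: "dual_feasible N X u v" and i: "1 \<le> i" "i \<le> N"
    and tr: "search_tree N X p u v way xs" "\<forall>j\<in>set xs. p j \<noteq> 0"
    and sl: "slack_invar N X p u v minv way (set xs)"
    and j1: "j1 \<in> {1..N}" "j1 \<notin> set xs" "\<And>j. j \<in> {1..N} \<Longrightarrow> j \<notin> set xs \<Longrightarrow> minv j1 \<le> minv j"
    and u': "\<And>r. u' r = (if \<exists>j\<in>set xs. p j = r then u r + minv j1 else u r)"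
    and v': "\<And>j. j \<in> {0..N} \<Longrightarrow> v' j = (if j \<in> set xs then v j - minv j1 else v j)"
    and minv': "\<And>j. j \<in> {1..N} \<Longrightarrow> j \<notin> set xs \<Longrightarrow> minv' j = minv j - minv j1"
  shows "tight_matching N X i p u' v'" "dual_feasible N X u' v'"
    "search_tree N X p u' v' way (xs @ [j1])"
    "slack_invar N X p u' v' minv' way (set xs)"
proof -
  define \<delta> where "\<delta> = minv j1"
  have xs: "xs \<noteq> []" "xs ! 0 = 0" "distinct xs" "set xs \<subseteq> {0..N}" using tr(1) by (auto simp: search_tree_def)
  have wj1: "way j1 \<in> set xs" "\<delta> = X (p (way j1)) j1 - u (p (way j1)) - v j1"
    using sl j1(1,2) unfolding slack_invar_def \<delta>_def by blast+
  have row: "p j \<in> {1..N}" if "j \<in> set xs" for j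
    using tight_matching_row[OF m i] that tr(2) xs(4) by blast
  have "p (way j1) \<in> {1..N}" using row wj1 by blast
  then have \<delta>0: "0 \<le> \<delta>" using f j1 wj1(2) unfolding dual_feasible_def by fastforce
  have up: "u' (p j) = u (p j) + \<delta>" if "j \<in> set xs" for j using that by (auto simp: u' \<delta>_def)
  have un: "u' (p j) = u (p j)" if "j \<in> {0..N}" "j \<notin> set xs" "p j \<noteq> 0" for j
  proof -
    have "p k \<noteq> p j" if k: "k \<in> set xs" for k
    proof
      assume "p k = p j"
      then have "j = k"
        using tight_matching_inj0[OF m, of j k] k \<open>j \<in> {0..N}\<close> \<open>p j \<noteq> 0\<close> subsetD[OF xs(4) k] by metis
      then show False using k \<open>j \<notin> set xs\<close> by simp
    qed
    then show ?thesis by (auto simp: u')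
  qed
  have vx: "v' j = v j - \<delta>" if "j \<in> set xs" for j using that xs(4) v'[of j] by (auto simp: \<delta>_def)
  have vn: "v' j = v j" if "j \<in> {1..N}" "j \<notin> set xs" for j using that v'[of j] by auto
  show "tight_matching N X i p u' v'"
  proof -
    have "X (p j) j = u' (p j) + v' j" if j: "j \<in> {1..N}" "p j \<noteq> 0" for j
    proof -
      have "X (p j) j = u (p j) + v j" using m(1) j by (auto simp: tight_matching_def)
      then show ?thesis using up[of j] un[of j] vx[of j] vn[of j] j by (cases "j \<in> set xs") auto
    qed
    then show ?thesis using m(1) unfolding tight_matching_def by blast
  qed
  have slack: "\<delta> \<le> X (p k) j - u (p k) - v j" if "k \<in> set xs" "j \<in> {1..N}" "j \<notin> set xs" for k j
  proof -
    have "minv j \<le> X (p k) j - u (p k) - v j" using sl that unfolding slack_invar_def by (meson DiffI)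
    then show ?thesis using j1(3)[OF that(2,3)] by (simp add: \<delta>_def)
  qed
  show "dual_feasible N X u' v'" unfolding dual_feasible_def
  proof (intro ballI)
    fix r j assume r: "r \<in> {1..N}" and j: "j \<in> {1..N}"
    have base: "u r + v j \<le> X r j" using f r j by (simp add: dual_feasible_def)
    show "u' r + v' j \<le> X r j"
    proof (cases "\<exists>k\<in>set xs. p k = r")
      case True
      then obtain k where k: "k \<in> set xs" "p k = r" by blast
      then show ?thesis using up[OF k(1)] vx[of j] vn[OF j] slack[OF k(1) j] base by (cases "j \<in> set xs") auto
    next
      case False
      \<comment> \<open>A reached column with an unreached row only gains slack, because \<delta> is
        nonnegative by feasibility. For an unreached column nothing changes.\<close>
      then have "u' r = u r" by (simp add: u')
      then show ?thesis using vx[of j] vn[OF j] base \<delta>0 by (cases "j \<in> set xs") auto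
    qed
  qed
  show "search_tree N X p u' v' way (xs @ [j1])"
  proof -
    have "\<exists>t'<t. way ((xs @ [j1]) ! t) = (xs @ [j1]) ! t' \<and> p ((xs @ [j1]) ! t') \<noteq> 0 \<and>
        X (p ((xs @ [j1]) ! t')) ((xs @ [j1]) ! t) = u' (p ((xs @ [j1]) ! t')) + v' ((xs @ [j1]) ! t)"
      if t: "t < length (xs @ [j1])" "0 < t" for t
    proof (cases "t < length xs")
      case True
      then obtain t' where t': "t' < t" "way (xs ! t) = xs ! t'" "p (xs ! t') \<noteq> 0"
        "X (p (xs ! t')) (xs ! t) = u (p (xs ! t')) + v (xs ! t)" using tr(1) t(2) unfolding search_tree_def by blast
      moreover have "u' (p (xs ! t')) = u (p (xs ! t')) + \<delta>" using up t' True by simp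
      moreover have "v' (xs ! t) = v (xs ! t) - \<delta>" using vx True by simp
      ultimately show ?thesis using True by (intro exI[of _ t']) (simp add: nth_append)
    next
      case False
      then have tl: "t = length xs" using t by simp
      obtain t' where t': "t' < length xs" "xs ! t' = way j1" using wj1(1) by (metis in_set_conv_nth)
      have "u' (p (way j1)) = u (p (way j1)) + \<delta>" using up wj1 by simp
      moreover have "v' j1 = v j1" using vn j1 by simp
      ultimately show ?thesis using t' tl wj1 tr(2) by (intro exI[of _ t']) (simp add: nth_append)
    qed
    then show ?thesis using xs j1 unfolding search_tree_def by (auto simp: nth_append)
  qed
  show "slack_invar N X p u' v' minv' way (set xs)" unfolding slack_invar_def
  proof (intro ballI)
    fix j assume "j \<in> {1..N} - set xs"
    then have j: "j \<in> {1..N}" "j \<notin> set xs" by auto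
    have s: "way j \<in> set xs" "minv j = X (p (way j)) j - u (p (way j)) - v j"
      "\<forall>k\<in>set xs. minv j \<le> X (p k) j - u (p k) - v j" using sl j unfolding slack_invar_def by blast+
    then show "way j \<in> set xs \<and> minv' j = X (p (way j)) j - u' (p (way j)) - v' j \<and>
        (\<forall>k\<in>set xs. minv' j \<le> X (p k) j - u' (p k) - v' j)"
      using up vn[OF j] minv'[OF j] by (auto simp: \<delta>_def)
  qed
qed

lemma relax_step:
  assumes sl: "slack_invar N X p u v minv way S"
    and minv': "\<And>j. j \<in> {1..N} \<Longrightarrow> j \<notin> S \<Longrightarrow> j \<noteq> j1 \<Longrightarrow>
      minv' j = (if X (p j1) j - u (p j1) - v j < minv j then X (p j1) j - u (p j1) - v j else minv j)"
    and way': "\<And>j. j \<in> {1..N} \<Longrightarrow> j \<notin> S \<Longrightarrow> j \<noteq> j1 \<Longrightarrow>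
      way' j = (if X (p j1) j - u (p j1) - v j < minv j then j1 else way j)"
  shows "slack_invar N X p u v minv' way' (insert j1 S)"
  unfolding slack_invar_def
proof (intro ballI)
  fix j assume "j \<in> {1..N} - insert j1 S"
  then have j: "j \<in> {1..N}" "j \<notin> S" "j \<noteq> j1" by auto
  then have "way j \<in> S" "minv j = X (p (way j)) j - u (p (way j)) - v j"
      "\<forall>k\<in>S. minv j \<le> X (p k) j - u (p k) - v j" using sl unfolding slack_invar_def by blast+
  then show "way' j \<in> insert j1 S \<and> minv' j = X (p (way' j)) j - u (p (way' j)) - v j \<and>
      (\<forall>k\<in>insert j1 S. minv' j \<le> X (p k) j - u (p k) - v j)"
    using minv'[OF j] way'[OF j] by (auto intro: order_trans less_imp_le)
qed

lemma search_tree_way_cong: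
  assumes "search_tree N X p u v way xs" "\<And>j. j \<in> set xs \<Longrightarrow> way' j = way j"
  shows "search_tree N X p u v way' xs"
  using assms unfolding search_tree_def by auto

text \<open>During augmentation column \<open>h\<close>, the \<open>t\<close>-th column of the search, is a hole: the other columns,
  the dummy included, match the rows up to \<open>i\<close>.\<close>

definition augment_invar ::
  "int \<Rightarrow> (int \<Rightarrow> int \<Rightarrow> real) \<Rightarrow> int \<Rightarrow> (int \<Rightarrow> int) \<Rightarrow> (int \<Rightarrow> real) \<Rightarrow> (int \<Rightarrow> real) \<Rightarrow> int list \<Rightarrow> nat \<Rightarrow> (int \<Rightarrow> int) \<Rightarrow> bool" where
  "augment_invar N X i p u v xs t p' \<longleftrightarrow> t < length xs \<and> (\<forall>t'<t. p' (xs ! t') = p (xs ! t')) \<and>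
    (\<forall>j\<in>{0..N} - {xs ! t}. 0 \<le> p' j \<and> p' j \<le> i) \<and>
    (\<forall>j\<in>{0..N} - {xs ! t}. \<forall>k\<in>{0..N} - {xs ! t}. p' j = p' k \<longrightarrow> p' j \<noteq> 0 \<longrightarrow> j = k) \<and>
    (\<forall>r\<in>{1..i}. \<exists>j\<in>{0..N} - {xs ! t}. p' j = r) \<and>
    (\<forall>j\<in>{1..N} - {xs ! t}. p' j \<noteq> 0 \<longrightarrow> X (p' j) j = u (p' j) + v j)"

lemma augment_invarD:
  assumes "augment_invar N X i p u v xs t p'"
  shows "t < length xs" "\<And>t'. t' < t \<Longrightarrow> p' (xs ! t') = p (xs ! t')"
    "\<And>j. j \<in> {0..N} - {xs ! t} \<Longrightarrow> 0 \<le> p' j \<and> p' j \<le> i"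
    "\<And>j k. j \<in> {0..N} - {xs ! t} \<Longrightarrow> k \<in> {0..N} - {xs ! t} \<Longrightarrow> p' j = p' k \<Longrightarrow> p' j \<noteq> 0 \<Longrightarrow> j = k"
    "\<And>r. r \<in> {1..i} \<Longrightarrow> \<exists>j\<in>{0..N} - {xs ! t}. p' j = r"
    "\<And>j. j \<in> {1..N} - {xs ! t} \<Longrightarrow> p' j \<noteq> 0 \<Longrightarrow> X (p' j) j = u (p' j) + v j"
  using assms unfolding augment_invar_def by blast+

lemma augment_invarI:
  assumes "t < length xs" "\<And>t'. t' < t \<Longrightarrow> p' (xs ! t') = p (xs ! t')"
    "\<And>j. j \<in> {0..N} - {xs ! t} \<Longrightarrow> 0 \<le> p' j" "\<And>j. j \<in> {0..N} - {xs ! t} \<Longrightarrow> p' j \<le> i"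
    "\<And>j k. j \<in> {0..N} - {xs ! t} \<Longrightarrow> k \<in> {0..N} - {xs ! t} \<Longrightarrow> p' j = p' k \<Longrightarrow> p' j \<noteq> 0 \<Longrightarrow> j = k"
    "\<And>r. r \<in> {1..i} \<Longrightarrow> \<exists>j\<in>{0..N} - {xs ! t}. p' j = r"
    "\<And>j. j \<in> {1..N} - {xs ! t} \<Longrightarrow> p' j \<noteq> 0 \<Longrightarrow> X (p' j) j = u (p' j) + v j"
  shows "augment_invar N X i p u v xs t p'"
  unfolding augment_invar_def by (intro conjI allI ballI impI) (fact assms)+

text \<open>The search stops at a free column, which can serve as the hole. The dummy holds row
  \<open>i\<close> and the real columns hold the rows below it.\<close>

lemma augment_invar_init:
  assumes m: "tight_matching N X i p u v" "p 0 = i" and i: "1 \<le> i"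
    and xs: "search_tree N X p u v way xs" "p (last xs) = 0"
  shows "augment_invar N X i p u v xs (length xs - 1) p"
proof -
  have xs': "xs \<noteq> []" "set xs \<subseteq> {0..N}" "xs ! 0 = 0" using xs by (auto simp: search_tree_def)
  have l: "xs ! (length xs - 1) = last xs" using xs' by (simp add: last_conv_nth)
  have l0: "last xs \<noteq> 0" using m(2) i xs(2) by auto
  have N0: "0 \<in> {0..N}" using xs' nth_mem[of 0 xs] by auto
  have split: "j = 0 \<or> j \<in> {1..N}" if "j \<in> {0..N}" for j using that by auto
  have "0 \<le> p j \<and> p j \<le> i" if "j \<in> {0..N}" for j
    using split[OF that] tight_matching_range[OF m(1), of j] m(2) i by fastforce
  moreover have "\<exists>j\<in>{0..N} - {last xs}. p j = r" if "r \<in> {1..i}" for r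
  proof (cases "r = i")
    case True
    then show ?thesis using m(2) N0 l0 by (intro bexI[of _ 0]) auto
  next
    case False
    then have "r \<in> {1..<i}" using that by auto
    then obtain j where "j \<in> {1..N}" "p j = r" using m(1) unfolding tight_matching_def by blast
    then show ?thesis using xs(2) that by (intro bexI[of _ j]) auto
  qed
  moreover have "X (p j) j = u (p j) + v j" if "j \<in> {1..N}" "p j \<noteq> 0" for j
    using m(1) that by (simp add: tight_matching_def)
  ultimately show ?thesis
    unfolding augment_invar_def l using tight_matching_inj0[OF m] xs' by auto
qed

text \<open>The hole \<open>xs ! t\<close> takes over the row of the column from which it was
  reached, and that column becomes the hole. The tree arc used for this is tight by
  \<open>search_tree\<close>, and the earlier part of the tree is still as the search left
  it.\<close>

lemma augment_step:
  assumes a: "augment_invar N X i p u v xs t p'" and xs: "search_tree N X p u v way xs" and t: "0 < t"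
  shows "\<exists>t'<t. way (xs ! t) = xs ! t' \<and> augment_invar N X i p u v xs t' (p'(xs ! t := p' (xs ! t')))"
proof -
  let ?h = "xs ! t"
  have tl: "t < length xs" by (rule augment_invarD(1)[OF a])
  obtain t' where t': "t' < t" "way ?h = xs ! t'" "p (xs ! t') \<noteq> 0"
    "X (p (xs ! t')) ?h = u (p (xs ! t')) + v ?h"
    using xs tl t unfolding search_tree_def by blast
  let ?g = "xs ! t'"
  have dist: "distinct xs" "set xs \<subseteq> {0..N}" using xs by (auto simp: search_tree_def)
  have gh: "?g \<noteq> ?h" using dist(1) tl t'(1) by (simp add: nth_eq_iff_index_eq)
  have gN: "?g \<in> {0..N}" and hN: "?h \<in> {0..N}" using subsetD[OF dist(2) nth_mem] tl t'(1) by (meson less_trans)+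
  have pg: "p' ?g = p ?g" by (rule augment_invarD(2)[OF a t'(1)])
  let ?p = "p'(?h := p' ?g)"
  have h2: "?p (xs ! s) = p (xs ! s)" if s: "s < t'" for s
  proof -
    from s have "xs ! s \<noteq> ?h" using dist(1) tl t'(1) by (simp add: nth_eq_iff_index_eq)
    then show "?p (xs ! s) = p (xs ! s)" using augment_invarD(2)[OF a, of s] s t'(1) by simp
  qed
  have h3: "0 \<le> ?p j \<and> ?p j \<le> i" if "j \<in> {0..N} - {?g}" for j
    using augment_invarD(3)[OF a, of ?g] augment_invarD(3)[OF a, of j] gh gN that by (cases "j = ?h") auto
  have h4: "j = k" if "j \<in> {0..N} - {?g}" "k \<in> {0..N} - {?g}" "?p j = ?p k" "?p j \<noteq> 0" for j k
  proof -
    \<comment> \<open>\<open>c\<close> undoes the move: it sends the filled hole to the column whose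
      row it received, so injectivity is inherited from \<open>p'\<close>.\<close>
    define c where "c x = (if x = ?h then ?g else x)" for x
    have c: "c x \<in> {0..N} - {?h}" "?p x = p' (c x)" if "x \<in> {0..N} - {?g}" for x
      using that gN gh by (auto simp: c_def)
    have "c j = c k"
      using augment_invarD(4)[OF a c(1)[OF that(1)] c(1)[OF that(2)]] c(2)[OF that(1)] c(2)[OF that(2)] that(3,4) by metis
    then show ?thesis using that(1,2) unfolding c_def by (metis DiffE insertI1)
  qed
  have h5: "\<exists>j\<in>{0..N} - {?g}. ?p j = r" if "r \<in> {1..i}" for r
  proof -
    obtain j where j: "j \<in> {0..N} - {?h}" "p' j = r" using augment_invarD(5)[OF a \<open>r \<in> {1..i}\<close>] by blast
    show ?thesis
    proof (cases "j = ?g")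
      case True
      then show ?thesis using j hN gh by (intro bexI[of _ ?h]) auto
    next
      case False
      then show ?thesis using j by (intro bexI[of _ j]) auto
    qed
  qed
  have h6: "X (?p j) j = u (?p j) + v j" if "j \<in> {1..N} - {?g}" "?p j \<noteq> 0" for j
  proof (cases "j = ?h")
    case True
    then show ?thesis using t'(4) pg by simp
  next
    case False
    then show ?thesis using augment_invarD(6)[OF a, of j] that by auto
  qed
  have "augment_invar N X i p u v xs t' ?p"
  proof (rule augment_invarI)
    show "t' < length xs" using t'(1) tl by simp
  qed (fact h2 h3[THEN conjunct1] h3[THEN conjunct2] h4 h5 h6)+
  then show ?thesis using t' by blast
qed

text \<open>The hole has arrived at the dummy, so the rows up to \<open>i\<close> all sit in real
  columns.\<close>

lemma augment_invar_final:
  assumes a: "augment_invar N X i p u v xs 0 p'" and xs: "xs ! 0 = 0"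
  shows "tight_matching N X (i + 1) p' u v"
proof -
  note d = augment_invarD[OF a, unfolded xs]
  have sub: "j \<in> {0..N} - {0}" "j \<in> {1..N} - {0}" if "j \<in> {1..N}" for j using that by auto
  have "\<exists>j\<in>{1..N}. p' j = r" if "r \<in> {1..<i + 1}" for r
  proof -
    have "r \<in> {1..i}" using that by auto
    then obtain j where "j \<in> {0..N} - {0}" "p' j = r" using d(5) by blast
    then show ?thesis by (intro bexI[of _ j]) auto
  qed
  moreover have "0 \<le> p' j \<and> p' j < i + 1" if "j \<in> {1..N}" for j
    using d(3)[OF sub(1)[OF that]] by simp
  moreover have "j = k" if "j \<in> {1..N}" "k \<in> {1..N}" "p' j = p' k" "p' j \<noteq> 0" for j k
    using d(4)[OF sub(1)[OF that(1)] sub(1)[OF that(2)] that(3,4)] .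
  moreover have "X (p' j) j = u (p' j) + v j" if "j \<in> {1..N}" "p' j \<noteq> 0" for j
    using d(6)[OF sub(2)[OF that(1)] that(2)] .
  ultimately show ?thesis unfolding tight_matching_def by (intro conjI ballI impI) fast+
qed

text \<open>Weak duality: the dual value \<open>u (q j) + v j\<close>, summed over the columns, is
  the same for every bijection, bounds its cost from below, and equals the cost of the tight
  matching.\<close>

lemma tight_matching_complete:
  assumes m: "tight_matching N X (N + 1) p u v" and f: "dual_feasible N X u v"
  shows "bij_betw p {1..N} {1..N}"
    and "bij_betw q {1..N} {1..N} \<Longrightarrow> (\<Sum>j\<in>{1..N}. X (p j) j) \<le> (\<Sum>j\<in>{1..N}. X (q j) j)"
proof -
  have sub: "{1..N} \<subseteq> p ` {1..N}"
  proof
    fix r assume "r \<in> {1..N}"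
    then have "r \<in> {1..<N + 1}" by auto
    moreover have "\<forall>r\<in>{1..<N + 1}. \<exists>j\<in>{1..N}. p j = r" using m unfolding tight_matching_def by blast
    ultimately obtain j where "j \<in> {1..N}" "p j = r" by (meson bspec)
    then show "r \<in> p ` {1..N}" by (intro image_eqI[of _ _ j]) auto
  qed
  have "card (p ` {1..N}) \<le> card {1..N}" by (intro card_image_le) auto
  then have im: "p ` {1..N} = {1..N}" using sub by (metis card_seteq finite_atLeastAtMost_int finite_imageI)
  then have "inj_on p {1..N}" by (intro eq_card_imp_inj_on) auto
  then show p: "bij_betw p {1..N} {1..N}" using im by (simp add: bij_betw_def)
  have tight: "X (p j) j = u (p j) + v j" if "j \<in> {1..N}" for j
  proof -
    have "p j \<in> {1..N}" using im that by blast
    then have "p j \<noteq> 0" by auto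
    then show ?thesis using m that by (simp add: tight_matching_def)
  qed
  assume q: "bij_betw q {1..N} {1..N}"
  have dual: "(\<Sum>j\<in>{1..N}. u (f j) + v j) = (\<Sum>j\<in>{1..N}. u j) + (\<Sum>j\<in>{1..N}. v j)"
    if "bij_betw f {1..N} {1..N}" for f
    using sum.reindex_bij_betw[OF that, of u] by (simp add: sum.distrib)
  have "(\<Sum>j\<in>{1..N}. X (p j) j) = (\<Sum>j\<in>{1..N}. u (p j) + v j)" using tight by (intro sum.cong) auto
  also have "\<dots> = (\<Sum>j\<in>{1..N}. u (q j) + v j)" using dual[OF p] dual[OF q] by simp
  also have "\<dots> \<le> (\<Sum>j\<in>{1..N}. X (q j) j)"
    using f bij_betwE[OF q] by (intro sum_mono) (auto simp: dual_feasible_def)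
  finally show "(\<Sum>j\<in>{1..N}. X (p j) j) \<le> (\<Sum>j\<in>{1..N}. X (q j) j)" .
qed

section \<open>The Hungarian method as a program\<close>

definition costm :: "state \<Rightarrow> int \<Rightarrow> int \<Rightarrow> real" where "costm s r j = reals s ''X'' (r, j)"

abbreviation (input) C :: "int \<Rightarrow> iexp" where "C \<equiv> IConst"
abbreviation (input) N1 :: iexp where "N1 \<equiv> IPlus (V ''n'') (IConst 1)"

definition reduced :: "name \<Rightarrow> rexp" where
  "reduced r = RMinus (RMinus (RRead ''X'' (V r) (V ''j'')) (RAt ''u'' (V r))) (RAt ''v'' (V ''j''))"

definition init_body :: com where
  "init_body = Seq (SetAt ''used'' (V ''j'') (C 0)) (Seq (RSetAt ''minv'' (V ''j'') (reduced ''i'')) (SetAt ''way'' (V ''j'') (C 0)))"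

text \<open>The row to be inserted is put into the dummy column 0, which counts as reached. The
  initial slacks are therefore the reduced costs of that row, with \<open>way\<close> pointing to
  0.\<close>

definition init_search :: com where
  "init_search = Seq (Seq (SetAt ''p'' (C 0) (V ''i'')) (Seq (Set ''j0'' (C 0)) (Seq (SetAt ''used'' (C 0) (C 1)) (Set ''go'' (C 1)))))
     (For ''j'' (C 1) N1 init_body)"

text \<open>Real columns start at 1, so \<open>j1 = 0\<close> can mean that no candidate has been
  found yet.\<close>

definition select_body :: com where
  "select_body = Cond (BAnd (IEq (At ''used'' (V ''j'')) (C 0)) (BOr (IEq (V ''j1'') (C 0)) (RLess (RAt ''minv'' (V ''j'')) (RAt ''minv'' (V ''j1'')))))
     (Set ''j1'' (V ''j'')) Skip"

definition select :: com where
  "select = Seq (Set ''j1'' (C 0)) (For ''j'' (C 1) N1 select_body)"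

definition dual_body :: com where
  "dual_body = Cond (IEq (At ''used'' (V ''j'')) (C 1))
     (Seq (RSetAt ''u'' (At ''p'' (V ''j'')) (RPlus (RAt ''u'' (At ''p'' (V ''j''))) (RV ''delta'')))
          (RSetAt ''v'' (V ''j'') (RMinus (RAt ''v'' (V ''j'')) (RV ''delta''))))
     (RSetAt ''minv'' (V ''j'') (RMinus (RAt ''minv'' (V ''j'')) (RV ''delta'')))"

text \<open>The minimum is saved in \<open>delta\<close> because the loop itself lowers
  \<open>minv\<close> at \<open>j1\<close>. The loop starts at 0: the dummy column carries the row
  under insertion.\<close>

definition dual :: com where
  "dual = Seq (RSet ''delta'' (RAt ''minv'' (V ''j1''))) (For ''j'' (C 0) N1 dual_body)"

definition relax_body :: com where
  "relax_body = Cond (IEq (At ''used'' (V ''j'')) (C 0))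
     (Seq (RSet ''cur'' (reduced ''i0''))
       (Cond (RLess (RV ''cur'') (RAt ''minv'' (V ''j'')))
         (Seq (RSetAt ''minv'' (V ''j'') (RV ''cur'')) (SetAt ''way'' (V ''j'') (V ''j0''))) Skip)) Skip"

definition relax :: com where
  "relax = Seq (Set ''i0'' (At ''p'' (V ''j0''))) (For ''j'' (C 1) N1 relax_body)"

definition extend :: com where
  "extend = Seq (Seq (SetAt ''used'' (V ''j1'') (C 1)) (Set ''j0'' (V ''j1'')))
     (Cond (IEq (At ''p'' (V ''j0'')) (C 0)) (Set ''go'' (C 0)) relax)"

definition search_step :: com where
  "search_step = Seq select (Seq dual extend)"

definition search :: com where
  "search = Seq init_search (While (IEq (V ''go'') (C 1)) search_step)"

definition augment_body :: com where
  "augment_body = Seq (Set ''j1'' (At ''way'' (V ''j0''))) (Seq (SetAt ''p'' (V ''j0'') (At ''p'' (V ''j1''))) (Set ''j0'' (V ''j1'')))"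

definition augment :: com where
  "augment = While (ILess (C 0) (V ''j0'')) augment_body"

definition hungarian :: com where
  "hungarian = For ''i'' (C 1) N1 (Seq search augment)"

lemmas hungarian_code = init_body_def init_search_def select_body_def select_def dual_body_def dual_def
  relax_body_def relax_def extend_def search_step_def search_def augment_body_def augment_def

lemma rval_reduced[simp]: "rval (reduced r) s = costm s (arr s r 0) (arr s ''j'' 0) - rarr s ''u'' (arr s r 0) - rarr s ''v'' (arr s ''j'' 0)"
  by (simp add: reduced_def costm_def)

lemma costm_write[simp]: 
  "costm (write_int a ij z s) = costm s"
  "a \<noteq> ''X'' \<Longrightarrow> costm (write_real a ij x s) = costm s"
  by (simp_all add: costm_def fun_eq_iff arr_write)

lemma frame_costm: "frame A R s s' \<Longrightarrow> ''X'' \<notin> R \<Longrightarrow> costm s' = costm s"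
  by (simp add: frame_def costm_def fun_eq_iff)

section \<open>Correctness and running time of the Hungarian method\<close>

lemma wp_init_search:
  assumes N: "arr s ''n'' 0 = int n" and W: "n + 1 \<le> W" and i: "arr s ''i'' 0 = i" "1 \<le> i" "i \<le> int n"
  shows "wp init_search s (5 * n + 6) W (\<lambda>s'. arr s' ''p'' = (arr s ''p'')(0 := i) \<and> arr s' ''j0'' 0 = 0 \<and>
    arr s' ''go'' 0 = 1 \<and> arr s' ''used'' 0 = 1 \<and>
    (\<forall>j\<in>{1..int n}. arr s' ''used'' j = 0 \<and> arr s' ''way'' j = 0 \<and>
      rarr s' ''minv'' j = costm s i j - rarr s ''u'' i - rarr s ''v'' j))" (is "wp _ _ _ _ ?Q")
  unfolding init_search_def
proof (rule wp_Seq'[where ?T1.0 = 4 and ?T2.0 = "5 * n + 2"])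
  show "wp (Seq (SetAt ''p'' (C 0) (V ''i'')) (Seq (Set ''j0'' (C 0)) (Seq (SetAt ''used'' (C 0) (C 1)) (Set ''go'' (C 1)))))
     s 4 W (\<lambda>s'. arr s' ''p'' = (arr s ''p'')(0 := i) \<and> arr s' ''j0'' 0 = 0 \<and>
    arr s' ''go'' 0 = 1 \<and> arr s' ''used'' 0 = 1)"
    using i W by (intro wp_straight) (simp_all add: arr_write)
next
  fix s1 assume s1: "arr s1 ''p'' = (arr s ''p'')(0 := i) \<and> arr s1 ''j0'' 0 = 0 \<and>
    arr s1 ''go'' 0 = 1 \<and> arr s1 ''used'' 0 = 1"
    and "frame (iwrites (Seq (SetAt ''p'' (C 0) (V ''i'')) (Seq (Set ''j0'' (C 0)) (Seq (SetAt ''used'' (C 0) (C 1)) (Set ''go'' (C 1))))))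
      (rwrites (Seq (SetAt ''p'' (C 0) (V ''i'')) (Seq (Set ''j0'' (C 0)) (Seq (SetAt ''used'' (C 0) (C 1)) (Set ''go'' (C 1)))))) s s1"
  then have f1: "frame {''p'', ''j0'', ''used'', ''go''} {} s s1" by (simp add: insert_commute)
  have e1: "arr s1 ''n'' 0 = int n" "arr s1 ''i'' 0 = i" "rarr s1 = rarr s" "costm s1 = costm s"
    using N i f1 by (simp_all add: frame_arr[OF f1] frame_rarr[OF f1] frame_costm[OF f1] fun_eq_iff)
  define I where "I k s' \<longleftrightarrow> arr s' ''used'' 0 = 1 \<and>
    (\<forall>j\<in>{1..<k}. arr s' ''used'' j = 0 \<and> arr s' ''way'' j = 0 \<and>
      rarr s' ''minv'' j = costm s i j - rarr s ''u'' i - rarr s ''v'' j)" for k s'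
  show "wp (For ''j'' (C 1) N1 init_body) s1 (5 * n + 2) W ?Q"
  proof (rule wp_For[where I = I and l = 1 and h = "int n + 1" and B = 3])
    fix s' assume "frame (insert ''j'' (iwrites init_body)) (rwrites init_body) s1 s'"
    then have f: "frame {''j'', ''used'', ''way''} {''minv''} s1 s'" by (simp add: init_body_def insert_commute)
    show "ival N1 s' = int n + 1" using e1 by (simp add: frame_arr[OF f])
    { fix k assume k: "1 \<le> k" "k < int n + 1" "I k s'" "arr s' ''j'' 0 = k"
      have fin: "\<And>j. j < k + 1 \<Longrightarrow> j = k \<or> j < k" by linarith
      show "wp init_body s' 3 W (\<lambda>s''. I (k + 1) (write_int ''j'' (0, 0) (k + 1) s''))"
        using k e1 W by (intro wp_straight)
          (auto simp: init_body_def I_def arr_write frame_arr[OF f] frame_rarr[OF f] frame_costm[OF f] dest: fin)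
    }
    { assume "I (int n + 1) s'"
      then show "?Q s'"
        using s1 by (auto simp: I_def frame_arr[OF f])
    }
  next
    fix s' assume "s' = write_int ''j'' (0, 0) 1 s1"
    then show "I 1 s'" using s1 by (simp add: I_def arr_write)
  qed (use W in \<open>auto simp: init_body_def\<close>)
qed simp

lemma wp_select:
  assumes N: "arr s ''n'' 0 = int n" and W: "n + 1 \<le> W" 
    and ex: "\<exists>j\<in>{1..int n}. arr s ''used'' j = 0"
  shows "wp select s (4 * n + 3) W (\<lambda>s'. arr s' ''j1'' 0 \<in> {1..int n} \<and> arr s ''used'' (arr s' ''j1'' 0) = 0 \<and>
    (\<forall>j\<in>{1..int n}. arr s ''used'' j = 0 \<longrightarrow> rarr s ''minv'' (arr s' ''j1'' 0) \<le> rarr s ''minv'' j))" (is "wp _ _ _ _ ?Q")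
  unfolding select_def
proof (rule wp_Seq'[where ?T1.0 = 1 and ?T2.0 = "4 * n + 2"])
  show "wp (Set ''j1'' (C 0)) s 1 W (\<lambda>s'. arr s' ''j1'' 0 = 0)"
    by (intro wp_straight) (simp_all add: arr_write)
next
  fix s1 assume s1: "arr s1 ''j1'' 0 = 0" and "frame (iwrites (Set ''j1'' (C 0))) (rwrites (Set ''j1'' (C 0))) s s1"
  then have f1: "frame {''j1''} {} s s1" by simp
  have e1: "arr s1 ''n'' 0 = int n" "arr s1 ''used'' = arr s ''used''" "rarr s1 = rarr s"
    using N f1 by (simp_all add: frame_arr[OF f1] frame_rarr[OF f1] fun_eq_iff)
  define I where "I k s' \<longleftrightarrow> (if arr s' ''j1'' 0 = 0 then \<forall>j\<in>{1..<k}. arr s ''used'' j \<noteq> 0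
     else arr s' ''j1'' 0 \<in> {1..int n} \<and> arr s ''used'' (arr s' ''j1'' 0) = 0 \<and>
      (\<forall>j\<in>{1..<k}. arr s ''used'' j = 0 \<longrightarrow> rarr s ''minv'' (arr s' ''j1'' 0) \<le> rarr s ''minv'' j))" for k s'
  show "wp (For ''j'' (C 1) N1 select_body) s1 (4 * n + 2) W ?Q"
  proof (rule wp_For[where I = I and l = 1 and h = "int n + 1" and B = 2])
    fix s' assume "frame (insert ''j'' (iwrites select_body)) (rwrites select_body) s1 s'"
    then have f: "frame {''j'', ''j1''} {} s1 s'" by (simp add: select_body_def insert_commute)
    show "ival N1 s' = int n + 1" using e1 by (simp add: frame_arr[OF f])
    { fix k assume k: "1 \<le> k" "k < int n + 1" "I k s'" "arr s' ''j'' 0 = k"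
      have upto: "{1..<k + 1} = insert k {1..<k}" using k by auto
      have kn: "k \<le> int n" using k by simp
      have e: "arr s' ''used'' = arr s ''used''" "rarr s' = rarr s"
        using e1 by (simp_all add: frame_arr[OF f] frame_rarr[OF f] fun_eq_iff)
      show "wp select_body s' 2 W (\<lambda>s''. I (k + 1) (write_int ''j'' (0, 0) (k + 1) s''))"
      proof (cases "arr s ''used'' k = 0 \<and> (arr s' ''j1'' 0 = 0 \<or> rarr s ''minv'' k < rarr s ''minv'' (arr s' ''j1'' 0))")
        case True
        then have new: "\<forall>j\<in>{1..<k}. arr s ''used'' j = 0 \<longrightarrow> rarr s ''minv'' k \<le> rarr s ''minv'' j"
          using k(3) by (auto simp: I_def split: if_splits)
        show ?thesis using True new k(1,4) kn W
          by (intro wp_straight) (auto simp: select_body_def I_def upto e arr_write)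
      next
        case False
        then show ?thesis using k kn W
          by (intro wp_straight) (auto simp: select_body_def I_def upto e arr_write split: if_splits)
      qed
    }
    { assume I: "I (int n + 1) s'"
      have "{1..<int n + 1} = {1..int n}" by auto
      then show "?Q s'"
        using I ex by (auto simp: I_def split: if_splits)
    }
  next
    fix s' assume "s' = write_int ''j'' (0, 0) 1 s1"
    then show "I 1 s'" using s1 by (simp add: I_def arr_write)
  qed (use W in \<open>auto simp: select_body_def\<close>)
qed simp

text \<open>The program raises row potentials through the columns that hold the rows, so two reached
  columns with the same row would raise it twice; \<open>inj\<close> excludes this.\<close>

lemma wp_dual:
  assumes N: "arr s ''n'' 0 = int n" and W: "n + 1 \<le> W" 
    and inj: "\<And>j k. j \<in> {0..int n} \<Longrightarrow> k \<in> {0..int n} \<Longrightarrow> arr s ''used'' j = 1 \<Longrightarrow> arr s ''used'' k = 1 \<Longrightarrow>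
      arr s ''p'' j = arr s ''p'' k \<Longrightarrow> j = k"
    and d: "rarr s ''minv'' (arr s ''j1'' 0) = d"
  shows "wp dual s (5 * n + 8) W (\<lambda>s'.
    (\<forall>r. rarr s' ''u'' r = (if \<exists>j\<in>{0..int n}. arr s ''used'' j = 1 \<and> arr s ''p'' j = r then rarr s ''u'' r + d else rarr s ''u'' r)) \<and>
    (\<forall>j\<in>{0..int n}. rarr s' ''v'' j = (if arr s ''used'' j = 1 then rarr s ''v'' j - d else rarr s ''v'' j) \<and>
       rarr s' ''minv'' j = (if arr s ''used'' j = 1 then rarr s ''minv'' j else rarr s ''minv'' j - d)))"
  unfolding dual_def
proof (rule wp_Seq'[where ?T1.0 = 1 and ?T2.0 = "5 * n + 7"])
  show "wp (RSet ''delta'' (RAt ''minv'' (V ''j1''))) s 1 W (\<lambda>s'. rarr s' ''delta'' 0 = d)"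
    using d by (intro wp_straight) (simp_all add: arr_write)
next
  fix s1 assume s1: "rarr s1 ''delta'' 0 = d"
    and "frame (iwrites (RSet ''delta'' (RAt ''minv'' (V ''j1'')))) (rwrites (RSet ''delta'' (RAt ''minv'' (V ''j1'')))) s s1"
  then have f1: "frame {} {''delta''} s s1" by simp
  have e1: "arr s1 ''n'' 0 = int n" "arr s1 ''used'' = arr s ''used''" "arr s1 ''p'' = arr s ''p''"
    "rarr s1 ''u'' = rarr s ''u''" "rarr s1 ''v'' = rarr s ''v''" "rarr s1 ''minv'' = rarr s ''minv''"
    using N f1 by (simp_all add: frame_arr[OF f1] frame_rarr[OF f1])
  define I where "I k s' \<longleftrightarrow>
    (\<forall>r. rarr s' ''u'' r = (if \<exists>j\<in>{0..<k}. arr s ''used'' j = 1 \<and> arr s ''p'' j = r then rarr s ''u'' r + d else rarr s ''u'' r)) \<and>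
    (\<forall>j\<in>{0..int n}. rarr s' ''v'' j = (if j < k \<and> arr s ''used'' j = 1 then rarr s ''v'' j - d else rarr s ''v'' j) \<and>
       rarr s' ''minv'' j = (if j < k \<and> arr s ''used'' j \<noteq> 1 then rarr s ''minv'' j - d else rarr s ''minv'' j))" for k s'
  show "wp (For ''j'' (C 0) N1 dual_body) s1 (5 * n + 7) W (\<lambda>s'.
    (\<forall>r. rarr s' ''u'' r = (if \<exists>j\<in>{0..int n}. arr s ''used'' j = 1 \<and> arr s ''p'' j = r then rarr s ''u'' r + d else rarr s ''u'' r)) \<and>
    (\<forall>j\<in>{0..int n}. rarr s' ''v'' j = (if arr s ''used'' j = 1 then rarr s ''v'' j - d else rarr s ''v'' j) \<and>
       rarr s' ''minv'' j = (if arr s ''used'' j = 1 then rarr s ''minv'' j else rarr s ''minv'' j - d)))"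
  proof (rule wp_For[where I = I and l = 0 and h = "int n + 1" and B = 3])
    fix s' assume "frame (insert ''j'' (iwrites dual_body)) (rwrites dual_body) s1 s'"
    then have f: "frame {''j''} {''u'', ''v'', ''minv''} s1 s'" by (simp add: dual_body_def insert_commute)
    show "ival N1 s' = int n + 1" using e1 by (simp add: frame_arr[OF f])
    { fix k assume k: "0 \<le> k" "k < int n + 1" "I k s'" "arr s' ''j'' 0 = k"
      have upto: "{0..<k + 1} = insert k {0..<k}" using k by auto
      have fresh: "\<not> (\<exists>j\<in>{0..<k}. arr s ''used'' j = 1 \<and> arr s ''p'' j = arr s ''p'' k)" if "arr s ''used'' k = 1"
        using inj[of _ k] that k by force
      have kn: "k \<le> int n" using k by simp
      have I: "\<And>r. rarr s' ''u'' r = (if \<exists>j\<in>{0..<k}. arr s ''used'' j = 1 \<and> arr s ''p'' j = r then rarr s ''u'' r + d else rarr s ''u'' r)"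
        "\<And>j. j \<in> {0..int n} \<Longrightarrow> rarr s' ''v'' j = (if j < k \<and> arr s ''used'' j = 1 then rarr s ''v'' j - d else rarr s ''v'' j)"
        "\<And>j. j \<in> {0..int n} \<Longrightarrow> rarr s' ''minv'' j = (if j < k \<and> arr s ''used'' j \<noteq> 1 then rarr s ''minv'' j - d else rarr s ''minv'' j)"
        using k(3) unfolding I_def by blast+
      have e: "arr s' ''used'' = arr s ''used''" "arr s' ''p'' = arr s ''p''" "rarr s' ''delta'' 0 = d"
        using e1 s1 by (simp_all add: frame_arr[OF f] frame_rarr[OF f])
      show "wp dual_body s' 3 W (\<lambda>s''. I (k + 1) (write_int ''j'' (0, 0) (k + 1) s''))"
      proof (cases "arr s ''used'' k = 1")
        case True
        then show ?thesis using k(1,4) kn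
          by (intro wp_straight) (auto simp: dual_body_def I_def upto e arr_write I fresh[OF True])
      next
        case False
        then show ?thesis using k(1,4) kn
          by (intro wp_straight) (auto simp: dual_body_def I_def upto e arr_write I)
      qed
    }
    { assume I: "I (int n + 1) s'"
      have "{0..<int n + 1} = {0..int n}" by auto
      then show "(\<forall>r. rarr s' ''u'' r = (if \<exists>j\<in>{0..int n}. arr s ''used'' j = 1 \<and> arr s ''p'' j = r then rarr s ''u'' r + d else rarr s ''u'' r)) \<and>
        (\<forall>j\<in>{0..int n}. rarr s' ''v'' j = (if arr s ''used'' j = 1 then rarr s ''v'' j - d else rarr s ''v'' j) \<and>
           rarr s' ''minv'' j = (if arr s ''used'' j = 1 then rarr s ''minv'' j else rarr s ''minv'' j - d))"
        using I unfolding I_def by auto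
    }
  next
    fix s' assume "s' = write_int ''j'' (0, 0) 0 s1"
    then show "I 0 s'" using e1 by (simp add: I_def arr_write)
  qed (use W in \<open>auto simp: dual_body_def nat_add_distrib\<close>)
qed simp

lemma wp_relax:
  assumes N: "arr s ''n'' 0 = int n" and W: "n + 1 \<le> W" and j0: "arr s ''j0'' 0 = j0" "0 \<le> j0" "j0 \<le> int n"
    and pj0: "0 \<le> arr s ''p'' j0" "arr s ''p'' j0 \<le> int n" and 
    rc: "\<And>j. rc j = costm s (arr s ''p'' j0) j - rarr s ''u'' (arr s ''p'' j0) - rarr s ''v'' j"
  shows "wp relax s (7 * n + 3) W (\<lambda>s'. \<forall>j\<in>{0..int n}.
    rarr s' ''minv'' j = (if 1 \<le> j \<and> arr s ''used'' j = 0 \<and> rc j < rarr s ''minv'' j then rc j else rarr s ''minv'' j) \<and>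
    arr s' ''way'' j = (if 1 \<le> j \<and> arr s ''used'' j = 0 \<and> rc j < rarr s ''minv'' j then j0 else arr s ''way'' j))" (is "wp _ _ _ _ ?Q")
  unfolding relax_def
proof (rule wp_Seq'[where ?T1.0 = 1 and ?T2.0 = "7 * n + 2"])
  show "wp (Set ''i0'' (At ''p'' (V ''j0''))) s 1 W (\<lambda>s'. arr s' ''i0'' 0 = arr s ''p'' j0)"
    using j0 pj0 W by (intro wp_straight) (simp_all add: arr_write)
next
  fix s1 assume s1: "arr s1 ''i0'' 0 = arr s ''p'' j0"
    and "frame (iwrites (Set ''i0'' (At ''p'' (V ''j0'')))) (rwrites (Set ''i0'' (At ''p'' (V ''j0'')))) s s1"
  then have f1: "frame {''i0''} {} s s1" by simp
  have e1: "arr s1 ''n'' 0 = int n" "arr s1 ''used'' = arr s ''used''" "arr s1 ''j0'' 0 = j0" "arr s1 ''way'' = arr s ''way''"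
    "rarr s1 = rarr s" "costm s1 = costm s"
    using N f1 j0 by (simp_all add: frame_arr[OF f1] frame_rarr[OF f1] frame_costm[OF f1] fun_eq_iff)
  define I where "I k s' \<longleftrightarrow> (\<forall>j\<in>{0..int n}.
    rarr s' ''minv'' j = (if j < k \<and> 1 \<le> j \<and> arr s ''used'' j = 0 \<and> rc j < rarr s ''minv'' j then rc j else rarr s ''minv'' j) \<and>
    arr s' ''way'' j = (if j < k \<and> 1 \<le> j \<and> arr s ''used'' j = 0 \<and> rc j < rarr s ''minv'' j then j0 else arr s ''way'' j))" for k s'
  show "wp (For ''j'' (C 1) N1 relax_body) s1 (7 * n + 2) W ?Q"
  proof (rule wp_For[where I = I and l = 1 and h = "int n + 1" and B = 5])
    fix s' assume "frame (insert ''j'' (iwrites relax_body)) (rwrites relax_body) s1 s'"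
    then have f: "frame {''j'', ''way''} {''cur'', ''minv''} s1 s'" by (simp add: relax_body_def insert_commute)
    show "ival N1 s' = int n + 1" using e1 by (simp add: frame_arr[OF f])
    { fix k assume k: "1 \<le> k" "k < int n + 1" "I k s'" "arr s' ''j'' 0 = k"
      have kn: "k \<le> int n" using k by simp
      have I: "\<And>j. j \<in> {0..int n} \<Longrightarrow> rarr s' ''minv'' j = (if j < k \<and> 1 \<le> j \<and> arr s ''used'' j = 0 \<and> rc j < rarr s ''minv'' j then rc j else rarr s ''minv'' j)"
        "\<And>j. j \<in> {0..int n} \<Longrightarrow> arr s' ''way'' j = (if j < k \<and> 1 \<le> j \<and> arr s ''used'' j = 0 \<and> rc j < rarr s ''minv'' j then j0 else arr s ''way'' j)"
        using k(3) unfolding I_def by blast+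
      have e: "arr s' ''used'' = arr s ''used''" "arr s' ''j0'' 0 = j0" "arr s' ''i0'' 0 = arr s ''p'' j0"
        "rarr s' ''u'' = rarr s ''u''" "rarr s' ''v'' = rarr s ''v''" "costm s' = costm s"
        using e1 s1 by (simp_all add: frame_arr[OF f] frame_rarr[OF f] frame_costm[OF f])
      show "wp relax_body s' 5 W (\<lambda>s''. I (k + 1) (write_int ''j'' (0, 0) (k + 1) s''))"
      proof (cases "arr s ''used'' k = 0 \<and> rc k < rarr s ''minv'' k")
        case True
        then show ?thesis using k(1,4) kn j0 W
          by (intro wp_straight) (auto simp: relax_body_def I_def e arr_write I rc)
      next
        case False
        then show ?thesis using k(1,4) kn j0 W
          by (intro wp_straight) (auto simp: relax_body_def I_def e arr_write I rc)
      qed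
    }
    { assume I: "I (int n + 1) s'"
      then show "?Q s'"
        unfolding I_def by auto
    }
  next
    fix s' assume "s' = write_int ''j'' (0, 0) 1 s1"
    then show "I 1 s'" using e1 by (simp add: I_def arr_write)
  qed (use W in \<open>auto simp: relax_body_def\<close>)
qed simp

definition search_state :: "nat \<Rightarrow> (int \<Rightarrow> int \<Rightarrow> real) \<Rightarrow> int \<Rightarrow> (int \<Rightarrow> int) \<Rightarrow> int list \<Rightarrow> state \<Rightarrow> bool" where
  "search_state n X i p xs s \<longleftrightarrow>
    arr s ''n'' 0 = int n \<and> arr s ''i'' 0 = i \<and> arr s ''p'' = p \<and> costm s = X \<and>
    tight_matching (int n) X i p (rarr s ''u'') (rarr s ''v'') \<and>
    dual_feasible (int n) X (rarr s ''u'') (rarr s ''v'') \<and>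
    search_tree (int n) X p (rarr s ''u'') (rarr s ''v'') (arr s ''way'') xs \<and>
    (\<forall>j\<in>{0..int n}. arr s ''used'' j = (if j \<in> set xs then 1 else 0)) \<and>
    arr s ''j0'' 0 = last xs"

text \<open>Slacks are claimed only while the search goes on: when a free column is reached,
  \<open>relax\<close> is skipped and \<open>minv\<close> and \<open>way\<close> are not brought up
  to date.\<close>

definition search_invar :: "nat \<Rightarrow> (int \<Rightarrow> int \<Rightarrow> real) \<Rightarrow> int \<Rightarrow> (int \<Rightarrow> int) \<Rightarrow> int list \<Rightarrow> state \<Rightarrow> bool" where
  "search_invar n X i p xs s \<longleftrightarrow> search_state n X i p xs s \<and>
    (if arr s ''go'' 0 = 1 then (\<forall>j\<in>set xs. p j \<noteq> 0) \<and>
        slack_invar (int n) X p (rarr s ''u'') (rarr s ''v'') (rarr s ''minv'') (arr s ''way'') (set xs)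
     else p (last xs) = 0)"

lemma wp_search_step:
  assumes inv: "search_invar n X i p xs s" and go: "arr s ''go'' 0 = 1"
    and i: "1 \<le> i" "i \<le> int n" "p 0 = i" and W: "n + 1 \<le> W"
  shows "wp search_step s (16 * n + 17) W (\<lambda>s'. \<exists>j1. j1 \<in> {1..int n} \<and> j1 \<notin> set xs \<and> search_invar n X i p (xs @ [j1]) s')" (is "wp _ _ _ _ ?Q")
proof -
  let ?N = "int n"
  have st: "arr s ''n'' 0 = int n" "arr s ''i'' 0 = i" "arr s ''p'' = p" "costm s = X"
    "tight_matching ?N X i p (rarr s ''u'') (rarr s ''v'')" "dual_feasible ?N X (rarr s ''u'') (rarr s ''v'')"
    "search_tree ?N X p (rarr s ''u'') (rarr s ''v'') (arr s ''way'') xs"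
    and used: "\<And>j. j \<in> {0..?N} \<Longrightarrow> arr s ''used'' j = (if j \<in> set xs then 1 else 0)"
    and matched: "\<forall>j\<in>set xs. p j \<noteq> 0"
    and slack: "slack_invar ?N X p (rarr s ''u'') (rarr s ''v'') (rarr s ''minv'') (arr s ''way'') (set xs)"
    using inv go unfolding search_invar_def search_state_def by simp_all
  have xs: "set xs \<subseteq> {0..?N}" "xs \<noteq> []" "xs ! 0 = 0" using st(7) by (auto simp: search_tree_def)
  have "0 \<in> set xs" using xs nth_mem[of 0 xs] by auto
  from unreached_column_exists[OF st(5) i(3) i(1,2) xs(1) matched this]
  have ex: "\<exists>j\<in>{1..?N}. arr s ''used'' j = 0" using used by fastforce
  show ?thesis unfolding search_step_def
  proof (rule wp_Seq'[OF wp_select[OF st(1) W ex], where ?T2.0 = "12 * n + 14"])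
    fix s1 assume j1: "arr s1 ''j1'' 0 \<in> {1..?N} \<and> arr s ''used'' (arr s1 ''j1'' 0) = 0 \<and>
      (\<forall>j\<in>{1..?N}. arr s ''used'' j = 0 \<longrightarrow> rarr s ''minv'' (arr s1 ''j1'' 0) \<le> rarr s ''minv'' j)"
      and "frame (iwrites select) (rwrites select) s s1"
    then have f1: "frame {''j'', ''j1''} {} s s1" by (simp add: select_def select_body_def insert_commute)
    define j1 where "j1 = arr s1 ''j1'' 0"
    have j1N: "j1 \<in> {1..?N}" and j1x: "j1 \<notin> set xs"
      and j1min: "\<And>j. j \<in> {1..?N} \<Longrightarrow> j \<notin> set xs \<Longrightarrow> rarr s ''minv'' j1 \<le> rarr s ''minv'' j"
      using j1 used[of j1] used by (auto simp: j1_def split: if_splits)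
    have e1: "arr s1 ''n'' 0 = ?N" "arr s1 ''i'' 0 = i" "arr s1 ''p'' = p" "costm s1 = X" "rarr s1 = rarr s"
      "arr s1 ''used'' = arr s ''used''" "arr s1 ''way'' = arr s ''way''" "arr s1 ''go'' 0 = 1"
      using st go by (simp_all add: frame_arr[OF f1] frame_rarr[OF f1] frame_costm[OF f1] fun_eq_iff)
    have used1: "arr s1 ''used'' j = 1 \<longleftrightarrow> j \<in> set xs" if "j \<in> {0..?N}" for j
      using used[OF that] e1 by simp
    have inj: "j = k" if "j \<in> {0..?N}" "k \<in> {0..?N}" "arr s1 ''used'' j = 1" "arr s1 ''used'' k = 1"
      "arr s1 ''p'' j = arr s1 ''p'' k" for j k
      using tight_matching_inj0[OF st(5) i(3) that(1,2)] that used1 matched e1(3) by metis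
    define \<delta> where "\<delta> = rarr s ''minv'' j1"
    have d: "rarr s1 ''minv'' (arr s1 ''j1'' 0) = \<delta>" using e1 by (simp add: \<delta>_def j1_def)
    show "wp (Seq dual extend) s1 (12 * n + 14) W ?Q"
    proof (rule wp_Seq'[OF wp_dual[OF e1(1) W inj d], where ?T2.0 = "7 * n + 6"])
      fix s2 assume s2: "(\<forall>r. rarr s2 ''u'' r = (if \<exists>j\<in>{0..int n}. arr s1 ''used'' j = 1 \<and> arr s1 ''p'' j = r then rarr s1 ''u'' r + \<delta> else rarr s1 ''u'' r)) \<and>
        (\<forall>j\<in>{0..int n}. rarr s2 ''v'' j = (if arr s1 ''used'' j = 1 then rarr s1 ''v'' j - \<delta> else rarr s1 ''v'' j) \<and>
         rarr s2 ''minv'' j = (if arr s1 ''used'' j = 1 then rarr s1 ''minv'' j else rarr s1 ''minv'' j - \<delta>))"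
        and "frame (iwrites dual) (rwrites dual) s1 s2"
      then have f2: "frame {''j''} {''delta'', ''u'', ''v'', ''minv''} s1 s2" by (simp add: dual_def dual_body_def insert_commute)
      have e2: "arr s2 ''n'' 0 = ?N" "arr s2 ''i'' 0 = i" "arr s2 ''p'' = p" "costm s2 = X"
        "arr s2 ''used'' = arr s ''used''" "arr s2 ''way'' = arr s ''way''" "arr s2 ''j1'' 0 = j1" "arr s2 ''go'' 0 = 1"
        using e1 by (simp_all add: frame_arr[OF f2] frame_costm[OF f2] j1_def)
      have ex_iff: "(\<exists>j\<in>{0..?N}. arr s1 ''used'' j = 1 \<and> arr s1 ''p'' j = r) \<longleftrightarrow> (\<exists>j\<in>set xs. p j = r)" for r
        using used1 xs(1) e1(3) by (metis subsetD)
      have u2: "rarr s2 ''u'' r = (if \<exists>j\<in>set xs. p j = r then rarr s ''u'' r + rarr s ''minv'' j1 else rarr s ''u'' r)" for r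
        using s2 ex_iff e1(5) by (simp add: \<delta>_def)
      have v2: "rarr s2 ''v'' j = (if j \<in> set xs then rarr s ''v'' j - rarr s ''minv'' j1 else rarr s ''v'' j)" if "j \<in> {0..?N}" for j
        using s2 used1[OF that] that e1(5) by (simp add: \<delta>_def)
      have m2: "rarr s2 ''minv'' j = rarr s ''minv'' j - rarr s ''minv'' j1" if "j \<in> {1..?N}" "j \<notin> set xs" for j
        using s2 used1[of j] that e1(5) by (simp add: \<delta>_def)
      note ds = dual_step[OF st(5) i(3) st(6) i(1,2) st(7) matched slack j1N j1x j1min u2 v2 m2]
      show "wp extend s2 (7 * n + 6) W ?Q"
        unfolding extend_def
      proof (rule wp_Seq'[where ?T1.0 = 2 and ?T2.0 = "7 * n + 4" and R = "\<lambda>s'. arr s' ''used'' = (arr s ''used'')(j1 := 1) \<and> arr s' ''j0'' 0 = j1"])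
        show "wp (Seq (SetAt ''used'' (V ''j1'') (C 1)) (Set ''j0'' (V ''j1''))) s2 2 W
          (\<lambda>s'. arr s' ''used'' = (arr s ''used'')(j1 := 1) \<and> arr s' ''j0'' 0 = j1)"
          using e2 W j1N by (intro wp_straight) (simp_all add: arr_write)
      next
        fix s3 assume s3: "arr s3 ''used'' = (arr s ''used'')(j1 := 1) \<and> arr s3 ''j0'' 0 = j1"
          and "frame (iwrites (Seq (SetAt ''used'' (V ''j1'') (C 1)) (Set ''j0'' (V ''j1''))))
            (rwrites (Seq (SetAt ''used'' (V ''j1'') (C 1)) (Set ''j0'' (V ''j1'')))) s2 s3"
        then have f3: "frame {''used'', ''j0''} {} s2 s3" by (simp add: insert_commute)
        have e3: "arr s3 ''n'' 0 = ?N" "arr s3 ''i'' 0 = i" "arr s3 ''p'' = p" "costm s3 = X"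
          "arr s3 ''way'' = arr s ''way''" "arr s3 ''go'' 0 = 1" "rarr s3 = rarr s2" 
          using e2 by (simp_all add: frame_arr[OF f3] frame_rarr[OF f3] frame_costm[OF f3] fun_eq_iff)
        have used3: "\<forall>j\<in>{0..?N}. arr s3 ''used'' j = (if j \<in> set (xs @ [j1]) then 1 else 0)"
          using used s3 by auto
        show "wp (Cond (IEq (At ''p'' (V ''j0'')) (C 0)) (Set ''go'' (C 0)) relax) s3 (7 * n + 4) W
            ?Q"
        proof (rule wp_Cond[where T' = "7 * n + 3"])
          assume b: "bval (IEq (At ''p'' (V ''j0'')) (C 0)) s3"
          then have p0: "p j1 = 0" using s3 e3 by simp
          have "search_invar n X i p (xs @ [j1]) (write_int ''go'' (0, 0) 0 s3)"
            using ds used3 e3 s3 p0 unfolding search_invar_def search_state_def by (simp add: arr_write)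
          then show "wp (Set ''go'' (C 0)) s3 (7 * n + 3) W
              ?Q"
            using j1N j1x by (intro wp_straight) auto
        next
          assume b: "\<not> bval (IEq (At ''p'' (V ''j0'')) (C 0)) s3"
          then have p0: "p j1 \<noteq> 0" using s3 e3 by simp
          define rc where "rc j = X (p j1) j - rarr s2 ''u'' (p j1) - rarr s2 ''v'' j" for j
          have pr: "0 \<le> arr s3 ''p'' j1" "arr s3 ''p'' j1 \<le> ?N"
            using tight_matching_range[OF st(5) j1N] e3 i by auto
          have rc: "rc j = costm s3 (arr s3 ''p'' j1) j - rarr s3 ''u'' (arr s3 ''p'' j1) - rarr s3 ''v'' j" for j
            using e3 by (simp add: rc_def)
          have j1r: "0 \<le> j1" "j1 \<le> ?N" using j1N by auto
          show "wp relax s3 (7 * n + 3) W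
              ?Q"
          proof (rule wp_mono[OF wp_frame[OF wp_relax[OF e3(1) W s3[THEN conjunct2] j1r pr rc]] order_refl])
            fix s4 assume s4: "(\<forall>j\<in>{0..int n}.
              rarr s4 ''minv'' j = (if 1 \<le> j \<and> arr s3 ''used'' j = 0 \<and> rc j < rarr s3 ''minv'' j then rc j else rarr s3 ''minv'' j) \<and>
              arr s4 ''way'' j = (if 1 \<le> j \<and> arr s3 ''used'' j = 0 \<and> rc j < rarr s3 ''minv'' j then j1 else arr s3 ''way'' j)) \<and>
              frame (iwrites relax) (rwrites relax) s3 s4"
            then have f4: "frame {''i0'', ''j'', ''way''} {''cur'', ''minv''} s3 s4"
              by (simp add: relax_def relax_body_def insert_commute)
            have e4: "arr s4 ''n'' 0 = ?N" "arr s4 ''i'' 0 = i" "arr s4 ''p'' = p" "costm s4 = X"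
              "arr s4 ''used'' = arr s3 ''used''" "arr s4 ''j0'' 0 = j1" "arr s4 ''go'' 0 = 1"
              "rarr s4 ''u'' = rarr s2 ''u''" "rarr s4 ''v'' = rarr s2 ''v''"
              using e3 s3 by (simp_all add: frame_arr[OF f4] frame_rarr[OF f4] frame_costm[OF f4])
            have unused: "arr s3 ''used'' j = 0 \<longleftrightarrow> j \<notin> set xs \<and> j \<noteq> j1" if "j \<in> {0..?N}" for j
              using bspec[OF used3 that] by auto
            have way_same: "arr s4 ''way'' j = arr s ''way'' j" if "j \<in> set (xs @ [j1])" for j
            proof -
              have "j \<in> {0..?N}" using that xs(1) j1N by auto
              then show ?thesis using s4 unused[of j] that e3(5) by auto
            qed
            have tr: "search_tree ?N X p (rarr s4 ''u'') (rarr s4 ''v'') (arr s4 ''way'') (xs @ [j1])"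
              using search_tree_way_cong[OF ds(3) way_same] e4 by simp
            have sl: "slack_invar ?N X p (rarr s4 ''u'') (rarr s4 ''v'') (rarr s4 ''minv'') (arr s4 ''way'') (insert j1 (set xs))"
              unfolding e4
            proof (rule relax_step[OF ds(4)])
              fix j assume j: "j \<in> {1..?N}" "j \<notin> set xs" "j \<noteq> j1"
              then have "j \<in> {0..?N}" "1 \<le> j" "arr s3 ''used'' j = 0" using unused[of j] by auto
              then show "rarr s4 ''minv'' j = (if X (p j1) j - rarr s2 ''u'' (p j1) - rarr s2 ''v'' j < rarr s2 ''minv'' j
                  then X (p j1) j - rarr s2 ''u'' (p j1) - rarr s2 ''v'' j else rarr s2 ''minv'' j)"
                "arr s4 ''way'' j = (if X (p j1) j - rarr s2 ''u'' (p j1) - rarr s2 ''v'' j < rarr s2 ''minv'' j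
                  then j1 else arr s ''way'' j)"
                using s4 e3 by (simp_all add: rc_def)
            qed
            have "search_invar n X i p (xs @ [j1]) s4"
              using tr sl ds(1,2) used3 e4 matched p0 unfolding search_invar_def search_state_def by simp
            then show "\<exists>j1. j1 \<in> {1..int n} \<and> j1 \<notin> set xs \<and> search_invar n X i p (xs @ [j1]) s4"
              using j1N j1x by blast
          qed
        qed simp
      qed simp
    qed (assumption+, linarith)
  qed simp
qed

lemma tight_matching_cong:
  assumes "tight_matching N X i p u v" "\<And>j. j \<in> {1..N} \<Longrightarrow> p' j = p j"
  shows "tight_matching N X i p' u v"
  using assms unfolding tight_matching_def by simp

lemma wp_search:
  assumes N: "arr s ''n'' 0 = int n" and W: "n + 1 \<le> W" and i: "arr s ''i'' 0 = i" "1 \<le> i" "i \<le> int n"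
    and m: "tight_matching (int n) (costm s) i (arr s ''p'') (rarr s ''u'') (rarr s ''v'')"
    and f: "dual_feasible (int n) (costm s) (rarr s ''u'') (rarr s ''v'')"
  shows "wp search s (5 * n + 7 + n * (16 * n + 18)) W (\<lambda>s'. \<exists>xs. 
    search_state n (costm s) i ((arr s ''p'')(0 := i)) xs s' \<and> arr s ''p'' (last xs) = 0 \<and> last xs \<noteq> 0)"
  unfolding search_def
proof (rule wp_Seq'[OF wp_init_search[OF N W i], where ?T2.0 = "n * (16 * n + 17 + 1) + 1"])
  let ?p = "(arr s ''p'')(0 := i)"
  fix s1 assume s1: "arr s1 ''p'' = (arr s ''p'')(0 := i) \<and> arr s1 ''j0'' 0 = 0 \<and>
    arr s1 ''go'' 0 = 1 \<and> arr s1 ''used'' 0 = 1 \<and>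
    (\<forall>j\<in>{1..int n}. arr s1 ''used'' j = 0 \<and> arr s1 ''way'' j = 0 \<and>
      rarr s1 ''minv'' j = costm s i j - rarr s ''u'' i - rarr s ''v'' j)"
    and "frame (iwrites init_search) (rwrites init_search) s s1"
  then have f1: "frame {''p'', ''j0'', ''used'', ''go'', ''j'', ''way''} {''minv''} s s1"
    by (simp add: init_search_def init_body_def insert_commute)
  have e1: "arr s1 ''n'' 0 = int n" "arr s1 ''i'' 0 = i" "costm s1 = costm s" "rarr s1 ''u'' = rarr s ''u''" "rarr s1 ''v'' = rarr s ''v''"
    using N i by (simp_all add: frame_arr[OF f1] frame_rarr[OF f1] frame_costm[OF f1])
  \<comment> \<open>With the dummy there are n + 1 columns, so the variant \<open>k\<close> counts
    the unreached ones.\<close>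
  define J where "J k s' \<longleftrightarrow> (\<exists>xs. search_invar n (costm s) i ?p xs s' \<and> k + length xs = n + 1)" for k s'
  have "J n s1"
  proof -
    have m': "tight_matching (int n) (costm s) i ?p (rarr s ''u'') (rarr s ''v'')"
      by (rule tight_matching_cong[OF m]) auto
    have "search_tree (int n) (costm s) ?p (rarr s ''u'') (rarr s ''v'') (arr s1 ''way'') [0]"
      by (simp add: search_tree_def)
    moreover have "slack_invar (int n) (costm s) ?p (rarr s ''u'') (rarr s ''v'') (rarr s1 ''minv'') (arr s1 ''way'') {0}"
      using s1 by (simp add: slack_invar_def)
    moreover have "\<forall>j\<in>{0..int n}. arr s1 ''used'' j = (if j \<in> set [0] then 1 else 0)"
      using s1 by auto
    ultimately have "search_invar n (costm s) i ?p [0] s1"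
      using s1 e1 m' f i unfolding search_invar_def search_state_def by simp
    then show ?thesis unfolding J_def by (intro exI[of _ "[0]"]) simp
  qed
  moreover have "0 < k \<and> wp search_step s' (16 * n + 17) W (J (k - 1))"
    if J: "J k s'" and b: "bval (IEq (V ''go'') (C 1)) s'" for k s'
  proof -
    obtain xs where xs: "search_invar n (costm s) i ?p xs s'" "k + length xs = n + 1" using J by (auto simp: J_def)
    have go: "arr s' ''go'' 0 = 1" using b by simp
    have st: "tight_matching (int n) (costm s) i ?p (rarr s' ''u'') (rarr s' ''v'')"
      "search_tree (int n) (costm s) ?p (rarr s' ''u'') (rarr s' ''v'') (arr s' ''way'') xs"
      "\<forall>j\<in>set xs. ?p j \<noteq> 0"
      using xs(1) go unfolding search_invar_def search_state_def by simp_all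
    have xs': "set xs \<subseteq> {0..int n}" "xs \<noteq> []" "xs ! 0 = 0" "distinct xs" using st(2) by (auto simp: search_tree_def)
    have "0 \<in> set xs" using xs' nth_mem[of 0 xs] by auto
    from unreached_column_exists[OF st(1) _ i(2,3) xs'(1) st(3) this]
    have "set xs \<subset> {0..int n}" using xs'(1) by force
    then have "card (set xs) < card {0..int n}" by (intro psubset_card_mono) auto
    then have k: "0 < k" using distinct_card[OF xs'(4)] xs(2) by simp
    have "wp search_step s' (16 * n + 17) W (J (k - 1))"
    proof (rule wp_mono[OF wp_search_step[OF xs(1) go i(2,3) _ W] order_refl])
      fix s'' assume "\<exists>j1. j1 \<in> {1..int n} \<and> j1 \<notin> set xs \<and> search_invar n (costm s) i ?p (xs @ [j1]) s''"
      then obtain j1 where "search_invar n (costm s) i ?p (xs @ [j1]) s''" by blast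
      then show "J (k - 1) s''" unfolding J_def using xs(2) k by (intro exI[of _ "xs @ [j1]"]) simp
    qed simp
    then show ?thesis using k by simp
  qed
  ultimately have "wp (While (IEq (V ''go'') (C 1)) search_step) s1 (n * (16 * n + 17 + 1) + 1) W
      (\<lambda>s'. (\<exists>k'. J k' s') \<and> \<not> bval (IEq (V ''go'') (C 1)) s')"
    by (intro wp_While[where I = J])
  then show "wp (While (IEq (V ''go'') (C 1)) search_step) s1 (n * (16 * n + 17 + 1) + 1) W
      (\<lambda>s'. \<exists>xs. search_state n (costm s) i ?p xs s' \<and> arr s ''p'' (last xs) = 0 \<and> last xs \<noteq> 0)"
  proof (rule wp_mono[OF _ order_refl])
    fix s' assume "(\<exists>k'. J k' s') \<and> \<not> bval (IEq (V ''go'') (C 1)) s'"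
    then obtain xs where xs: "search_invar n (costm s) i ?p xs s'" "arr s' ''go'' 0 \<noteq> 1" by (auto simp: J_def)
    then have "search_state n (costm s) i ?p xs s'" "?p (last xs) = 0" by (simp_all add: search_invar_def)
    then show "\<exists>xs. search_state n (costm s) i ?p xs s' \<and> arr s ''p'' (last xs) = 0 \<and> last xs \<noteq> 0"
      using i by (intro exI[of _ xs]) (auto split: if_splits)
  qed
qed simp

lemma wp_augment:
  assumes st: "search_state n X i p xs s" and i: "1 \<le> i" "i \<le> int n" "p 0 = i" and last: "p (last xs) = 0" and W: "n + 1 \<le> W"
  shows "wp augment s (4 * n + 1) W (\<lambda>s'. tight_matching (int n) X (i + 1) (arr s' ''p'') (rarr s ''u'') (rarr s ''v''))" (is "wp _ _ _ _ ?Q")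
proof -
  let ?N = "int n"
  have e: "arr s ''n'' 0 = int n" "arr s ''p'' = p" "arr s ''j0'' 0 = last xs"
    "tight_matching ?N X i p (rarr s ''u'') (rarr s ''v'')"
    "search_tree ?N X p (rarr s ''u'') (rarr s ''v'') (arr s ''way'') xs"
    using st unfolding search_state_def by simp_all
  have xs: "set xs \<subseteq> {0..?N}" "xs \<noteq> []" "xs ! 0 = 0" "distinct xs" using e(5) by (auto simp: search_tree_def)
  have "card (set xs) \<le> card {0..?N}" using xs by (intro card_mono) auto
  then have len: "length xs \<le> n + 1" using distinct_card[OF xs(4)] by simp
  have rng: "0 \<le> xs ! t \<and> xs ! t \<le> ?N" if "t < length xs" for t using xs(1) nth_mem[OF that] by auto
  define J where "J k s' \<longleftrightarrow> augment_invar ?N X i p (rarr s ''u'') (rarr s ''v'') xs k (arr s' ''p'') \<and>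
    arr s' ''j0'' 0 = xs ! k \<and> arr s' ''way'' = arr s ''way''" for k s'
  have "J (length xs - 1) s"
    using augment_invar_init[OF e(4) i(3) i(1) e(5) last] e xs by (simp add: J_def last_conv_nth)
  moreover have "0 < k \<and> wp augment_body s' 3 W (\<lambda>s''. \<exists>k'<k. J k' s'')"
    if J: "J k s'" and b: "bval (ILess (C 0) (V ''j0'')) s'" for k s'
  proof -
    have a: "augment_invar ?N X i p (rarr s ''u'') (rarr s ''v'') xs k (arr s' ''p'')"
      and j0: "arr s' ''j0'' 0 = xs ! k" and way: "arr s' ''way'' = arr s ''way''" using J by (auto simp: J_def)
    have k: "0 < k" using b j0 xs(3) by (cases k) auto
    obtain t' where t': "t' < k" "arr s ''way'' (xs ! k) = xs ! t'"
      "augment_invar ?N X i p (rarr s ''u'') (rarr s ''v'') xs t' ((arr s' ''p'')(xs ! k := arr s' ''p'' (xs ! t')))"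
      using augment_step[OF a e(5) k] by blast
    have kl: "k < length xs" by (rule augment_invarD(1)[OF a])
    have ne: "xs ! t' \<noteq> xs ! k" using xs(4) t'(1) kl by (simp add: nth_eq_iff_index_eq)
    have r: "0 \<le> arr s' ''p'' (xs ! t')" "arr s' ''p'' (xs ! t') \<le> ?N" 
      using augment_invarD(3)[OF a, of "xs ! t'"] rng[of t'] t'(1) kl ne i by auto
    have "wp augment_body s' 3 W (J t')"
      using j0 way t' r rng[of t'] kl W
      by (intro wp_straight) (auto simp: augment_body_def J_def arr_write)
    then show ?thesis using k t'(1) by (auto elim!: wp_mono)
  qed
  \<comment> \<open>A column may have been reached from any earlier one, so the hole can jump back
    by several places. Weakening the invariant to some index at most \<open>k\<close> turns this
    into a variant that drops by one.\<close>
  ultimately have "wp (While (ILess (C 0) (V ''j0'')) augment_body) s ((length xs - 1) * (3 + 1) + 1) W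
      (\<lambda>s'. (\<exists>k'. \<exists>k''\<le>k'. J k'' s') \<and> \<not> bval (ILess (C 0) (V ''j0'')) s')"
  proof (intro wp_While[where I = "\<lambda>k s'. \<exists>k''\<le>k. J k'' s'"])
    fix k s' assume J: "\<exists>k''\<le>k. J k'' s'" and b: "bval (ILess (C 0) (V ''j0'')) s'"
      and step: "\<And>k s'. J k s' \<Longrightarrow> bval (ILess (C 0) (V ''j0'')) s' \<Longrightarrow> 0 < k \<and> wp augment_body s' 3 W (\<lambda>s''. \<exists>k'<k. J k' s'')"
    obtain k'' where k'': "k'' \<le> k" "J k'' s'" using J by blast
    have "wp augment_body s' 3 W (\<lambda>s''. \<exists>k'\<le>k - 1. J k' s'')"
    proof (rule wp_mono[OF conjunct2[OF step[OF k''(2) b]] order_refl])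
      fix s'' assume "\<exists>k'<k''. J k' s''"
      then obtain k' where "k' < k''" "J k' s''" by blast
      then show "\<exists>k'\<le>k - 1. J k' s''" using k''(1) by (intro exI[of _ k']) simp
    qed
    then show "0 < k \<and> wp augment_body s' 3 W (\<lambda>s'. \<exists>k''\<le>k - 1. J k'' s')" using step[OF k''(2) b] k''(1) by simp
  qed blast
  then show ?thesis unfolding augment_def
  proof (rule wp_mono)
    fix s' assume "(\<exists>k'. \<exists>k''\<le>k'. J k'' s') \<and> \<not> bval (ILess (C 0) (V ''j0'')) s'"
    then obtain k where k: "J k s'" "arr s' ''j0'' 0 \<le> 0" by auto
    then have kl: "k < length xs" and z: "xs ! k \<le> 0" using augment_invarD(1) by (auto simp: J_def)
    \<comment> \<open>Columns are nonnegative, so the loop ends at the dummy, and distinctness puts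
      the dummy at position 0.\<close>
    then have "xs ! k = xs ! 0" using rng[OF kl] xs(3) by simp
    then have "k = 0" using xs(2,4) kl by (simp add: nth_eq_iff_index_eq)
    then have "augment_invar (int n) X i p (rarr s ''u'') (rarr s ''v'') xs 0 (arr s' ''p'')"
      using k by (simp add: J_def)
    then show "?Q s'"
      by (rule augment_invar_final[OF _ xs(3)])
  qed (use len in simp)
qed

lemma iwrites_hungarian: "iwrites (Seq search augment) = {''p'', ''j0'', ''used'', ''go'', ''j'', ''way'', ''j1'', ''i0''}"
  "rwrites (Seq search augment) = {''minv'', ''delta'', ''u'', ''v'', ''cur''}"
  by (auto simp: hungarian_code)

text \<open>Each of the n insertions reaches at most n further columns, and each of these costs
  three linear scans: selecting, updating the potentials and relaxing.\<close>

lemma wp_hungarian: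
  assumes N: "arr s ''n'' 0 = int n" and W: "n + 1 \<le> W" and p: "arr s ''p'' = (\<lambda>_. 0)"
    and f: "dual_feasible (int n) (costm s) (rarr s ''u'') (rarr s ''v'')"
  shows "wp hungarian s (n * (9 * n + 10 + n * (16 * n + 18)) + 2) W (\<lambda>s'. \<exists>u v.
    tight_matching (int n) (costm s) (int n + 1) (arr s' ''p'') u v \<and> dual_feasible (int n) (costm s) u v)" (is "wp _ _ _ _ ?Q")
proof -
  have ni: "''i'' \<notin> iwrites (Seq search augment)" unfolding iwrites_hungarian by simp
  show ?thesis unfolding hungarian_def
  proof (rule wp_For[where l = 1 and h = "int n + 1" and B = "9 * n + 8 + n * (16 * n + 18)" and
      I = "\<lambda>i s'. tight_matching (int n) (costm s) i (arr s' ''p'') (rarr s' ''u'') (rarr s' ''v'') \<and>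
        dual_feasible (int n) (costm s) (rarr s' ''u'') (rarr s' ''v'')"])
    fix s' assume "frame (insert ''i'' (iwrites (Seq search augment))) (rwrites (Seq search augment)) s s'"
    then have fr: "frame {''i'', ''p'', ''j0'', ''used'', ''go'', ''j'', ''way'', ''j1'', ''i0''} {''minv'', ''delta'', ''u'', ''v'', ''cur''} s s'"
      unfolding iwrites_hungarian .
    have e: "arr s' ''n'' 0 = int n" "costm s' = costm s" using N by (simp_all add: frame_arr[OF fr] frame_costm[OF fr])
    show "ival N1 s' = int n + 1" using e by simp
    { fix i assume i: "1 \<le> i" "i < int n + 1" and inv: "tight_matching (int n) (costm s) i (arr s' ''p'') (rarr s' ''u'') (rarr s' ''v'') \<and>
        dual_feasible (int n) (costm s) (rarr s' ''u'') (rarr s' ''v'')" and ii: "arr s' ''i'' 0 = i"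
      have i': "i \<le> int n" using i by simp
      show "wp (Seq search augment) s' (9 * n + 8 + n * (16 * n + 18)) W
        (\<lambda>s''. tight_matching (int n) (costm s) (i + 1) (arr (write_int ''i'' (0, 0) (i + 1) s'') ''p'')
          (rarr (write_int ''i'' (0, 0) (i + 1) s'') ''u'') (rarr (write_int ''i'' (0, 0) (i + 1) s'') ''v'') \<and>
        dual_feasible (int n) (costm s) (rarr (write_int ''i'' (0, 0) (i + 1) s'') ''u'') (rarr (write_int ''i'' (0, 0) (i + 1) s'') ''v''))"
      proof (rule wp_Seq'[OF wp_search[OF e(1) W ii i(1) i'], where ?T2.0 = "4 * n + 1"])
        fix s1 assume "\<exists>xs. search_state n (costm s') i ((arr s' ''p'')(0 := i)) xs s1 \<and> arr s' ''p'' (last xs) = 0 \<and> last xs \<noteq> 0"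
        then obtain xs where xs: "search_state n (costm s) i ((arr s' ''p'')(0 := i)) xs s1" "arr s' ''p'' (last xs) = 0" "last xs \<noteq> 0"
          using e by auto
        have df: "dual_feasible (int n) (costm s) (rarr s1 ''u'') (rarr s1 ''v'')" using xs(1) by (simp add: search_state_def)
        show "wp augment s1 (4 * n + 1) W
          (\<lambda>s''. tight_matching (int n) (costm s) (i + 1) (arr (write_int ''i'' (0, 0) (i + 1) s'') ''p'')
            (rarr (write_int ''i'' (0, 0) (i + 1) s'') ''u'') (rarr (write_int ''i'' (0, 0) (i + 1) s'') ''v'') \<and>
          dual_feasible (int n) (costm s) (rarr (write_int ''i'' (0, 0) (i + 1) s'') ''u'') (rarr (write_int ''i'' (0, 0) (i + 1) s'') ''v''))"
        proof (rule wp_mono[OF wp_frame[OF wp_augment[OF xs(1) i(1) i' _ _ W]] order_refl])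
          fix s'' assume a: "tight_matching (int n) (costm s) (i + 1) (arr s'' ''p'') (rarr s1 ''u'') (rarr s1 ''v'') \<and>
              frame (iwrites augment) (rwrites augment) s1 s''"
          then have fr: "frame {''j1'', ''p'', ''j0''} {} s1 s''" by (simp add: augment_def augment_body_def insert_commute)
          show "tight_matching (int n) (costm s) (i + 1) (arr (write_int ''i'' (0, 0) (i + 1) s'') ''p'')
              (rarr (write_int ''i'' (0, 0) (i + 1) s'') ''u'') (rarr (write_int ''i'' (0, 0) (i + 1) s'') ''v'') \<and>
            dual_feasible (int n) (costm s) (rarr (write_int ''i'' (0, 0) (i + 1) s'') ''u'') (rarr (write_int ''i'' (0, 0) (i + 1) s'') ''v'')"
            using a df by (simp add: arr_write frame_rarr[OF fr])
        qed (use xs in auto)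
      qed (use inv e in auto)
    }
    { assume "tight_matching (int n) (costm s) (int n + 1) (arr s' ''p'') (rarr s' ''u'') (rarr s' ''v'') \<and>
        dual_feasible (int n) (costm s) (rarr s' ''u'') (rarr s' ''v'')"
      then show "?Q s'"
        by blast
    }
  next
    fix s' assume "s' = write_int ''i'' (0, 0) 1 s"
    then show "tight_matching (int n) (costm s) 1 (arr s' ''p'') (rarr s' ''u'') (rarr s' ''v'') \<and>
        dual_feasible (int n) (costm s) (rarr s' ''u'') (rarr s' ''v'')"
      using p f by (simp add: arr_write tight_matching_init)
  qed (use W ni in auto)
qed

section \<open>Patching cycles\<close>

text \<open>The labels are constant exactly on the cycles of \<open>p\<close>; the second half is expressed through
  the sets closed under \<open>p\<close>, so that no paths along cycles are needed.\<close>

definition closed_unions :: "int \<Rightarrow> (int \<Rightarrow> int) \<Rightarrow> (int \<Rightarrow> int) \<Rightarrow> bool" where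
  "closed_unions N p lab \<longleftrightarrow> (\<forall>S\<subseteq>{1..N}. p ` S \<subseteq> S \<longrightarrow> (\<forall>x\<in>S. \<forall>y\<in>{1..N}. lab y = lab x \<longrightarrow> y \<in> S))"

definition cycle_labels :: "int \<Rightarrow> (int \<Rightarrow> int) \<Rightarrow> (int \<Rightarrow> int) \<Rightarrow> bool" where
  "cycle_labels N p lab \<longleftrightarrow> (\<forall>x\<in>{1..N}. lab (p x) = lab x) \<and> closed_unions N p lab"

lemma closed_unionsD:
  "closed_unions N p lab \<Longrightarrow> S \<subseteq> {1..N} \<Longrightarrow> p ` S \<subseteq> S \<Longrightarrow> x \<in> S \<Longrightarrow> y \<in> {1..N} \<Longrightarrow> lab y = lab x \<Longrightarrow> y \<in> S"
  unfolding closed_unions_def by blast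

text \<open>By finiteness \<open>p\<close> maps \<open>S\<close> onto \<open>S\<close>, and being
  injective it cannot enter \<open>S\<close> from outside.\<close>

lemma closed_iff:
  assumes p: "bij_betw p {1..N::int} {1..N}" and S: "S \<subseteq> {1..N}" "p ` S \<subseteq> S" and x: "x \<in> {1..N}"
  shows "p x \<in> S \<longleftrightarrow> x \<in> S"
proof
  assume "p x \<in> S"
  have inj: "inj_on p {1..N}" using p by (simp add: bij_betw_def)
  have "p ` S = S"
    using S finite_subset[OF S(1)] inj_on_subset[OF inj S(1)] by (intro endo_inj_surj) auto
  then obtain y where "y \<in> S" "p y = p x" using \<open>p x \<in> S\<close> by (metis imageE)
  then show "x \<in> S" using inj x S(1) by (metis inj_onD subsetD)
qed (use S in blast)

text \<open>A closed set contains both \<open>x\<close> and \<open>p x\<close> or neither, so their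
  classes lie in the same closed sets and may be merged.\<close>

lemma closed_unions_merge:
  assumes p: "bij_betw p {1..N} {1..N}" and l: "closed_unions N p lab" and x: "x \<in> {1..N}"
    and lab': "\<And>y. y \<in> {1..N} \<Longrightarrow> lab' y = (if lab y = lab (p x) then lab x else lab y)"
  shows "closed_unions N p lab'"
  unfolding closed_unions_def
proof (intro allI impI ballI)
  fix S z y assume S: "S \<subseteq> {1..N}" "p ` S \<subseteq> S" and z: "z \<in> S" and y: "y \<in> {1..N}" and eq: "lab' y = lab' z"
  have zN: "z \<in> {1..N}" and pxN: "p x \<in> {1..N}" using z S x bij_betwE[OF p] by blast+
  note step = closed_unionsD[OF l S]
  have px: "p x \<in> S \<longleftrightarrow> x \<in> S" by (rule closed_iff[OF p S x])
  consider "lab y = lab z" | "lab y = lab (p x)" "lab z = lab x" | "lab z = lab (p x)" "lab y = lab x"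
    using eq lab'[OF y] lab'[OF zN] by (auto split: if_splits)
  then show "y \<in> S"
  proof cases
    case 1
    then show ?thesis using step[OF z y] by simp
  next
    case 2
    then have "x \<in> S" using step[OF z x] by simp
    then show ?thesis using step[OF _ y, of "p x"] px 2 by simp
  next
    case 3
    then have "p x \<in> S" using step[OF z pxN] by simp
    then show ?thesis using step[OF _ y, of x] px 3 by simp
  qed
qed

text \<open>Exchanging the values of \<open>p\<close> at points of two cycles splices the cycles
  into one. Conversely, a set closed under the new map contains both points or neither, is then
  closed under \<open>p\<close> as well, and so is a union of the merged classes.\<close>

lemma cycle_labels_patch:
  assumes p: "bij_betw p {1..N} {1..N}" and l: "cycle_labels N p lab"
    and x: "x \<in> {1..N}" and y: "y \<in> {1..N}" and ne: "lab x \<noteq> lab y"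
    and lab': "\<And>z. z \<in> {1..N} \<Longrightarrow> lab' z = (if lab z = lab y then lab x else lab z)"
  defines "p' \<equiv> p(x := p y, y := p x)"
  shows "bij_betw p' {1..N} {1..N}" "cycle_labels N p' lab'"
proof -
  have xy: "x \<noteq> y" using ne by auto
  have inj: "inj_on p {1..N}" and im: "p ` {1..N} = {1..N}" using p by (auto simp: bij_betw_def)
  have pN: "p z \<in> {1..N}" if "z \<in> {1..N}" for z using im that by blast
  have const: "lab (p z) = lab z" if "z \<in> {1..N}" for z using l that by (simp add: cycle_labels_def)
  have cl: "closed_unions N p lab" using l by (simp add: cycle_labels_def)
  have "p' = p \<circ> Transposition.transpose x y"
    by (auto simp: p'_def fun_eq_iff Transposition.transpose_def)
  moreover have "bij_betw (Transposition.transpose x y) {1..N} {1..N}"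
    using x y by (intro permutes_imp_bij permutes_swap_id)
  ultimately show p': "bij_betw p' {1..N} {1..N}" using bij_betw_trans[OF _ p] by metis
  have p'N: "p' z \<in> {1..N}" if "z \<in> {1..N}" for z using bij_betwE[OF p'] that by blast
  have "lab' (p' z) = lab' z" if z: "z \<in> {1..N}" for z
    using lab'[OF p'N[OF z]] lab'[OF z] const[OF x] const[OF y] const[OF z] by (auto simp: p'_def)
  moreover have "closed_unions N p' lab'" unfolding closed_unions_def
  proof (intro allI impI ballI)
    fix S z w assume S: "S \<subseteq> {1..N}" "p' ` S \<subseteq> S" and z: "z \<in> S" and w: "w \<in> {1..N}" and eq: "lab' w = lab' z"
    have zN: "z \<in> {1..N}" using z S by blast
    text \<open>If \<open>S\<close> contained only one of \<open>x\<close> and \<open>y\<close>, removing the \<open>p\<close>-cycle of that vertex would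
      leave a \<open>p\<close>-closed set that meets, hence contains, the cycle of the other one.\<close>
    have half: "b \<in> S" if ab: "a \<in> S" "{a, b} = {x, y}" for a b
    proof -
      have aN: "a \<in> {1..N}" and bN: "b \<in> {1..N}" and lne: "lab a \<noteq> lab b" and p'a: "p' a = p b"
        using ab x y ne xy by (auto simp: doubleton_eq_iff p'_def)
      define T where "T = {t \<in> S. lab t \<noteq> lab a}"
      have "b \<in> T" if bT: "p b \<in> T"
      proof (rule closed_unionsD[OF cl _ _ bT bN])
        show "T \<subseteq> {1..N}" using S by (auto simp: T_def)
        show "lab b = lab (p b)" using const[OF bN] by simp
        show "p ` T \<subseteq> T"
        proof
          fix t' assume "t' \<in> p ` T"
          then obtain t where t: "t \<in> S" "lab t \<noteq> lab a" "t' = p t" by (auto simp: T_def)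
          have tN: "t \<in> {1..N}" using t S by blast
          have "p t \<in> S"
          proof (cases "t = b")
            case True
            then show ?thesis using p'a ab S by (metis image_subset_iff)
          next
            case False
            then have "p t = p' t" using t(2) ab by (auto simp: p'_def doubleton_eq_iff)
            then show ?thesis using S(2) t(1) by auto
          qed
          then show "t' \<in> T" using t const[OF tN] by (simp add: T_def)
        qed
      qed
      moreover have "p b \<in> T" using p'a ab(1) S(2) const[OF bN] lne by (auto simp: T_def image_subset_iff)
      ultimately show "b \<in> S" by (simp add: T_def)
    qed
    then have both: "x \<in> S \<longleftrightarrow> y \<in> S" by (metis insert_commute)
    have clp: "p ` S \<subseteq> S"
    proof
      fix t' assume "t' \<in> p ` S"
      then obtain t where t: "t \<in> S" "t' = p t" by blast
      have "p x = p' y" "p y = p' x" "t \<noteq> x \<Longrightarrow> t \<noteq> y \<Longrightarrow> p t = p' t" using xy by (auto simp: p'_def)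
      then show "t' \<in> S" using t both S(2) by (metis image_subset_iff)
    qed
    note step = closed_unionsD[OF cl S(1) clp]
    consider "lab w = lab z" | "lab w = lab y" "lab z = lab x" | "lab z = lab y" "lab w = lab x"
      using eq lab'[OF w] lab'[OF zN] by (auto split: if_splits)
    then show "w \<in> S"
    proof cases
      case 1
      then show ?thesis using step[OF z w] by simp
    next
      case 2
      then have "x \<in> S" using step[OF z x] by simp
      then show ?thesis using step[OF _ w, of y] both 2 by simp
    next
      case 3
      then have "y \<in> S" using step[OF z y] by simp
      then show ?thesis using step[OF _ w, of x] both 3 by simp
    qed
  qed
  ultimately show "cycle_labels N p' lab'" by (simp add: cycle_labels_def)
qed

text \<open>A join exchanges the values at a column \<open>w\<close> and a column \<open>k\<close>
  of a large class \<open>c\<close>, and its new arcs are those from \<open>p w\<close> to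
  \<open>k\<close> and from \<open>p k\<close> to \<open>w\<close>; \<open>r\<close> stands for
  \<open>p w\<close>. The set \<open>D\<close> stands for columns changed by earlier joins, two for
  each join. Allowing every such \<open>D\<close> makes the property independent of what the program
  has done.\<close>

definition cheap_joins :: "int \<Rightarrow> (int \<Rightarrow> int \<Rightarrow> real) \<Rightarrow> (int \<Rightarrow> int) \<Rightarrow> (int \<Rightarrow> int) \<Rightarrow> real \<Rightarrow> real \<Rightarrow> bool" where
  "cheap_joins N X p lab K g \<longleftrightarrow> real (card (lab ` {1..N})) \<le> K \<and>
    (\<forall>c. \<forall>r\<in>{1..N}. \<forall>w\<in>{1..N}. \<forall>D. D \<subseteq> {y\<in>{1..N}. lab y = c} \<longrightarrow> real (card D) \<le> 2 * K \<longrightarrow>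
      real_of_int N \<le> K * real (card {y\<in>{1..N}. lab y = c}) \<longrightarrow> lab r \<noteq> c \<longrightarrow> lab w \<noteq> c \<longrightarrow>
      (\<exists>k\<in>{y\<in>{1..N}. lab y = c} - D. X r k \<le> g \<and> X (p k) w \<le> g))"

text \<open>The labels only become coarser, so a large initial cycle stays inside one current cycle.
  The cost bound is conditional and quantified over \<open>K\<close> and \<open>g\<close>, because
  the program does not know whether cheap joins exist; it charges \<open>2 * g\<close> for every
  cycle that has disappeared.\<close>

definition patch_invar ::
  "int \<Rightarrow> (int \<Rightarrow> int \<Rightarrow> real) \<Rightarrow> (int \<Rightarrow> int) \<Rightarrow> (int \<Rightarrow> int) \<Rightarrow> (int \<Rightarrow> int) \<Rightarrow> (int \<Rightarrow> int) \<Rightarrow> bool" where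
  "patch_invar N X p0 lab0 p lab \<longleftrightarrow>
    bij_betw p {1..N} {1..N} \<and> cycle_labels N p lab \<and> (\<forall>x\<in>{1..N}. lab x \<in> {1..N}) \<and>
    (\<forall>x\<in>{1..N}. \<forall>y\<in>{1..N}. lab0 x = lab0 y \<longrightarrow> lab x = lab y) \<and>
    (\<forall>K g. cheap_joins N X p0 lab0 K g \<longrightarrow>
      (\<Sum>j\<in>{1..N}. X (p j) j) \<le> (\<Sum>j\<in>{1..N}. X (p0 j) j) +
        2 * g * (real (card (lab0 ` {1..N})) - real (card (lab ` {1..N}))) \<and>
      real (card {k\<in>{1..N}. p k \<noteq> p0 k}) \<le> 2 * (real (card (lab0 ` {1..N})) - real (card (lab ` {1..N}))))"

lemma patch_invar_init:
  assumes "bij_betw p {1..N} {1..N}" "cycle_labels N p lab" "\<forall>x\<in>{1..N}. lab x \<in> {1..N}"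
  shows "patch_invar N X p lab p lab"
  using assms by (simp add: patch_invar_def)

text \<open>The sizes of the fibres add up to the size of \<open>A\<close>, so not all of them are
  below the average. The inequality is multiplied out to stay in the natural numbers.\<close>

lemma large_fibre_exists:
  assumes "finite A" "A \<noteq> {}"
  shows "\<exists>c\<in>f ` A. card A \<le> card (f ` A) * card {y \<in> A. f y = c}"
proof (rule ccontr)
  assume "\<not> ?thesis"
  then have less: "card (f ` A) * card {y \<in> A. f y = c} < card A" if "c \<in> f ` A" for c using that by auto
  have "card A = (\<Sum>c\<in>f ` A. card {y \<in> A. f y = c})"
    using sum.image_gen[OF assms(1), of "\<lambda>_. 1 :: nat" f] by simp
  then have "card (f ` A) * card A = (\<Sum>c\<in>f ` A. card (f ` A) * card {y \<in> A. f y = c})"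
    by (simp add: sum_distrib_left)
  also have "\<dots> < (\<Sum>c\<in>f ` A. card A)" using less assms by (intro sum_strict_mono) auto
  finally show False by simp
qed

text \<open>The program takes the globally cheapest exchange, so it need not know which cycle is
  large: it is enough that one exchange is cheap. That exchange joins the current cycle containing a
  large initial cycle with some other cycle, through a column whose row is still the initial
  one.\<close>

lemma patch_invar_step:
  assumes inv: "patch_invar N X p0 lab0 p lab" and x: "x \<in> {1..N}" and y: "y \<in> {1..N}" and ne: "lab x \<noteq> lab y"
    and nonneg: "\<And>i j. i \<in> {1..N} \<Longrightarrow> j \<in> {1..N} \<Longrightarrow> 0 \<le> X i j"
    and best: "\<And>x' y'. x' \<in> {1..N} \<Longrightarrow> y' \<in> {1..N} \<Longrightarrow> lab x' \<noteq> lab y' \<Longrightarrow>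
      X (p y) x + X (p x) y \<le> X (p y') x' + X (p x') y'"
    and lab': "\<And>z. z \<in> {1..N} \<Longrightarrow> lab' z = (if lab z = lab y then lab x else lab z)"
  defines "p' \<equiv> p(x := p y, y := p x)"
  shows "patch_invar N X p0 lab0 p' lab'" "card (lab' ` {1..N}) + 1 = card (lab ` {1..N})"
proof -
  let ?V = "{1..N}"
  define L0 L L' where "L0 = real (card (lab0 ` ?V))" and "L = real (card (lab ` ?V))" and "L' = real (card (lab' ` ?V))"
  have p: "bij_betw p ?V ?V" and l: "cycle_labels N p lab" and lr: "\<And>z. z \<in> ?V \<Longrightarrow> lab z \<in> ?V"
    and coarse: "\<And>z w. z \<in> ?V \<Longrightarrow> w \<in> ?V \<Longrightarrow> lab0 z = lab0 w \<Longrightarrow> lab z = lab w"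
    using inv unfolding patch_invar_def by blast+
  have bound: "(\<Sum>j\<in>?V. X (p j) j) \<le> (\<Sum>j\<in>?V. X (p0 j) j) + 2 * g * (L0 - L)"
    "real (card {k\<in>?V. p k \<noteq> p0 k}) \<le> 2 * (L0 - L)" if "cheap_joins N X p0 lab0 K g" for K g
    using inv that unfolding patch_invar_def L0_def L_def by blast+
  have pN: "p z \<in> ?V" if "z \<in> ?V" for z using bij_betwE[OF p] that by blast
  have xy: "x \<noteq> y" using ne by auto
  note cl = cycle_labels_patch[OF p l x y ne lab', folded p'_def]
  have im: "lab' ` ?V = lab ` ?V - {lab y}"
  proof
    show "lab' ` ?V \<subseteq> lab ` ?V - {lab y}" using lab' x ne by auto
    show "lab ` ?V - {lab y} \<subseteq> lab' ` ?V"
    proof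
      fix c assume "c \<in> lab ` ?V - {lab y}"
      then obtain z where "z \<in> ?V" "c = lab z" "lab z \<noteq> lab y" by auto
      then show "c \<in> lab' ` ?V" using lab'[of z] by (intro image_eqI[of _ _ z]) auto
    qed
  qed
  have "lab y \<in> lab ` ?V" using y by blast
  then show cardL: "card (lab' ` ?V) + 1 = card (lab ` ?V)"
    unfolding im using card_Suc_Diff1[of "lab ` ?V" "lab y"] by simp
  then have L': "L' = L - 1" by (simp add: L'_def L_def)
  \<comment> \<open>The two removed arcs have nonnegative cost, so the increase is at most the cost
    of the two new arcs.\<close>
  have swap: "(\<Sum>j\<in>?V. X (p' j) j) = (\<Sum>j\<in>?V. X (p j) j) - X (p x) x - X (p y) y + (X (p y) x + X (p x) y)"
  proof -
    have split: "(\<Sum>j\<in>?V. X (f j) j) = X (f x) x + X (f y) y + (\<Sum>j\<in>?V - {x, y}. X (f j) j)" for f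
    proof -
      have "(\<Sum>j\<in>?V. X (f j) j) = (\<Sum>j\<in>{x, y}. X (f j) j) + (\<Sum>j\<in>?V - {x, y}. X (f j) j)"
        using x y by (subst sum.subset_diff[of "{x, y}"]) auto
      then show ?thesis using xy by simp
    qed
    have "(\<Sum>j\<in>?V - {x, y}. X (p' j) j) = (\<Sum>j\<in>?V - {x, y}. X (p j) j)"
      by (intro sum.cong) (auto simp: p'_def)
    then show ?thesis unfolding split[of p'] split[of p] using xy by (simp add: p'_def)
  qed
  have "(\<Sum>j\<in>?V. X (p' j) j) \<le> (\<Sum>j\<in>?V. X (p0 j) j) + 2 * g * (L0 - L') \<and>
      real (card {k\<in>?V. p' k \<noteq> p0 k}) \<le> 2 * (L0 - L')" if cj: "cheap_joins N X p0 lab0 K g" for K g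
  proof
    obtain c where c: "c \<in> lab0 ` ?V" "card ?V \<le> card (lab0 ` ?V) * card {y \<in> ?V. lab0 y = c}"
      using large_fibre_exists[of ?V lab0] x by (metis empty_iff finite_atLeastAtMost_int)
    have L0K: "L0 \<le> K" using cj by (simp add: cheap_joins_def L0_def)
    let ?C = "{y \<in> ?V. lab0 y = c}"
    have "real_of_int N = real (card ?V)" using x by simp
    also have "\<dots> \<le> L0 * real (card ?C)" using c(2) unfolding L0_def of_nat_mult[symmetric] by (simp only: of_nat_le_iff)
    also have "\<dots> \<le> K * real (card ?C)" using L0K by (intro mult_right_mono) auto
    finally have big: "real_of_int N \<le> K * real (card ?C)" .
    obtain z0 where z0: "z0 \<in> ?V" "lab0 z0 = c" using c(1) by auto
    have Cd: "lab z = lab z0" if "z \<in> ?V" "lab0 z = c" for z using coarse[OF that(1) z0(1)] that z0 by simp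
    \<comment> \<open>\<open>x\<close> and \<open>y\<close> have different labels, so at least one
      of them lies outside the current cycle containing the class \<open>c\<close>.\<close>
    obtain w where w: "w \<in> ?V" "lab w \<noteq> lab z0" using x y ne by metis
    have pw: "p w \<in> ?V" "lab (p w) \<noteq> lab z0" using w l pN by (auto simp: cycle_labels_def)
    have wc: "lab0 w \<noteq> c" "lab0 (p w) \<noteq> c" using Cd w pw by auto
    \<comment> \<open>\<open>cheap_joins\<close> speaks about the initial \<open>p0\<close>, so the
      columns where \<open>p\<close> already differs from it are forbidden.\<close>
    define D where "D = {k \<in> ?C. p k \<noteq> p0 k}"
    have "card D \<le> card {k\<in>?V. p k \<noteq> p0 k}"
      by (rule card_mono[OF finite_subset[of _ ?V]]) (auto simp: D_def)
    then have "real (card D) \<le> 2 * (L0 - L)" using bound(2)[OF cj] by linarith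
    then have D: "D \<subseteq> ?C" "real (card D) \<le> 2 * K" using L0K by (auto simp: D_def L_def)
    obtain k where k: "k \<in> ?C - D" "X (p w) k \<le> g" "X (p0 k) w \<le> g"
      using cj D big wc w(1) pw(1) unfolding cheap_joins_def by blast
    have kV: "k \<in> ?V" "p k = p0 k" "lab k = lab z0" using k(1) Cd by (auto simp: D_def)
    have "X (p y) x + X (p x) y \<le> X (p k) w + X (p w) k" using kV w by (intro best) auto
    then have "X (p y) x + X (p x) y \<le> 2 * g" using k kV by simp
    then have "(\<Sum>j\<in>?V. X (p' j) j) \<le> (\<Sum>j\<in>?V. X (p j) j) + 2 * g"
      unfolding swap using nonneg[OF pN[OF x] x] nonneg[OF pN[OF y] y] by linarith
    also have "\<dots> \<le> (\<Sum>j\<in>?V. X (p0 j) j) + 2 * g * (L0 - L')"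
      using bound(1)[OF cj] by (simp add: L' algebra_simps)
    finally show "(\<Sum>j\<in>?V. X (p' j) j) \<le> (\<Sum>j\<in>?V. X (p0 j) j) + 2 * g * (L0 - L')" .
    have "{k\<in>?V. p' k \<noteq> p0 k} \<subseteq> {k\<in>?V. p k \<noteq> p0 k} \<union> {x, y}" by (auto simp: p'_def split: if_splits)
    moreover have "finite {k\<in>?V. p k \<noteq> p0 k}" by (rule finite_subset[of _ ?V]) auto
    ultimately have "card {k\<in>?V. p' k \<noteq> p0 k} \<le> card ({k\<in>?V. p k \<noteq> p0 k} \<union> {x, y})"
      by (intro card_mono finite_UnI) auto
    also have "\<dots> \<le> card {k\<in>?V. p k \<noteq> p0 k} + 2"
      by (rule order_trans[OF card_Un_le]) (simp add: card_insert_if)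
    finally show "real (card {k\<in>?V. p' k \<noteq> p0 k}) \<le> 2 * (L0 - L')" using bound(2)[OF cj] by (simp add: L')
  qed
  moreover have "lab' z \<in> ?V" if "z \<in> ?V" for z using lab'[OF that] lr[OF that] lr[OF x] by auto
  moreover have "lab' z = lab' w" if "z \<in> ?V" "w \<in> ?V" "lab0 z = lab0 w" for z w
    using lab' that coarse[OF that] by simp
  ultimately show "patch_invar N X p0 lab0 p' lab'"
    using cl unfolding patch_invar_def L0_def L'_def by blast
qed

section \<open>The patching program\<close>

definition merge :: com where
  "merge = For ''y'' (C 1) N1 (Cond (IEq (At ''lab'' (V ''y'')) (V ''b'')) (SetAt ''lab'' (V ''y'') (V ''a'')) Skip)"

text \<open>A naive union-find that unites each vertex with its image, in linear time for each
  union. Both labels are copied first because \<open>merge\<close> overwrites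
  \<open>lab\<close>.\<close>

definition label_body :: com where
  "label_body = Seq (Seq (Set ''a'' (At ''lab'' (V ''x''))) (Set ''b'' (At ''lab'' (At ''p'' (V ''x''))))) merge"

definition label :: com where
  "label = Seq (For ''x'' (C 1) N1 (SetAt ''lab'' (V ''x'') (V ''x''))) (For ''x'' (C 1) N1 label_body)"

definition find_body :: com where
  "find_body = Cond (BNot (IEq (At ''lab'' (V ''x'')) (At ''lab'' (V ''y''))))
     (Seq (RSet ''cur'' (RPlus (RRead ''X'' (At ''p'' (V ''y'')) (V ''x'')) (RRead ''X'' (At ''p'' (V ''x'')) (V ''y''))))
       (Cond (BOr (IEq (V ''bx'') (C 0)) (RLess (RV ''cur'') (RV ''best'')))
         (Seq (RSet ''best'' (RV ''cur'')) (Seq (Set ''bx'' (V ''x'')) (Set ''by'' (V ''y'')))) Skip)) Skip"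

text \<open>A full quadratic search in each of the n rounds, which is still cubic in total. Vertices
  start at 1, so \<open>bx = 0\<close> means that no pair was found.\<close>

definition find :: com where
  "find = Seq (Set ''bx'' (C 0)) (For ''x'' (C 1) N1 (For ''y'' (C 1) N1 find_body))"

definition swap :: com where
  "swap = Seq (Set ''tmp'' (At ''p'' (V ''bx''))) (Seq (SetAt ''p'' (V ''bx'') (At ''p'' (V ''by'')))
     (Seq (SetAt ''p'' (V ''by'') (V ''tmp'')) (Seq (Set ''a'' (At ''lab'' (V ''bx''))) (Set ''b'' (At ''lab'' (V ''by''))))))"

definition join :: com where
  "join = Cond (IEq (V ''bx'') (C 0)) Skip (Seq swap merge)"

text \<open>There are at most n cycles and each effective round removes one; once a single cycle is
  left, the remaining rounds do nothing.\<close>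

definition patch :: com where
  "patch = For ''t'' (C 1) N1 (Seq find join)"

text \<open>\<open>p\<close> is the predecessor map, so following it from vertex 1 lists the tour
  backwards and the positions are filled from n down to 1.\<close>

definition emit_body :: com where
  "emit_body = Seq (SetAt ''tour'' (IMinus N1 (V ''t'')) (V ''c'')) (Set ''c'' (At ''p'' (V ''c'')))"

definition emit :: com where
  "emit = Seq (Set ''c'' (C 1)) (For ''t'' (C 1) N1 emit_body)"

definition atsp_program :: com where
  "atsp_program = Seq hungarian (Seq label (Seq patch emit))"

section \<open>Correctness and running time of the patching program\<close>

lemma wp_merge:
  assumes N: "arr s ''n'' 0 = int n" and W: "n + 1 \<le> W" and ab: "arr s ''a'' 0 = a" "arr s ''b'' 0 = b" "a \<in> {1..int n}"
  shows "wp merge s (4 * n + 2) W (\<lambda>s'. \<forall>y\<in>{1..int n}. arr s' ''lab'' y = (if arr s ''lab'' y = b then a else arr s ''lab'' y))" (is "wp _ _ _ _ ?Q")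
  unfolding merge_def
proof (rule wp_For[where l = 1 and h = "int n + 1" and B = 2 and
    I = "\<lambda>k s'. \<forall>y\<in>{1..int n}. arr s' ''lab'' y = (if y < k \<and> arr s ''lab'' y = b then a else arr s ''lab'' y)"])
  let ?B = "Cond (IEq (At ''lab'' (V ''y'')) (V ''b'')) (SetAt ''lab'' (V ''y'') (V ''a'')) Skip"
  fix s' assume "frame (insert ''y'' (iwrites ?B)) (rwrites ?B) s s'"
  then have f: "frame {''y'', ''lab''} {} s s'" by simp
  have e: "arr s' ''n'' 0 = int n" "arr s' ''a'' 0 = a" "arr s' ''b'' 0 = b" using N ab by (simp_all add: frame_arr[OF f])
  show "ival N1 s' = int n + 1" using e by simp
  { fix k assume k: "1 \<le> k" "k < int n + 1" "arr s' ''y'' 0 = k"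
      and I: "\<forall>y\<in>{1..int n}. arr s' ''lab'' y = (if y < k \<and> arr s ''lab'' y = b then a else arr s ''lab'' y)"
    have kn: "k \<in> {1..int n}" using k by simp
    have lk: "arr s' ''lab'' k = arr s ''lab'' k" using bspec[OF I kn] by simp
    show "wp ?B s' 2 W (\<lambda>s''. \<forall>y\<in>{1..int n}. arr (write_int ''y'' (0, 0) (k + 1) s'') ''lab'' y =
        (if y < k + 1 \<and> arr s ''lab'' y = b then a else arr s ''lab'' y))"
    proof (cases "arr s ''lab'' k = b")
      case True
      then show ?thesis using k(3) lk e ab(3) W I by (intro wp_straight) (auto simp: arr_write)
    next
      case False
      have "\<forall>y\<in>{1..int n}. arr s' ''lab'' y = (if y < k + 1 \<and> arr s ''lab'' y = b then a else arr s ''lab'' y)"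
      proof
        fix y assume "y \<in> {1..int n}"
        moreover have "y < k + 1 \<longleftrightarrow> y < k \<or> y = k" by auto
        ultimately show "arr s' ''lab'' y = (if y < k + 1 \<and> arr s ''lab'' y = b then a else arr s ''lab'' y)"
          using I False by auto
      qed
      then show ?thesis using k(3) lk e False by (intro wp_straight) (auto simp: arr_write)
    qed
  }
  { assume "\<forall>y\<in>{1..int n}. arr s' ''lab'' y = (if y < int n + 1 \<and> arr s ''lab'' y = b then a else arr s ''lab'' y)"
    then show "?Q s'" by simp
  }
next
  fix s' assume "s' = write_int ''y'' (0, 0) 1 s"
  then show "\<forall>y\<in>{1..int n}. arr s' ''lab'' y = (if y < 1 \<and> arr s ''lab'' y = b then a else arr s ''lab'' y)"
    by (simp add: arr_write)
qed (use W in auto)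

lemma frame_merge: "iwrites merge = {''y'', ''lab''}" "rwrites merge = {}"
  by (auto simp: merge_def)

lemma wp_label:
  assumes N: "arr s ''n'' 0 = int n" and W: "n + 1 \<le> W" and p: "bij_betw (arr s ''p'') {1..int n} {1..int n}"
  shows "wp label s (n * (4 * n + 9) + 4) W (\<lambda>s'. cycle_labels (int n) (arr s ''p'') (arr s' ''lab'') \<and>
    (\<forall>x\<in>{1..int n}. arr s' ''lab'' x \<in> {1..int n}))"
  unfolding label_def
proof (rule wp_Seq'[where ?T1.0 = "3 * n + 2" and ?T2.0 = "n * (4 * n + 6) + 2"
    and R = "\<lambda>s'. \<forall>x\<in>{1..int n}. arr s' ''lab'' x = x"])
  show "wp (For ''x'' (C 1) N1 (SetAt ''lab'' (V ''x'') (V ''x''))) s (3 * n + 2) W (\<lambda>s'. \<forall>x\<in>{1..int n}. arr s' ''lab'' x = x)"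
  proof (rule wp_For[where l = 1 and h = "int n + 1" and B = 1 and I = "\<lambda>k s'. \<forall>x\<in>{1..<k}. arr s' ''lab'' x = x"])
    fix s' assume "frame (insert ''x'' (iwrites (SetAt ''lab'' (V ''x'') (V ''x'')))) (rwrites (SetAt ''lab'' (V ''x'') (V ''x''))) s s'"
    then have f: "frame {''x'', ''lab''} {} s s'" by simp
    show "ival N1 s' = int n + 1" using N by (simp add: frame_arr[OF f])
    { fix k assume k: "1 \<le> k" "k < int n + 1" "\<forall>x\<in>{1..<k}. arr s' ''lab'' x = x" "arr s' ''x'' 0 = k"
      then show "wp (SetAt ''lab'' (V ''x'') (V ''x'')) s' 1 W (\<lambda>s''. \<forall>x\<in>{1..<k + 1}. arr (write_int ''x'' (0, 0) (k + 1) s'') ''lab'' x = x)"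
        using W by (intro wp_straight) (auto simp: arr_write)
    }
    { assume "\<forall>x\<in>{1..<int n + 1}. arr s' ''lab'' x = x"
      then show "\<forall>x\<in>{1..int n}. arr s' ''lab'' x = x" by simp
    }
  qed (use W in auto)
next
  let ?p = "arr s ''p''"
  fix s1 assume s1: "\<forall>x\<in>{1..int n}. arr s1 ''lab'' x = x"
    and "frame (iwrites (For ''x'' (C 1) N1 (SetAt ''lab'' (V ''x'') (V ''x'')))) (rwrites (For ''x'' (C 1) N1 (SetAt ''lab'' (V ''x'') (V ''x'')))) s s1"
  then have f1: "frame {''x'', ''lab''} {} s s1" by simp
  have e1: "arr s1 ''n'' 0 = int n" "arr s1 ''p'' = ?p" using N by (simp_all add: frame_arr[OF f1])
  have pN: "?p x \<in> {1..int n}" if "x \<in> {1..int n}" for x using bij_betwE[OF p] that by blast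
  \<comment> \<open>All labels differ at the start, so \<open>closed_unions\<close> holds trivially.
    Constancy along \<open>p\<close> is built up vertex by vertex, and merging whole classes never
    destroys an equality of labels.\<close>
  define I where "I k s' \<longleftrightarrow> closed_unions (int n) ?p (arr s' ''lab'') \<and> (\<forall>x\<in>{1..<k}. arr s' ''lab'' (?p x) = arr s' ''lab'' x) \<and>
    (\<forall>x\<in>{1..int n}. arr s' ''lab'' x \<in> {1..int n})" for k s'
  show "wp (For ''x'' (C 1) N1 label_body) s1 (n * (4 * n + 6) + 2) W (\<lambda>s'. cycle_labels (int n) ?p (arr s' ''lab'') \<and>
    (\<forall>x\<in>{1..int n}. arr s' ''lab'' x \<in> {1..int n}))"
  proof (rule wp_For[where l = 1 and h = "int n + 1" and B = "4 * n + 4" and I = I])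
    fix s' assume "s' = write_int ''x'' (0, 0) 1 s1"
    then have "\<forall>x\<in>{1..int n}. arr s' ''lab'' x = x" using s1 by (simp add: arr_write)
    then show "I 1 s'" unfolding I_def closed_unions_def by (auto simp: subset_eq)
  next
    fix s' assume "frame (insert ''x'' (iwrites label_body)) (rwrites label_body) s1 s'"
    then have f: "frame {''x'', ''a'', ''b'', ''y'', ''lab''} {} s1 s'"
      by (simp add: label_body_def frame_merge insert_commute)
    have e: "arr s' ''n'' 0 = int n" "arr s' ''p'' = ?p" using e1 by (simp_all add: frame_arr[OF f])
    show "ival N1 s' = int n + 1" using e by simp
    { fix k assume k: "1 \<le> k" "k < int n + 1" and I: "I k s'" and x: "arr s' ''x'' 0 = k"
      let ?l = "arr s' ''lab''"
      have kN: "k \<in> {1..int n}" using k by simp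
      have I': "closed_unions (int n) ?p ?l" "\<And>x. x \<in> {1..<k} \<Longrightarrow> ?l (?p x) = ?l x" "\<And>x. x \<in> {1..int n} \<Longrightarrow> ?l x \<in> {1..int n}"
        using I unfolding I_def by blast+
      show "wp label_body s' (4 * n + 4) W (\<lambda>s''. I (k + 1) (write_int ''x'' (0, 0) (k + 1) s''))"
        unfolding label_body_def
      proof (rule wp_Seq'[where ?T1.0 = 2 and ?T2.0 = "4 * n + 2"
          and R = "\<lambda>s''. arr s'' ''a'' 0 = ?l k \<and> arr s'' ''b'' 0 = ?l (?p k)"])
        show "wp (Seq (Set ''a'' (At ''lab'' (V ''x''))) (Set ''b'' (At ''lab'' (At ''p'' (V ''x''))))) s' 2 W
            (\<lambda>s''. arr s'' ''a'' 0 = ?l k \<and> arr s'' ''b'' 0 = ?l (?p k))"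
          using x e I'(3)[OF kN] I'(3)[OF pN[OF kN]] W by (intro wp_straight) (auto simp: arr_write)
      next
        fix s2 assume s2: "arr s2 ''a'' 0 = ?l k \<and> arr s2 ''b'' 0 = ?l (?p k)"
          and "frame (iwrites (Seq (Set ''a'' (At ''lab'' (V ''x''))) (Set ''b'' (At ''lab'' (At ''p'' (V ''x'')))))) 
            (rwrites (Seq (Set ''a'' (At ''lab'' (V ''x''))) (Set ''b'' (At ''lab'' (At ''p'' (V ''x'')))))) s' s2"
        then have f2: "frame {''a'', ''b''} {} s' s2" by (simp add: insert_commute)
        have e2: "arr s2 ''n'' 0 = int n" "arr s2 ''lab'' = ?l" using e by (simp_all add: frame_arr[OF f2])
        show "wp merge s2 (4 * n + 2) W (\<lambda>s''. I (k + 1) (write_int ''x'' (0, 0) (k + 1) s''))"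
        proof (rule wp_mono[OF wp_merge[OF e2(1) W s2[THEN conjunct1] s2[THEN conjunct2] I'(3)[OF kN]] order_refl])
          fix s3 assume "\<forall>y\<in>{1..int n}. arr s3 ''lab'' y = (if arr s2 ''lab'' y = ?l (?p k) then ?l k else arr s2 ''lab'' y)"
          then have l3: "arr s3 ''lab'' y = (if ?l y = ?l (?p k) then ?l k else ?l y)" if "y \<in> {1..int n}" for y
            using e2 that by simp
          have "closed_unions (int n) ?p (arr s3 ''lab'')" by (rule closed_unions_merge[OF p I'(1) kN l3])
          moreover have "arr s3 ''lab'' (?p x) = arr s3 ''lab'' x" if "x \<in> {1..<k + 1}" for x
          proof -
            have xN: "x \<in> {1..int n}" and "x = k \<or> x \<in> {1..<k}" using that k by auto
            then show ?thesis using l3[OF xN] l3[OF pN[OF xN]] I'(2)[of x] by auto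
          qed
          moreover have "arr s3 ''lab'' x \<in> {1..int n}" if "x \<in> {1..int n}" for x
            using l3[OF that] I'(3)[OF that] I'(3)[OF kN] by simp
          ultimately show "I (k + 1) (write_int ''x'' (0, 0) (k + 1) s3)" unfolding I_def by (simp add: arr_write)
        qed
      qed simp
    }
    { assume "I (int n + 1) s'"
      then show "cycle_labels (int n) ?p (arr s' ''lab'') \<and> (\<forall>x\<in>{1..int n}. arr s' ''lab'' x \<in> {1..int n})"
        unfolding I_def cycle_labels_def by simp
    }
  qed (use W in \<open>auto simp: label_body_def frame_merge\<close>)
qed (simp add: algebra_simps)

text \<open>\<open>S\<close> is the set of pairs already examined, so one invariant serves the outer
  loop, with complete rows, and the inner loop, with one incomplete row.\<close>

definition find_invar :: "nat \<Rightarrow> state \<Rightarrow> (int \<times> int) set \<Rightarrow> state \<Rightarrow> bool" where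
  "find_invar n s S s' \<longleftrightarrow> (let val = (\<lambda>x y. costm s (arr s ''p'' y) x + costm s (arr s ''p'' x) y) in
    if arr s' ''bx'' 0 = 0 then \<forall>(x, y)\<in>S. arr s ''lab'' x = arr s ''lab'' y
    else arr s' ''bx'' 0 \<in> {1..int n} \<and> arr s' ''by'' 0 \<in> {1..int n} \<and>
      arr s ''lab'' (arr s' ''bx'' 0) \<noteq> arr s ''lab'' (arr s' ''by'' 0) \<and>
      rarr s' ''best'' 0 = val (arr s' ''bx'' 0) (arr s' ''by'' 0) \<and>
      (\<forall>(x, y)\<in>S. arr s ''lab'' x \<noteq> arr s ''lab'' y \<longrightarrow> rarr s' ''best'' 0 \<le> val x y))"

lemma find_invar_write: "a \<noteq> ''bx'' \<Longrightarrow> a \<noteq> ''by'' \<Longrightarrow> find_invar n s S (write_int a (0, 0) z s') = find_invar n s S s'"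
  by (simp add: find_invar_def arr_write)

lemma wp_find_body:
  assumes W: "n + 1 \<le> W" and I: "find_invar n s S s'" 
    and xy: "arr s' ''x'' 0 = x" "arr s' ''y'' 0 = y" "x \<in> {1..int n}" "y \<in> {1..int n}"
    and e: "arr s' ''p'' = arr s ''p''" "arr s' ''lab'' = arr s ''lab''" "costm s' = costm s"
  shows "wp find_body s' 6 W (find_invar n s (insert (x, y) S))"
proof (rule wp_straight)
  have X: "reals s' ''X'' (i, j) = costm s i j" for i j using e(3) by (simp add: costm_def fun_eq_iff)
  show "post find_body W s' (find_invar n s (insert (x, y) S))"
  proof (cases "arr s ''lab'' x = arr s ''lab'' y")
    case True
    then show ?thesis using I xy e by (auto simp: find_body_def find_invar_def Let_def split: if_splits)
  next
    case False
    note ne = this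
    show ?thesis
    proof (cases "arr s' ''bx'' 0 = 0 \<or> costm s (arr s ''p'' y) x + costm s (arr s ''p'' x) y < rarr s' ''best'' 0")
      case True
      then have "\<forall>(x', y')\<in>S. arr s ''lab'' x' \<noteq> arr s ''lab'' y' \<longrightarrow>
          costm s (arr s ''p'' y) x + costm s (arr s ''p'' x) y \<le> costm s (arr s ''p'' y') x' + costm s (arr s ''p'' x') y'"
        using I by (fastforce simp: find_invar_def Let_def split: if_splits)
      then show ?thesis using True ne xy e W X
        by (simp add: find_body_def find_invar_def Let_def arr_write)
    next
      case False
      then show ?thesis using I ne xy e X
        by (auto simp: find_body_def find_invar_def Let_def arr_write)
    qed
  qed
qed (simp add: find_body_def)

lemma frame_find: "iwrites find_body = {''bx'', ''by''}" "rwrites find_body = {''cur'', ''best''}"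
  by (auto simp: find_body_def)

lemma wp_find:
  assumes N: "arr s ''n'' 0 = int n" and W: "n + 1 \<le> W"
  shows "wp find s (n * (8 * n + 4) + 3) W (find_invar n s ({1..int n} \<times> {1..int n}))"
  unfolding find_def
proof (rule wp_Seq'[where ?T1.0 = 1 and ?T2.0 = "n * (8 * n + 4) + 2" and R = "\<lambda>s'. arr s' ''bx'' 0 = 0"])
  show "wp (Set ''bx'' (C 0)) s 1 W (\<lambda>s'. arr s' ''bx'' 0 = 0)"
    by (intro wp_straight) (simp_all add: arr_write)
next
  fix s1 assume s1: "arr s1 ''bx'' 0 = 0" and "frame (iwrites (Set ''bx'' (C 0))) (rwrites (Set ''bx'' (C 0))) s s1"
  then have f1: "frame {''bx''} {} s s1" by simp
  show "wp (For ''x'' (C 1) N1 (For ''y'' (C 1) N1 find_body)) s1 (n * (8 * n + 4) + 2) W (find_invar n s ({1..int n} \<times> {1..int n}))"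
  proof (rule wp_For[where l = 1 and h = "int n + 1" and B = "8 * n + 2" and I = "\<lambda>k. find_invar n s ({1..<k} \<times> {1..int n})"])
    fix s' assume "s' = write_int ''x'' (0, 0) 1 s1"
    then show "find_invar n s ({1..<1} \<times> {1..int n}) s'" using s1 by (simp add: find_invar_def arr_write)
  next
    fix s' assume "frame (insert ''x'' (iwrites (For ''y'' (C 1) N1 find_body))) (rwrites (For ''y'' (C 1) N1 find_body)) s1 s'"
    then have f2: "frame {''x'', ''y'', ''bx'', ''by''} {''cur'', ''best''} s1 s'" by (simp add: frame_find)
    have f: "frame {''x'', ''y'', ''bx'', ''by''} {''cur'', ''best''} s s'"
      by (rule frame_trans[OF frame_subset[OF f1] f2]) auto
    show "ival N1 s' = int n + 1" using N by (simp add: frame_arr[OF f])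
    { fix k assume k: "1 \<le> k" "k < int n + 1" and I: "find_invar n s ({1..<k} \<times> {1..int n}) s'" and x: "arr s' ''x'' 0 = k"
      show "wp (For ''y'' (C 1) N1 find_body) s' (8 * n + 2) W
        (\<lambda>s''. find_invar n s ({1..<k + 1} \<times> {1..int n}) (write_int ''x'' (0, 0) (k + 1) s''))"
      proof (rule wp_For[where l = 1 and h = "int n + 1" and B = 6 and I = "\<lambda>j. find_invar n s ({1..<k} \<times> {1..int n} \<union> {k} \<times> {1..<j})"])
        fix s'' assume "s'' = write_int ''y'' (0, 0) 1 s'"
        then show "find_invar n s ({1..<k} \<times> {1..int n} \<union> {k} \<times> {1..<1}) s''" using I by (simp add: find_invar_write)
      next
        fix s'' assume "frame (insert ''y'' (iwrites find_body)) (rwrites find_body) s' s''"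
        then have g2: "frame {''y'', ''bx'', ''by''} {''cur'', ''best''} s' s''" by (simp add: frame_find)
        have g: "frame {''x'', ''y'', ''bx'', ''by''} {''cur'', ''best''} s s''"
          by (rule frame_trans[OF f frame_subset[OF g2]]) auto
        show "ival N1 s'' = int n + 1" using N by (simp add: frame_arr[OF g])
        { fix j assume j: "1 \<le> j" "j < int n + 1" and I: "find_invar n s ({1..<k} \<times> {1..int n} \<union> {k} \<times> {1..<j}) s''" and y: "arr s'' ''y'' 0 = j"
          have x': "arr s'' ''x'' 0 = k" using x by (simp add: frame_arr[OF g2])
          have S: "{1..<k} \<times> {1..int n} \<union> {k} \<times> {1..<j + 1} = insert (k, j) ({1..<k} \<times> {1..int n} \<union> {k} \<times> {1..<j})"
            using j by auto
          have "wp find_body s'' 6 W (find_invar n s (insert (k, j) ({1..<k} \<times> {1..int n} \<union> {k} \<times> {1..<j})))"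
            by (rule wp_find_body[OF W I x' y]) (use j k in \<open>simp_all add: frame_arr[OF g] frame_costm[OF g]\<close>)
          then show "wp find_body s'' 6 W (\<lambda>s3. find_invar n s ({1..<k} \<times> {1..int n} \<union> {k} \<times> {1..<j + 1}) (write_int ''y'' (0, 0) (j + 1) s3))"
            unfolding S by (simp add: find_invar_write)
        }
        { assume I: "find_invar n s ({1..<k} \<times> {1..int n} \<union> {k} \<times> {1..<int n + 1}) s''"
          have S: "{1..<k + 1} \<times> {1..int n} = {1..<k} \<times> {1..int n} \<union> {k} \<times> {1..<int n + 1}" using k by auto
          show "find_invar n s ({1..<k + 1} \<times> {1..int n}) (write_int ''x'' (0, 0) (k + 1) s'')"
            using I unfolding S by (simp add: find_invar_write)
        }
      qed (use W in \<open>auto simp: frame_find\<close>)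
    }
    { assume I: "find_invar n s ({1..<int n + 1} \<times> {1..int n}) s'"
      have "{1..<int n + 1} = {1..int n}" by auto
      then show "find_invar n s ({1..int n} \<times> {1..int n}) s'" using I by simp
    }
  qed (use W in \<open>auto simp: frame_find algebra_simps\<close>)
qed simp

lemma frame_find': "iwrites find = {''bx'', ''x'', ''y'', ''by''}" "rwrites find = {''cur'', ''best''}"
  by (auto simp: find_def frame_find)

text \<open>Before round k at most n + 1 - k cycles are left, or one if that number is smaller. A
  round without a candidate pair shows that all labels agree, so the bound by one is already
  attained.\<close>

lemma wp_patch:
  assumes N: "arr s ''n'' 0 = int n" and W: "n + 1 \<le> W"
    and nonneg: "\<And>i j. i \<in> {1..int n} \<Longrightarrow> j \<in> {1..int n} \<Longrightarrow> 0 \<le> costm s i j"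
    and init: "patch_invar (int n) (costm s) p0 lab0 (arr s ''p'') (arr s ''lab'')"
  shows "wp patch s (n * (n * (8 * n + 4) + 4 * n + 13) + 2) W (\<lambda>s'.
    patch_invar (int n) (costm s) p0 lab0 (arr s' ''p'') (arr s' ''lab'') \<and> card (arr s' ''lab'' ` {1..int n}) \<le> 1)"
  unfolding patch_def
proof (rule wp_For[where l = 1 and h = "int n + 1" and B = "n * (8 * n + 4) + 4 * n + 11" and
    I = "\<lambda>k s'. patch_invar (int n) (costm s) p0 lab0 (arr s' ''p'') (arr s' ''lab'') \<and>
      int (card (arr s' ''lab'' ` {1..int n})) \<le> max 1 (int n + 1 - k)"])
  fix s' assume "s' = write_int ''t'' (0, 0) 1 s"
  moreover have "card (arr s ''lab'' ` {1..int n}) \<le> card {1..int n}" by (intro card_image_le) simp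
  ultimately show "patch_invar (int n) (costm s) p0 lab0 (arr s' ''p'') (arr s' ''lab'') \<and>
      int (card (arr s' ''lab'' ` {1..int n})) \<le> max 1 (int n + 1 - 1)"
    using init by (simp add: arr_write)
next
  fix s' assume "frame (insert ''t'' (iwrites (Seq find join))) (rwrites (Seq find join)) s s'"
  then have f: "frame {''t'', ''bx'', ''x'', ''y'', ''by'', ''tmp'', ''p'', ''a'', ''b'', ''lab''} {''cur'', ''best''} s s'"
    by (simp add: frame_find' join_def swap_def frame_merge insert_commute)
  have e: "arr s' ''n'' 0 = int n" "costm s' = costm s" using N by (simp_all add: frame_arr[OF f] frame_costm[OF f])
  show "ival N1 s' = int n + 1" using e by simp
  { fix k assume k: "1 \<le> k" "k < int n + 1" and I: "patch_invar (int n) (costm s) p0 lab0 (arr s' ''p'') (arr s' ''lab'') \<and>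
      int (card (arr s' ''lab'' ` {1..int n})) \<le> max 1 (int n + 1 - k)"
    let ?p = "arr s' ''p''" and ?l = "arr s' ''lab''"
    let ?Q = "\<lambda>s''. patch_invar (int n) (costm s) p0 lab0 (arr s'' ''p'') (arr s'' ''lab'') \<and>
        int (card (arr s'' ''lab'' ` {1..int n})) \<le> max 1 (int n + 1 - (k + 1))"
    have "bij_betw ?p {1..int n} {1..int n}" using I unfolding patch_invar_def by blast
    then have pN: "?p x \<in> {1..int n}" if "x \<in> {1..int n}" for x
      using that bij_betwE by blast
    have lN: "?l x \<in> {1..int n}" if "x \<in> {1..int n}" for x using I that unfolding patch_invar_def by blast
    have "wp (Seq find join) s' (n * (8 * n + 4) + 4 * n + 11) W ?Q"
    proof (rule wp_Seq'[OF wp_find[OF e(1) W], where ?T2.0 = "4 * n + 8"])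
      fix s1 assume fi: "find_invar n s' ({1..int n} \<times> {1..int n}) s1" and "frame (iwrites find) (rwrites find) s' s1"
      then have f1: "frame {''bx'', ''x'', ''y'', ''by''} {''cur'', ''best''} s' s1" by (simp add: frame_find')
      have e1: "arr s1 ''n'' 0 = int n" "arr s1 ''p'' = ?p" "arr s1 ''lab'' = ?l" using e by (simp_all add: frame_arr[OF f1])
      show "wp join s1 (4 * n + 8) W ?Q" unfolding join_def
      proof (rule wp_Cond[where T' = "4 * n + 7"])
        assume "bval (IEq (V ''bx'') (C 0)) s1"
        then have bx: "arr s1 ''bx'' 0 = 0" by simp
        have "\<forall>(x, y)\<in>{1..int n} \<times> {1..int n}. ?l x = ?l y"
          using fi unfolding find_invar_def Let_def bx by (simp only: if_True simp_thms)
        then have eq: "?l x = ?l y" if "x \<in> {1..int n}" "y \<in> {1..int n}" for x y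
          using that by blast
        have "1 \<in> {1..int n}" using k by simp
        then have "?l ` {1..int n} \<subseteq> {?l 1}" using eq by blast
        then have "card (?l ` {1..int n}) \<le> card {?l 1}" by (intro card_mono) auto
        then show "wp Skip s1 (4 * n + 7) W ?Q" using I e1 by (intro wp_straight) auto
      next
        assume b: "\<not> bval (IEq (V ''bx'') (C 0)) s1"
        define x y where "x = arr s1 ''bx'' 0" and "y = arr s1 ''by'' 0"
        have xy: "x \<in> {1..int n}" "y \<in> {1..int n}" "?l x \<noteq> ?l y"
          and best: "\<And>x' y'. x' \<in> {1..int n} \<Longrightarrow> y' \<in> {1..int n} \<Longrightarrow> ?l x' \<noteq> ?l y' \<Longrightarrow>
            costm s (?p y) x + costm s (?p x) y \<le> costm s (?p y') x' + costm s (?p x') y'"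
          using fi b e by (auto simp: find_invar_def Let_def x_def y_def)
        show "wp (Seq swap merge) s1 (4 * n + 7) W ?Q"
        proof (rule wp_Seq'[where ?T1.0 = 5 and ?T2.0 = "4 * n + 2" and
            R = "\<lambda>s2. arr s2 ''p'' = ?p(x := ?p y, y := ?p x) \<and> arr s2 ''a'' 0 = ?l x \<and> arr s2 ''b'' 0 = ?l y"])
          have "y \<noteq> x" using xy by auto
          then show "wp swap s1 5 W (\<lambda>s2. arr s2 ''p'' = ?p(x := ?p y, y := ?p x) \<and> arr s2 ''a'' 0 = ?l x \<and> arr s2 ''b'' 0 = ?l y)"
            using e1 W pN[OF xy(1)] pN[OF xy(2)] lN[OF xy(1)] lN[OF xy(2)]
            by (intro wp_straight) (auto simp: swap_def arr_write x_def[symmetric] y_def[symmetric])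
        next
          fix s2 assume s2: "arr s2 ''p'' = ?p(x := ?p y, y := ?p x) \<and> arr s2 ''a'' 0 = ?l x \<and> arr s2 ''b'' 0 = ?l y"
            and "frame (iwrites swap) (rwrites swap) s1 s2"
          then have f2: "frame {''tmp'', ''p'', ''a'', ''b''} {} s1 s2" by (simp add: swap_def insert_commute)
          have e2: "arr s2 ''n'' 0 = int n" "arr s2 ''lab'' = ?l" using e1 by (simp_all add: frame_arr[OF f2])
          show "wp merge s2 (4 * n + 2) W ?Q"
          proof (rule wp_mono[OF wp_frame[OF wp_merge[OF e2(1) W s2[THEN conjunct2, THEN conjunct1] s2[THEN conjunct2, THEN conjunct2] lN[OF xy(1)]]] order_refl])
            fix s3 assume s3: "(\<forall>z\<in>{1..int n}. arr s3 ''lab'' z = (if arr s2 ''lab'' z = ?l y then ?l x else arr s2 ''lab'' z)) \<and>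
              frame (iwrites merge) (rwrites merge) s2 s3"
            then have f3: "frame {''y'', ''lab''} {} s2 s3" by (simp add: frame_merge)
            have p3: "arr s3 ''p'' = ?p(x := ?p y, y := ?p x)" using s2 by (simp add: frame_arr[OF f3])
            have l3: "arr s3 ''lab'' z = (if ?l z = ?l y then ?l x else ?l z)" if "z \<in> {1..int n}" for z
              using s3 that e2 by simp
            note st = patch_invar_step[OF conjunct1[OF I] xy nonneg best l3]
            show "?Q s3" unfolding p3 using st I by auto
          qed
        qed simp
      qed simp
    qed simp
    then show "wp (Seq find join) s' (n * (8 * n + 4) + 4 * n + 11) W (\<lambda>s''. 
      patch_invar (int n) (costm s) p0 lab0 (arr (write_int ''t'' (0, 0) (k + 1) s'') ''p'') (arr (write_int ''t'' (0, 0) (k + 1) s'') ''lab'') \<and>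
        int (card (arr (write_int ''t'' (0, 0) (k + 1) s'') ''lab'' ` {1..int n})) \<le> max 1 (int n + 1 - (k + 1)))"
      by (simp add: arr_write)
  }
  { assume "patch_invar (int n) (costm s) p0 lab0 (arr s' ''p'') (arr s' ''lab'') \<and>
      int (card (arr s' ''lab'' ` {1..int n})) \<le> max 1 (int n + 1 - (int n + 1))"
    then show "patch_invar (int n) (costm s) p0 lab0 (arr s' ''p'') (arr s' ''lab'') \<and> card (arr s' ''lab'' ` {1..int n}) \<le> 1"
      by simp
  }
qed (use W in \<open>auto simp: frame_find' join_def swap_def frame_merge algebra_simps\<close>)

lemma wp_emit:
  assumes N: "arr s ''n'' 0 = int n" and n: "1 \<le> n" and W: "n + 1 \<le> W"
    and p: "bij_betw (arr s ''p'') {1..int n} {1..int n}"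
  shows "wp emit s (4 * n + 3) W (\<lambda>s'. \<forall>t\<in>{1..n}. arr s' ''tour'' (int t) = ((arr s ''p'') ^^ (n - t)) 1)"
  unfolding emit_def
proof (rule wp_Seq'[where ?T1.0 = 1 and ?T2.0 = "4 * n + 2" and R = "\<lambda>s'. arr s' ''c'' 0 = 1"])
  show "wp (Set ''c'' (C 1)) s 1 W (\<lambda>s'. arr s' ''c'' 0 = 1)"
    using W by (intro wp_straight) (simp_all add: arr_write)
next
  let ?p = "arr s ''p''"
  fix s1 assume s1: "arr s1 ''c'' 0 = 1" and "frame (iwrites (Set ''c'' (C 1))) (rwrites (Set ''c'' (C 1))) s s1"
  then have f1: "frame {''c''} {} s s1" by simp
  have e1: "arr s1 ''n'' 0 = int n" "arr s1 ''p'' = ?p" using N by (simp_all add: frame_arr[OF f1])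
  have it: "(?p ^^ m) 1 \<in> {1..int n}" for m
  proof (induction m)
    case (Suc m)
    then show ?case using bij_betwE[OF p] by (simp del: atLeastAtMost_iff)
  qed (use n in simp)
  show "wp (For ''t'' (C 1) N1 emit_body) s1 (4 * n + 2) W (\<lambda>s'. \<forall>t\<in>{1..n}. arr s' ''tour'' (int t) = (?p ^^ (n - t)) 1)"
  proof (rule wp_For[where l = 1 and h = "int n + 1" and B = 2 and I = "\<lambda>k s'. arr s' ''c'' 0 = (?p ^^ nat (k - 1)) 1 \<and>
      (\<forall>t\<in>{1..n}. int n + 1 - k < int t \<longrightarrow> arr s' ''tour'' (int t) = (?p ^^ (n - t)) 1)"])
    fix s' assume "s' = write_int ''t'' (0, 0) 1 s1"
    then show "arr s' ''c'' 0 = (?p ^^ nat (1 - 1)) 1 \<and>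
      (\<forall>t\<in>{1..n}. int n + 1 - 1 < int t \<longrightarrow> arr s' ''tour'' (int t) = (?p ^^ (n - t)) 1)"
      using s1 by (simp add: arr_write)
  next
    fix s' assume "frame (insert ''t'' (iwrites emit_body)) (rwrites emit_body) s1 s'"
    then have f: "frame {''t'', ''tour'', ''c''} {} s1 s'" by (simp add: emit_body_def insert_commute)
    have e: "arr s' ''n'' 0 = int n" "arr s' ''p'' = ?p" using e1 by (simp_all add: frame_arr[OF f])
    show "ival N1 s' = int n + 1" using e by simp
    { fix k assume k: "1 \<le> k" "k < int n + 1" and I: "arr s' ''c'' 0 = (?p ^^ nat (k - 1)) 1 \<and>
      (\<forall>t\<in>{1..n}. int n + 1 - k < int t \<longrightarrow> arr s' ''tour'' (int t) = (?p ^^ (n - t)) 1)" and t: "arr s' ''t'' 0 = k"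
      have next_c: "?p ((?p ^^ nat (k - 1)) 1) = (?p ^^ nat k) 1"
      proof -
        have "nat k = Suc (nat (k - 1))" using k by simp
        then show ?thesis by simp
      qed
      have cur: "(?p ^^ nat (k - 1)) 1 = (?p ^^ (n - t)) 1" if "int t = int n + 1 - k" for t
      proof -
        have "nat (k - 1) = n - t" using that k by linarith
        then show ?thesis by simp
      qed
      have new: "\<forall>t\<in>{1..n}. int n - k < int t \<longrightarrow>
          ((arr s' ''tour'')(int n + 1 - k := (?p ^^ nat (k - 1)) 1)) (int t) = (?p ^^ (n - t)) 1"
        using I cur by auto
      show "wp emit_body s' 2 W (\<lambda>s''. arr (write_int ''t'' (0, 0) (k + 1) s'') ''c'' 0 = (?p ^^ nat (k + 1 - 1)) 1 \<and>
        (\<forall>t\<in>{1..n}. int n + 1 - (k + 1) < int t \<longrightarrow> arr (write_int ''t'' (0, 0) (k + 1) s'') ''tour'' (int t) = (?p ^^ (n - t)) 1))"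
        using I t e it[of "nat (k - 1)"] it[of "nat k"] W new next_c
        by (intro wp_straight) (simp_all add: emit_body_def arr_write)
    }
    { assume I: "arr s' ''c'' 0 = (?p ^^ nat (int n + 1 - 1)) 1 \<and>
        (\<forall>t\<in>{1..n}. int n + 1 - (int n + 1) < int t \<longrightarrow> arr s' ''tour'' (int t) = (?p ^^ (n - t)) 1)"
      then show "\<forall>t\<in>{1..n}. arr s' ''tour'' (int t) = (?p ^^ (n - t)) 1" by auto
    }
  qed (use W in \<open>auto simp: emit_body_def\<close>)
qed simp

section \<open>Correctness of the program\<close>

text \<open>The counterpart of \<open>cheap_joins\<close> for orbits of a permutation of natural
  numbers. The random analysis works with this form and never mentions labels or program
  states.\<close>

definition good_joins :: "nat \<Rightarrow> (nat \<times> nat \<Rightarrow> real) \<Rightarrow> (nat \<Rightarrow> nat) \<Rightarrow> real \<Rightarrow> real \<Rightarrow> bool" where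
  "good_joins n X q K g \<longleftrightarrow> real (card (orbit q ` {1..n})) \<le> K \<and>
    (\<forall>x\<in>{1..n}. \<forall>r\<in>{1..n}. \<forall>w\<in>{1..n}. \<forall>D. D \<subseteq> {1..n} \<longrightarrow> real (card D) \<le> 2 * K \<longrightarrow>
      real n \<le> K * real (card (orbit q x)) \<longrightarrow> r \<notin> orbit q x \<longrightarrow> w \<notin> orbit q x \<longrightarrow>
      (\<exists>k\<in>orbit q x - D. X (r, k) \<le> g \<and> X (q k, w) \<le> g))"

text \<open>Programs index by integers, matrices by naturals. The identity outside the vertex set is
  what \<open>permutes\<close> requires.\<close>

definition natperm :: "nat \<Rightarrow> (int \<Rightarrow> int) \<Rightarrow> nat \<Rightarrow> nat" where
  "natperm n p j = (if j \<in> {1..n} then nat (p (int j)) else j)"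

lemma bij_betw_int: "bij_betw int {1..n} {1..int n}"
  by (rule bij_betwI[where g = nat]) auto

lemma int_natperm:
  assumes "bij_betw p {1..int n} {1..int n}" "j \<in> {1..n}"
  shows "int (natperm n p j) = p (int j)"
proof -
  have "p (int j) \<in> {1..int n}" using assms bij_betwE by fastforce
  then show ?thesis using assms(2) by (simp add: natperm_def)
qed

lemma natperm_permutes:
  assumes p: "bij_betw p {1..int n} {1..int n}"
  shows "natperm n p permutes {1..n}"
proof (rule bij_imp_permutes)
  have "bij_betw nat {1..int n} {1..n}" by (rule bij_betwI[where g = int]) auto
  from bij_betw_trans[OF bij_betw_trans[OF bij_betw_int p] this]
  have "bij_betw (nat \<circ> (p \<circ> int)) {1..n} {1..n}" .
  then show "bij_betw (natperm n p) {1..n} {1..n}"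
    by (rule bij_betw_cong[THEN iffD1, rotated]) (simp add: natperm_def)
qed (simp add: natperm_def del: atLeastAtMost_iff)

lemma acost_natperm:
  assumes p: "bij_betw p {1..int n} {1..int n}"
    and X: "\<And>r j. r \<in> {1..int n} \<Longrightarrow> j \<in> {1..int n} \<Longrightarrow> Xi r j = X (nat r, nat j)"
  shows "acost n X (natperm n p) = (\<Sum>j\<in>{1..int n}. Xi (p j) j)"
proof -
  have "(\<Sum>j\<in>{1..int n}. Xi (p j) j) = (\<Sum>j\<in>{1..n}. Xi (p (int j)) (int j))"
    by (rule sum.reindex_bij_betw[OF bij_betw_int, symmetric])
  also have "\<dots> = acost n X (natperm n p)" unfolding acost_def
  proof (rule sum.cong[OF refl])
    fix j assume j: "j \<in> {1..n}"
    then have "p (int j) \<in> {1..int n}" using p bij_betwE by fastforce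
    then show "Xi (p (int j)) (int j) = X (natperm n p j, j)" using j by (subst X) (auto simp: natperm_def)
  qed
  finally show ?thesis ..
qed

lemma natperm_surj:
  assumes q: "q permutes {1..n}"
  shows "\<exists>p. bij_betw p {1..int n} {1..int n} \<and> natperm n p = q"
proof (intro exI conjI)
  let ?p = "\<lambda>j. int (q (nat j))"
  have map: "int (f (nat j)) \<in> {1..int n}" if "f permutes {1..n}" "j \<in> {1..int n}" for f j
  proof -
    have "nat j \<in> {1..n}" using that(2) by auto
    then have "f (nat j) \<in> {1..n}" using permutes_in_image[OF that(1)] by blast
    then show ?thesis by auto
  qed
  show "bij_betw ?p {1..int n} {1..int n}"
  proof (rule bij_betwI[where g = "\<lambda>j. int (inv q (nat j))"])
    show "?p \<in> {1..int n} \<rightarrow> {1..int n}" using map[OF q] by blast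
    show "(\<lambda>j. int (inv q (nat j))) \<in> {1..int n} \<rightarrow> {1..int n}" using map[OF permutes_inv[OF q]] by blast
  qed (simp_all add: permutes_inverses[OF q])
  show "natperm n ?p = q"
  proof
    fix j
    show "natperm n ?p j = q j"
      using permutes_not_in[OF q, of j] by (simp add: natperm_def del: atLeastAtMost_iff)
  qed
qed

text \<open>Constancy of the labels along \<open>p\<close> puts the orbit inside one class. The
  orbit is itself closed under \<open>p\<close>, so \<open>closed_unions\<close> gives the
  converse.\<close>

lemma orbit_natperm:
  assumes p: "bij_betw p {1..int n} {1..int n}" and l: "cycle_labels (int n) p lab" and x: "x \<in> {1..n}"
  shows "orbit (natperm n p) x = {y \<in> {1..n}. lab (int y) = lab (int x)}"
proof -
  let ?q = "natperm n p"
  have perm: "?q permutes {1..n}" by (rule natperm_permutes[OF p])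
  have qN: "?q y \<in> {1..n}" if "y \<in> {1..n}" for y using permutes_in_image[OF perm] that by blast
  have const: "lab (int (?q y)) = lab (int y)" if "y \<in> {1..n}" for y
    using l that int_natperm[OF p that] by (auto simp: cycle_labels_def)
  have sub: "y \<in> {1..n} \<and> lab (int y) = lab (int x)" if "y \<in> orbit ?q x" for y
    using that by (induction) (use x qN const in \<open>auto simp del: atLeastAtMost_iff\<close>)
  have self: "x \<in> orbit ?q x"
    using perm by (intro permutation_self_in_orbit) (auto simp: permutation_permutes)
  have "y \<in> orbit ?q x" if y: "y \<in> {1..n}" "lab (int y) = lab (int x)" for y
  proof -
    have cl: "closed_unions (int n) p lab" using l by (simp add: cycle_labels_def)
    have "int y \<in> int ` orbit ?q x"
    proof (rule closed_unionsD[OF cl])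
      show "int ` orbit ?q x \<subseteq> {1..int n}" using sub by fastforce
      show "p ` int ` orbit ?q x \<subseteq> int ` orbit ?q x"
      proof clarify
        fix z assume z: "z \<in> orbit ?q x"
        then have "p (int z) = int (?q z)" using sub int_natperm[OF p] by simp
        then show "p (int z) \<in> int ` orbit ?q x" using orbit.step[OF z] by blast
      qed
      show "int x \<in> int ` orbit ?q x" using self by blast
    qed (use y in auto)
    then show ?thesis by auto
  qed
  then show ?thesis using sub by blast
qed

text \<open>Label classes are orbits, so there are no more labels than orbits, and each request in
  terms of labels is one in terms of orbits.\<close>

lemma cheap_joins_if_good_joins:
  assumes p: "bij_betw p {1..int n} {1..int n}" and l: "cycle_labels (int n) p lab" and n: "1 \<le> n"
    and X: "\<And>r j. r \<in> {1..int n} \<Longrightarrow> j \<in> {1..int n} \<Longrightarrow> Xi r j = X (nat r, nat j)"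
    and good: "good_joins n X (natperm n p) K g"
  shows "cheap_joins (int n) Xi p lab K g"
  unfolding cheap_joins_def
proof (intro conjI allI ballI impI)
  let ?q = "natperm n p"
  note orb = orbit_natperm[OF p l]
  have img: "{1..int n} = int ` {1..n}" using bij_betw_int[of n] by (auto simp: bij_betw_def)
  have "lab ` {1..int n} \<subseteq> (\<lambda>S. lab (int (SOME y. y \<in> S))) ` orbit ?q ` {1..n}"
  proof
    fix c assume "c \<in> lab ` {1..int n}"
    then obtain x where x: "x \<in> {1..n}" "c = lab (int x)" unfolding img by blast
    have "x \<in> orbit ?q x" using x orb by simp
    then have "(SOME y. y \<in> orbit ?q x) \<in> orbit ?q x" by (rule someI)
    then have "lab (int (SOME y. y \<in> orbit ?q x)) = c" using orb[OF x(1)] x by simp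
    then show "c \<in> (\<lambda>S. lab (int (SOME y. y \<in> S))) ` orbit ?q ` {1..n}" using x(1) by blast
  qed
  then have "card (lab ` {1..int n}) \<le> card (orbit ?q ` {1..n})" by (rule surj_card_le[rotated]) simp
  then show "real (card (lab ` {1..int n})) \<le> K" using good by (simp add: good_joins_def)
next
  let ?q = "natperm n p"
  note orb = orbit_natperm[OF p l]
  fix c r w D
  let ?C = "{y \<in> {1..int n}. lab y = c}"
  assume r: "r \<in> {1..int n}" and w: "w \<in> {1..int n}" and D: "D \<subseteq> ?C" "real (card D) \<le> 2 * K"
    and big: "real_of_int (int n) \<le> K * real (card ?C)" and rc: "lab r \<noteq> c" and wc: "lab w \<noteq> c"
  \<comment> \<open>A value \<open>c\<close> that is not a label is excluded by \<open>big\<close>,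
    since \<open>n\<close> is positive.\<close>
  have "?C \<noteq> {}"
  proof
    assume "?C = {}"
    then have "card ?C = 0" by (simp only: card.empty)
    then show False using big n by simp
  qed
  then obtain z where z: "z \<in> {1..int n}" "lab z = c" by blast
  define x where "x = nat z"
  have x: "x \<in> {1..n}" "int x = z" using z by (auto simp: x_def)
  have C: "orbit ?q x = nat ` ?C"
  proof -
    have "orbit ?q x = {y \<in> {1..n}. lab (int y) = c}" using orb[OF x(1)] x z by simp
    also have "\<dots> = nat ` ?C"
    proof (intro equalityI subsetI)
      fix y assume "y \<in> {y \<in> {1..n}. lab (int y) = c}"
      then show "y \<in> nat ` ?C" by (intro image_eqI[of _ _ "int y"]) auto
    qed auto
    finally show ?thesis .
  qed
  have injn: "inj_on nat ?C" by (rule inj_onI) auto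
  have 1: "real n \<le> K * real (card (orbit ?q x))" unfolding C card_image[OF injn] using big by simp
  have DN: "nat ` D \<subseteq> {1..n}" "real (card (nat ` D)) \<le> 2 * K"
    using D(2) card_image[OF inj_on_subset[OF injn D(1)]] by (force dest: subsetD[OF D(1)], simp)
  have notin: "nat y \<notin> orbit ?q x" if "y \<in> {1..int n}" "lab y \<noteq> c" for y
    using that orb[OF x(1)] x z by simp
  have "nat r \<in> {1..n}" "nat w \<in> {1..n}" using r w by auto
  then obtain k where k: "k \<in> orbit ?q x - nat ` D" "X (nat r, k) \<le> g" "X (?q k, nat w) \<le> g"
    using good x(1) DN 1 notin[OF r rc] notin[OF w wc] unfolding good_joins_def by blast
  have kN: "k \<in> {1..n}" "lab (int k) = c" using k(1) orb[OF x(1)] x z by auto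
  have "int k \<notin> D" using k(1) by force
  moreover have "Xi r (int k) \<le> g" using k(2) r kN by (subst X) auto
  moreover have "p (int k) \<in> {1..int n}" using kN p bij_betwE by fastforce
  then have "Xi (p (int k)) w \<le> g" using k(3) w kN int_natperm[OF p kN(1)] by (subst X) (auto simp: natperm_def)
  ultimately show "\<exists>k\<in>?C - D. Xi r k \<le> g \<and> Xi (p k) w \<le> g" using kN by (intro bexI[of _ "int k"]) auto
qed

text \<open>The list runs backwards through the iterates of \<open>q\<close>, so \<open>q\<close> is
  the predecessor map along it. The iterates below the orbit length are distinct and exhaust the
  vertices.\<close>

lemma single_orbit_tour:
  assumes q: "q permutes {1..n}" and n: "1 \<le> n" and o: "orbit q 1 = {1..n}"
    and vs: "length vs = n" "\<And>i. i < n \<Longrightarrow> vs ! i = (q ^^ (n - Suc i)) 1"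
  shows "is_tour n vs" "tour_cost X vs = acost n X q"
proof -
  \<comment> \<open>The length of the orbit of 1; it equals \<open>n\<close> because the orbit is
    the whole vertex set.\<close>
  define d where "d = funpow_dist1 q 1 1"
  have self: "1 \<in> orbit q 1" using o n by simp
  have "orbit q 1 = (\<lambda>m. (q ^^ m) 1) ` {0..<d}" "inj_on (\<lambda>m. (q ^^ m) 1) {0..<d}"
    unfolding d_def by (rule orbit_conv_funpow_dist1[OF self], rule inj_on_funpow_dist1[OF self])
  then have im: "(\<lambda>m. (q ^^ m) 1) ` {0..<d} = {1..n}" and "card {1..n} = d"
    using o card_image[of "\<lambda>m. (q ^^ m) 1" "{0..<d}"] by auto
  then have d: "d = n" by simp
  have cyc: "(q ^^ n) 1 = 1" using funpow_dist1_prop[OF self] unfolding d_def[symmetric] d .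
  have "set vs = (\<lambda>i. vs ! i) ` {0..<n}" using vs(1) by (auto simp: set_conv_nth)
  also have "\<dots> = (\<lambda>i. (q ^^ (n - Suc i)) 1) ` {0..<n}" using vs(2) by (intro image_cong) auto
  also have "\<dots> = (\<lambda>m. (q ^^ m) 1) ` (\<lambda>i. n - Suc i) ` {0..<n}" by (simp add: image_image)
  also have "(\<lambda>i. n - Suc i) ` {0..<n} = {0..<n}"
  proof (intro equalityI subsetI)
    fix m assume "m \<in> {0..<n}"
    then show "m \<in> (\<lambda>i. n - Suc i) ` {0..<n}" by (intro image_eqI[of _ _ "n - Suc m"]) auto
  qed auto
  finally have set: "set vs = {1..n}" using im d by simp
  then show tour: "is_tour n vs" using vs(1) by (auto simp: is_tour_def intro!: card_distinct)
  show "tour_cost X vs = acost n X q"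
  proof (rule tour_cost_eq_acost[OF tour])
    fix i assume i: "i < n"
    show "q (vs ! (Suc i mod n)) = vs ! i"
    proof (cases "Suc i = n")
      case True
      \<comment> \<open>The wrap-around: the list starts with \<open>(q ^^ (n - 1)) 1\<close> and
        ends with 1, and \<open>q\<close> closes the cycle because its n-th power fixes 1.\<close>
      have "n - Suc 0 = i" using True by simp
      then have "vs ! 0 = (q ^^ i) 1" using vs(2)[of 0] n by simp
      moreover have "Suc i mod n = 0" using True by simp
      ultimately have "q (vs ! (Suc i mod n)) = (q ^^ Suc i) 1" by simp
      also have "\<dots> = (q ^^ n) 1" using True by (simp only:)
      finally show ?thesis using vs(2)[OF i] True cyc by simp
    next
      case False
      then have "q (vs ! (Suc i mod n)) = (q ^^ Suc (n - Suc (Suc i))) 1" using vs(2)[of "Suc i"] i by simp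
      also have "Suc (n - Suc (Suc i)) = n - Suc i" using i False by simp
      finally show ?thesis using vs(2)[OF i] by simp
    qed
  qed
qed

definition run_time :: "nat \<Rightarrow> nat" where
  "run_time n = n * (9 * n + 10 + n * (16 * n + 18)) + 2 + (n * (4 * n + 9) + 4 +
    (n * (n * (8 * n + 4) + 4 * n + 13) + 2 + (4 * n + 3)))"

text \<open>The guarantee is deterministic and holds for every nonnegative matrix; chance enters
  only through \<open>good_joins\<close>. The assignment is existentially quantified because several
  may be optimal and the program settles on one of them.\<close>

lemma wp_atsp_program:
  assumes n: "1 \<le> n" and nonneg: "\<And>a. a \<in> arcs n \<Longrightarrow> 0 \<le> X a"
  shows "wp atsp_program (atsp_input n X) (run_time n) (n + 1) (\<lambda>s'. is_tour n (atsp_output n s') \<and>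
    (\<exists>q. optimal_assignment n X q \<and> (\<forall>K g. 0 \<le> g \<longrightarrow> good_joins n X q K g \<longrightarrow>
      tour_cost X (atsp_output n s') \<le> acost n X q + 2 * g * K)))"
  unfolding atsp_program_def run_time_def
proof -
  define s where "s = atsp_input n X"
  define Xi where "Xi = costm s"
  let ?V = "{1..int n}"
  let ?Q = "\<lambda>s'. is_tour n (atsp_output n s') \<and>
    (\<exists>q. optimal_assignment n X q \<and> (\<forall>K g. 0 \<le> g \<longrightarrow> good_joins n X q K g \<longrightarrow>
      tour_cost X (atsp_output n s') \<le> acost n X q + 2 * g * K))"
  have s: "arr s ''n'' 0 = int n" "arr s ''p'' = (\<lambda>_. 0)" "rarr s ''u'' = (\<lambda>_. 0)" "rarr s ''v'' = (\<lambda>_. 0)"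
    by (auto simp: s_def atsp_input_def arr_def rarr_def fun_eq_iff)
  have Xi: "Xi r j = X (nat r, nat j)" if "r \<in> ?V" "j \<in> ?V" for r j
    using that by (simp add: Xi_def s_def costm_def atsp_input_def)
  have Xi0: "0 \<le> Xi r j" if "r \<in> ?V" "j \<in> ?V" for r j
  proof -
    have "(nat r, nat j) \<in> arcs n" using that by auto
    then show ?thesis using Xi[OF that] nonneg by simp
  qed
  \<comment> \<open>All memory is initially 0, and zero potentials are feasible for nonnegative
    costs.\<close>
  have df: "dual_feasible (int n) (costm s) (rarr s ''u'') (rarr s ''v'')"
    unfolding dual_feasible_def using Xi0 by (simp add: s Xi_def)
  show "wp (Seq hungarian (Seq label (Seq patch emit))) (atsp_input n X)
    (n * (9 * n + 10 + n * (16 * n + 18)) + 2 + (n * (4 * n + 9) + 4 +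
    (n * (n * (8 * n + 4) + 4 * n + 13) + 2 + (4 * n + 3)))) (n + 1) ?Q"
    unfolding s_def[symmetric]
  proof (rule wp_Seq'[OF wp_hungarian[OF s(1) order_refl s(2) df] _ order_refl])
    fix s1 assume h: "\<exists>u v. tight_matching (int n) (costm s) (int n + 1) (arr s1 ''p'') u v \<and> dual_feasible (int n) (costm s) u v"
      and "frame (iwrites hungarian) (rwrites hungarian) s s1"
    then have f1: "frame {''i'', ''p'', ''j0'', ''used'', ''go'', ''j'', ''way'', ''j1'', ''i0''} {''minv'', ''delta'', ''u'', ''v'', ''cur''} s s1"
      unfolding hungarian_def writes_For iwrites_hungarian by simp
    define p0 where "p0 = arr s1 ''p''"
    have p0: "bij_betw p0 ?V ?V" and opt: "\<And>q. bij_betw q ?V ?V \<Longrightarrow> (\<Sum>j\<in>?V. Xi (p0 j) j) \<le> (\<Sum>j\<in>?V. Xi (q j) j)"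
      using h tight_matching_complete unfolding p0_def Xi_def by blast+
    have e1: "arr s1 ''n'' 0 = int n" "costm s1 = Xi" using s by (simp_all add: frame_arr[OF f1] frame_costm[OF f1] Xi_def)
    have "optimal_assignment n X (natperm n p0)"
      unfolding optimal_assignment_def
    proof (intro conjI allI impI natperm_permutes p0)
      fix q' assume "q' permutes {1..n}"
      then obtain p' where p': "bij_betw p' ?V ?V" "natperm n p' = q'" using natperm_surj by blast
      show "acost n X (natperm n p0) \<le> acost n X q'"
        using opt[OF p'(1)] acost_natperm[where Xi = Xi and X = X, OF p0 Xi] acost_natperm[where Xi = Xi and X = X, OF p'(1) Xi] p'(2) by simp
    qed
    note opt0 = this
    show "wp (Seq label (Seq patch emit)) s1 (n * (4 * n + 9) + 4 +
        (n * (n * (8 * n + 4) + 4 * n + 13) + 2 + (4 * n + 3))) (n + 1) ?Q"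
    proof (rule wp_Seq'[OF wp_label[OF e1(1) order_refl p0[unfolded p0_def]] _ order_refl])
      fix s2 assume l: "cycle_labels (int n) (arr s1 ''p'') (arr s2 ''lab'') \<and> (\<forall>x\<in>?V. arr s2 ''lab'' x \<in> ?V)"
        and "frame (iwrites label) (rwrites label) s1 s2"
      then have f2: "frame {''x'', ''lab'', ''a'', ''b'', ''y''} {} s1 s2"
        by (simp add: label_def label_body_def frame_merge insert_commute)
      define lab0 where "lab0 = arr s2 ''lab''"
      have e2: "arr s2 ''n'' 0 = int n" "costm s2 = Xi" "arr s2 ''p'' = p0"
        using e1 by (simp_all add: frame_arr[OF f2] frame_costm[OF f2] p0_def)
      have l0: "cycle_labels (int n) p0 lab0" using l by (simp add: p0_def lab0_def)
      have inv: "patch_invar (int n) (costm s2) p0 lab0 (arr s2 ''p'') (arr s2 ''lab'')"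
        unfolding e2 lab0_def[symmetric] using l0 p0 l by (intro patch_invar_init) (auto simp: lab0_def)
      have nn: "0 \<le> costm s2 i j" if "i \<in> ?V" "j \<in> ?V" for i j using Xi0 that e2 by simp
      show "wp (Seq patch emit) s2 (n * (n * (8 * n + 4) + 4 * n + 13) + 2 + (4 * n + 3)) (n + 1) ?Q"
      proof (rule wp_Seq'[OF wp_patch[OF e2(1) order_refl nn inv] _ order_refl])
        fix s3 assume pi: "patch_invar (int n) (costm s2) p0 lab0 (arr s3 ''p'') (arr s3 ''lab'') \<and> card (arr s3 ''lab'' ` ?V) \<le> 1"
          and "frame (iwrites patch) (rwrites patch) s2 s3"
        then have f3: "frame {''t'', ''bx'', ''x'', ''y'', ''by'', ''tmp'', ''p'', ''a'', ''b'', ''lab''} {''cur'', ''best''} s2 s3"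
          by (simp add: patch_def frame_find' join_def swap_def frame_merge insert_commute)
        define p lab where "p = arr s3 ''p''" and "lab = arr s3 ''lab''"
        have e3: "arr s3 ''n'' 0 = int n" using e2 by (simp add: frame_arr[OF f3])
        have pi': "patch_invar (int n) Xi p0 lab0 p lab" using pi e2 by (simp add: p_def lab_def)
        have p: "bij_betw p ?V ?V" and l: "cycle_labels (int n) p lab"
          using pi' unfolding patch_invar_def by blast+
        \<comment> \<open>As \<open>n\<close> is positive there is a label, so patching leaves
          exactly one.\<close>
        have "finite (lab ` ?V)" "lab ` ?V \<noteq> {}" using n by auto
        then have card1: "card (lab ` ?V) = 1" using pi by (metis One_nat_def card_0_eq lab_def le_Suc_eq le_zero_eq)
        then obtain c where c: "lab ` ?V = {c}" by (metis card_1_singletonE)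
        have orb: "orbit (natperm n p) 1 = {1..n}"
        proof -
          have "lab (int y) = c" if "y \<in> {1..n}" for y
          proof -
            have "int y \<in> ?V" using that by auto
            then show ?thesis using c by blast
          qed
          then have "lab (int y) = lab (int 1)" if "y \<in> {1..n}" for y
            using that n by (metis atLeastAtMost_iff order_refl)
          moreover have "orbit (natperm n p) 1 = {y \<in> {1..n}. lab (int y) = lab (int 1)}"
            using n by (intro orbit_natperm[OF p l]) simp
          ultimately show ?thesis by blast
        qed
        show "wp emit s3 (4 * n + 3) (n + 1) ?Q"
        proof (rule wp_mono[OF wp_emit[OF e3 n order_refl p[unfolded p_def]] order_refl])
          fix s4 assume t: "\<forall>t\<in>{1..n}. arr s4 ''tour'' (int t) = (arr s3 ''p'' ^^ (n - t)) 1"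
          let ?vs = "atsp_output n s4"
          have it: "int ((natperm n p ^^ m) 1) = (p ^^ m) 1 \<and> (natperm n p ^^ m) 1 \<in> {1..n}" for m
          proof (induction m)
            case (Suc m)
            then show ?case
              using int_natperm[OF p, of "(natperm n p ^^ m) 1"] permutes_in_image[OF natperm_permutes[OF p], of "(natperm n p ^^ m) 1"]
              by (simp del: atLeastAtMost_iff)
          qed (use n in simp)
          have vs: "length ?vs = n" "?vs ! i = (natperm n p ^^ (n - Suc i)) 1" if "i < n" for i
          proof -
            show "length ?vs = n" by (simp add: atsp_output_def)
            have "Suc i \<in> {1..n}" using that by simp
            then have "arr s4 ''tour'' (int (Suc i)) = (p ^^ (n - Suc i)) 1" using t unfolding p_def by blast
            then have "nat (ints s4 ''tour'' (int (Suc i), 0)) = (natperm n p ^^ (n - Suc i)) 1"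
              using it[of "n - Suc i"] unfolding arr_def by (metis nat_int)
            then show "?vs ! i = (natperm n p ^^ (n - Suc i)) 1"
              using that unfolding atsp_output_def by (simp del: upt_Suc)
          qed
          have len: "length ?vs = n" by (simp add: atsp_output_def)
          note tour = single_orbit_tour[OF natperm_permutes[OF p] n orb len vs(2)]
          have "tour_cost X ?vs \<le> acost n X (natperm n p0) + 2 * g * K"
            if g: "0 \<le> g" and good: "good_joins n X (natperm n p0) K g" for K g
          proof -
            have cj: "cheap_joins (int n) Xi p0 lab0 K g"
              by (rule cheap_joins_if_good_joins[where Xi = Xi and X = X, OF p0 l0 n Xi good])
            then have "(\<Sum>j\<in>?V. Xi (p j) j) \<le> (\<Sum>j\<in>?V. Xi (p0 j) j) +
                2 * g * (real (card (lab0 ` ?V)) - real (card (lab ` ?V)))"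
              using pi' unfolding patch_invar_def by blast
            also have "\<dots> \<le> (\<Sum>j\<in>?V. Xi (p0 j) j) + 2 * g * K"
              using cj g by (intro add_left_mono mult_left_mono) (auto simp: cheap_joins_def)
            finally show ?thesis
              using tour(2)[of X] acost_natperm[where Xi = Xi and X = X, OF p Xi]
                acost_natperm[where Xi = Xi and X = X, OF p0 Xi] by simp
          qed
          then show "?Q s4" using tour(1) opt0 by blast
        qed
      qed
    qed
  qed
qed

lemma cubic_time_atsp_program: "cubic_time atsp_program"
  unfolding cubic_time_def
proof (rule exI[of _ "\<lambda>n. 200 * real n ^ 3"], rule exI[of _ "\<lambda>n. real n + 1"], rule exI[of _ 1], intro conjI allI impI)
  have le: "run_time n \<le> 200 * n ^ 3" if "1 \<le> n" for n
  proof -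
    \<comment> \<open>Naming the cube makes the comparison linear. The coefficients of
      \<open>run_time\<close> add up to 110, so 200 is ample.\<close>
    define c where "c = n * (n * n)"
    have "n \<le> n * n" using that by simp
    moreover have "n * n \<le> c" using that by (simp add: c_def)
    moreover have "run_time n = 24 * c + 39 * (n * n) + 36 * n + 11"
      by (simp add: run_time_def c_def algebra_simps)
    ultimately have "run_time n \<le> 200 * c" using that by linarith
    then show ?thesis by (simp add: c_def power3_eq_cube mult.assoc)
  qed
  show "(\<lambda>n. 200 * real n ^ 3) \<in> O(\<lambda>n. real n ^ 3)" by simp
  show "(\<lambda>n. real n + 1) \<in> O(\<lambda>n. real n ^ 1)" by real_asymp
  fix n :: nat and X :: "nat \<times> nat \<Rightarrow> real" assume n: "1 \<le> n" and nonneg: "\<forall>a\<in>arcs n. 0 \<le> X a"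
  have "wp atsp_program (atsp_input n X) (run_time n) (n + 1) (\<lambda>_. True)"
    by (rule wp_mono[OF wp_atsp_program[where X = X, OF n bspec[OF nonneg]] order_refl]) auto
  then obtain t m s where e: "exec atsp_program (atsp_input n X) t m s" "t \<le> run_time n" "m \<le> n + 1"
    by (auto simp: wp_def)
  have "real t \<le> real (200 * n ^ 3)" using e(2) le[OF n] by linarith
  then show "\<exists>t m s. exec atsp_program (atsp_input n X) t m s \<and> real t \<le> 200 * real n ^ 3 \<and> real m \<le> real n + 1"
    using e by (intro exI conjI) auto
qed

lemma atsp_program_output:
  assumes n: "1 \<le> n" and nonneg: "\<And>a. a \<in> arcs n \<Longrightarrow> 0 \<le> X a"
  shows "\<exists>vs q. outputs atsp_program n X vs \<and> is_tour n vs \<and> optimal_assignment n X q \<and>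
    (\<forall>K g. 0 \<le> g \<longrightarrow> good_joins n X q K g \<longrightarrow> tour_cost X vs \<le> acost n X q + 2 * g * K)"
proof -
  obtain t m s where e: "exec atsp_program (atsp_input n X) t m s" and t: "is_tour n (atsp_output n s)"
    and q: "\<exists>q. optimal_assignment n X q \<and> (\<forall>K g. 0 \<le> g \<longrightarrow> good_joins n X q K g \<longrightarrow>
      tour_cost X (atsp_output n s) \<le> acost n X q + 2 * g * K)"
    using wp_atsp_program[where X = X, OF assms] unfolding wp_def by blast
  have "outputs atsp_program n X (atsp_output n s)" unfolding outputs_def using e by blast
  then show ?thesis using t q by blast
qed

section \<open>Random row-symmetric instances\<close>

text \<open>An assignment uses n distinct arcs, and fewer than half of them can be among the small
  entries.\<close>

lemma acost_lower_bound:
  assumes nonneg: "\<And>a. a \<in> arcs n \<Longrightarrow> 0 \<le> x a" and q: "q permutes {1..n}" and t: "0 \<le> t"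
    and few: "real (card {a \<in> arcs n. x a < t}) < real n / 2"
  shows "real n / 2 * t \<le> acost n x q"
proof -
  have qN: "(q j, j) \<in> arcs n" if "j \<in> {1..n}" for j using that permutes_in_image[OF q] by blast
  define B where "B = {j \<in> {1..n}. x (q j, j) < t}"
  have "card B = card ((\<lambda>j. (q j, j)) ` B)" by (rule card_image[symmetric]) (simp add: inj_on_def)
  also have "\<dots> \<le> card {a \<in> arcs n. x a < t}"
  proof (rule card_mono)
    show "(\<lambda>j. (q j, j)) ` B \<subseteq> {a \<in> arcs n. x a < t}" using qN unfolding B_def by blast
  qed (rule finite_subset[of _ "arcs n"], auto)
  finally have "real (card B) < real n / 2" using few by linarith
  moreover have "card ({1..n} - B) = n - card B"
    by (subst card_Diff_subset) (auto simp: B_def)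
  moreover have "B \<subseteq> {1..n}" by (auto simp: B_def)
  then have "card B \<le> n" using card_mono[of "{1..n}" B] by simp
  ultimately have "real n / 2 \<le> real (card ({1..n} - B))" by (simp add: of_nat_diff)
  from mult_right_mono[OF this t] have "real n / 2 * t \<le> (\<Sum>j\<in>{1..n} - B. t)" by (simp only: sum_constant)
  also have "\<dots> \<le> (\<Sum>j\<in>{1..n} - B. x (q j, j))" by (intro sum_mono) (auto simp: B_def)
  also have "\<dots> \<le> acost n x q" unfolding acost_def using nonneg qN by (intro sum_mono2) auto
  finally show ?thesis .
qed

text \<open>The hypotheses \<open>row\<close>, \<open>col\<close> and \<open>dense\<close> of
  \<open>optimal_assignment_short_arcs\<close>, required for all rows and columns at once.\<close>

definition cheap_dense :: "nat \<Rightarrow> nat \<Rightarrow> real \<Rightarrow> (nat \<times> nat \<Rightarrow> real) \<Rightarrow> bool" where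
  "cheap_dense n k \<theta> x \<longleftrightarrow>
    (\<forall>r\<in>{1..n}. k \<le> card {w \<in> {1..n}. x (r, w) \<le> \<theta>}) \<and>
    (\<forall>j\<in>{1..n}. k \<le> card {v \<in> {1..n}. x (v, j) \<le> \<theta>}) \<and>
    (\<forall>S T. S \<subseteq> {1..n} \<longrightarrow> T \<subseteq> {1..n} \<longrightarrow> card S = k \<longrightarrow> card T = k \<longrightarrow> (\<exists>s\<in>S. \<exists>t\<in>T. x (s, t) \<le> \<theta>))"

text \<open>A vertex set that meets all \<open>k\<close> disjoint blocks has at least
  \<open>k\<close> elements. Thus a lower bound on the number of cheap arcs in a row follows from a
  union bound over blocks, without a concentration inequality for the count.\<close>

definition block :: "nat \<Rightarrow> nat \<Rightarrow> nat set" where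
  "block k i = {i * k + 1..i * k + k}"

lemma block_subset: "k * k \<le> n \<Longrightarrow> i < k \<Longrightarrow> block k i \<subseteq> {1..n}"
proof -
  assume "k * k \<le> n" "i < k"
  then have "(i + 1) * k \<le> n" using mult_le_mono1[of "i + 1" k k] by linarith
  then show ?thesis by (auto simp: block_def)
qed

lemma card_block: "card (block k i) = k"
  by (simp add: block_def)

lemma block_disjoint: "i < j \<Longrightarrow> block k i \<inter> block k j = {}"
proof -
  assume "i < j"
  then have "(i + 1) * k \<le> j * k" by (intro mult_le_mono1) simp
  then show ?thesis by (auto simp: block_def)
qed

lemma card_ge_blocks:
  assumes k: "k * k \<le> n" and A: "A \<subseteq> {1..n}" and hit: "\<And>i. i < k \<Longrightarrow> block k i \<inter> A \<noteq> {}"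
  shows "k \<le> card A"
proof -
  have "\<exists>f. \<forall>i\<in>{..<k}. f i \<in> block k i \<inter> A" using hit by (intro bchoice) blast
  then obtain f where f: "\<And>i. i < k \<Longrightarrow> f i \<in> block k i \<inter> A" by auto
  have "inj_on f {..<k}"
  proof (rule inj_onI, rule ccontr)
    fix i j assume ij: "i \<in> {..<k}" "j \<in> {..<k}" "f i = f j" "i \<noteq> j"
    then have "f i \<in> block k i \<inter> block k j" using f[of i] f[of j] by auto
    then show False using block_disjoint[of i j k] block_disjoint[of j i k] ij(4) by (cases "i < j") (auto simp: Int_commute)
  qed
  then have "card {..<k} \<le> card A" using f finite_subset[OF A] by (intro card_inj_on_le) auto
  then show ?thesis by simp
qed

section \<open>Independent exponential costs with bounded, row symmetric rates\<close>

locale random_costs = expo_product "arcs n" \<alpha> for n :: nat and \<alpha> :: "nat \<times> nat \<Rightarrow> real" +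
  fixes M :: real
  assumes n: "1 \<le> n" and M: "1 \<le> M"
    and rate_lower: "\<And>a. a \<in> arcs n \<Longrightarrow> 1 / M \<le> \<alpha> a"
    and rate_upper: "\<And>a. a \<in> arcs n \<Longrightarrow> \<alpha> a \<le> M"
    and row_sym: "\<And>v v' w. v \<in> {1..n} \<Longrightarrow> v' \<in> {1..n} \<Longrightarrow> w \<in> {1..n} \<Longrightarrow> \<alpha> (v, w) = \<alpha> (v', w)"
begin

abbreviation perms :: "(nat \<Rightarrow> nat) set" where "perms \<equiv> {q. q permutes {1..n}}"

lemma finite_perms: "finite perms"
  by (intro finite_permutations) simp

lemma perm_arc: "q permutes {1..n} \<Longrightarrow> j \<in> {1..n} \<Longrightarrow> (q j, j) \<in> arcs n"
  using permutes_in_image by fastforce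

lemma measurable_acost: "q permutes {1..n} \<Longrightarrow> (\<lambda>x. acost n x q) \<in> borel_measurable P"
  unfolding acost_def using perm_arc by (intro borel_measurable_sum measurable_coordinate) auto

lemma prob_UN_le:
  assumes "finite F" "\<And>i. i \<in> F \<Longrightarrow> A i \<in> events" "\<And>i. i \<in> F \<Longrightarrow> prob (A i) \<le> c"
  shows "prob (\<Union>i\<in>F. A i) \<le> real (card F) * c"
proof -
  have "prob (\<Union>i\<in>F. A i) \<le> (\<Sum>i\<in>F. prob (A i))"
    using assms by (intro finite_measure_subadditive_finite) auto
  also have "\<dots> \<le> (\<Sum>i\<in>F. c)" using assms by (intro sum_mono) auto
  finally show ?thesis by simp
qed

lemma sets_all_greater: "F \<subseteq> arcs n \<Longrightarrow> {x \<in> space P. \<forall>a\<in>F. \<theta> < x a} \<in> events"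
proof -
  assume F: "F \<subseteq> arcs n"
  then have fin: "finite F" by (rule finite_subset) simp
  have "(\<lambda>x. x a) \<in> borel_measurable P" if "a \<in> F" for a using F that by (intro measurable_coordinate) auto
  note [measurable] = this
  show ?thesis using fin by measurable
qed

lemma prob_all_greater_le:
  assumes F: "F \<subseteq> arcs n" and \<theta>: "0 \<le> \<theta>"
  shows "prob {x \<in> space P. \<forall>a\<in>F. \<theta> < x a} \<le> exp (- (real (card F) * \<theta> / M))"
proof -
  have "real (card F) / M = (\<Sum>a\<in>F. 1 / M)" by simp
  also have "\<dots> \<le> (\<Sum>a\<in>F. \<alpha> a)" using F rate_lower by (intro sum_mono) auto
  finally have "real (card F) / M * \<theta> \<le> (\<Sum>a\<in>F. \<alpha> a) * \<theta>" using \<theta> by (rule mult_right_mono)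
  then show ?thesis unfolding prob_all_greater[OF assms] by (simp add: mult.commute)
qed

lemma prob_many_small_le:
  assumes "0 \<le> t"
  shows "prob {x \<in> space P. real n / 2 \<le> real (card {a \<in> arcs n. x a < t})} \<le> 2 * real n * M * t"
proof -
  have "(\<Sum>a\<in>arcs n. \<alpha> a) \<le> (\<Sum>a\<in>arcs n. M)" using rate_upper by (intro sum_mono) auto
  also have "\<dots> = real n * real n * M" by simp
  finally have "(\<Sum>a\<in>arcs n. \<alpha> a) * t / (real n / 2) \<le> real n * real n * M * t / (real n / 2)"
    using assms by (intro divide_right_mono mult_right_mono) auto
  also have "\<dots> = 2 * real n * M * t" using n by (simp add: field_simps)
  finally show ?thesis using prob_many_small[OF assms, of "real n / 2"] n by simp
qed

text \<open>A union bound over rows and columns with a block lacking cheap arcs, and over pairs of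
  \<open>k\<close>-sets without a cheap arc between them. The number of such pairs is at most
  \<open>n ^ (2 * k)\<close>, against an exponent proportional to \<open>k * k\<close>. Only a
  measurable superset of the failure event is exhibited, which suffices for the final union
  bound.\<close>

lemma prob_not_cheap_dense:
  assumes k: "k * k \<le> n" and \<theta>: "0 \<le> \<theta>"
  shows "\<exists>B\<in>events. {x \<in> space P. \<not> cheap_dense n k \<theta> x} \<subseteq> B \<and>
    prob B \<le> 2 * real n * real k * exp (- (real k * \<theta> / M)) + real n ^ (2 * k) * exp (- (real (k * k) * \<theta> / M))"
proof -
  define G where "G F = {x \<in> space P. \<forall>a\<in>F. \<theta> < x a}" for F
  define B1 where "B1 = (\<Union>(r, i)\<in>{1..n} \<times> {..<k}. G ({r} \<times> block k i))"
  define B2 where "B2 = (\<Union>(j, i)\<in>{1..n} \<times> {..<k}. G (block k i \<times> {j}))"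
  define SS where "SS = {S. S \<subseteq> {1..n} \<and> card S = k}"
  define B3 where "B3 = (\<Union>(S, T)\<in>SS \<times> SS. G (S \<times> T))"
  have bl: "block k i \<subseteq> {1..n}" if "i < k" for i using block_subset[OF k that] .
  have ev: "G F \<in> events" and le: "prob (G F) \<le> exp (- (real (card F) * \<theta> / M))" if "F \<subseteq> arcs n" for F
    using sets_all_greater[OF that] prob_all_greater_le[OF that \<theta>] by (simp_all add: G_def)
  have finSS: "finite SS" unfolding SS_def by (rule finite_subset[of _ "Pow {1..n}"]) auto
  have "card SS = n choose k" unfolding SS_def using n_subsets[of "{1..n}" k] by simp
  also have "\<dots> \<le> n ^ k"
  proof (cases "k \<le> n")
    case True
    then show ?thesis by (rule binomial_le_pow)
  qed (simp add: binomial_eq_0)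
  finally have SSk: "card SS \<le> n ^ k" .
  have "card SS * card SS \<le> n ^ k * n ^ k" using SSk SSk by (rule mult_le_mono)
  then have "real (card (SS \<times> SS)) \<le> real (n ^ k * n ^ k)" by (simp only: card_cartesian_product of_nat_le_iff)
  then have cSS: "real (card (SS \<times> SS)) \<le> real n ^ (2 * k)" by (simp add: power_mult power2_eq_square power_mult_distrib mult.commute)
  have b1: "prob B1 \<le> real (card ({1..n} \<times> {..<k})) * exp (- (real k * \<theta> / M))"
    unfolding B1_def
  proof (rule prob_UN_le, simp, goal_cases)
    case (1 a)
    then have "{fst a} \<times> block k (snd a) \<subseteq> arcs n" using bl by fastforce
    from ev[OF this] show ?case by (simp add: split_def)
  next
    case (2 a)
    then have "{fst a} \<times> block k (snd a) \<subseteq> arcs n" using bl by fastforce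
    from le[OF this] show ?case by (simp add: split_def card_block card_cartesian_product)
  qed
  have b2: "prob B2 \<le> real (card ({1..n} \<times> {..<k})) * exp (- (real k * \<theta> / M))"
    unfolding B2_def
  proof (rule prob_UN_le, simp, goal_cases)
    case (1 a)
    then have "block k (snd a) \<times> {fst a} \<subseteq> arcs n" using bl by fastforce
    from ev[OF this] show ?case by (simp add: split_def)
  next
    case (2 a)
    then have "block k (snd a) \<times> {fst a} \<subseteq> arcs n" using bl by fastforce
    from le[OF this] show ?case by (simp add: split_def card_block card_cartesian_product)
  qed
  have b3: "prob B3 \<le> real (card (SS \<times> SS)) * exp (- (real (k * k) * \<theta> / M))"
    unfolding B3_def
  proof (rule prob_UN_le, use finSS in simp, goal_cases)
    case (1 a)
    then have "fst a \<times> snd a \<subseteq> arcs n" by (auto simp: SS_def)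
    from ev[OF this] show ?case by (simp add: split_def)
  next
    case (2 a)
    then have "fst a \<times> snd a \<subseteq> arcs n" "card (fst a) = k" "card (snd a) = k" by (auto simp: SS_def)
    with le[OF this(1)] show ?case by (simp add: split_def card_cartesian_product)
  qed
  have ev1: "B1 \<in> events" unfolding B1_def using bl by (intro sets.finite_UN) (fastforce intro!: ev)+
  have ev2: "B2 \<in> events" unfolding B2_def using bl by (intro sets.finite_UN) (fastforce intro!: ev)+
  have ev3: "B3 \<in> events" unfolding B3_def using finSS by (intro sets.finite_UN) (fastforce simp: SS_def intro!: ev)+
  have "{x \<in> space P. \<not> cheap_dense n k \<theta> x} \<subseteq> B1 \<union> B2 \<union> B3"
  proof (rule subsetI, rule ccontr)
    fix x assume x: "x \<in> {x \<in> space P. \<not> cheap_dense n k \<theta> x}" and nb: "x \<notin> B1 \<union> B2 \<union> B3"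
    have n1: "\<exists>w\<in>block k i. x (r, w) \<le> \<theta>" if "r \<in> {1..n}" "i < k" for r i
    proof -
      have "(r, i) \<in> {1..n} \<times> {..<k}" using that by blast
      then have "x \<notin> G ({r} \<times> block k i)" using nb unfolding B1_def by blast
      then show ?thesis using x by (auto simp: G_def not_less)
    qed
    have n2: "\<exists>v\<in>block k i. x (v, j) \<le> \<theta>" if "j \<in> {1..n}" "i < k" for j i
    proof -
      have "(j, i) \<in> {1..n} \<times> {..<k}" using that by blast
      then have "x \<notin> G (block k i \<times> {j})" using nb unfolding B2_def by blast
      then show ?thesis using x by (auto simp: G_def not_less)
    qed
    have n3: "\<exists>s\<in>S. \<exists>t\<in>T. x (s, t) \<le> \<theta>" if "S \<subseteq> {1..n}" "T \<subseteq> {1..n}" "card S = k" "card T = k" for S T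
    proof -
      have "(S, T) \<in> SS \<times> SS" using that by (simp add: SS_def)
      then have "x \<notin> G (S \<times> T)" using nb by (auto simp: B3_def)
      then show ?thesis using x by (auto simp: G_def not_less)
    qed
    have "cheap_dense n k \<theta> x" unfolding cheap_dense_def
    proof (intro conjI ballI allI impI)
      fix r assume r: "r \<in> {1..n}"
      show "k \<le> card {w \<in> {1..n}. x (r, w) \<le> \<theta>}"
        by (rule card_ge_blocks[OF k]) (use n1[OF r] bl in blast)+
      show "k \<le> card {v \<in> {1..n}. x (v, r) \<le> \<theta>}"
        by (rule card_ge_blocks[OF k]) (use n2[OF r] bl in blast)+
    qed (use n3 in blast)
    then show False using x by simp
  qed
  moreover have "prob (B1 \<union> B2 \<union> B3) \<le> 2 * real n * real k * exp (- (real k * \<theta> / M)) +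
      real n ^ (2 * k) * exp (- (real (k * k) * \<theta> / M))"
  proof -
    have "prob (B1 \<union> B2 \<union> B3) \<le> prob B1 + prob B2 + prob B3"
      using measure_Un_le[of B1 P B2] measure_Un_le[of "B1 \<union> B2" P B3] ev1 ev2 ev3 by auto
    moreover have "real (card (SS \<times> SS)) * exp (- (real (k * k) * \<theta> / M)) \<le> real n ^ (2 * k) * exp (- (real (k * k) * \<theta> / M))"
      using cSS by (intro mult_right_mono) auto
    moreover have "real (card ({1..n} \<times> {..<k})) = real n * real k" by simp
    ultimately show ?thesis using b1 b2 b3 by (simp only:)
  qed
  moreover have "B1 \<union> B2 \<union> B3 \<in> events" using ev1 ev2 ev3 by (intro sets.Un)
  ultimately show ?thesis by blast
qed

text \<open>The difference of the two costs is a nonzero linear form in the matrix entries, and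
  hyperplanes have probability zero.\<close>

lemma prob_tie:
  assumes q: "q permutes {1..n}" "q' permutes {1..n}" "q \<noteq> q'"
  shows "prob {x \<in> space P. acost n x q = acost n x q'} = 0"
proof -
  obtain j where j: "q j \<noteq> q' j" using q(3) by (auto simp: fun_eq_iff)
  then have jN: "j \<in> {1..n}" using q permutes_not_in by metis
  define c where "c a = (if q (snd a) = fst a then 1 else 0) - (if q' (snd a) = fst a then 1 else (0::real))" for a :: "nat \<times> nat"
  have ind: "acost n x f = (\<Sum>a\<in>arcs n. (if f (snd a) = fst a then 1 else 0) * x a)" if f: "f permutes {1..n}" for f x
  proof -
    have "(\<Sum>a\<in>arcs n. (if f (snd a) = fst a then 1 else 0) * x a) =
        (\<Sum>w\<in>{1..n}. \<Sum>v\<in>{1..n}. (if f w = v then 1 else 0) * x (v, w))"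
      by (subst sum.swap) (simp add: sum.cartesian_product split_def)
    also have "\<dots> = (\<Sum>w\<in>{1..n}. x (f w, w))"
    proof (rule sum.cong[OF refl])
      fix w assume "w \<in> {1..n}"
      then have "f w \<in> {1..n}" using permutes_in_image[OF f] by blast
      then show "(\<Sum>v\<in>{1..n}. (if f w = v then 1 else 0) * x (v, w)) = x (f w, w)"
        by (subst sum.mono_neutral_right[of _ "{f w}"]) auto
    qed
    finally show ?thesis by (simp add: acost_def)
  qed
  have "(\<Sum>a\<in>arcs n. c a * x a) = acost n x q - acost n x q'" for x
    unfolding ind[OF q(1)] ind[OF q(2)] c_def by (simp add: sum_subtractf[symmetric] left_diff_distrib)
  then have "{x \<in> space P. acost n x q = acost n x q'} = {x \<in> space P. (\<Sum>a\<in>arcs n. c a * x a) = 0}" by auto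
  moreover have "(q j, j) \<in> arcs n" by (rule perm_arc[OF q(1) jN])
  moreover have "c (q j, j) \<noteq> 0" using j by (auto simp: c_def)
  ultimately show ?thesis using prob_hyperplane[of "(q j, j)" c] by simp
qed

section \<open>The law of the optimal assignment\<close>

definition best :: "(nat \<Rightarrow> nat) \<Rightarrow> (nat \<times> nat \<Rightarrow> real) set" where
  "best q = {x \<in> space P. \<forall>q'\<in>perms - {q}. acost n x q < acost n x q'}"

lemma sets_best: "q permutes {1..n} \<Longrightarrow> best q \<in> events"
proof -
  assume q: "q permutes {1..n}"
  have [measurable]: "(\<lambda>x. acost n x f) \<in> borel_measurable P" if "f \<in> perms" for f using that measurable_acost by simp
  have [measurable]: "(\<lambda>x. acost n x q) \<in> borel_measurable P" by (rule measurable_acost[OF q])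
  have "finite (perms - {q})" using finite_perms by simp
  then show ?thesis unfolding best_def by measurable
qed

text \<open>Permuting the rows of the matrix by \<open>q\<close> preserves the law, since the rates
  depend on the column only, and turns the cost of \<open>f\<close> into that of
  \<open>q \<circ> f\<close>. This carries optimality of the identity to optimality of
  \<open>q\<close>.\<close>

lemma prob_best_eq:
  assumes q: "q permutes {1..n}"
  shows "prob (best q) = prob (best id)"
proof -
  define \<pi> where "\<pi> a = (q (fst a), snd a)" for a :: "nat \<times> nat"
  have qN: "q v \<in> {1..n} \<longleftrightarrow> v \<in> {1..n}" for v by (rule permutes_in_image[OF q])
  have "inj_on \<pi> (arcs n)" using injD[OF permutes_inj[OF q]] by (auto simp: inj_on_def \<pi>_def)
  moreover have im: "\<pi> ` arcs n \<subseteq> arcs n"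
  proof
    fix a assume "a \<in> \<pi> ` arcs n"
    then obtain v w where "v \<in> {1..n}" "w \<in> {1..n}" "a = (q v, w)" by (auto simp: \<pi>_def simp del: atLeastAtMost_iff)
    then show "a \<in> arcs n" using qN[of v] by blast
  qed
  moreover have "\<alpha> (\<pi> a) = \<alpha> a" if arc: "a \<in> arcs n" for a
  proof -
    obtain v w where a: "v \<in> {1..n}" "w \<in> {1..n}" "a = (v, w)"
      using arc by blast
    then have "q v \<in> {1..n}" using qN by blast
    then show ?thesis using row_sym[of "q v" v w] a by (simp add: \<pi>_def del: atLeastAtMost_iff)
  qed
  moreover have "best id \<in> sets vol" using sets_best[OF permutes_id] by (simp only: sets_P)
  ultimately have "prob {x \<in> space P. (\<lambda>a\<in>arcs n. x (\<pi> a)) \<in> best id} = prob (best id)"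
    by (rule prob_reindex)
  moreover have "{x \<in> space P. (\<lambda>a\<in>arcs n. x (\<pi> a)) \<in> best id} = best q"
  proof -
    have ac: "acost n (\<lambda>a\<in>arcs n. x (\<pi> a)) f = acost n x (q \<circ> f)" if "f permutes {1..n}" for x f
      unfolding acost_def using perm_arc[OF that] by (intro sum.cong) (auto simp: \<pi>_def)
    have "(\<forall>f\<in>perms - {id}. acost n x (q \<circ> id) < acost n x (q \<circ> f)) \<longleftrightarrow> (\<forall>q'\<in>perms - {q}. acost n x q < acost n x q')" for x
    proof (intro iffI ballI)
      fix q' assume h: "\<forall>f\<in>perms - {id}. acost n x (q \<circ> id) < acost n x (q \<circ> f)" and q': "q' \<in> perms - {q}"
      have "inv q \<circ> q' permutes {1..n}" using q' permutes_inv[OF q] by (auto intro: permutes_compose)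
      moreover have "q \<circ> (inv q \<circ> q') = q'" using permutes_inv_o(1)[OF q] by (simp add: o_assoc)
      moreover from this q' have "inv q \<circ> q' \<noteq> id" by auto
      ultimately show "acost n x q < acost n x q'" using h by force
    next
      fix f assume h: "\<forall>q'\<in>perms - {q}. acost n x q < acost n x q'" and f: "f \<in> perms - {id}"
      have "q \<circ> f permutes {1..n}" using f q by (auto intro: permutes_compose)
      moreover have "q \<circ> f \<noteq> q"
      proof
        assume "q \<circ> f = q"
        then have "f = id" using permutes_inj[OF q] by (metis comp_apply ext id_apply injD)
        then show False using f by simp
      qed
      ultimately show "acost n x (q \<circ> id) < acost n x (q \<circ> f)" using h by simp
    qed
    moreover have "(\<lambda>a\<in>arcs n. x (\<pi> a)) \<in> space P" for x unfolding space_P by simp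
    ultimately show ?thesis unfolding best_def using ac permutes_id[of "{1..n}"] by auto
  qed
  ultimately show ?thesis by simp
qed

lemma best_unique: "x \<in> best q \<Longrightarrow> x \<in> best q' \<Longrightarrow> q \<in> perms \<Longrightarrow> q' \<in> perms \<Longrightarrow> q = q'"
proof (rule ccontr)
  assume x: "x \<in> best q" "x \<in> best q'" and q: "q \<in> perms" "q' \<in> perms" and ne: "q \<noteq> q'"
  have "acost n x q < acost n x q'" using x(1) q(2) ne unfolding best_def by blast
  moreover have "acost n x q' < acost n x q" using x(2) q(1) ne unfolding best_def by blast
  ultimately show False by simp
qed

lemma best_disjoint: "disjoint_family_on best perms"
  unfolding disjoint_family_on_def using best_unique by blast

text \<open>The events \<open>best q\<close> are disjoint and equally likely, so each has
  probability at most 1/n!. By Markov's inequality for counting, at most a fraction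
  \<open>harm n / K\<close> of the permutations has more than \<open>K\<close> cycles.\<close>

lemma prob_many_cycles:
  assumes K: "0 < K"
  shows "prob (\<Union>q\<in>{q \<in> perms. K < real (card (orbit q ` {1..n}))}. best q) \<le> harm n / K"
proof -
  let ?L = "{q \<in> perms. K < real (card (orbit q ` {1..n}))}"
  have fact: "real (card perms) = fact n" using card_permutations[of "{1..n}" n] by simp
  have "prob (\<Union>q\<in>perms. best q) = (\<Sum>q\<in>perms. prob (best q))"
  proof (rule finite_measure_finite_Union[OF finite_perms _ best_disjoint])
    show "best ` perms \<subseteq> events" using sets_best by blast
  qed
  also have "\<dots> = (\<Sum>q\<in>perms. prob (best id))" by (intro sum.cong refl prob_best_eq) simp
  also have "\<dots> = fact n * prob (best id)" by (simp only: sum_constant fact)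
  finally have id: "fact n * prob (best id) \<le> 1" using prob_le_1 by metis
  have "real (card ?L) * K = (\<Sum>q\<in>?L. K)" by simp
  also have "\<dots> \<le> (\<Sum>q\<in>?L. real (card (orbit q ` {1..n})))" by (intro sum_mono) auto
  also have "\<dots> \<le> (\<Sum>q\<in>perms. real (card (orbit q ` {1..n})))" using finite_perms by (intro sum_mono2) auto
  also have "\<dots> \<le> fact n * harm n" using sum_card_orbits_le[of "{1..n}"] by simp
  finally have card: "real (card ?L) \<le> fact n * (harm n / K)" using K by (simp add: field_simps)
  have "prob (\<Union>q\<in>?L. best q) \<le> real (card ?L) * prob (best id)"
  proof (rule prob_UN_le)
    show "finite ?L" using finite_perms by simp
    fix q assume "q \<in> ?L"
    then have q: "q permutes {1..n}" by simp
    show "best q \<in> events" by (rule sets_best[OF q])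
    show "prob (best q) \<le> prob (best id)" by (rule eq_refl[OF prob_best_eq[OF q]])
  qed
  also have "\<dots> \<le> fact n * (harm n / K) * prob (best id)" using card by (intro mult_right_mono) auto
  also have "\<dots> = (fact n * prob (best id)) * (harm n / K)" by simp
  also have "\<dots> \<le> 1 * (harm n / K)" using id K by (intro mult_right_mono) (auto simp: harm_nonneg)
  finally show ?thesis by simp
qed

end

section \<open>Requests for joins\<close>

context random_costs
begin

lemma space_P_vol: "space P = space vol"
  by (simp only: space_P space_PiM space_lborel space_borel)

text \<open>An index \<open>(z, r, w, D)\<close> stands for a request to join the large cycle through \<open>z\<close> with a
  cycle containing \<open>r\<close> and \<open>w\<close> without touching the vertices in \<open>D\<close>.\<close>

definition requests :: "real \<Rightarrow> (nat \<Rightarrow> nat) \<Rightarrow> (nat \<times> nat \<times> nat \<times> nat set) set" where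
  "requests K q = {(z, r, w, D). z \<in> {1..n} \<and> r \<in> {1..n} \<and> w \<in> {1..n} \<and> D \<subseteq> {1..n} \<and> real (card D) \<le> 2 * K \<and>
     real n \<le> K * real (card (orbit q z)) \<and> r \<notin> orbit q z \<and> w \<notin> orbit q z}"

definition refused :: "(nat \<Rightarrow> nat) \<Rightarrow> real \<Rightarrow> (nat \<times> nat \<Rightarrow> real) \<Rightarrow> nat \<times> nat \<times> nat \<times> nat set \<Rightarrow> bool" where
  "refused q b x = (\<lambda>(z, r, w, D). \<forall>k\<in>orbit q z - D. \<not> (x (r, k) \<le> b \<and> x (q k, w) \<le> b))"

lemma good_joins_iff:
  "good_joins n x q K g \<longleftrightarrow> real (card (orbit q ` {1..n})) \<le> K \<and> (\<forall>i\<in>requests K q. \<not> refused q g x i)"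
  unfolding good_joins_def requests_def refused_def by auto

lemma orbit_subset_vertices: "q permutes {1..n} \<Longrightarrow> z \<in> {1..n} \<Longrightarrow> orbit q z \<subseteq> {1..n}"
  by (rule permutes_orbit_subset)

lemma pred_refused:
  assumes q: "q permutes {1..n}" and i: "i \<in> requests K q" and b: "b \<in> borel_measurable P"
  shows "Measurable.pred P (\<lambda>x. refused q (b x) x i)"
proof -
  obtain z r w D where i': "i = (z, r, w, D)" "z \<in> {1..n}" "r \<in> {1..n}" "w \<in> {1..n}"
    using i unfolding requests_def by blast
  have O: "orbit q z \<subseteq> {1..n}" by (rule orbit_subset_vertices[OF q i'(2)])
  have fin: "finite (orbit q z - D)" using finite_subset[OF O] by simp
  have "Measurable.pred P (\<lambda>x. \<not> (x (r, k) \<le> b x \<and> x (q k, w) \<le> b x))" if k: "k \<in> orbit q z - D" for k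
  proof -
    have kN: "k \<in> {1..n}" and "q k \<in> {1..n}" using k O permutes_in_image[OF q, of k] by blast+
    then have a: "(r, k) \<in> arcs n" "(q k, w) \<in> arcs n" using i' by blast+
    have "Measurable.pred P (\<lambda>x. x a \<le> b x)" if "a \<in> arcs n" for a
      unfolding pred_def by (rule borel_measurable_le[OF measurable_coordinate[OF that] b])
    with a show ?thesis by (intro pred_intros_logic)
  qed
  then show ?thesis unfolding refused_def i'(1) case_prod_conv by (intro pred_intros_finite fin)
qed

lemma finite_requests: "finite (requests K q)"
  by (rule finite_subset[of _ "{1..n} \<times> {1..n} \<times> {1..n} \<times> Pow {1..n}"]) (auto simp: requests_def)

text \<open>The three vertices give n^3 choices. A set \<open>D\<close> of at most \<open>d\<close>
  vertices, \<open>d\<close> being the integer part of \<open>2 * K\<close>, is encoded by a word of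
  length \<open>d\<close> over \<open>{0..n}\<close>.\<close>

lemma card_requests_le:
  assumes K: "0 \<le> K"
  shows "real (card (requests K q)) \<le> real n ^ 3 * (real n + 1) powr (2 * K)"
proof -
  define d where "d = nat \<lfloor>2 * K\<rfloor>"
  define DD where "DD = {D. D \<subseteq> {1..n} \<and> real (card D) \<le> 2 * K}"
  have "DD \<subseteq> (\<lambda>xs. set xs - {0}) ` {xs. set xs \<subseteq> {0..n} \<and> length xs = d}"
  proof
    fix D assume "D \<in> DD"
    then have D: "D \<subseteq> {1..n}" "card D \<le> d" by (auto simp: DD_def d_def le_nat_floor)
    have fin: "finite D" by (rule finite_subset[OF D(1)]) simp
    let ?xs = "sorted_list_of_set D @ replicate (d - card D) 0"
    have "set ?xs \<subseteq> {0..n}" "set ?xs - {0} = D" using D(1) fin by (auto simp: set_replicate_conv_if)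
    moreover have "length ?xs = d" using D fin by simp
    ultimately show "D \<in> (\<lambda>xs. set xs - {0}) ` {xs. set xs \<subseteq> {0..n} \<and> length xs = d}"
      by (intro image_eqI[of _ _ ?xs]) auto
  qed
  then have "card DD \<le> card {xs. set xs \<subseteq> {0..n} \<and> length xs = d}"
    by (rule surj_card_le[rotated]) (simp add: finite_lists_length_eq)
  also have "\<dots> = (n + 1) ^ d" using card_lists_length_eq[of "{0..n}" d] by simp
  finally have "real (card DD) \<le> real ((n + 1) ^ d)" by (simp only: of_nat_le_iff)
  also have "\<dots> = (real n + 1) powr real d" by (simp add: powr_realpow add.commute)
  also have "\<dots> \<le> (real n + 1) powr (2 * K)" using K n by (intro powr_mono) (auto simp: d_def)
  finally have DD: "real (card DD) \<le> (real n + 1) powr (2 * K)" .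
  have "card (requests K q) \<le> card ({1..n} \<times> {1..n} \<times> {1..n} \<times> DD)"
    by (rule card_mono) (auto simp: requests_def DD_def intro: finite_subset[of _ "Pow {1..n}"])
  also have "\<dots> = n ^ 3 * card DD" by (simp add: card_cartesian_product power3_eq_cube)
  finally have "real (card (requests K q)) \<le> real n ^ 3 * real (card DD)"
    unfolding of_nat_power[symmetric] of_nat_mult[symmetric] by (simp only: of_nat_le_iff)
  also have "\<dots> \<le> real n ^ 3 * (real n + 1) powr (2 * K)" using DD by (intro mult_left_mono) auto
  finally show ?thesis .
qed

text \<open>Each usable \<open>k\<close> offers the pair of arcs \<open>(r, k)\<close> and
  \<open>(q k, w)\<close>. All these arcs are distinct: \<open>q\<close> is injective, and
  \<open>w\<close> lies outside the orbit while \<open>k\<close> lies inside. At least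
  \<open>n / K - 2 * K\<close> independent pairs therefore have to fail.\<close>

lemma prob_refused_le:
  assumes q: "q permutes {1..n}" and i: "i \<in> requests K q" and K: "0 < K" and \<beta>: "0 \<le> \<beta>"
  shows "prob {x \<in> space P. refused q \<beta> x i} \<le> exp (- ((1 - exp (- \<beta> / M))\<^sup>2 * (real n / K - 2 * K)))"
proof -
  obtain z r w D where i': "i = (z, r, w, D)" "z \<in> {1..n}" "r \<in> {1..n}" "w \<in> {1..n}" "D \<subseteq> {1..n}" "real (card D) \<le> 2 * K"
    "real n \<le> K * real (card (orbit q z))" "r \<notin> orbit q z" "w \<notin> orbit q z"
    using i unfolding requests_def by blast
  define C where "C = orbit q z - D"
  define p where "p = 1 - exp (- \<beta> / M)"
  have O: "orbit q z \<subseteq> {1..n}" by (rule orbit_subset_vertices[OF q i'(2)])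
  have CN: "C \<subseteq> {1..n}" "finite C" using O finite_subset[OF O] by (auto simp: C_def)
  have qC: "q k \<in> {1..n}" if "k \<in> C" for k using that CN(1) permutes_in_image[OF q, of k] by blast
  have "card (orbit q z) - card D \<le> card C" unfolding C_def
    using i'(5) by (intro diff_card_le_card_Diff) (auto intro: finite_subset)
  then have "real (card (orbit q z)) - real (card D) \<le> real (card C)" by linarith
  moreover have "real n / K \<le> real (card (orbit q z))" using i'(7) K by (simp add: field_simps)
  ultimately have cC: "real n / K - 2 * K \<le> real (card C)" using i'(6) by linarith
  have p: "0 \<le> p" "p \<le> 1" using \<beta> M by (auto simp: p_def)
  have "prob {x \<in> space P. \<forall>k\<in>C. \<not> (x (r, k) \<le> \<beta> \<and> x (q k, w) \<le> \<beta>)} \<le> (1 - p\<^sup>2) ^ card C"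
  proof (rule prob_no_cheap_pair[OF CN(2)])
    show "(\<lambda>k. (r, k)) ` C \<subseteq> arcs n" using CN i' by blast
    show "(\<lambda>k. (q k, w)) ` C \<subseteq> arcs n" using qC i' by blast
    show "inj_on (\<lambda>k. (r, k)) C" by (simp add: inj_on_def)
    show "inj_on (\<lambda>k. (q k, w)) C" using injD[OF permutes_inj[OF q]] by (auto simp: inj_on_def)
    show "(\<lambda>k. (r, k)) ` C \<inter> (\<lambda>k. (q k, w)) ` C = {}" using i'(9) by (auto simp: C_def)
    fix a assume a: "a \<in> arcs n"
    have "\<beta> / M \<le> \<alpha> a * \<beta>" using rate_lower[OF a] \<beta> mult_right_mono[of "1 / M" "\<alpha> a" \<beta>] by simp
    then have "p \<le> 1 - exp (- \<alpha> a * \<beta>)" by (simp add: p_def)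
    also have "\<dots> = measure (expo (\<alpha> a)) {..\<beta>}"
      using emeasure_expo_atMost[OF rate_pos \<beta>, of a] \<beta> rate_pos[of a] by (simp add: measure_def)
    finally show "p \<le> measure (expo (\<alpha> a)) {..\<beta>}" .
  qed (rule p)
  also have "\<dots> \<le> exp (- p\<^sup>2) ^ card C"
    using p exp_ge_add_one_self[of "- p\<^sup>2"] by (intro power_mono) (auto simp: power_le_one)
  also have "\<dots> = exp (- (p\<^sup>2 * real (card C)))" by (simp add: exp_of_nat_mult[symmetric] mult.commute)
  also have "\<dots> \<le> exp (- (p\<^sup>2 * (real n / K - 2 * K)))" using cC by (simp add: mult_left_mono)
  finally show ?thesis unfolding i'(1) refused_def C_def p_def case_prod_conv .
qed

section \<open>Separating cheap arcs from excess costs\<close>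

definition low_arcs :: "real \<Rightarrow> (nat \<Rightarrow> nat) \<Rightarrow> (nat \<times> nat \<Rightarrow> real) \<Rightarrow> bool" where
  "low_arcs \<beta> q x \<longleftrightarrow> (\<forall>j\<in>{1..n}. x (q j, j) < \<beta>)"

text \<open>Competitors are restricted to assignments of low arcs, which makes this, unlike
  \<open>best\<close>, a property of the costs below \<beta> alone.\<close>

definition low_best :: "real \<Rightarrow> (nat \<Rightarrow> nat) \<Rightarrow> (nat \<times> nat \<Rightarrow> real) \<Rightarrow> bool" where
  "low_best \<beta> q x \<longleftrightarrow> low_arcs \<beta> q x \<and> (\<forall>q'\<in>perms - {q}. low_arcs \<beta> q' x \<longrightarrow> acost n x q < acost n x q')"

lemma low_best_unique: "low_best \<beta> q x \<Longrightarrow> low_best \<beta> q' x \<Longrightarrow> q \<in> perms \<Longrightarrow> q' \<in> perms \<Longrightarrow> q = q'"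
proof (rule ccontr)
  assume l: "low_best \<beta> q x" "low_best \<beta> q' x" and q: "q \<in> perms" "q' \<in> perms" and ne: "q \<noteq> q'"
  have "acost n x q < acost n x q'" using l q(2) ne unfolding low_best_def by blast
  moreover have "acost n x q' < acost n x q" using l q(1) ne unfolding low_best_def by blast
  ultimately show False by simp
qed

text \<open>Resampling keeps every cost below \<beta> and leaves the others at or above \<beta>.
  Neither the set of low assignments nor their costs change.\<close>

lemma low_best_resample:
  assumes q: "q permutes {1..n}"
  shows "low_best \<beta> q (\<lambda>a\<in>arcs n. resample \<beta> (U a) (Y a)) \<longleftrightarrow> low_best \<beta> q U"
proof -
  let ?R = "\<lambda>a\<in>arcs n. resample \<beta> (U a) (Y a)"
  have R: "?R (f j, j) = resample \<beta> (U (f j, j)) (Y (f j, j))" if "f permutes {1..n}" "j \<in> {1..n}" for f j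
    using perm_arc[OF that] by (simp only: restrict_apply if_True)
  have low: "low_arcs \<beta> f ?R \<longleftrightarrow> low_arcs \<beta> f U" if f: "f permutes {1..n}" for f
    unfolding low_arcs_def by (intro ball_cong refl) (simp only: R[OF f] resample_less_iff)
  have cost: "acost n ?R f = acost n U f" if f: "f permutes {1..n}" "low_arcs \<beta> f U" for f
    unfolding acost_def
  proof (rule sum.cong[OF refl])
    fix j assume j: "j \<in> {1..n}"
    then show "?R (f j, j) = U (f j, j)" using f(2) by (simp only: R[OF f(1) j] low_arcs_def resample_eq)
  qed
  show ?thesis
  proof (cases "low_arcs \<beta> q U")
    case True
    have "(low_arcs \<beta> q' ?R \<longrightarrow> acost n ?R q < acost n ?R q') \<longleftrightarrow> (low_arcs \<beta> q' U \<longrightarrow> acost n U q < acost n U q')"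
      if "q' \<in> perms - {q}" for q'
    proof -
      have q': "q' permutes {1..n}" using that by simp
      show ?thesis unfolding low[OF q'] cost[OF q True]
      proof (intro imp_cong refl)
        assume "low_arcs \<beta> q' U"
        then show "acost n U q < acost n ?R q' \<longleftrightarrow> acost n U q < acost n U q'" by (simp only: cost[OF q'])
      qed
    qed
    then show ?thesis unfolding low_best_def using low[OF q] by blast
  next
    case False
    then show ?thesis unfolding low_best_def using low[OF q] by blast
  qed
qed

text \<open>The factor 2 consists of the threshold itself and an excess of at most \<beta> above
  it.\<close>

definition unpatchable :: "real \<Rightarrow> real \<Rightarrow> (nat \<times> nat \<Rightarrow> real) set" where
  "unpatchable K \<beta> = (\<Union>q\<in>perms. \<Union>i\<in>requests K q. {x \<in> space P. low_best \<beta> q x \<and> refused q (2 * \<beta>) x i})"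

lemma sets_unpatchable: "unpatchable K \<beta> \<in> events"
  unfolding unpatchable_def
proof (intro sets.finite_UN finite_perms finite_requests)
  fix q i assume q: "q \<in> perms" and i: "i \<in> requests K q"
  have q': "q permutes {1..n}" using q by simp
  have [measurable]: "Measurable.pred P (\<lambda>x. refused q (2 * \<beta>) x i)"
    by (rule pred_refused[OF q' i]) simp
  have [measurable]: "(\<lambda>x. acost n x f) \<in> borel_measurable P" if "f \<in> perms" for f
    using that measurable_acost by blast
  have [measurable]: "Measurable.pred P (low_arcs \<beta> f)" if "f \<in> perms" for f
  proof -
    have "(\<lambda>x. x (f j, j)) \<in> borel_measurable P" if "j \<in> {1..n}" for j
      using that \<open>f \<in> perms\<close> perm_arc by (intro measurable_coordinate) blast
    note [measurable] = this
    show ?thesis unfolding low_arcs_def by measurable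
  qed
  have "finite (perms - {q})" using finite_perms by simp
  moreover have "(\<lambda>x. acost n x q) \<in> borel_measurable P" using q' by (rule measurable_acost)
  moreover have "Measurable.pred P (low_arcs \<beta> q)" using q by measurable
  ultimately have "Measurable.pred P (low_best \<beta> q)"
    unfolding low_best_def by measurable
  then show "{x \<in> space P. low_best \<beta> q x \<and> refused q (2 * \<beta>) x i} \<in> events" by measurable
qed

text \<open>The arcs below \<open>\<beta>\<close> determine \<open>q\<close>. By the memoryless property the excess of the other arcs over
  \<open>\<beta>\<close> is independent of them, and it is this excess that serves the requests.\<close>

lemma prob_unpatchable_le:
  assumes K: "0 < K" and \<beta>: "0 \<le> \<beta>"
  shows "prob (unpatchable K \<beta>) \<le> real n ^ 3 * (real n + 1) powr (2 * K) *
    exp (- ((1 - exp (- \<beta> / M))\<^sup>2 * (real n / K - 2 * K)))" (is "_ \<le> ?c * ?e")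
proof (rule prob_resample_le[OF \<beta>])
  show "unpatchable K \<beta> \<in> sets vol" using sets_unpatchable unfolding sets_P .
  fix U :: "nat \<times> nat \<Rightarrow> real"
  let ?R = "\<lambda>Y. \<lambda>a\<in>arcs n. resample \<beta> (U a) (Y a)"
  show "\<exists>T\<in>sets vol. {Y \<in> space vol. ?R Y \<in> unpatchable K \<beta>} \<subseteq> T \<and> prob T \<le> ?c * ?e"
  proof (cases "\<exists>q\<in>perms. low_best \<beta> q U")
    case False
    then have "{Y \<in> space vol. ?R Y \<in> unpatchable K \<beta>} = {}"
      using low_best_resample by (auto simp: unpatchable_def)
    then show ?thesis by (intro bexI[of _ "{}"]) auto
  next
    case True
    then obtain q where q: "q permutes {1..n}" "low_best \<beta> q U" by blast
    define T where "T = (\<Union>i\<in>requests K q. {Y \<in> space P. refused q \<beta> Y i})"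
    have ev: "{Y \<in> space P. refused q \<beta> Y i} \<in> events" if "i \<in> requests K q" for i
      using pred_refused[OF q(1) that, of "\<lambda>_. \<beta>"] by measurable
    have "T \<in> events" unfolding T_def using ev finite_requests by (intro sets.finite_UN) auto
    then have T: "T \<in> sets vol" by (simp only: sets_P)
    have "prob T \<le> real (card (requests K q)) * ?e"
      unfolding T_def using ev prob_refused_le[OF q(1) _ K \<beta>] by (intro prob_UN_le finite_requests) auto
    also have "real (card (requests K q)) * ?e \<le> ?c * ?e"
      using card_requests_le[of K q] K by (intro mult_right_mono) auto
    finally have "prob T \<le> ?c * ?e" .
    moreover have "{Y \<in> space vol. ?R Y \<in> unpatchable K \<beta>} \<subseteq> T"
    proof
      fix Y assume Y: "Y \<in> {Y \<in> space vol. ?R Y \<in> unpatchable K \<beta>}"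
      then obtain q' i where q': "q' permutes {1..n}" "i \<in> requests K q'" "low_best \<beta> q' (?R Y)" "refused q' (2 * \<beta>) (?R Y) i"
        unfolding unpatchable_def by blast
      have "low_best \<beta> q' U" using low_best_resample[OF q'(1)] q'(3) by blast
      \<comment> \<open>Uniqueness pins the assignment to the \<open>q\<close> determined by
        \<open>U\<close>. From here on it is independent of the fresh values
        \<open>Y\<close>.\<close>
      then have eq: "q' = q" using low_best_unique q q'(1) by blast
      obtain z r w D where i: "i = (z, r, w, D)" "z \<in> {1..n}" "r \<in> {1..n}" "w \<in> {1..n}"
        using q'(2) unfolding requests_def by blast
      have cheap: "?R Y a \<le> 2 * \<beta>" if "a \<in> arcs n" "Y a \<le> \<beta>" for a
      proof -
        have "resample \<beta> (U a) (Y a) \<le> 2 * \<beta>" using that(2) \<beta> by (simp add: resample_def)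
        then show ?thesis using that(1) by (simp only: restrict_apply if_True)
      qed
      have "refused q \<beta> Y i" unfolding refused_def i(1) case_prod_conv
      proof (intro ballI notI)
        fix k assume k: "k \<in> orbit q z - D" and c: "Y (r, k) \<le> \<beta> \<and> Y (q k, w) \<le> \<beta>"
        have "k \<in> {1..n}" using k orbit_subset_vertices[OF q(1) i(2)] by blast
        moreover from this have "q k \<in> {1..n}" using permutes_in_image[OF q(1)] by blast
        ultimately have "(r, k) \<in> arcs n" "(q k, w) \<in> arcs n" using i by blast+
        then have "?R Y (r, k) \<le> 2 * \<beta>" "?R Y (q k, w) \<le> 2 * \<beta>" using cheap c by blast+
        then show False using q'(4) k unfolding eq refused_def i(1) case_prod_conv by blast
      qed
      then show "Y \<in> T" using Y q'(2) unfolding T_def eq space_P_vol by blast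
    qed
    ultimately show ?thesis using T by blast
  qed
qed

text \<open>The join threshold is a multiple of the assignment cost, not an absolute number, so the
  event is invariant under scaling and \<open>P_cone\<close> applies to it. All optimal assignments
  are covered, because the one found by the program is not specified.\<close>

definition nice :: "real \<Rightarrow> real \<Rightarrow> (nat \<times> nat \<Rightarrow> real) set" where
  "nice K \<gamma> = {x \<in> space P. (\<forall>a\<in>arcs n. 0 \<le> x a) \<and> (\<forall>q. optimal_assignment n x q \<longrightarrow>
     0 < acost n x q \<and> good_joins n x q K (\<gamma> * acost n x q))}"

lemma sets_nice: "nice K \<gamma> \<in> events"
proof -
  have eq: "nice K \<gamma> = {x \<in> space P. (\<forall>a\<in>arcs n. 0 \<le> x a) \<and>
    (\<forall>q\<in>perms. (\<forall>q'\<in>perms. acost n x q \<le> acost n x q') \<longrightarrow>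
      0 < acost n x q \<and> real (card (orbit q ` {1..n})) \<le> K \<and> (\<forall>i\<in>requests K q. \<not> refused q (\<gamma> * acost n x q) x i))}"
    unfolding nice_def optimal_assignment_def good_joins_iff by blast
  have 1: "Measurable.pred P (\<lambda>x. \<forall>a\<in>arcs n. 0 \<le> x a)"
  proof (intro pred_intros_finite)
    fix a assume "a \<in> arcs n"
    from measurable_coordinate[OF this] show "Measurable.pred P (\<lambda>x. 0 \<le> x a)"
      unfolding pred_def by (intro borel_measurable_le borel_measurable_const)
  qed simp
  have 2: "Measurable.pred P (\<lambda>x. \<forall>q\<in>perms. (\<forall>q'\<in>perms. acost n x q \<le> acost n x q') \<longrightarrow>
      0 < acost n x q \<and> real (card (orbit q ` {1..n})) \<le> K \<and> (\<forall>i\<in>requests K q. \<not> refused q (\<gamma> * acost n x q) x i))"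
  proof (intro pred_intros_finite(3) finite_perms)
    fix q assume q: "q \<in> perms"
    have le: "Measurable.pred P (\<lambda>x. \<forall>q'\<in>perms. acost n x q \<le> acost n x q')"
    proof (intro pred_intros_finite(3) finite_perms)
      fix q' assume "q' \<in> perms"
      then show "Measurable.pred P (\<lambda>x. acost n x q \<le> acost n x q')"
        unfolding pred_def using q by (intro borel_measurable_le measurable_acost) auto
    qed
    have pos: "Measurable.pred P (\<lambda>x. 0 < acost n x q)"
      unfolding pred_def using q by (intro borel_measurable_less borel_measurable_const measurable_acost) auto
    have "Measurable.pred P (\<lambda>x. \<not> refused q (\<gamma> * acost n x q) x i)" if i: "i \<in> requests K q" for i
    proof (intro pred_intros_logic pred_refused[OF _ i])
      show q': "q permutes {1..n}" using q by simp
      show "(\<lambda>x. \<gamma> * acost n x q) \<in> borel_measurable P"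
        by (rule borel_measurable_times[OF borel_measurable_const measurable_acost[OF q']])
    qed
    then have ref: "Measurable.pred P (\<lambda>x. \<forall>i\<in>requests K q. \<not> refused q (\<gamma> * acost n x q) x i)"
      by (intro pred_intros_finite(3) finite_requests)
    show "Measurable.pred P (\<lambda>x. (\<forall>q'\<in>perms. acost n x q \<le> acost n x q') \<longrightarrow>
      0 < acost n x q \<and> real (card (orbit q ` {1..n})) \<le> K \<and> (\<forall>i\<in>requests K q. \<not> refused q (\<gamma> * acost n x q) x i))"
    proof (intro pred_intros_logic le pos ref)
      show "Measurable.pred P (\<lambda>x. real (card (orbit q ` {1..n})) \<le> K)" by (rule measurable_const) simp
    qed
  qed
  from 1 2 have "Measurable.pred P (\<lambda>x. (\<forall>a\<in>arcs n. 0 \<le> x a) \<and> (\<forall>q\<in>perms. (\<forall>q'\<in>perms. acost n x q \<le> acost n x q') \<longrightarrow>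
      0 < acost n x q \<and> real (card (orbit q ` {1..n})) \<le> K \<and> (\<forall>i\<in>requests K q. \<not> refused q (\<gamma> * acost n x q) x i)))"
    by (rule pred_intros_logic)
  then show ?thesis unfolding eq pred_def .
qed

lemma nice_cone:
  assumes x: "x \<in> space vol" and c: "0 < c"
  shows "(\<lambda>a\<in>arcs n. c * x a) \<in> nice K \<gamma> \<longleftrightarrow> x \<in> nice K \<gamma>"
proof -
  let ?y = "\<lambda>a\<in>arcs n. c * x a"
  have y: "?y a = c * x a" if "a \<in> arcs n" for a using that by (simp only: restrict_apply if_True)
  have cost: "acost n ?y q = c * acost n x q" if "q permutes {1..n}" for q
    unfolding acost_def sum_distrib_left using perm_arc[OF that] by (intro sum.cong refl y) blast
  have opt: "optimal_assignment n ?y q \<longleftrightarrow> optimal_assignment n x q" for q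
    unfolding optimal_assignment_def using cost c by (metis mult_le_cancel_left_pos)
  have ref: "refused q (\<gamma> * acost n ?y q) ?y i \<longleftrightarrow> refused q (\<gamma> * acost n x q) x i"
    if q: "q permutes {1..n}" and i: "i \<in> requests K q" for q i
  proof -
    obtain z r w D where i': "i = (z, r, w, D)" "z \<in> {1..n}" "r \<in> {1..n}" "w \<in> {1..n}"
      using i unfolding requests_def by blast
    have "?y (r, k) \<le> \<gamma> * acost n ?y q \<and> ?y (q k, w) \<le> \<gamma> * acost n ?y q \<longleftrightarrow>
        x (r, k) \<le> \<gamma> * acost n x q \<and> x (q k, w) \<le> \<gamma> * acost n x q" if k: "k \<in> orbit q z - D" for k
    proof -
      have "k \<in> {1..n}" using k orbit_subset_vertices[OF q i'(2)] by blast
      moreover from this have "q k \<in> {1..n}" using permutes_in_image[OF q] by blast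
      ultimately have a: "(r, k) \<in> arcs n" "(q k, w) \<in> arcs n" using i' by blast+
      note y[OF a(1)] y[OF a(2)]
      moreover have "\<gamma> * acost n ?y q = c * (\<gamma> * acost n x q)" using cost[OF q] by simp
      ultimately show ?thesis using c by (simp only: mult_le_cancel_left_pos)
    qed
    then show ?thesis unfolding refused_def i'(1) case_prod_conv by blast
  qed
  have "(\<forall>a\<in>arcs n. 0 \<le> ?y a) \<longleftrightarrow> (\<forall>a\<in>arcs n. 0 \<le> x a)"
    using y c by (metis mult_le_cancel_left_pos mult_zero_right)
  moreover have "?y \<in> space P" "x \<in> space P" using x unfolding space_P space_PiM by auto
  moreover have "0 < acost n ?y q \<and> good_joins n ?y q K (\<gamma> * acost n ?y q) \<longleftrightarrow>
      0 < acost n x q \<and> good_joins n x q K (\<gamma> * acost n x q)" if "optimal_assignment n x q" for q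
  proof -
    have q: "q permutes {1..n}" using that by (simp add: optimal_assignment_def)
    have "0 < acost n ?y q \<longleftrightarrow> 0 < acost n x q" using cost[OF q] c by (simp add: zero_less_mult_iff)
    then show ?thesis unfolding good_joins_iff using ref[OF q] by blast
  qed
  ultimately show ?thesis unfolding nice_def using opt by blast
qed

text \<open>The failure events are too many tiny entries, missing density, too many cycles, refused
  requests, ties and negative entries; the last two are null. Optimal arcs cost at most 3\<theta>,
  hence lie strictly below the threshold 4\<theta>, and requests are served at twice that, which
  explains the 8\<theta>.\<close>

lemma prob_nice_ge:
  assumes k: "k * k \<le> n" and \<theta>: "0 < \<theta>" and t: "0 < t" and K: "0 < K" and \<gamma>: "8 * \<theta> \<le> \<gamma> * (real n / 2 * t)"
  shows "1 - (2 * real n * M * t +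
    (2 * real n * real k * exp (- (real k * \<theta> / M)) + real n ^ (2 * k) * exp (- (real (k * k) * \<theta> / M))) +
    harm n / K +
    real n ^ 3 * (real n + 1) powr (2 * K) * exp (- ((1 - exp (- (4 * \<theta>) / M))\<^sup>2 * (real n / K - 2 * K)))) \<le> prob (nice K \<gamma>)"
proof -
  define B0 where "B0 = {x \<in> space P. real n / 2 \<le> real (card {a \<in> arcs n. x a < t})}"
  obtain B1 where B1: "B1 \<in> events" "{x \<in> space P. \<not> cheap_dense n k \<theta> x} \<subseteq> B1"
    "prob B1 \<le> 2 * real n * real k * exp (- (real k * \<theta> / M)) + real n ^ (2 * k) * exp (- (real (k * k) * \<theta> / M))"
    using prob_not_cheap_dense[OF k, of \<theta>] \<theta> by auto
  define B2 where "B2 = (\<Union>q\<in>{q \<in> perms. K < real (card (orbit q ` {1..n}))}. best q)"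
  define B3 where "B3 = unpatchable K (4 * \<theta>)"
  define pairs where "pairs = {(q, q'). q \<in> perms \<and> q' \<in> perms \<and> q \<noteq> q'}"
  define B4 where "B4 = (\<Union>(q, q')\<in>pairs. {x \<in> space P. acost n x q = acost n x q'})"
  define B5 where "B5 = space P - {x \<in> space vol. \<forall>a\<in>arcs n. 0 \<le> x a}"
  have fin_pairs: "finite pairs"
    by (rule finite_subset[of _ "perms \<times> perms"]) (use finite_perms in \<open>auto simp: pairs_def\<close>)
  note spaces = space_P_vol
  have pos: "{x \<in> space vol. \<forall>a\<in>arcs n. 0 \<le> x a} \<in> events"
    unfolding spaces[symmetric]
  proof -
    have "Measurable.pred P (\<lambda>x. \<forall>a\<in>arcs n. 0 \<le> x a)"
    proof (intro pred_intros_finite)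
      fix a assume "a \<in> arcs n"
      from measurable_coordinate[OF this] show "Measurable.pred P (\<lambda>x. 0 \<le> x a)"
        unfolding pred_def by (intro borel_measurable_le borel_measurable_const)
    qed simp
    then show "{x \<in> space P. \<forall>a\<in>arcs n. 0 \<le> x a} \<in> events" unfolding pred_def .
  qed
  have B0e: "B0 \<in> events"
  proof -
    have "real (card {a \<in> arcs n. x a < t}) = (\<Sum>a\<in>arcs n. indicator {..<t} (x a))" for x
      by (simp add: indicator_def sum.If_cases Int_def)
    then have "B0 = {x \<in> space P. real n / 2 \<le> (\<Sum>a\<in>arcs n. indicator {..<t} (x a))}" by (simp add: B0_def)
    also have "\<dots> \<in> events" by measurable
    finally show ?thesis .
  qed
  have tie: "{x \<in> space P. acost n x q = acost n x q'} \<in> events" if "q \<in> perms" "q' \<in> perms" for q q'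
  proof -
    have [measurable]: "(\<lambda>x. acost n x q) \<in> borel_measurable P" "(\<lambda>x. acost n x q') \<in> borel_measurable P"
      using that measurable_acost by blast+
    show ?thesis by measurable
  qed
  have B4e: "B4 \<in> events" unfolding B4_def using fin_pairs tie by (intro sets.finite_UN) (auto simp: pairs_def)
  have "prob B4 \<le> real (card pairs) * 0" unfolding B4_def
  proof (rule prob_UN_le[OF fin_pairs])
    fix a assume "a \<in> pairs"
    then obtain q q' where a: "a = (q, q')" "q \<in> perms" "q' \<in> perms" "q \<noteq> q'" by (auto simp: pairs_def)
    show "(case a of (q, q') \<Rightarrow> {x \<in> space P. acost n x q = acost n x q'}) \<in> events" using a tie by simp
    show "prob (case a of (q, q') \<Rightarrow> {x \<in> space P. acost n x q = acost n x q'}) \<le> 0" using a prob_tie by simp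
  qed
  then have p4: "prob B4 \<le> 0" by simp
  have "prob {x \<in> space vol. \<forall>a\<in>arcs n. 0 \<le> x a} = 1" unfolding measure_def P_nonneg by simp
  then have p5: "prob B5 = 0" unfolding B5_def prob_compl[OF pos] by simp
  have B2e: "B2 \<in> events" unfolding B2_def using finite_perms sets_best by (intro sets.finite_UN) auto
  have B3e: "B3 \<in> events" unfolding B3_def by (rule sets_unpatchable)
  have B5e: "B5 \<in> events" unfolding B5_def using pos by (rule sets.compl_sets)
  define B where "B = B0 \<union> B1 \<union> B2 \<union> B3 \<union> B4 \<union> B5"
  have sub: "prob (X \<union> Y) \<le> prob X + prob Y" if "X \<in> events" "Y \<in> events" for X Y
    using measure_Un_le that by blast
  have e1: "B0 \<union> B1 \<in> events" "B0 \<union> B1 \<union> B2 \<in> events" "B0 \<union> B1 \<union> B2 \<union> B3 \<in> events" "B0 \<union> B1 \<union> B2 \<union> B3 \<union> B4 \<in> events" "B \<in> events"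
    unfolding B_def by (simp_all only: sets.Un B0e B1(1) B2e B3e B4e B5e)
  have "prob B \<le> prob B0 + prob B1 + prob B2 + prob B3 + prob B4 + prob B5"
    unfolding B_def
    using sub[OF B0e B1(1)] sub[OF e1(1) B2e] sub[OF e1(2) B3e] sub[OF e1(3) B4e] sub[OF e1(4) B5e] by linarith
  also have "\<dots> \<le> 2 * real n * M * t +
    (2 * real n * real k * exp (- (real k * \<theta> / M)) + real n ^ (2 * k) * exp (- (real (k * k) * \<theta> / M))) +
    harm n / K +
    real n ^ 3 * (real n + 1) powr (2 * K) * exp (- ((1 - exp (- (4 * \<theta>) / M))\<^sup>2 * (real n / K - 2 * K)))"
    using prob_many_small_le[of t] t B1(3) prob_many_cycles[OF K] prob_unpatchable_le[OF K, of "4 * \<theta>"] \<theta> p4 p5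
    unfolding B0_def[symmetric] B2_def[symmetric] B3_def[symmetric] by linarith
  finally have pB: "prob B \<le> 2 * real n * M * t +
    (2 * real n * real k * exp (- (real k * \<theta> / M)) + real n ^ (2 * k) * exp (- (real (k * k) * \<theta> / M))) +
    harm n / K +
    real n ^ 3 * (real n + 1) powr (2 * K) * exp (- ((1 - exp (- (4 * \<theta>) / M))\<^sup>2 * (real n / K - 2 * K)))" .
  have "space P - B \<subseteq> nice K \<gamma>"
  proof
    fix x assume "x \<in> space P - B"
    then have x: "x \<in> space P" "x \<notin> B0" "x \<notin> B1" "x \<notin> B2" "x \<notin> B3" "x \<notin> B4" "x \<notin> B5" by (auto simp: B_def)
    have nonneg: "0 \<le> x a" if "a \<in> arcs n" for a using x(1,7) that spaces unfolding B5_def by blast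
    have few: "real (card {a \<in> arcs n. x a < t}) < real n / 2" using x(1,2) by (auto simp: B0_def)
    have dense: "cheap_dense n k \<theta> x" using x(1,3) B1(2) by blast
    have "0 < acost n x q \<and> good_joins n x q K (\<gamma> * acost n x q)" if opt: "optimal_assignment n x q" for q
    proof -
      have q: "q permutes {1..n}" and le: "\<And>q'. q' permutes {1..n} \<Longrightarrow> acost n x q \<le> acost n x q'"
        using opt by (simp_all add: optimal_assignment_def)
      have lt: "acost n x q < acost n x q'" if q': "q' \<in> perms - {q}" for q'
      proof -
        have "(q, q') \<in> pairs" using q q' by (auto simp: pairs_def)
        then have "acost n x q \<noteq> acost n x q'" using x(1,6) unfolding B4_def by blast
        then show ?thesis using le[of q'] q' by simp
      qed
      have "x \<in> best q" using x(1) lt unfolding best_def by blast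
      then have cyc: "real (card (orbit q ` {1..n})) \<le> K" using x(4) q unfolding B2_def by (metis (no_types, lifting) UN_iff mem_Collect_eq not_le)
      have low: "real n / 2 * t \<le> acost n x q"
        using acost_lower_bound[OF nonneg q _ few] t by simp
      moreover have "0 < real n / 2 * t" using n t by simp
      ultimately have ac: "0 < acost n x q" by linarith
      have "0 \<le> \<gamma>"
      proof (rule ccontr)
        assume "\<not> 0 \<le> \<gamma>"
        then have "\<gamma> * (real n / 2 * t) \<le> 0" using \<open>0 < real n / 2 * t\<close> by (intro mult_nonpos_nonneg) auto
        then show False using \<gamma> \<theta> by linarith
      qed
      then have th: "8 * \<theta> \<le> \<gamma> * acost n x q" using \<gamma> mult_left_mono[OF low, of \<gamma>] by linarith
      \<comment> \<open>The threshold exceeds 3\<theta> because \<open>low_arcs\<close> is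
        strict.\<close>
      have "low_arcs (4 * \<theta>) q x" unfolding low_arcs_def
      proof
        fix j assume j: "j \<in> {1..n}"
        have "q j \<in> {1..n}" using j permutes_in_image[OF q] by blast
        then have "x (q j, j) \<le> 3 * \<theta>"
          using dense j \<theta> unfolding cheap_dense_def
          by (intro optimal_assignment_short_arcs[OF opt j nonneg, where k = k]) auto
        then show "x (q j, j) < 4 * \<theta>" using \<theta> by linarith
      qed
      then have "low_best (4 * \<theta>) q x" unfolding low_best_def using lt by blast
      then have "\<not> refused q (2 * (4 * \<theta>)) x i" if "i \<in> requests K q" for i
        using x(1,5) q that unfolding B3_def unpatchable_def by blast
      \<comment> \<open>Raising the price limit cannot turn a served request into a refused
        one.\<close>
      then have "\<not> refused q (\<gamma> * acost n x q) x i" if "i \<in> requests K q" for i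
        using that th unfolding refused_def by (force split: prod.splits)
      then show ?thesis unfolding good_joins_iff using ac cyc by blast
    qed
    then show "x \<in> nice K \<gamma>" unfolding nice_def using x(1) nonneg by blast
  qed
  then have "prob (space P - B) \<le> prob (nice K \<gamma>)" by (intro finite_measure_mono sets_nice)
  then show ?thesis using prob_compl[OF e1(5)] pB by linarith
qed

end

section \<open>Choice of the parameters and asymptotics\<close>

lemma harm_le_ln: 
  assumes "1 \<le> n"
  shows "harm n \<le> ln (real n) + (1 :: real)"
proof -
  obtain m where m: "n = Suc m" using assms by (cases n) auto
  \<comment> \<open>The difference of harmonic number and logarithm decreases, and it is 1 at the
    start.\<close>
  have "harm (Suc m) - ln (real (Suc m)) \<le> harm (Suc 0) - ln (real (Suc 0))"
    using decseq_harm_diff_ln by (rule decseqD) simp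
  then show ?thesis by (simp add: m harm_def)
qed

text \<open>The bound of \<open>prob_nice_ge\<close> for $K = n^{1/20}$, $\theta = n^{-2/5}$, $nMt = n^{-1/20}$,
  $k = \lfloor \sqrt n \rfloor$ and $M = n^{1/100}$.\<close>

definition error_bound :: "nat \<Rightarrow> real" where
  "error_bound n = 2 * real n powr (-1/20) +
    (2 * real n ^ 2 * exp (- (sqrt (real n) / 2 * real n powr (-2/5) / real n powr (1/100))) +
     exp (2 * ln (real n) - sqrt (real n) / 2 * real n powr (-2/5) / real n powr (1/100))) +
    (ln (real n) + 1) / real n powr (1/20) +
    real n ^ 3 * (real n + 1) powr (2 * real n powr (1/20)) *
      exp (- ((2 * real n powr (-2/5) / real n powr (1/100))\<^sup>2 * (real n / real n powr (1/20) - 2 * real n powr (1/20))))"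

lemma error_bound_tendsto: "error_bound \<longlonglongrightarrow> 0"
  unfolding error_bound_def by real_asymp

text \<open>In this order, the conditions make the joins negligible against \<epsilon>, make the
  floor of sqrt n at least half of sqrt n, make the exponent for pairs of \<open>k\<close>-sets
  nonpositive, allow the estimate of 1 - exp(-y) by y/2, and make the number of usable columns
  nonnegative.\<close>

lemma eventually_parameters:
  assumes "0 < \<epsilon>"
  shows "eventually (\<lambda>n. 32 * real n powr (-29/100) \<le> \<epsilon> \<and> 16 \<le> n \<and>
    2 * ln (real n) \<le> sqrt (real n) / 2 * real n powr (-2/5) / real n powr (1/100) \<and>
    4 * real n powr (-2/5) \<le> 1 \<and> 0 \<le> real n / real n powr (1/20) - 2 * real n powr (1/20)) sequentially"
proof (intro eventually_conj)
  have "(\<lambda>n. 32 * real n powr (-29/100)) \<longlonglongrightarrow> 0" by real_asymp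
  from order_tendstoD(2)[OF this assms] show "eventually (\<lambda>n. 32 * real n powr (-29/100) \<le> \<epsilon>) sequentially"
    by (rule eventually_mono) simp
  show "eventually (\<lambda>n. 2 * ln (real n) \<le> sqrt (real n) / 2 * real n powr (-2/5) / real n powr (1/100)) sequentially"
    by real_asymp
  show "eventually (\<lambda>n. 4 * real n powr (-2/5) \<le> 1) sequentially" by real_asymp
  show "eventually (\<lambda>n. 0 \<le> real n / real n powr (1/20) - 2 * real n powr (1/20)) sequentially" by real_asymp
qed (rule eventually_ge_at_top)

lemma one_minus_exp_ge:
  assumes "0 \<le> y" "y \<le> (1 :: real)"
  shows "y / 2 \<le> 1 - exp (- y)"
proof -
  have "(1 - y / 2) * (1 + y) = 1 + y * (1 - y) / 2" by (simp add: field_simps)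
  moreover have "0 \<le> y * (1 - y)" using assms by simp
  ultimately have "1 \<le> (1 - y / 2) * (1 + y)" by simp
  also have "\<dots> \<le> (1 - y / 2) * exp y" using assms exp_ge_add_one_self[of y] by (intro mult_left_mono) auto
  finally show ?thesis by (simp add: exp_minus field_simps)
qed

lemma (in random_costs) prob_nice_ge_error_bound:
  assumes M': "M \<le> real n powr (1/100)" and \<epsilon>: "0 < \<epsilon>"
    and par: "32 * real n powr (-29/100) \<le> \<epsilon>" "16 \<le> n"
      "2 * ln (real n) \<le> sqrt (real n) / 2 * real n powr (-2/5) / real n powr (1/100)"
      "4 * real n powr (-2/5) \<le> 1" "0 \<le> real n / real n powr (1/20) - 2 * real n powr (1/20)"
  shows "1 - error_bound n \<le> prob (nice (real n powr (1/20)) (\<epsilon> / (2 * real n powr (1/20))))"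
proof -
  define N where "N = real n"
  define K \<theta> m where "K = N powr (1/20)" and "\<theta> = N powr (-2/5)" and "m = N powr (1/100)"
  define t where "t = N powr (-1/20) / (N * M)"
  define k where "k = nat \<lfloor>sqrt N\<rfloor>"
  define y where "y = sqrt N / 2 * \<theta> / m"
  have N: "16 \<le> N" using par(2) by (simp add: N_def)
  have pos: "0 < K" "0 < \<theta>" "0 < m" "0 < t" using N M by (simp_all add: K_def \<theta>_def m_def t_def)
  have "real k = of_int \<lfloor>sqrt N\<rfloor>" using N by (simp add: k_def)
  then have kN: "real k \<le> sqrt N" "sqrt N - 1 \<le> real k" by linarith+
  have s4: "4 \<le> sqrt N" using N by (intro real_le_rsqrt) simp
  have k2: "sqrt N / 2 \<le> real k" and k1: "1 \<le> k" using kN s4 by linarith+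
  have "real k * real k \<le> sqrt N * sqrt N" using kN N by (intro mult_mono) auto
  then have "real (k * k) \<le> real n" using N by (simp add: N_def)
  then have kk: "k * k \<le> n" by (simp only: of_nat_le_iff)
  have kn: "real k \<le> N"
  proof -
    have "k \<le> k * k" using k1 by simp
    then have "k \<le> n" using kk by (rule le_trans)
    then show ?thesis by (simp add: N_def)
  qed
  have ykM: "y \<le> real k * \<theta> / M"
  proof -
    have "y \<le> real k * \<theta> / m" unfolding y_def using k2 pos by (intro divide_right_mono mult_right_mono) auto
    also have "\<dots> \<le> real k * \<theta> / M" using M' M pos by (intro divide_left_mono) (auto simp: m_def N_def)
    finally show ?thesis .
  qed
  have cond: "8 * \<theta> \<le> \<epsilon> / (2 * K) * (real n / 2 * t)"
  proof -
    \<comment> \<open>The split is 29/100 + 11/100 = 2/5, the exponent of \<theta>, where 11/100 =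
      1/20 + 1/20 + 1/100 collects the contributions of \<open>t\<close>, \<open>K\<close> and
      \<open>m\<close>.\<close>
    have "32 * (N powr (-29/100)) * (N powr (-11/100)) \<le> \<epsilon> * (N powr (-11/100))"
      using par(1) by (intro mult_right_mono) (auto simp: N_def)
    moreover have "N powr (-29/100) * N powr (-11/100) = \<theta>" by (simp add: powr_add[symmetric] \<theta>_def)
    moreover have "N powr (-11/100) = N powr (-1/20) / (K * m)"
      by (simp add: K_def m_def powr_add[symmetric] powr_diff[symmetric])
    ultimately have "32 * \<theta> \<le> \<epsilon> * (N powr (-1/20) / (K * m))" by (simp add: mult.assoc)
    also have "\<dots> \<le> \<epsilon> * (N powr (-1/20) / (K * M))"
      using M' M pos \<epsilon> by (intro mult_left_mono divide_left_mono) (auto simp: m_def N_def)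
    also have "\<dots> = 4 * (\<epsilon> / (2 * K) * (real n / 2 * t))" using N M by (simp add: t_def N_def field_simps)
    finally show ?thesis by linarith
  qed
  have "2 * real n * M * t = 2 * N powr (-1/20)" using N M by (simp add: t_def N_def)
  moreover have "2 * real n * real k * exp (- (real k * \<theta> / M)) \<le> 2 * N ^ 2 * exp (- y)"
  proof (rule mult_mono)
    show "2 * real n * real k \<le> 2 * N ^ 2"
      using mult_left_mono[OF kn, of N] N by (simp add: N_def power2_eq_square)
  qed (use ykM in auto)
  moreover have "real n ^ (2 * k) * exp (- (real (k * k) * \<theta> / M)) \<le> exp (2 * ln N - y)"
  proof -
    have "real n ^ (2 * k) = exp (2 * real k * ln N)"
      using N by (simp add: N_def powr_realpow[symmetric] powr_def)
    then have "real n ^ (2 * k) * exp (- (real (k * k) * \<theta> / M)) = exp (real k * (2 * ln N - real k * \<theta> / M))"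
      by (simp add: exp_add[symmetric] algebra_simps)
    also have "\<dots> \<le> exp (1 * (2 * ln N - y))"
    proof -
      have "real k * (2 * ln N - real k * \<theta> / M) \<le> real k * (2 * ln N - y)" using ykM by (intro mult_left_mono) auto
      \<comment> \<open>The bracket is nonpositive, so replacing the factor \<open>k\<close> by 1
        only increases the product.\<close>
      also have "\<dots> \<le> 1 * (2 * ln N - y)"
        using par(3) k1 by (intro mult_right_mono_neg) (auto simp: y_def \<theta>_def m_def N_def)
      finally show ?thesis by simp
    qed
    finally show ?thesis by simp
  qed
  moreover have "harm n / K \<le> (ln N + 1) / K"
    using harm_le_ln[OF n] pos by (intro divide_right_mono) (auto simp: N_def)
  moreover have "real n ^ 3 * (real n + 1) powr (2 * K) * exp (- ((1 - exp (- (4 * \<theta>) / M))\<^sup>2 * (real n / K - 2 * K))) \<le>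
      N ^ 3 * (N + 1) powr (2 * K) * exp (- ((2 * \<theta> / m)\<^sup>2 * (N / K - 2 * K)))"
  proof -
    have "4 * \<theta> / M \<le> 4 * \<theta> / 1" using M pos by (intro divide_left_mono) auto
    then have "4 * \<theta> / M \<le> 1" using par(4) by (simp add: \<theta>_def N_def)
    then have "4 * \<theta> / M / 2 \<le> 1 - exp (- (4 * \<theta> / M))" using pos M by (intro one_minus_exp_ge) auto
    moreover have "2 * \<theta> / m \<le> 4 * \<theta> / M / 2" using M' M pos by (simp, intro divide_left_mono) (auto simp: m_def N_def)
    ultimately have "2 * \<theta> / m \<le> 1 - exp (- (4 * \<theta>) / M)" by simp
    then have "(2 * \<theta> / m)\<^sup>2 \<le> (1 - exp (- (4 * \<theta>) / M))\<^sup>2" using pos by (intro power_mono) auto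
    then have "(2 * \<theta> / m)\<^sup>2 * (N / K - 2 * K) \<le> (1 - exp (- (4 * \<theta>) / M))\<^sup>2 * (N / K - 2 * K)"
      using par(5) by (intro mult_right_mono) (auto simp: N_def K_def)
    then show ?thesis unfolding N_def by (intro mult_left_mono) auto
  qed
  ultimately have "2 * real n * M * t +
    (2 * real n * real k * exp (- (real k * \<theta> / M)) + real n ^ (2 * k) * exp (- (real (k * k) * \<theta> / M))) +
    harm n / K +
    real n ^ 3 * (real n + 1) powr (2 * K) * exp (- ((1 - exp (- (4 * \<theta>) / M))\<^sup>2 * (real n / K - 2 * K))) \<le> error_bound n"
    unfolding error_bound_def N_def[symmetric] K_def[symmetric] \<theta>_def[symmetric] m_def[symmetric] y_def[symmetric] by linarith
  then show ?thesis
    using prob_nice_ge[OF kk pos(2) pos(4) pos(1) cond] unfolding K_def N_def by linarith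
qed

section \<open>From exponential costs back to the simplex\<close>

lemma (in random_costs) measure_uniform_simplex_nice:
  assumes L: "0 < L"
  shows "measure (uniform_simplex n \<alpha> L) (nice K \<gamma>) = prob (nice K \<gamma>)"
proof -
  have simplex: "cost_simplex n \<alpha> L = corner L" unfolding cost_simplex_def corner_def ..
  interpret u: prob_space "uniform_simplex n \<alpha> L"
    using n L rate_pos by (rule prob_space_uniform_simplex)
  have space: "space vol \<in> sets vol" by (rule sets.top)
  have "emeasure (uniform_simplex n \<alpha> L) (space vol) = 1"
    using u.emeasure_space_1 by (simp add: uniform_simplex_def)
  moreover have "corner L \<inter> space vol = corner L" using sets.sets_into_space[OF sets_corner] by blast
  \<comment> \<open>In \<open>ennreal\<close> a quotient v/v equals 1 only for positive finite v, so
    this yields both facts about the volume of the simplex.\<close>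
  ultimately have "emeasure vol (corner L) / emeasure vol (corner L) = 1"
    unfolding uniform_simplex_def simplex emeasure_uniform_measure[OF sets_corner space] by (simp only:)
  then have v: "emeasure vol (corner L) \<noteq> 0" "emeasure vol (corner L) \<noteq> \<top>" by auto
  have A: "nice K \<gamma> \<in> sets vol" using sets_nice by (simp only: sets_P)
  have "emeasure (uniform_simplex n \<alpha> L) (nice K \<gamma>) = emeasure vol (corner L \<inter> nice K \<gamma>) / emeasure vol (corner L)"
    unfolding uniform_simplex_def simplex by (intro emeasure_uniform_measure sets_corner A)
  also have "emeasure vol (corner L \<inter> nice K \<gamma>) = emeasure P (nice K \<gamma>) * emeasure vol (corner L)"
    using P_cone[OF A _ nice_cone L] by (subst Int_commute) (auto simp: nice_def)
  finally have "emeasure (uniform_simplex n \<alpha> L) (nice K \<gamma>) = emeasure P (nice K \<gamma>)"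
    using v by (simp add: ennreal_mult_divide_eq)
  then show ?thesis by (simp add: measure_def)
qed

lemma uniform_simplex_cong:
  assumes "\<And>a. a \<in> arcs n \<Longrightarrow> \<alpha> a = \<alpha>' a"
  shows "uniform_simplex n \<alpha> L = uniform_simplex n \<alpha>' L"
proof -
  have "(\<Sum>a\<in>arcs n. \<alpha> a * X a) = (\<Sum>a\<in>arcs n. \<alpha>' a * X a)" for X
    using assms by (intro sum.cong) auto
  then show ?thesis by (simp only: uniform_simplex_def cost_simplex_def)
qed

text \<open>At most \<open>K\<close> joins with two new arcs each, at
  \<open>\<epsilon> / (2 * K)\<close> of the assignment cost per arc, add at most the fraction
  \<epsilon>. The optimal tour is at least as expensive as the assignment.\<close>

lemma near_optimal_if_good_joins:
  assumes n: "1 \<le> n" and nonneg: "\<And>a. a \<in> arcs n \<Longrightarrow> 0 \<le> X a" and K: "0 < K" and \<epsilon>: "0 < \<epsilon>"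
    and good: "\<And>q. optimal_assignment n X q \<Longrightarrow> 0 < acost n X q \<and> good_joins n X q K (\<epsilon> / (2 * K) * acost n X q)"
  shows "\<exists>vs. outputs atsp_program n X vs \<and> is_tour n vs \<and> \<bar>tour_cost X vs / opt_cost n X - 1\<bar> \<le> \<epsilon>"
proof -
  obtain vs q where vs: "outputs atsp_program n X vs" "is_tour n vs" and q: "optimal_assignment n X q"
    and le: "\<And>K g. 0 \<le> g \<Longrightarrow> good_joins n X q K g \<Longrightarrow> tour_cost X vs \<le> acost n X q + 2 * g * K"
    using atsp_program_output[where X = X, OF n nonneg] by blast
  have ac: "0 < acost n X q" using good[OF q] by blast
  have "tour_cost X vs \<le> acost n X q + 2 * (\<epsilon> / (2 * K) * acost n X q) * K"
    using ac K \<epsilon> by (intro le conjunct2[OF good[OF q]]) simp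
  also have "\<dots> = (1 + \<epsilon>) * acost n X q" using K by (simp add: field_simps)
  also have "\<dots> \<le> (1 + \<epsilon>) * opt_cost n X"
    using optimal_assignment_le_opt_cost[OF q] \<epsilon> by (intro mult_left_mono) auto
  finally have up: "tour_cost X vs \<le> (1 + \<epsilon>) * opt_cost n X" .
  have pos: "0 < opt_cost n X" using ac optimal_assignment_le_opt_cost[OF q] by linarith
  have low: "opt_cost n X \<le> tour_cost X vs" by (rule opt_cost_le[OF vs(2)])
  have "1 \<le> tour_cost X vs / opt_cost n X" "tour_cost X vs / opt_cost n X \<le> 1 + \<epsilon>"
    using up low pos by (simp_all add: divide_le_eq)
  then have "\<bar>tour_cost X vs / opt_cost n X - 1\<bar> \<le> \<epsilon>" by linarith
  then show ?thesis using vs by blast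
qed

lemma success_probability:
  fixes \<alpha> :: "nat \<times> nat \<Rightarrow> real"
  assumes n: "1 \<le> n" and pos: "\<forall>a\<in>arcs n. 0 < \<alpha> a" and row: "row_symmetric n \<alpha>" and bnd: "M_bounded n M \<alpha>"
    and M_le: "M \<le> real n powr (1/100)" and L: "0 < L" and \<epsilon>: "0 < \<epsilon>"
    and par: "32 * real n powr (-29/100) \<le> \<epsilon>" "16 \<le> n"
      "2 * ln (real n) \<le> sqrt (real n) / 2 * real n powr (-2/5) / real n powr (1/100)"
      "4 * real n powr (-2/5) \<le> 1" "0 \<le> real n / real n powr (1/20) - 2 * real n powr (1/20)"
  shows "1 - error_bound n \<le> measure (uniform_simplex n \<alpha> L) {X \<in> space (uniform_simplex n \<alpha> L).
    \<exists>vs. outputs atsp_program n X vs \<and> is_tour n vs \<and> \<bar>tour_cost X vs / opt_cost n X - 1\<bar> \<le> \<epsilon>}" (is "_ \<le> measure ?U ?T")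
proof -
  \<comment> \<open>The exponential product needs a positive rate at every index, also outside the
    arcs.\<close>
  define \<alpha>' where "\<alpha>' a = (if a \<in> arcs n then \<alpha> a else 1)" for a
  have eq: "\<alpha>' a = \<alpha> a" if "a \<in> arcs n" for a using that by (simp only: \<alpha>'_def if_True)
  have "(1, 1) \<in> arcs n" using n by simp
  then have b: "1 / M \<le> \<alpha> (1, 1)" "\<alpha> (1, 1) \<le> M" "0 < \<alpha> (1, 1)" using bnd pos unfolding M_bounded_def by blast+
  have "1 \<le> M"
  proof (rule ccontr)
    assume "\<not> 1 \<le> M"
    moreover have "0 < M" using b by linarith
    ultimately have "M * M < 1 * 1" by (intro mult_strict_mono) auto
    then have "M < 1 / M" using \<open>0 < M\<close> by (simp add: less_divide_eq)
    then show False using b by linarith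
  qed
  interpret random_costs n \<alpha>' M
  proof
    show "finite (arcs n)" by simp
    show "0 < \<alpha>' a" for a
    proof (cases "a \<in> arcs n")
      case True
      then show ?thesis using bspec[OF pos True] by (simp only: eq)
    next
      case False
      then show ?thesis by (simp only: \<alpha>'_def if_False zero_less_one)
    qed
    show "1 / M \<le> \<alpha>' a" "\<alpha>' a \<le> M" if "a \<in> arcs n" for a
      using bnd that unfolding eq[OF that] M_bounded_def by blast+
    fix v v' w assume v: "v \<in> {1..n}" "v' \<in> {1..n}" "w \<in> {1..n}"
    then have a: "(v, w) \<in> arcs n" "(v', w) \<in> arcs n" by blast+
    show "\<alpha>' (v, w) = \<alpha>' (v', w)" unfolding eq[OF a(1)] eq[OF a(2)] using row v unfolding row_symmetric_def by blast
  qed (fact n \<open>1 \<le> M\<close>)+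
  let ?K = "real n powr (1/20)"
  have U: "?U = uniform_simplex n \<alpha>' L" by (rule uniform_simplex_cong) (rule eq[symmetric])
  have spU: "space ?U = space vol" and seU: "sets ?U = sets vol" by (simp_all add: uniform_simplex_def)
  interpret u: prob_space ?U using n L pos by (intro prob_space_uniform_simplex) auto
  have K: "0 < ?K" using n by simp
  have "nice ?K (\<epsilon> / (2 * ?K)) \<subseteq> ?T"
  proof
    fix X assume X: "X \<in> nice ?K (\<epsilon> / (2 * ?K))"
    have "\<exists>vs. outputs atsp_program n X vs \<and> is_tour n vs \<and> \<bar>tour_cost X vs / opt_cost n X - 1\<bar> \<le> \<epsilon>"
      by (rule near_optimal_if_good_joins[OF n _ K \<epsilon>]) (use X in \<open>unfold nice_def, blast\<close>)+
    then show "X \<in> ?T" using X unfolding nice_def spU space_P_vol by blast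
  qed
  moreover have "?T \<in> sets ?U" unfolding seU spU by (rule sets_good_output)
  ultimately have "measure ?U (nice ?K (\<epsilon> / (2 * ?K))) \<le> measure ?U ?T" by (rule u.finite_measure_mono)
  then show ?thesis
    using prob_nice_ge_error_bound[OF M_le \<epsilon> par] unfolding U measure_uniform_simplex_nice[OF L] by linarith
qed

text \<open>The bound \<open>error_bound\<close> depends on \<open>n\<close> alone and not on the
  coefficients, so it settles all admissible sequences at once.\<close>

theorem theorem2p11:
  "\<exists>\<delta>>0. \<exists>P. cubic_time P \<and>
    (\<forall>(\<alpha> :: nat \<Rightarrow> nat \<times> nat \<Rightarrow> real) (M :: nat \<Rightarrow> real) (L :: nat \<Rightarrow> real).
      (\<forall>n\<ge>1. (\<forall>a\<in>arcs n. 0 < \<alpha> n a) \<and> row_symmetric n (\<alpha> n) \<and> M_bounded n (M n) (\<alpha> n) \<and>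
        M n \<le> real n powr \<delta> \<and> 0 < L n) \<longrightarrow>
      (\<forall>\<epsilon>>0. (\<lambda>n. measure (uniform_simplex n (\<alpha> n) (L n))
          {X \<in> space (uniform_simplex n (\<alpha> n) (L n)).
            \<exists>vs. outputs P n X vs \<and> is_tour n vs \<and>
              \<bar>tour_cost X vs / opt_cost n X - 1\<bar> \<le> \<epsilon>}) \<longlonglongrightarrow> 1))"
proof (rule exI[of _ "1/100"], intro conjI, simp, rule exI[of _ atsp_program], intro conjI allI impI)
  show "cubic_time atsp_program" by (rule cubic_time_atsp_program)
  fix \<alpha> :: "nat \<Rightarrow> nat \<times> nat \<Rightarrow> real" and M L :: "nat \<Rightarrow> real" and \<epsilon> :: real
  assume h: "\<forall>n\<ge>1. (\<forall>a\<in>arcs n. 0 < \<alpha> n a) \<and> row_symmetric n (\<alpha> n) \<and> M_bounded n (M n) (\<alpha> n) \<and>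
        M n \<le> real n powr (1/100) \<and> 0 < L n" and \<epsilon>: "0 < \<epsilon>"
  let ?p = "\<lambda>n. measure (uniform_simplex n (\<alpha> n) (L n)) {X \<in> space (uniform_simplex n (\<alpha> n) (L n)).
            \<exists>vs. outputs atsp_program n X vs \<and> is_tour n vs \<and> \<bar>tour_cost X vs / opt_cost n X - 1\<bar> \<le> \<epsilon>}"
  show "?p \<longlonglongrightarrow> 1"
  proof (rule tendsto_sandwich)
    show "eventually (\<lambda>n. 1 - error_bound n \<le> ?p n) sequentially"
      using eventually_parameters[OF \<epsilon>]
    proof eventually_elim
      case (elim n)
      then have "1 \<le> n" by linarith
      then show ?case using h elim \<epsilon> by (intro success_probability[where M = "M n"]) blast+
    qed
    show "eventually (\<lambda>n. ?p n \<le> 1) sequentially"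
      using eventually_ge_at_top[of 1]
    proof eventually_elim
      case (elim n)
      then interpret prob_space "uniform_simplex n (\<alpha> n) (L n)"
        using h by (intro prob_space_uniform_simplex) blast+
      show ?case by (rule prob_le_1)
    qed
    have "(\<lambda>n. 1 - error_bound n) \<longlonglongrightarrow> 1 - 0" by (intro tendsto_diff tendsto_const error_bound_tendsto)
    then show "(\<lambda>n. 1 - error_bound n) \<longlonglongrightarrow> 1" by simp
  qed simp
qed

end
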